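(* There exist $\delta_*>0$ and $C^*>0$ such that for any $0<\delta\le\delta_*$ and any $\boldsymbol{\phi}^{in}\in \boldsymbol{E_H}$ with $$\|\boldsymbol{\phi}^{in}-\boldsymbol{H}\|_{H^1\times L^2}\le \delta ,$$ there exists a unique global solution $\boldsymbol{\phi}=(\phi_1,\phi_2)\in C(\mathbb{R},\boldsymbol{E_H})$ of $$\partial_t\phi_1=\partial_x\phi_2,\qquad \partial_t\phi_2=-\partial_x\left(\partial_x^2\phi_1+\phi_1-\phi_1^3\right)$$ with $\boldsymbol{\phi}(0)=\boldsymbol{\phi}^{in}$. Moreover, for some smooth function $t\mapsto\rho(t)\in\mathbb{R}$, $$\sup_{t\in\mathbb{R}}\|\boldsymbol{\phi}(t,\cdot+\rho(t))-\boldsymbol{H}\|_{H^1\times L^2}\le C^*\|\boldsymbol{\phi}^{in}-\boldsymbol{H}\|_{H^1\times L^2}.$$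
   Context: All functions are real valued on $\mathbb{R}$ and $(t,x)\in\mathbb{R}^2$. The system is the first-order form of $\partial_t^2\phi+\partial_x^2(\partial_x^2\phi+\phi-\phi^3)=0$ with $\phi_1=\phi$, $\phi_2=\partial_x^{-1}\partial_t\phi$. The static kink is $\boldsymbol{H}(x)=(H(x),0)$, $H(x)=\tanh(x/\sqrt2)$. The set $$\boldsymbol{E}=\{(\phi_1,\phi_2)\in L^1_{loc}(\mathbb{R})^2:\ \partial_x\phi_1,\ \phi_2\in L^2(\mathbb{R}),\ \phi_1^2-1\in L^2(\mathbb{R})\},$$ and $\boldsymbol{E_H}=\{\boldsymbol{\phi}\in\boldsymbol{E}:\ \boldsymbol{\phi}-\boldsymbol{H}\in H^1(\mathbb{R})\times L^2(\mathbb{R})\}$, with the topology given by the distance $\|\boldsymbol\phi-\boldsymbol\psi\|_{H^1\times L^2}$. Solutions are understood in the integral (Duhamel) sense for the perturbation $\boldsymbol{u}=\boldsymbol{\phi}-\boldsymbol{H}\in C(\mathbb{R};H^1\times L^2)$, which satisfies $\partial_tu_1=\partial_xu_2$, $\partial_tu_2=\partial_x(-\partial_x^2u_1+2u_1+F)$, $F=3u_1(H^2-1)+u_1^2(u_1+3H)$. *)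

theory Defs
  imports "HOL-Analysis.Analysis" "HOL-Library.Function_Algebras"
begin

text \<open>
  Elements of Lebesgue and Sobolev spaces are represented by Lebesgue measurable functions
  \<^typ>\<open>real \<Rightarrow> real\<close>; equality of the corresponding classes is equality almost everywhere.
  Differences of functions and of pairs of functions are the pointwise ones.
\<close>

type_synonym state = "(real \<Rightarrow> real) \<times> (real \<Rightarrow> real)"

definition state_eq :: "state \<Rightarrow> state \<Rightarrow> bool"  (infix \<open>\<approx>\<close> 50)
  where "f \<approx> g \<longleftrightarrow> (AE x in lebesgue. fst f x = fst g x) \<and> (AE x in lebesgue. snd f x = snd g x)"


subsection \<open>Function spaces\<close>

definition smooth :: "(real \<Rightarrow> real) \<Rightarrow> bool"
  where "smooth f \<longleftrightarrow> (\<forall>n x. (deriv ^^ n) f field_differentiable (at x))"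

definition test_function :: "(real \<Rightarrow> real) \<Rightarrow> bool"
  where "test_function \<eta> \<longleftrightarrow> smooth \<eta> \<and> (\<exists>R. \<forall>x. R < \<bar>x\<bar> \<longrightarrow> \<eta> x = 0)"

definition L1_loc :: "(real \<Rightarrow> real) set"
  where "L1_loc = {f. \<forall>a b. f absolutely_integrable_on {a..b}}"

definition L2 :: "(real \<Rightarrow> real) set"
  where "L2 = {f. f \<in> borel_measurable lebesgue \<and> integrable lebesgue (\<lambda>x. (f x)\<^sup>2)}"

definition L2_norm :: "(real \<Rightarrow> real) \<Rightarrow> real"
  where "L2_norm f = sqrt (LINT x|lebesgue. (f x)\<^sup>2)"

definition has_weak_deriv :: "(real \<Rightarrow> real) \<Rightarrow> (real \<Rightarrow> real) \<Rightarrow> bool"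
  where "has_weak_deriv f g \<longleftrightarrow> f \<in> L1_loc \<and> g \<in> L1_loc \<and>
    (\<forall>\<eta>. test_function \<eta> \<longrightarrow>
      (LINT x|lebesgue. f x * deriv \<eta> x) = - (LINT x|lebesgue. g x * \<eta> x))"

text \<open>The weak derivative is determined up to almost everywhere equality.\<close>

definition weak_deriv :: "(real \<Rightarrow> real) \<Rightarrow> real \<Rightarrow> real"
  where "weak_deriv f = (SOME g. has_weak_deriv f g)"

definition H1 :: "(real \<Rightarrow> real) set"
  where "H1 = {f \<in> L2. \<exists>g\<in>L2. has_weak_deriv f g}"

definition H1_norm :: "(real \<Rightarrow> real) \<Rightarrow> real"
  where "H1_norm f = sqrt ((L2_norm f)\<^sup>2 + (L2_norm (weak_deriv f))\<^sup>2)"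

text \<open>The norm of \<open>H\<^sup>1 \<times> L\<^sup>2\<close>, to be used on \<^term>\<open>H1 \<times> L2\<close> only.\<close>

definition X_norm :: "state \<Rightarrow> real"
  where "X_norm f = sqrt ((H1_norm (fst f))\<^sup>2 + (L2_norm (snd f))\<^sup>2)"


subsection \<open>The kink and the energy space\<close>

definition H :: "real \<Rightarrow> real"
  where "H x = tanh (x / sqrt 2)"

definition kink :: state
  where "kink = (H, \<lambda>x. 0)"

definition E :: "state set"
  where "E = {\<phi>. fst \<phi> \<in> L1_loc \<and> snd \<phi> \<in> L1_loc \<and>
    (\<exists>g\<in>L2. has_weak_deriv (fst \<phi>) g) \<and> snd \<phi> \<in> L2 \<and> (\<lambda>x. (fst \<phi> x)\<^sup>2 - 1) \<in> L2}"

definition E_H :: "state set"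
  where "E_H = {\<phi> \<in> E. \<phi> - kink \<in> H1 \<times> L2}"

definition continuous_in_E_H :: "(real \<Rightarrow> state) \<Rightarrow> bool"
  where "continuous_in_E_H \<phi> \<longleftrightarrow> (\<forall>t. \<phi> t \<in> E_H) \<and>
    (\<forall>t. ((\<lambda>s. X_norm (\<phi> s - \<phi> t)) \<longlongrightarrow> 0) (at t))"

definition translate :: "real \<Rightarrow> state \<Rightarrow> state"
  where "translate r \<phi> = ((\<lambda>x. fst \<phi> (x + r)), (\<lambda>x. snd \<phi> (x + r)))"


subsection \<open>The free evolution\<close>

text \<open>
  Fourier transform on \<open>L\<^sup>2\<close> with the convention \<open>\<integral> e\<^bsup>-ix\<xi>\<^esup> f(x) dx\<close>, as the \<open>L\<^sup>2\<close> limit of the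
  transforms of the truncations of \<open>f\<close> to \<open>[-R, R]\<close>. The nonnegative integral is used
  so that the condition cannot hold through non-integrability.
\<close>

definition has_fourier :: "(real \<Rightarrow> real) \<Rightarrow> (real \<Rightarrow> complex) \<Rightarrow> bool"
  where "has_fourier f g \<longleftrightarrow> g \<in> borel_measurable lebesgue \<and>
    integrable lebesgue (\<lambda>\<xi>. (cmod (g \<xi>))\<^sup>2) \<and>
    ((\<lambda>R. \<integral>\<^sup>+\<xi>. ennreal ((cmod ((LINT x:{-R..R}|lebesgue. cis (- (x * \<xi>)) * complex_of_real (f x))
        - g \<xi>))\<^sup>2) \<partial>lebesgue) \<longlongrightarrow> 0) at_top"

definition fourier :: "(real \<Rightarrow> real) \<Rightarrow> real \<Rightarrow> complex"
  where "fourier f = (SOME g. has_fourier f g)"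

definition freq :: "real \<Rightarrow> real"
  where "freq \<xi> = \<bar>\<xi>\<bar> * sqrt (\<xi>\<^sup>2 + 2)"

text \<open>
  The group on \<open>H\<^sup>1 \<times> L\<^sup>2\<close> generated by \<open>(u\<^sub>1, u\<^sub>2) \<mapsto> (\<partial>\<^sub>x u\<^sub>2, \<partial>\<^sub>x (- \<partial>\<^sub>x\<^sup>2 u\<^sub>1 + 2 u\<^sub>1))\<close>. On the Fourier side
  the generator is the matrix with rows \<open>(0, i\<xi>)\<close> and \<open>(i\<xi>(\<xi>\<^sup>2 + 2), 0)\<close>, whose square is
  \<open>- (freq \<xi>)\<^sup>2\<close> times the identity; hence the exponential below.
  Division by \<open>freq \<xi> = 0\<close> occurs at \<open>\<xi> = 0\<close> only.
\<close>

definition free_group :: "real \<Rightarrow> state \<Rightarrow> state"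
  where "free_group t f = (SOME g. g \<in> H1 \<times> L2 \<and>
    (AE \<xi> in lebesgue. fourier (fst g) \<xi> =
        of_real (cos (freq \<xi> * t)) * fourier (fst f) \<xi>
        + \<i> * of_real (\<xi> * sin (freq \<xi> * t) / freq \<xi>) * fourier (snd f) \<xi>) \<and>
    (AE \<xi> in lebesgue. fourier (snd g) \<xi> =
        \<i> * of_real (\<xi> * (\<xi>\<^sup>2 + 2) * sin (freq \<xi> * t) / freq \<xi>) * fourier (fst f) \<xi>
        + of_real (cos (freq \<xi> * t)) * fourier (snd f) \<xi>))"


subsection \<open>Solutions in the Duhamel sense\<close>

text \<open>
  \<open>J\<close> is the (oriented, Riemann) integral of \<open>w\<close> from \<open>0\<close> to \<open>t\<close> with values in \<open>H\<^sup>1 \<times> L\<^sup>2\<close>.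
  In the Duhamel formula the integrand is continuous with values in \<open>H\<^sup>1 \<times> L\<^sup>2\<close>.
\<close>

definition has_X_integral :: "(real \<Rightarrow> state) \<Rightarrow> real \<Rightarrow> state \<Rightarrow> bool"
  where "has_X_integral w t J \<longleftrightarrow> J \<in> H1 \<times> L2 \<and> (\<forall>s\<in>{min 0 t..max 0 t}. w s \<in> H1 \<times> L2) \<and>
    (\<forall>\<epsilon>>0. \<exists>d>0. \<forall>p. p tagged_division_of {min 0 t..max 0 t} \<and> (\<lambda>s. ball s d) fine p \<longrightarrow>
      X_norm (((\<lambda>x. sgn t * (\<Sum>(s, K)\<in>p. measure lborel K * fst (w s) x)),
               (\<lambda>x. sgn t * (\<Sum>(s, K)\<in>p. measure lborel K * snd (w s) x))) - J) < \<epsilon>)"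

definition nonlin :: "(real \<Rightarrow> real) \<Rightarrow> real \<Rightarrow> real"
  where "nonlin u x = 3 * u x * ((H x)\<^sup>2 - 1) + (u x)\<^sup>2 * (u x + 3 * H x)"

text \<open>
  How \<^const>\<open>nonlin\<close> arises from \<open>\<partial>\<^sub>t \<phi>\<^sub>2 = - \<partial>\<^sub>x (\<partial>\<^sub>x\<^sup>2 \<phi>\<^sub>1 + \<phi>\<^sub>1 - \<phi>\<^sub>1\<^sup>3)\<close> with \<open>\<phi>\<^sub>1 = H + u\<^sub>1\<close>, given that
  \<open>H'' = - H + H\<^sup>3\<close>.
\<close>

lemma nonlin_expansion:
  "- ((H x + u x) - (H x + u x) ^ 3) = - (H x - (H x) ^ 3) + 2 * u x + nonlin u x"
  by (simp add: nonlin_def power2_eq_square power3_eq_cube algebra_simps)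

lemma H_has_derivs:
  "(H has_real_derivative (1 - (H x)\<^sup>2) / sqrt 2) (at x)"
  "((\<lambda>x. (1 - (H x)\<^sup>2) / sqrt 2) has_real_derivative (- H x + (H x) ^ 3)) (at x)"
proof -
  have *: "(H has_real_derivative (1 - (H y)\<^sup>2) / sqrt 2) (at y)" for y
    unfolding H_def [abs_def]
    by (rule derivative_eq_intros refl | simp add: real_div_sqrt field_simps)+
  show "(H has_real_derivative (1 - (H x)\<^sup>2) / sqrt 2) (at x)"
    by (rule *)
  have "((\<lambda>x. (1 - (H x)\<^sup>2) / sqrt 2) has_real_derivative
          - (2 * H x * ((1 - (H x)\<^sup>2) / sqrt 2)) / sqrt 2) (at x)"
    by (auto intro!: derivative_eq_intros *)
  moreover have "- (2 * h * ((1 - h\<^sup>2) / sqrt 2)) / sqrt 2 = - h + h ^ 3" for h :: real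
    by (simp add: field_simps power2_eq_square power3_eq_cube)
  ultimately show "((\<lambda>x. (1 - (H x)\<^sup>2) / sqrt 2) has_real_derivative (- H x + (H x) ^ 3)) (at x)"
    by simp
qed

text \<open>
  With \<open>u = \<phi> - kink\<close>:
  \<open>u(t) = S(t) u(0) + \<integral>\<^sub>0\<^sup>t S(t - s) (0, \<partial>\<^sub>x F(u\<^sub>1(s))) ds\<close>, where \<open>S\<close> is \<^const>\<open>free_group\<close> and
  \<open>F\<close> is \<^const>\<open>nonlin\<close>.
\<close>

definition global_solution :: "(real \<Rightarrow> state) \<Rightarrow> bool"
  where "global_solution \<phi> \<longleftrightarrow> continuous_in_E_H \<phi> \<and>
    (\<forall>t. \<exists>J. has_X_integral
            (\<lambda>s. free_group (t - s) ((\<lambda>x. 0), weak_deriv (nonlin (fst (\<phi> s - kink))))) t J \<and>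
          \<phi> t - kink \<approx> free_group t (\<phi> 0 - kink) + J)"

end

theory Submission
  imports Defs "HOL-Probability.Sinc_Integral"
begin

text \<open>
  The quadratic part of the energy is a Hilbert space norm on \<open>H\<^sup>1 \<times> L\<^sup>2\<close> for which the free evolution is
  a unitary group \<open>U\<close>. Since \<open>(0, \<partial>\<^sub>x F(u\<^sub>1))\<close> is locally Lipschitz there, \<open>v(t) = U(-t) u(t)\<close> turns the
  Duhamel equation into an ordinary differential equation. It has unique global solutions because the
  energy \<open>En\<close> is conserved and, with Gronwall for \<open>\<parallel>u\<^sub>1\<parallel>\<^sub>2\<close>, controls the norm.

  For stability no spectral theory is needed: completing the square (Bogomolny) gives
  \<open>2 En = \<parallel>u\<^sub>2\<parallel>\<^sup>2 + \<parallel>\<partial>\<^sub>x \<phi>\<^sub>1 - (1 - \<phi>\<^sub>1\<^sup>2)/\<surd>2\<parallel>\<^sup>2\<close>, so at each time \<open>\<phi>\<^sub>1\<close> nearly solves the first order kink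
  equation. Comparing \<open>\<phi>\<^sub>1\<close>, recentred at one of its zeros, with \<open>H\<close> on each half line shows that it is
  \<open>H\<^sup>1\<close>-close to \<open>H\<close>. As \<open>\<partial>\<^sub>t u\<^sub>1 = \<partial>\<^sub>x u\<^sub>2\<close> is small in \<open>H\<^sup>-\<^sup>1\<close>, the zero moves little in unit time, and
  interpolating its positions at integer times yields the smooth \<open>\<rho>\<close>.
\<close>

section \<open>The Hilbert space of square integrable functions\<close>

text \<open>The notions to be treated are given by choice or by limits of functions:
  \<open>weak_deriv\<close>, \<open>fourier\<close> and \<open>free_group\<close> select
  representatives, and \<open>has_X_integral\<close> is a limit of Riemann sums. Each is therefore
  shown to be determined up to null sets and carried to the Hilbert space
  \<open>l2 \<times> l2\<close> by the map \<open>TT\<close>; \<open>global_solution_iff\<close> is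
  the resulting dictionary. Derivatives are taken as the generator of translations in L2, since this
  notion is visible both as a multiplier in frequency and as a limit of difference quotients, which
  gives the product rules.

  The obstacle to conserving \<open>En\<close> is regularity: \<open>u1\<close> need not be
  differentiable in time with values in L2, because \<partial>x u2 is only in H^-1. But an increment
  of \<open>u1\<close> can be tested against itself, so its squared L2 norm is o(|t - s|), and a
  functional with a quadratic L2 remainder can still be differentiated
  (\<open>functional_DERIV\<close>).

  The centre chosen at each time is an arbitrary zero: no continuity in time is available and no
  modulation equation is solved. Only the displacement over unit time is bounded, and this is all
  that the interpolation uses.\<close>

lemma L2_measurable [measurable_dest]: "f \<in> L2 \<Longrightarrow> f \<in> borel_measurable lebesgue"
  by (simp add: L2_def)

lemma L2_integrable: "f \<in> L2 \<Longrightarrow> integrable lebesgue (\<lambda>x. (f x)\<^sup>2)"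
  by (simp add: L2_def)

lemma L2I: "f \<in> borel_measurable lebesgue \<Longrightarrow> integrable lebesgue (\<lambda>x. (f x)\<^sup>2) \<Longrightarrow> f \<in> L2"
  by (simp add: L2_def)

lemma L2_bound:
  assumes "g \<in> L2" "f \<in> borel_measurable lebesgue" "AE x in lebesgue. \<bar>f x\<bar> \<le> K * \<bar>g x\<bar>"
  shows "f \<in> L2"
proof (rule L2I)
  have "integrable lebesgue (\<lambda>x. K\<^sup>2 * (g x)\<^sup>2)"
    using L2_integrable[OF assms(1)] by simp
  then show "integrable lebesgue (\<lambda>x. (f x)\<^sup>2)"
  proof (rule Bochner_Integration.integrable_bound)
    show "AE x in lebesgue. norm ((f x)\<^sup>2) \<le> norm (K\<^sup>2 * (g x)\<^sup>2)"
      using assms(3)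
    proof eventually_elim
      case (elim x)
      then have "\<bar>f x\<bar>\<^sup>2 \<le> (K * \<bar>g x\<bar>)\<^sup>2" by (intro power_mono) auto
      then show ?case by (simp add: power_mult_distrib)
    qed
  qed (use assms(2) in measurable)
qed (fact assms(2))

lemma L2_zero [simp]: "(\<lambda>x. 0) \<in> L2"
  by (simp add: L2_def)

lemma L2_add:
  assumes "f \<in> L2" "g \<in> L2" shows "(\<lambda>x. f x + g x) \<in> L2"
proof (rule L2I)
  have [measurable]: "f \<in> borel_measurable lebesgue" "g \<in> borel_measurable lebesgue"
    using assms by (auto simp: L2_def)
  show "(\<lambda>x. f x + g x) \<in> borel_measurable lebesgue" by measurable
  have "integrable lebesgue (\<lambda>x. 2 * (f x)\<^sup>2 + 2 * (g x)\<^sup>2)"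
    using assms by (simp add: L2_def)
  then show "integrable lebesgue (\<lambda>x. (f x + g x)\<^sup>2)"
  proof (rule Bochner_Integration.integrable_bound)
    have "(f x + g x)\<^sup>2 \<le> 2 * (f x)\<^sup>2 + 2 * (g x)\<^sup>2" for x
      using sum_squares_bound[of "f x" "g x"] unfolding power2_sum by linarith
    then show "AE x in lebesgue. norm ((f x + g x)\<^sup>2) \<le> norm (2 * (f x)\<^sup>2 + 2 * (g x)\<^sup>2)"
      by auto
  qed measurable
qed

lemma L2_scale: "f \<in> L2 \<Longrightarrow> (\<lambda>x. c * f x) \<in> L2"
  by (rule L2_bound[where g=f and K="\<bar>c\<bar>"]) (auto simp: L2_def abs_mult)

lemma L2_minus: "f \<in> L2 \<Longrightarrow> (\<lambda>x. - f x) \<in> L2"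
  using L2_scale[of f "-1"] by simp

lemma L2_diff: "f \<in> L2 \<Longrightarrow> g \<in> L2 \<Longrightarrow> (\<lambda>x. f x - g x) \<in> L2"
  using L2_add[of f "\<lambda>x. - g x"] L2_minus[of g] by simp

lemma L2_mult_integrable:
  assumes "f \<in> L2" "g \<in> L2" shows "integrable lebesgue (\<lambda>x. f x * g x)"
proof -
  have [measurable]: "f \<in> borel_measurable lebesgue" "g \<in> borel_measurable lebesgue"
    using assms by (auto simp: L2_def)
  have "integrable lebesgue (\<lambda>x. (f x)\<^sup>2 + (g x)\<^sup>2)"
    using assms by (simp add: L2_def)
  then show ?thesis
  proof (rule Bochner_Integration.integrable_bound)
    have "\<bar>f x * g x\<bar> \<le> (f x)\<^sup>2 + (g x)\<^sup>2" for x
    proof -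
      have "2 * (\<bar>f x\<bar> * \<bar>g x\<bar>) \<le> (f x)\<^sup>2 + (g x)\<^sup>2"
        using sum_squares_bound[of "\<bar>f x\<bar>" "\<bar>g x\<bar>"] by (simp add: mult.assoc)
      moreover have "0 \<le> \<bar>f x\<bar> * \<bar>g x\<bar>" by simp
      ultimately show ?thesis unfolding abs_mult by linarith
    qed
    then show "AE x in lebesgue. norm (f x * g x) \<le> norm ((f x)\<^sup>2 + (g x)\<^sup>2)"
      by auto
  qed measurable
qed

lemma L2_cong_AE:
  assumes "f \<in> L2" "g \<in> borel_measurable lebesgue" "AE x in lebesgue. f x = g x"
  shows "g \<in> L2"
  by (rule L2_bound[where g=f and K=1]) (use assms in auto)

section \<open>Square integrable functions modulo null sets, as a real inner product space\<close>

definition l2rel :: "(real \<Rightarrow> real) \<Rightarrow> (real \<Rightarrow> real) \<Rightarrow> bool"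
  where "l2rel f g \<longleftrightarrow> f \<in> L2 \<and> g \<in> L2 \<and> (AE x in lebesgue. f x = g x)"

\<comment> \<open>The relation is partial so that functions outside L2 do not enter the quotient.
  Every element of the type is then a class of square integrable functions, and the type itself can
  be made an instance of the Hilbert space classes.\<close>
quotient_type l2 = "real \<Rightarrow> real" / partial: l2rel
proof (rule part_equivpI)
  show "\<exists>x. l2rel x x"
    by (rule exI[of _ "\<lambda>x. 0"]) (simp add: l2rel_def)
  show "symp l2rel"
    by (auto intro!: sympI simp: l2rel_def eq_commute)
  show "transp l2rel"
  proof (rule transpI)
    fix f g h assume "l2rel f g" "l2rel g h"
    then have fg: "AE x in lebesgue. f x = g x" "AE x in lebesgue. g x = h x" and "f \<in> L2" "h \<in> L2"
      by (auto simp: l2rel_def)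
    from fg have "AE x in lebesgue. f x = h x"
      by eventually_elim simp
    then show "l2rel f h" using \<open>f \<in> L2\<close> \<open>h \<in> L2\<close> by (simp add: l2rel_def)
  qed
qed

text \<open>\<open>cl f\<close> carries information only when \<open>f \<in> L2\<close>. The
  representative \<open>fn a\<close> is an arbitrary fixed choice, so identities about it hold
  almost everywhere only; this is why algebraic laws are proved by combining such identities
  pointwise.\<close>

definition cl :: "(real \<Rightarrow> real) \<Rightarrow> l2" where "cl = abs_l2"
definition fn :: "l2 \<Rightarrow> real \<Rightarrow> real" where "fn = rep_l2"

lemma fn_L2 [simp]: "fn a \<in> L2"
  using Quotient3_rep_reflp[OF Quotient3_l2, of a] by (simp add: fn_def l2rel_def)

lemma fn_measurable [measurable]: "fn a \<in> borel_measurable lebesgue"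
  using fn_L2 by (simp add: L2_def del: fn_L2)

lemma cl_fn [simp]: "cl (fn a) = a"
  using Quotient3_abs_rep[OF Quotient3_l2, of a] by (simp add: fn_def cl_def)

lemma cl_eq_iff:
  assumes "f \<in> L2" "g \<in> L2" shows "cl f = cl g \<longleftrightarrow> (AE x in lebesgue. f x = g x)"
  using Quotient3_rel[OF Quotient3_l2, of f g] assms by (auto simp: cl_def l2rel_def)

lemma cl_cong:
  assumes "f \<in> L2" "AE x in lebesgue. f x = g x" "g \<in> borel_measurable lebesgue"
  shows "cl f = cl g"
  using assms L2_cong_AE[OF assms(1) assms(3,2)] by (simp add: cl_eq_iff)

lemma fn_cl: "f \<in> L2 \<Longrightarrow> AE x in lebesgue. fn (cl f) x = f x"
  using cl_eq_iff[of "fn (cl f)" f] by simp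

lemma l2_eq_iff: "a = b \<longleftrightarrow> (AE x in lebesgue. fn a x = fn b x)"
  using cl_eq_iff[of "fn a" "fn b"] by simp

instantiation l2 :: real_vector
begin
definition "zero_l2 = cl (\<lambda>x. 0)"
definition "plus_l2 a b = cl (\<lambda>x. fn a x + fn b x)"
definition "minus_l2 a b = cl (\<lambda>x. fn a x - fn b x)"
definition "uminus_l2 a = cl (\<lambda>x. - fn a x)"
definition "scaleR_l2 c a = cl (\<lambda>x. c * fn a x)"

lemma fn_zero: "AE x in lebesgue. fn 0 x = 0"
  unfolding zero_l2_def by (rule fn_cl) simp

lemma fn_add: "AE x in lebesgue. fn (a + b) x = fn a x + fn b x"
  unfolding plus_l2_def by (intro fn_cl L2_add fn_L2)

lemma fn_diff: "AE x in lebesgue. fn (a - b) x = fn a x - fn b x"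
  unfolding minus_l2_def by (intro fn_cl L2_diff fn_L2)

lemma fn_uminus: "AE x in lebesgue. fn (- a) x = - fn a x"
  unfolding uminus_l2_def by (intro fn_cl L2_minus fn_L2)

lemma fn_scaleR: "AE x in lebesgue. fn (c *\<^sub>R a) x = c * fn a x"
  unfolding scaleR_l2_def by (intro fn_cl L2_scale fn_L2)

instance
proof
  fix a b c :: l2 and r s :: real
  show "a + b + c = a + (b + c)"
    using fn_add[of "a+b" c] fn_add[of a b] fn_add[of a "b+c"] fn_add[of b c]
    unfolding l2_eq_iff by eventually_elim simp
  show "a + b = b + a"
    by (simp add: plus_l2_def add.commute)
  show "0 + a = a"
    using fn_add[of 0 a] fn_zero unfolding l2_eq_iff by eventually_elim simp
  show "- a + a = 0"
    using fn_add[of "-a" a] fn_zero fn_uminus[of a] unfolding l2_eq_iff by eventually_elim simp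
  show "a - b = a + - b"
    using fn_add[of a "-b"] fn_diff[of a b] fn_uminus[of b] unfolding l2_eq_iff by eventually_elim simp
  show "r *\<^sub>R (a + b) = r *\<^sub>R a + r *\<^sub>R b"
    using fn_add[of a b] fn_add[of "r *\<^sub>R a" "r *\<^sub>R b"] fn_scaleR[of r a] fn_scaleR[of r b] fn_scaleR[of r "a+b"]
    unfolding l2_eq_iff by eventually_elim (simp add: algebra_simps)
  show "(r + s) *\<^sub>R a = r *\<^sub>R a + s *\<^sub>R a"
    using fn_add[of "r *\<^sub>R a" "s *\<^sub>R a"] fn_scaleR[of r a] fn_scaleR[of s a] fn_scaleR[of "r+s" a]
    unfolding l2_eq_iff by eventually_elim (simp add: algebra_simps)
  show "r *\<^sub>R s *\<^sub>R a = (r * s) *\<^sub>R a"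
    using fn_scaleR[of r "s *\<^sub>R a"] fn_scaleR[of s a] fn_scaleR[of "r * s" a]
    unfolding l2_eq_iff by eventually_elim (simp add: algebra_simps)
  show "1 *\<^sub>R a = a"
    using fn_scaleR[of 1 a] unfolding l2_eq_iff by eventually_elim simp
qed
end

instantiation l2 :: real_inner
begin
definition "inner_l2 a b = (LINT x|lebesgue. fn a x * fn b x)"
definition "norm_l2 (a::l2) = sqrt (inner a a)"
definition "sgn_l2 (a::l2) = a /\<^sub>R norm a"
definition "dist_l2 (a::l2) b = norm (a - b)"
definition [code del]: "uniformity_l2 = (INF e\<in>{0<..}. principal {(x::l2, y). dist x y < e})"
definition [code del]: "open_l2 (U::l2 set) \<longleftrightarrow> (\<forall>x\<in>U. eventually (\<lambda>(x', y). x' = x \<longrightarrow> y \<in> U) uniformity)"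

lemma inner_l2_cong:
  assumes "AE x in lebesgue. fn a x = f x" "AE x in lebesgue. fn b x = g x"
    "f \<in> borel_measurable lebesgue" "g \<in> borel_measurable lebesgue"
  shows "inner a b = (LINT x|lebesgue. f x * g x)"
  unfolding inner_l2_def
proof (rule integral_cong_AE)
  show "AE x in lebesgue. fn a x * fn b x = f x * g x"
    using assms(1,2) by eventually_elim simp
qed (use assms(3,4) in measurable)

instance
proof
  fix a b c :: l2 and r :: real
  show "dist a b = norm (a - b)" by (rule dist_l2_def)
  show "sgn a = a /\<^sub>R norm a" by (rule sgn_l2_def)
  show "uniformity = (INF e\<in>{0<..}. principal {(x::l2, y). dist x y < e})" by (rule uniformity_l2_def)
  show "open U \<longleftrightarrow> (\<forall>x\<in>U. eventually (\<lambda>(x', y). x' = x \<longrightarrow> y \<in> U) uniformity)" for U :: "l2 set" by (rule open_l2_def)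
  show "inner a b = inner b a" by (simp add: inner_l2_def mult.commute)
  show "inner (a + b) c = inner a c + inner b c"
  proof -
    have "inner (a + b) c = (LINT x|lebesgue. (fn a x + fn b x) * fn c x)"
      by (rule inner_l2_cong[OF fn_add]) auto
    also have "\<dots> = inner a c + inner b c"
      unfolding inner_l2_def by (simp add: ring_distribs L2_mult_integrable)
    finally show ?thesis .
  qed
  show "inner (r *\<^sub>R a) b = r * inner a b"
  proof -
    have "inner (r *\<^sub>R a) b = (LINT x|lebesgue. (r * fn a x) * fn b x)"
      by (rule inner_l2_cong[OF fn_scaleR]) auto
    also have "\<dots> = r * inner a b"
      unfolding inner_l2_def by (simp add: mult.assoc)
    finally show ?thesis .
  qed
  show "0 \<le> inner a a" by (simp add: inner_l2_def)
  show "inner a a = 0 \<longleftrightarrow> a = 0"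
  proof -
    have "inner a a = 0 \<longleftrightarrow> (AE x in lebesgue. fn a x * fn a x = 0)"
      unfolding inner_l2_def
      by (rule integral_nonneg_eq_0_iff_AE) (auto intro: L2_mult_integrable)
    also have "\<dots> \<longleftrightarrow> (AE x in lebesgue. fn a x = fn 0 x)"
    proof
      assume "AE x in lebesgue. fn a x * fn a x = 0"
      then show "AE x in lebesgue. fn a x = fn 0 x"
        using fn_zero by eventually_elim simp
    next
      assume "AE x in lebesgue. fn a x = fn 0 x"
      then show "AE x in lebesgue. fn a x * fn a x = 0"
        using fn_zero by eventually_elim simp
    qed
    finally show ?thesis by (simp add: l2_eq_iff)
  qed
  show "norm a = sqrt (inner a a)" by (rule norm_l2_def)
qed
end

lemma inner_cl:
  assumes "f \<in> L2" "g \<in> L2" shows "inner (cl f) (cl g) = (LINT x|lebesgue. f x * g x)"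
  by (rule inner_l2_cong[OF fn_cl fn_cl]) (use assms in \<open>auto simp: L2_def\<close>)

lemma norm_cl: "f \<in> L2 \<Longrightarrow> norm (cl f) = L2_norm f"
  by (simp add: norm_eq_sqrt_inner inner_cl L2_norm_def power2_eq_square)

lemma norm_cl_power2: "f \<in> L2 \<Longrightarrow> (norm (cl f))\<^sup>2 = (LINT x|lebesgue. (f x)\<^sup>2)"
  by (simp add: norm_cl L2_norm_def)

lemma norm_l2_power2: "(norm a)\<^sup>2 = (LINT x|lebesgue. (fn a x)\<^sup>2)"
  using norm_cl_power2[of "fn a"] by simp

lemma cl_add:
  assumes f: "f \<in> L2" and g: "g \<in> L2" shows "cl (\<lambda>x. f x + g x) = cl f + cl g"
  using fn_cl[OF L2_add[OF f g]] fn_add[of "cl f" "cl g"] fn_cl[OF f] fn_cl[OF g]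
  unfolding l2_eq_iff by eventually_elim simp

lemma cl_scaleR:
  assumes f: "f \<in> L2" shows "cl (\<lambda>x. c * f x) = c *\<^sub>R cl f"
  using fn_cl[OF L2_scale[OF f, of c]] fn_scaleR[of c "cl f"] fn_cl[OF f]
  unfolding l2_eq_iff by eventually_elim simp

lemma cl_uminus: "f \<in> L2 \<Longrightarrow> cl (\<lambda>x. - f x) = - cl f"
  using cl_scaleR[of f "-1"] by simp

lemma cl_diff: "f \<in> L2 \<Longrightarrow> g \<in> L2 \<Longrightarrow> cl (\<lambda>x. f x - g x) = cl f - cl g"
  using cl_add[of f "\<lambda>x. - g x"] cl_uminus[of g] L2_minus[of g] by simp

lemma cl_zero: "cl (\<lambda>x. 0) = 0"
  by (simp add: zero_l2_def)

lemma norm_cl_le: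
  assumes "g \<in> L2" "f \<in> borel_measurable lebesgue" "AE x in lebesgue. \<bar>f x\<bar> \<le> \<bar>g x\<bar>"
  shows "norm (cl f) \<le> norm (cl g)"
proof -
  have f: "f \<in> L2" by (rule L2_bound[where g=g and K=1]) (use assms in auto)
  have "(norm (cl f))\<^sup>2 \<le> (norm (cl g))\<^sup>2"
    unfolding norm_cl_power2[OF f] norm_cl_power2[OF assms(1)]
    by (rule integral_mono_AE) (use assms f in \<open>auto simp: L2_integrable abs_le_square_iff\<close>)
  then show ?thesis by (rule power2_le_imp_le) simp
qed

lemma nn_integral_L2: "f \<in> L2 \<Longrightarrow> (\<integral>\<^sup>+x. ennreal ((f x)\<^sup>2) \<partial>lebesgue) = ennreal ((norm (cl f))\<^sup>2)"
  by (simp add: norm_cl_power2 nn_integral_eq_integral L2_integrable)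

section \<open>Fatou, completeness and dominated convergence in L2\<close>

lemma L2_nn_integralI:
  assumes "f \<in> borel_measurable lebesgue" "(\<integral>\<^sup>+x. ennreal ((f x)\<^sup>2) \<partial>lebesgue) \<le> ennreal (B\<^sup>2)"
  shows "f \<in> L2" and "0 \<le> B \<Longrightarrow> norm (cl f) \<le> B"
proof -
  have [measurable]: "f \<in> borel_measurable lebesgue" by fact
  show f: "f \<in> L2"
  proof (rule L2I)
    have "(\<integral>\<^sup>+x. ennreal ((f x)\<^sup>2) \<partial>lebesgue) < \<infinity>"
      using assms(2) by (auto intro: le_less_trans simp: ennreal_less_top)
    then show "integrable lebesgue (\<lambda>x. (f x)\<^sup>2)"
      by (intro integrableI_nonneg) auto
  qed fact
  show "norm (cl f) \<le> B" if "0 \<le> B"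
  proof -
    have "(norm (cl f))\<^sup>2 \<le> B\<^sup>2"
      using assms(2) unfolding nn_integral_L2[OF f] by simp
    then show ?thesis using that by (rule power2_le_imp_le)
  qed
qed

text \<open>Fatou for the squares. It supplies membership of the limit together with the bound,
  which is what completeness needs, since there the limit is known only pointwise and no dominating
  function is available.\<close>

lemma L2_fatou:
  assumes "\<And>n. f n \<in> L2" "\<And>n. norm (cl (f n)) \<le> B" "g \<in> borel_measurable lebesgue"
    "AE x in lebesgue. (\<lambda>n. f n x) \<longlonglongrightarrow> g x"
  shows "g \<in> L2" "norm (cl g) \<le> B"
proof -
  have B: "0 \<le> B" using assms(2)[of 0] norm_ge_zero order_trans by blast
  have "(\<integral>\<^sup>+x. ennreal ((g x)\<^sup>2) \<partial>lebesgue) = (\<integral>\<^sup>+x. liminf (\<lambda>n. ennreal ((f n x)\<^sup>2)) \<partial>lebesgue)"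
  proof (rule nn_integral_cong_AE, use assms(4) in eventually_elim)
    case (elim x)
    then have "(\<lambda>n. ennreal ((f n x)\<^sup>2)) \<longlonglongrightarrow> ennreal ((g x)\<^sup>2)"
      by (intro tendsto_ennrealI tendsto_power)
    from lim_imp_Liminf[OF trivial_limit_sequentially this] show ?case by simp
  qed
  also have "\<dots> \<le> liminf (\<lambda>n. \<integral>\<^sup>+x. ennreal ((f n x)\<^sup>2) \<partial>lebesgue)"
    by (rule nn_integral_liminf) (use assms(1) in \<open>auto simp: L2_def\<close>)
  also have "\<dots> = liminf (\<lambda>n. ennreal ((norm (cl (f n)))\<^sup>2))"
    by (simp add: nn_integral_L2 assms(1))
  also have "\<dots> \<le> limsup (\<lambda>n. ennreal ((norm (cl (f n)))\<^sup>2))"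
    by (rule Liminf_le_Limsup) simp
  also have "\<dots> \<le> ennreal (B\<^sup>2)"
    by (rule Limsup_bounded) (auto intro!: always_eventually ennreal_leI power_mono assms(2))
  finally have *: "(\<integral>\<^sup>+x. ennreal ((g x)\<^sup>2) \<partial>lebesgue) \<le> ennreal (B\<^sup>2)" .
  show "g \<in> L2" "norm (cl g) \<le> B"
    using L2_nn_integralI[OF assms(3) *] B by auto
qed

text \<open>The weights \<open>2^n\<close> do the work: \<open>2^n * (1/4)^n\<close> is summable, so
  the series of \<open>2^n * (d n x)^2\<close> is finite almost everywhere. At such points the
  increments are bounded by a geometric sequence of ratio \<open>sqrt (1/2)\<close>, and the
  sequence converges.\<close>

lemma l2_Cauchy_subseq_AE:
  fixes a :: "nat \<Rightarrow> l2"
  assumes "\<And>n. norm (a (Suc n) - a n) \<le> (1/2)^n"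
  shows "AE x in lebesgue. convergent (\<lambda>n. fn (a n) x)"
proof -
  define d where "d n x = fn (a (Suc n)) x - fn (a n) x" for n x
  have d: "d n \<in> L2" for n unfolding d_def by (intro L2_diff fn_L2)
  have [measurable]: "d n \<in> borel_measurable lebesgue" for n using d by (rule L2_measurable)
  have cld: "cl (d n) = a (Suc n) - a n" for n
    unfolding d_def by (simp add: cl_diff)
  have nd: "(norm (cl (d n)))\<^sup>2 \<le> (1/4)^n" for n
  proof -
    have "((1/2)^n)\<^sup>2 = ((1/4)^n :: real)"
      by (simp add: power2_eq_square flip: power_mult_distrib)
    with power_mono[OF assms[of n], of 2] cld[of n] show ?thesis by simp
  qed
  have "(\<integral>\<^sup>+x. (\<Sum>n. ennreal (2^n * (d n x)\<^sup>2)) \<partial>lebesgue) = (\<Sum>n. \<integral>\<^sup>+x. ennreal (2^n * (d n x)\<^sup>2) \<partial>lebesgue)"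
    by (rule nn_integral_suminf) measurable
  also have "\<dots> = (\<Sum>n. ennreal (2^n * (norm (cl (d n)))\<^sup>2))"
    by (intro suminf_cong) (simp add: ennreal_mult nn_integral_cmult nn_integral_L2 d)
  also have "\<dots> \<le> (\<Sum>n. ennreal ((1/2)^n))"
  proof (intro suminf_le allI ennreal_leI)
    fix n
    have "2^n * (norm (cl (d n)))\<^sup>2 \<le> 2^n * (1/4)^n" using nd by (intro mult_left_mono) auto
    also have "\<dots> = (1/2)^n" by (simp add: power_mult_distrib[symmetric])
    finally show "2^n * (norm (cl (d n)))\<^sup>2 \<le> (1/2)^n" .
  qed auto
  also have "\<dots> = ennreal (\<Sum>n. (1/2)^n)"
    by (intro suminf_ennreal_eq summable_sums) (auto intro: summable_geometric)
  finally have "(\<integral>\<^sup>+x. (\<Sum>n. ennreal (2^n * (d n x)\<^sup>2)) \<partial>lebesgue) \<noteq> \<infinity>"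
    by (auto simp: top_unique)
  then have "AE x in lebesgue. (\<Sum>n. ennreal (2^n * (d n x)\<^sup>2)) \<noteq> \<infinity>"
    by (intro nn_integral_PInf_AE) auto
  then show ?thesis
  proof eventually_elim
    case (elim x)
    define C where "C = enn2real (\<Sum>n. ennreal (2^n * (d n x)\<^sup>2))"
    have C: "(\<Sum>n. ennreal (2^n * (d n x)\<^sup>2)) = ennreal C" "0 \<le> C"
      unfolding C_def using elim
      by (rule ennreal_enn2real[symmetric, OF iffD1[OF less_top], unfolded infinity_ennreal_def[symmetric]]) (rule enn2real_nonneg)
    have "\<bar>d n x\<bar> \<le> sqrt C * (sqrt (1/2))^n" for n
    proof -
      have "ennreal (2^n * (d n x)\<^sup>2) \<le> ennreal C"
      proof -
        have "f n \<le> suminf f" for f :: "nat \<Rightarrow> ennreal"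
          using sum_le_suminf[of f "{n}"] by simp
        from this[of "\<lambda>n. ennreal (2^n * (d n x)\<^sup>2)"] show ?thesis
          unfolding C(1) .
      qed
      then have "2^n * (d n x)\<^sup>2 \<le> C" using C(2) by simp
      then have "(d n x)\<^sup>2 \<le> C * (1/2)^n" by (simp add: power_divide field_simps)
      then have "sqrt ((d n x)\<^sup>2) \<le> sqrt (C * (1/2)^n)" by (rule real_sqrt_le_mono)
      then show ?thesis unfolding real_sqrt_abs by (simp only: real_sqrt_mult real_sqrt_power)
    qed
    then have d_le: "norm (d n x) \<le> sqrt C * (sqrt (1/2))^n" if "n \<ge> 0" for n
      unfolding real_norm_def .
    have "sqrt (1/2) < sqrt 1" unfolding real_sqrt_less_iff by simp
    then have "norm (sqrt (1/2)) < 1" by simp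
    then have "summable (\<lambda>n. sqrt C * (sqrt (1/2))^n)"
      by (intro summable_mult summable_geometric)
    from summable_comparison_test'[OF this d_le] have "summable (\<lambda>n. d n x)" .
    then have "convergent (\<lambda>n. \<Sum>i<n. d i x)" by (simp add: summable_iff_convergent)
    moreover have "(\<Sum>i<n. d i x) = fn (a n) x - fn (a 0) x" for n
      unfolding d_def by (rule sum_lessThan_telescope)
    ultimately have "convergent (\<lambda>n. fn (a n) x - fn (a 0) x)" by simp
    then show ?case
      using convergent_add_const_iff[of "- fn (a 0) x" "\<lambda>n. fn (a n) x"] by simp
  qed
qed

text \<open>Riesz-Fischer: a rapidly Cauchy subsequence converges almost everywhere, and Fatou
  applied to its differences turns the pointwise limit into a limit in norm.\<close>

instance l2 :: complete_space
proof
  fix X :: "nat \<Rightarrow> l2" assume X: "Cauchy X"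
  have "\<exists>N. \<forall>m\<ge>N. \<forall>n\<ge>N. norm (X m - X n) < (1/2)^k" for k
    using X by (auto simp: Cauchy_def dist_norm)
  then obtain N where N: "\<And>k m n. m \<ge> N k \<Longrightarrow> n \<ge> N k \<Longrightarrow> norm (X m - X n) < (1/2)^k"
    by metis
  \<comment> \<open>Summing the thresholds gives \<open>r m \<ge> N k\<close> for all
    \<open>m \<ge> k\<close> although \<open>N\<close> need not be monotone.\<close>
  define r where "r k = (\<Sum>i\<le>k. N i) + k" for k
  have rN: "r k \<ge> N k" for k unfolding r_def by (simp add: member_le_sum trans_le_add1)
  have rk: "r k \<ge> k" for k unfolding r_def by simp
  have rmono: "r m \<ge> N k" if "m \<ge> k" for m k
    using member_le_sum[of k "{..m}" N] that unfolding r_def by simp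
  define a where "a n = X (r n)" for n
  have aa: "norm (a m - a n) \<le> (1/2)^k" if "m \<ge> k" "n \<ge> k" for m n k
    unfolding a_def using N[of k "r m" "r n"] rmono that by (simp add: less_imp_le)
  have conv: "AE x in lebesgue. convergent (\<lambda>n. fn (a n) x)"
    by (rule l2_Cauchy_subseq_AE) (auto intro: aa)
  define g where "g x = lim (\<lambda>n. fn (a n) x)" for x
  have [measurable]: "g \<in> borel_measurable lebesgue"
    unfolding g_def by measurable
  have lim: "AE x in lebesgue. (\<lambda>n. fn (a n) x) \<longlonglongrightarrow> g x"
    using conv by eventually_elim (simp add: g_def convergent_LIMSEQ_iff)
  have *: "(\<lambda>x. g x - fn (a k) x) \<in> L2" "norm (cl (\<lambda>x. g x - fn (a k) x)) \<le> (1/2)^k" for k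
  proof -
    define f where "f n x = fn (a (n + k)) x - fn (a k) x" for n x
    have f: "f n \<in> L2" for n unfolding f_def by (intro L2_diff fn_L2)
    have 1: "cl (f n) = a (n + k) - a k" for n unfolding f_def by (simp add: cl_diff)
    have 2: "AE x in lebesgue. (\<lambda>n. f n x) \<longlonglongrightarrow> g x - fn (a k) x"
      using lim
    proof eventually_elim
      case (elim x)
      then have "(\<lambda>n. fn (a (n + k)) x) \<longlonglongrightarrow> g x" by (rule LIMSEQ_ignore_initial_segment)
      then show ?case unfolding f_def by (intro tendsto_diff tendsto_const)
    qed
    show "(\<lambda>x. g x - fn (a k) x) \<in> L2" "norm (cl (\<lambda>x. g x - fn (a k) x)) \<le> (1/2)^k"
      by (rule L2_fatou[where B="(1/2)^k", OF f _ _ 2]; simp add: 1 aa)+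
  qed
  have g: "g \<in> L2"
    using L2_add[OF *(1)[of 0] fn_L2[of "a 0"]] by simp
  have **: "norm (cl g - a k) \<le> (1/2)^k" for k
    using *(2)[of k] g by (simp add: cl_diff)
  have "X \<longlonglongrightarrow> cl g"
  proof (rule LIMSEQ_I)
    fix e :: real assume "e > 0"
    then obtain k where k: "2 * (1/2)^k < e"
      using real_arch_pow_inv[of "e/2" "1/2"] by (auto simp: field_simps)
    have "norm (X n - cl g) < e" if "n \<ge> N k" for n
    proof -
      have "norm (X n - a k) < (1/2)^k" unfolding a_def using N that rN by simp
      moreover have "norm (a k - cl g) \<le> (1/2)^k" using **[of k] by (simp add: norm_minus_commute)
      moreover have "norm (X n - cl g) \<le> norm (X n - a k) + norm (a k - cl g)"
        using norm_triangle_ineq[of "X n - a k" "a k - cl g"] by simp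
      ultimately show ?thesis using k by linarith
    qed
    then show "\<exists>no. \<forall>n\<ge>no. norm (X n - cl g) < e" by blast
  qed
  then show "convergent X" by (rule convergentI)
qed

instance l2 :: banach ..

text \<open>Fatou applied to the differences from the norm limit shows that they have arbitrarily
  small norm. The point is that \<open>g\<close> is not assumed to be in L2: this is how an
  unbounded multiplier is later seen to produce a square integrable function.\<close>

lemma l2_limit_unique_AE:
  assumes "a \<longlonglongrightarrow> b" "g \<in> borel_measurable lebesgue"
    "AE x in lebesgue. (\<lambda>n. fn (a n) x) \<longlonglongrightarrow> g x"
  shows "g \<in> L2" "cl g = b"
proof -
  have *: "(\<lambda>x. g x - fn b x) \<in> L2 \<and> norm (cl (\<lambda>x. g x - fn b x)) \<le> e" if e: "e > 0" for e
  proof -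
    obtain k where k: "\<And>n. n \<ge> k \<Longrightarrow> norm (a n - b) < e"
      using LIMSEQ_D[OF assms(1) e] by blast
    define f where "f n x = fn (a (n + k)) x - fn b x" for n x
    have f: "f n \<in> L2" for n unfolding f_def by (intro L2_diff fn_L2)
    have 1: "cl (f n) = a (n + k) - b" for n unfolding f_def by (simp add: cl_diff)
    have 2: "AE x in lebesgue. (\<lambda>n. f n x) \<longlonglongrightarrow> g x - fn b x"
      using assms(3)
    proof eventually_elim
      case (elim x)
      then have "(\<lambda>n. fn (a (n + k)) x) \<longlonglongrightarrow> g x" by (rule LIMSEQ_ignore_initial_segment)
      then show ?case unfolding f_def by (intro tendsto_diff tendsto_const)
    qed
    have 3: "norm (cl (f n)) \<le> e" for n unfolding 1 using k[of "n+k"] by (simp add: less_imp_le)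
    show ?thesis
      using L2_fatou[OF f 3 _ 2] assms(2) by auto
  qed
  show g: "g \<in> L2"
    using L2_add[OF conjunct1[OF *[of 1]] fn_L2[of b]] by simp
  have "norm (cl g - b) \<le> e" if "e > 0" for e
    using *[OF that] g by (simp add: cl_diff)
  then have "norm (cl g - b) \<le> 0" by (rule field_le_epsilon) simp
  then show "cl g = b" by simp
qed

lemma l2_dominated_convergence:
  assumes "w \<in> L2" "\<And>n. f n \<in> borel_measurable lebesgue" "g \<in> borel_measurable lebesgue"
    "\<And>n. AE x in lebesgue. \<bar>f n x\<bar> \<le> \<bar>w x\<bar>" "AE x in lebesgue. (\<lambda>n. f n x) \<longlonglongrightarrow> g x"
  shows "(\<lambda>n. cl (f n)) \<longlonglongrightarrow> cl g"
proof -
  note [measurable] = assms(2,3)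
  have f: "f n \<in> L2" for n by (rule L2_bound[where g=w and K=1]) (use assms in auto)
  have "AE x in lebesgue. \<forall>n. \<bar>f n x\<bar> \<le> \<bar>w x\<bar>" using assms(4) by (simp add: AE_all_countable)
  then have gw: "AE x in lebesgue. \<bar>g x\<bar> \<le> \<bar>w x\<bar>"
    using assms(5)
  proof eventually_elim
    case (elim x)
    show ?case by (rule LIMSEQ_le_const2[OF tendsto_rabs[OF elim(2)]]) (use elim(1) in auto)
  qed
  have g: "g \<in> L2" by (rule L2_bound[where g=w and K=1]) (use assms gw in auto)
  have "(\<lambda>n. integral\<^sup>L lebesgue (\<lambda>x. (f n x - g x)\<^sup>2)) \<longlonglongrightarrow> integral\<^sup>L lebesgue (\<lambda>x::real. (0::real))"
  proof (rule integral_dominated_convergence[where w="\<lambda>x. 4 * (w x)\<^sup>2"])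
    show "integrable lebesgue (\<lambda>x. 4 * (w x)\<^sup>2)" using assms(1) by (simp add: L2_integrable)
    show "AE x in lebesgue. (\<lambda>n. (f n x - g x)\<^sup>2) \<longlonglongrightarrow> 0"
      using assms(5)
    proof eventually_elim
      case (elim x)
      from tendsto_power[OF tendsto_diff[OF elim tendsto_const[of "g x"]], of 2] show ?case by simp
    qed
    show "AE x in lebesgue. norm ((f n x - g x)\<^sup>2) \<le> 4 * (w x)\<^sup>2" for n
      using assms(4)[of n] gw
    proof eventually_elim
      case (elim x)
      then have "\<bar>f n x - g x\<bar> \<le> 2 * \<bar>w x\<bar>" by linarith
      then have "\<bar>f n x - g x\<bar>\<^sup>2 \<le> (2 * \<bar>w x\<bar>)\<^sup>2" by (intro power_mono) auto
      then show ?case by (simp add: power_mult_distrib)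
    qed
  qed measurable
  moreover have "(LINT x|lebesgue. (f n x - g x)\<^sup>2) = (norm (cl (f n) - cl g))\<^sup>2" for n
    using norm_cl_power2[OF L2_diff[OF f[of n] g]] f g by (simp add: cl_diff)
  ultimately have "(\<lambda>n. (norm (cl (f n) - cl g))\<^sup>2) \<longlonglongrightarrow> 0" by simp
  then have "(\<lambda>n. norm (cl (f n) - cl g)) \<longlonglongrightarrow> 0"
    by (simp add: tendsto_null_power[of _ _ 2] power_tendsto_0_iff)
  then show ?thesis by (simp add: tendsto_norm_zero_iff LIM_zero_iff)
qed

lemma l2_dominated_convergence_at:
  fixes t :: real
  assumes "w \<in> L2" "\<And>s. f s \<in> borel_measurable lebesgue" "g \<in> borel_measurable lebesgue"
    "\<And>s. AE x in lebesgue. \<bar>f s x\<bar> \<le> \<bar>w x\<bar>" "AE x in lebesgue. ((\<lambda>s. f s x) \<longlongrightarrow> g x) (at t)"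
  shows "((\<lambda>s. cl (f s)) \<longlongrightarrow> cl g) (at t)"
proof (subst tendsto_at_iff_sequentially, intro allI impI)
  fix X :: "nat \<Rightarrow> real" assume X: "\<forall>i. X i \<in> UNIV - {t}" "X \<longlonglongrightarrow> t"
  then have *: "filterlim X (at t) sequentially" by (auto simp: filterlim_at)
  show "((\<lambda>s. cl (f s)) \<circ> X) \<longlonglongrightarrow> cl g"
    unfolding comp_def
  proof (rule l2_dominated_convergence[OF assms(1)])
    show "AE x in lebesgue. (\<lambda>n. f (X n) x) \<longlonglongrightarrow> g x"
      using assms(5) by eventually_elim (rule filterlim_compose[OF _ *])
  qed (use assms in auto)
qed

subsection \<open>Multiplication operators and isometries of the line\<close>

definition bd :: "(real \<Rightarrow> real) \<Rightarrow> bool"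
  where "bd p \<longleftrightarrow> p \<in> borel_measurable lebesgue \<and> (\<exists>K. \<forall>x. \<bar>p x\<bar> \<le> K)"

text \<open>The operator is also used with unbounded multipliers, namely the identity,
  \<open>mw\<close> and \<sigma>. It is then meaningful only on those classes for which the product
  is again in L2.\<close>

definition mul :: "(real \<Rightarrow> real) \<Rightarrow> l2 \<Rightarrow> l2"
  where "mul p a = cl (\<lambda>x. p x * fn a x)"

lemma bdI: "p \<in> borel_measurable lebesgue \<Longrightarrow> (\<And>x. \<bar>p x\<bar> \<le> K) \<Longrightarrow> bd p"
  by (auto simp: bd_def)

lemma bd_measurable [measurable_dest]: "bd p \<Longrightarrow> p \<in> borel_measurable lebesgue"
  by (simp add: bd_def)

lemma bd_mult: "bd p \<Longrightarrow> bd q \<Longrightarrow> bd (\<lambda>x. p x * q x)"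
  unfolding bd_def
proof (elim conjE exE, intro conjI)
  fix K K' assume "\<forall>x. \<bar>p x\<bar> \<le> K" "\<forall>x. \<bar>q x\<bar> \<le> K'"
  then have "\<bar>p x * q x\<bar> \<le> K * K'" for x
    unfolding abs_mult by (intro mult_mono) (auto intro: order_trans[OF abs_ge_zero[of "p x"]])
  then show "\<exists>K. \<forall>x. \<bar>p x * q x\<bar> \<le> K" by blast
qed measurable

lemma bd_add: "bd p \<Longrightarrow> bd q \<Longrightarrow> bd (\<lambda>x. p x + q x)"
  unfolding bd_def
proof (elim conjE exE, intro conjI)
  fix K K' assume "\<forall>x. \<bar>p x\<bar> \<le> K" "\<forall>x. \<bar>q x\<bar> \<le> K'"
  then have "\<bar>p x + q x\<bar> \<le> K + K'" for x
    using abs_triangle_ineq[of "p x" "q x"] by (meson add_mono order_trans)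
  then show "\<exists>K. \<forall>x. \<bar>p x + q x\<bar> \<le> K" by blast
qed measurable

lemma bd_const [simp]: "bd (\<lambda>x. c)"
  by (auto simp: bd_def)

lemma bd_uminus: "bd p \<Longrightarrow> bd (\<lambda>x. - p x)"
  using bd_mult[of "\<lambda>x. -1" p] by simp

lemma bd_diff: "bd p \<Longrightarrow> bd q \<Longrightarrow> bd (\<lambda>x. p x - q x)"
  using bd_add[of p "\<lambda>x. - q x"] bd_uminus[of q] by simp

lemma bd_power: "bd p \<Longrightarrow> bd (\<lambda>x. p x ^ n)"
  by (induction n) (auto intro: bd_mult)

lemma continuous_lebesgue_measurable:
  fixes p :: "real \<Rightarrow> real" shows "continuous_on UNIV p \<Longrightarrow> p \<in> borel_measurable lebesgue"
  by (rule measurable_completion) (simp add: borel_measurable_continuous_onI)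

lemma bd_continuous: "continuous_on UNIV p \<Longrightarrow> (\<And>x. \<bar>p x\<bar> \<le> K) \<Longrightarrow> bd p"
  by (rule bdI[OF continuous_lebesgue_measurable])

lemma bd_cos [simp]:
  assumes "p \<in> borel_measurable lebesgue" shows "bd (\<lambda>x. cos (p x))"
  using measurable_compose[OF assms borel_measurable_continuous_onI[OF continuous_at_imp_continuous_on[OF ballI[OF isCont_cos]]]]
  by (intro bdI[where K=1]) auto

lemma bd_sin [simp]:
  assumes "p \<in> borel_measurable lebesgue" shows "bd (\<lambda>x. sin (p x))"
  using measurable_compose[OF assms borel_measurable_continuous_onI[OF continuous_at_imp_continuous_on[OF ballI[OF isCont_sin]]]]
  by (intro bdI[where K=1]) auto

lemma L2_bd_mult:
  assumes p: "bd p" and f: "f \<in> L2" shows "(\<lambda>x. p x * f x) \<in> L2"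
proof -
  obtain K where K: "\<And>x. \<bar>p x\<bar> \<le> K" using p by (auto simp: bd_def)
  have [measurable]: "p \<in> borel_measurable lebesgue" "f \<in> borel_measurable lebesgue"
    using p f by (simp_all add: bd_def L2_def)
  show ?thesis
  proof (rule L2_bound[OF f])
    show "AE x in lebesgue. \<bar>p x * f x\<bar> \<le> K * \<bar>f x\<bar>"
      unfolding abs_mult by (intro AE_I2 mult_right_mono K) auto
  qed measurable
qed

lemma fn_mul: "(\<lambda>x. p x * fn a x) \<in> L2 \<Longrightarrow> AE x in lebesgue. fn (mul p a) x = p x * fn a x"
  unfolding mul_def by (rule fn_cl)

lemma fn_mul_bd: "bd p \<Longrightarrow> AE x in lebesgue. fn (mul p a) x = p x * fn a x"
  by (rule fn_mul) (simp add: L2_bd_mult)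

lemma mul_cl:
  assumes p: "bd p" and f: "f \<in> L2" shows "mul p (cl f) = cl (\<lambda>x. p x * f x)"
  using fn_mul_bd[OF p, of "cl f"] fn_cl[OF L2_bd_mult[OF p f]] fn_cl[OF f]
  unfolding l2_eq_iff by eventually_elim simp

lemma mul_add:
  assumes p: "bd p" shows "mul p (a + b) = mul p a + mul p b"
  using fn_mul_bd[OF p, of "a+b"] fn_mul_bd[OF p, of a] fn_mul_bd[OF p, of b] fn_add[of a b] fn_add[of "mul p a" "mul p b"]
  unfolding l2_eq_iff by eventually_elim (simp add: ring_distribs)

lemma mul_scaleR:
  assumes p: "bd p" shows "mul p (c *\<^sub>R a) = c *\<^sub>R mul p a"
  using fn_mul_bd[OF p, of "c *\<^sub>R a"] fn_mul_bd[OF p, of a] fn_scaleR[of c a] fn_scaleR[of c "mul p a"]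
  unfolding l2_eq_iff by eventually_elim simp

lemma norm_mul_le:
  assumes "p \<in> borel_measurable lebesgue" "\<And>x. \<bar>p x\<bar> \<le> K" shows "norm (mul p a) \<le> K * norm a"
proof -
  have K: "0 \<le> K" using assms(2)[of 0] by simp
  have "norm (cl (\<lambda>x. p x * fn a x)) \<le> norm (cl (\<lambda>x. K * fn a x))"
    by (rule norm_cl_le) (use assms K in \<open>auto simp: L2_scale abs_mult intro!: mult_right_mono\<close>)
  then show ?thesis using K by (simp add: mul_def cl_scaleR)
qed

lemma bounded_linear_mul: "bd p \<Longrightarrow> bounded_linear (mul p)"
proof -
  assume p: "bd p"
  then obtain K where K: "\<forall>x. \<bar>p x\<bar> \<le> K" by (auto simp: bd_def)
  show ?thesis
    by (rule bounded_linear_intro[where K=K])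
      (use p K norm_mul_le[of p K] in \<open>auto simp: mul_add mul_scaleR bd_def mult.commute\<close>)
qed

lemma mul_mul:
  assumes p: "bd p" and q: "bd q" shows "mul p (mul q a) = mul (\<lambda>x. p x * q x) a"
  using fn_mul_bd[OF p, of "mul q a"] fn_mul_bd[OF q, of a] fn_mul_bd[OF bd_mult[OF p q], of a]
  unfolding l2_eq_iff by eventually_elim simp

lemma mul_add_left:
  assumes p: "bd p" and q: "bd q" shows "mul (\<lambda>x. p x + q x) a = mul p a + mul q a"
  using fn_mul_bd[OF p, of a] fn_mul_bd[OF q, of a] fn_mul_bd[OF bd_add[OF p q], of a] fn_add[of "mul p a" "mul q a"]
  unfolding l2_eq_iff by eventually_elim (simp add: ring_distribs)

lemma mul_uminus_left:
  assumes p: "bd p" shows "mul (\<lambda>x. - p x) a = - mul p a"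
  using fn_mul_bd[OF p, of a] fn_mul_bd[OF bd_uminus[OF p], of a] fn_uminus[of "mul p a"]
  unfolding l2_eq_iff by eventually_elim simp

lemma mul_one: "mul (\<lambda>x. 1) a = a"
  by (simp add: mul_def)

lemma mul_zero: "mul (\<lambda>x. 0) a = 0"
  by (simp add: mul_def cl_zero)

lemma inner_mul_left: "bd p \<Longrightarrow> inner (mul p a) b = (LINT x|lebesgue. p x * fn a x * fn b x)"
  by (rule inner_l2_cong[OF fn_mul_bd]) (auto simp: bd_def)

lemma inner_mul_right: "bd p \<Longrightarrow> inner a (mul p b) = inner (mul p a) b"
proof -
  assume p: "bd p"
  have "inner a (mul p b) = inner (mul p b) a" by (rule inner_commute)
  also have "\<dots> = (LINT x|lebesgue. p x * fn a x * fn b x)"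
    by (simp add: inner_mul_left[OF p] ac_simps)
  finally show ?thesis by (simp add: inner_mul_left[OF p])
qed

text \<open>The values \<open>c = 1\<close> and \<open>c = -1\<close> give translations and
  reflections, so that invariance of Lebesgue measure is used once for both.\<close>

definition aff :: "real \<Rightarrow> real \<Rightarrow> l2 \<Rightarrow> l2"
  where "aff c t a = cl (\<lambda>x. fn a (t + c * x))"

lemma affine_measurable_lebesgue:
  fixes c t :: real assumes "c = 1 \<or> c = -1"
  shows "(\<lambda>x. t + c * x) \<in> lebesgue \<rightarrow>\<^sub>M lebesgue"
  using lebesgue_affine_measurable[of "\<lambda>_. c" t] assms by (auto simp: mult.commute)

lemma distr_affine_lebesgue:
  fixes c t :: real assumes "c = 1 \<or> c = -1"
  shows "distr lebesgue lebesgue (\<lambda>x. t + c * x) = lebesgue"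
proof -
  have "lebesgue = density (distr lebesgue lebesgue (\<lambda>x. t + c * x)) (\<lambda>_. ennreal \<bar>c\<bar>)"
    by (rule lebesgue_real_affine) (use assms in auto)
  also have "\<dots> = density (distr lebesgue lebesgue (\<lambda>x. t + c * x)) (\<lambda>_. 1)"
    using assms by auto
  also have "\<dots> = distr lebesgue lebesgue (\<lambda>x. t + c * x)" by (rule density_1)
  finally show ?thesis by simp
qed

lemma AE_affine:
  fixes c t :: real assumes "c = 1 \<or> c = -1" "AE x in lebesgue. P x"
  shows "AE x in lebesgue. P (t + c * x)"
proof -
  have "AE x in distr lebesgue lebesgue (\<lambda>x. t + c * x). P x"
    unfolding distr_affine_lebesgue[OF assms(1)] by (rule assms(2))
  then show ?thesis
    by (rule AE_distrD[OF affine_measurable_lebesgue[OF assms(1)]])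
qed

lemma integral_affine:
  fixes f :: "real \<Rightarrow> real"
  assumes "c = 1 \<or> c = -1" "f \<in> borel_measurable lebesgue"
  shows "(LINT x|lebesgue. f (t + c * x)) = (LINT x|lebesgue. f x)"
  using integral_distr[OF affine_measurable_lebesgue[OF assms(1), of t] assms(2)]
  by (simp add: distr_affine_lebesgue[OF assms(1)])

lemma integrable_affine:
  fixes f :: "real \<Rightarrow> real"
  assumes "c = 1 \<or> c = -1" "integrable lebesgue f"
  shows "integrable lebesgue (\<lambda>x. f (t + c * x))"
  using integrable_distr_eq[OF affine_measurable_lebesgue[OF assms(1), of t], of f] assms(2)
  by (simp add: distr_affine_lebesgue[OF assms(1)])

lemma L2_affine:
  assumes "c = 1 \<or> c = -1" "f \<in> L2" shows "(\<lambda>x. f (t + c * x)) \<in> L2"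
proof (rule L2I)
  show "(\<lambda>x. f (t + c * x)) \<in> borel_measurable lebesgue"
    using measurable_compose[OF affine_measurable_lebesgue[OF assms(1), of t] L2_measurable[OF assms(2)]] .
  show "integrable lebesgue (\<lambda>x. (f (t + c * x))\<^sup>2)"
    by (rule integrable_affine[OF assms(1) L2_integrable[OF assms(2)]])
qed

lemma fn_aff: "c = 1 \<or> c = -1 \<Longrightarrow> AE x in lebesgue. fn (aff c t a) x = fn a (t + c * x)"
  unfolding aff_def by (intro fn_cl L2_affine fn_L2)

lemma aff_cl:
  assumes c: "c = 1 \<or> c = -1" and f: "f \<in> L2" shows "aff c t (cl f) = cl (\<lambda>x. f (t + c * x))"
  using fn_aff[OF c, of t "cl f"] AE_affine[OF c fn_cl[OF f], of t] fn_cl[OF L2_affine[OF c f, of t]]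
  unfolding l2_eq_iff by eventually_elim simp

lemma aff_add:
  assumes c: "c = 1 \<or> c = -1" shows "aff c t (a + b) = aff c t a + aff c t b"
  using fn_aff[OF c, of t "a+b"] fn_aff[OF c, of t a] fn_aff[OF c, of t b] AE_affine[OF c fn_add[of a b], of t]
    fn_add[of "aff c t a" "aff c t b"]
  unfolding l2_eq_iff by eventually_elim simp

lemma aff_scaleR:
  assumes c: "c = 1 \<or> c = -1" shows "aff c t (r *\<^sub>R a) = r *\<^sub>R aff c t a"
  using fn_aff[OF c, of t "r *\<^sub>R a"] fn_aff[OF c, of t a] AE_affine[OF c fn_scaleR[of r a], of t]
    fn_scaleR[of r "aff c t a"]
  unfolding l2_eq_iff by eventually_elim simp

lemma inner_aff:
  assumes "c = 1 \<or> c = -1" shows "inner (aff c t a) (aff c t b) = inner a b"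
proof -
  have [measurable]: "(\<lambda>x. fn a (t + c * x)) \<in> borel_measurable lebesgue" for a
    using L2_affine[OF assms fn_L2] by (rule L2_measurable)
  have "inner (aff c t a) (aff c t b) = (LINT x|lebesgue. fn a (t + c * x) * fn b (t + c * x))"
    by (rule inner_l2_cong[OF fn_aff fn_aff]) (use assms in measurable)
  also have "\<dots> = inner a b"
    unfolding inner_l2_def by (rule integral_affine[OF assms]) measurable
  finally show ?thesis .
qed

lemma norm_aff: "c = 1 \<or> c = -1 \<Longrightarrow> norm (aff c t a) = norm a"
  by (simp add: norm_eq_sqrt_inner inner_aff)

lemma bounded_linear_aff: "c = 1 \<or> c = -1 \<Longrightarrow> bounded_linear (aff c t)"
  by (rule bounded_linear_intro[where K=1]) (auto simp: aff_add aff_scaleR norm_aff)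

lemma aff_aff:
  assumes c: "c = 1 \<or> c = -1" and d: "d = 1 \<or> d = -1"
  shows "aff c t (aff d s a) = aff (d * c) (s + d * t) a"
proof -
  have dc: "d * c = 1 \<or> d * c = -1" using c d by auto
  show ?thesis
    using fn_aff[OF c, of t "aff d s a"] AE_affine[OF c fn_aff[OF d, of s a], of t] fn_aff[OF dc, of "s + d * t" a]
    unfolding l2_eq_iff by eventually_elim (simp add: algebra_simps)
qed

lemma aff_id: "aff 1 0 a = a"
  by (simp add: aff_def)

lemma inner_aff_left:
  "c = 1 \<or> c = -1 \<Longrightarrow> inner (aff c t a) b = inner a (aff c (- c * t) b)"
  using inner_aff[of c t a "aff c (- c * t) b"] aff_aff[of c c t "- c * t" b]
  by (auto simp: aff_id)

abbreviation tr :: "real \<Rightarrow> l2 \<Rightarrow> l2" where "tr \<equiv> aff 1"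
abbreviation rfl :: "l2 \<Rightarrow> l2" where "rfl \<equiv> aff (-1) 0"

lemma rfl_rfl: "rfl (rfl a) = a"
  by (simp add: aff_aff aff_id)

lemma fn_tr: "AE x in lebesgue. fn (tr h a) x = fn a (x + h)"
  using fn_aff[of 1 h a] by (simp add: add.commute)

lemma tr_cl: "f \<in> L2 \<Longrightarrow> tr h (cl f) = cl (\<lambda>x. f (x + h))"
  using aff_cl[of 1 f h] by (simp add: add.commute)

lemma fn_rfl: "AE x in lebesgue. fn (rfl a) x = fn a (- x)"
  using fn_aff[of "-1" 0 a] by simp

lemma inner_rfl_left: "inner (rfl a) b = inner a (rfl b)"
  using inner_aff_left[of "-1" 0 a b] by simp

subsection \<open>Density of interval indicators\<close>

definition iv :: "real \<Rightarrow> real \<Rightarrow> l2" where "iv a b = cl (indicator {a..b})"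

lemma indicator_interval_L2 [simp]: "(indicator {a..b::real} :: real \<Rightarrow> real) \<in> L2"
proof (rule L2I)
  have "(\<lambda>x. (indicator {a..b} x :: real)\<^sup>2) = indicator {a..b}"
    by (auto simp: indicator_def)
  then show "integrable lebesgue (\<lambda>x::real. (indicator {a..b} x :: real)\<^sup>2)"
    by (simp add: integrable_real_indicator emeasure_lborel_Icc_eq)
qed (rule borel_measurable_indicator, simp)

lemma indicator_Int_interval_L2:
  assumes "A \<in> sets lebesgue" shows "(indicator (A \<inter> {a..b::real}) :: real \<Rightarrow> real) \<in> L2"
proof (rule L2_bound[OF indicator_interval_L2[of a b]])
  show "(indicator (A \<inter> {a..b}) :: real \<Rightarrow> real) \<in> borel_measurable lebesgue"
    by (rule borel_measurable_indicator) (use assms in auto)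
  show "AE x in lebesgue. \<bar>indicator (A \<inter> {a..b}) x :: real\<bar> \<le> 1 * \<bar>indicator {a..b} x\<bar>"
    by (auto simp: indicator_def)
qed

lemma cl_sum:
  assumes "finite I" "\<And>i. i \<in> I \<Longrightarrow> f i \<in> L2"
  shows "(\<lambda>x. \<Sum>i\<in>I. f i x) \<in> L2 \<and> cl (\<lambda>x. \<Sum>i\<in>I. f i x) = (\<Sum>i\<in>I. cl (f i))"
  using assms
  by (induction I rule: finite_induct) (auto simp: cl_zero cl_add L2_add)

lemma sets_borel_lebesgue: "A \<in> sets borel \<Longrightarrow> A \<in> sets lebesgue"
  by auto

text \<open>Density of step functions in the form of an induction rule. Borel sets are reached from
  intervals by a \<pi>-\<lambda> argument, then simple functions by linearity, then everything by
  dominated convergence.\<close>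

lemma l2_interval_induct:
  assumes iv: "\<And>a b. P (iv a b)"
    and add: "\<And>a b. P a \<Longrightarrow> P b \<Longrightarrow> P (a + b)"
    and scale: "\<And>c a. P a \<Longrightarrow> P (c *\<^sub>R a)"
    and lim: "\<And>X x. (\<And>n::nat. P (X n)) \<Longrightarrow> X \<longlonglongrightarrow> x \<Longrightarrow> P x"
  shows "P a"
proof -
  have P0: "P 0"
    using scale[OF iv[of 0 0], of 0] by simp
  have Psum: "P (\<Sum>i\<in>I. f i)" if "finite I" "\<And>i. i \<in> I \<Longrightarrow> P (f i)" for I :: "'b set" and f
    using that by (induction I rule: finite_induct) (auto simp: P0 add)
  have Pdiff: "P (a - b)" if "P a" "P b" for a b
    using add[OF that(1) scale[OF that(2), of "-1"]] by simp
  \<comment> \<open>Cutting with \<open>{-r..r}\<close> gives every Borel set, in particular a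
    complement, finite measure, so the induction over the generated sigma algebra stays inside
    L2.\<close>
  have Pset: "P (cl (indicator (A \<inter> {-r..r})))" if "A \<in> sets borel" for A and r :: real
  proof -
    have eq: "sets (borel :: real measure) = sigma_sets UNIV (range (\<lambda>(a, b). {a..b::real}))"
      using borel_eq_atLeastAtMost by (metis sets_measure_of top_greatest Pow_UNIV)
    have Int: "Int_stable (range (\<lambda>(a, b). {a..b::real}))"
      by (auto simp: Int_stable_def image_iff)
    have Pw: "range (\<lambda>(a, b). {a..b::real}) \<subseteq> Pow UNIV" by simp
    have "A \<in> sigma_sets UNIV (range (\<lambda>(a, b). {a..b::real}))" using that eq by simp
    with Int Pw show ?thesis
    proof (induction A rule: sigma_sets_induct_disjoint)
      case (basic A)
      then obtain a b where "A = {a..b}" by auto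
      then have "A \<inter> {-r..r} = {max a (-r)..min b r}" by auto
      then show ?case using iv[of "max a (-r)" "min b r"] by (simp add: iv_def)
    next
      case empty
      have "(indicator {} :: real \<Rightarrow> real) = (\<lambda>x. 0)" by auto
      then show ?case using P0 by (simp add: cl_zero)
    next
      case (compl A)
      then have A: "A \<in> sets borel" using eq by simp
      have "(indicator ((UNIV - A) \<inter> {-r..r}) :: real \<Rightarrow> real) = (\<lambda>x. indicator {-r..r} x - indicator (A \<inter> {-r..r}) x)"
        by (auto simp: indicator_def)
      then have "cl (indicator ((UNIV - A) \<inter> {-r..r})) = iv (-r) r - cl (indicator (A \<inter> {-r..r}))"
        by (simp add: cl_diff iv_def indicator_Int_interval_L2 sets_borel_lebesgue[OF A])
      then show ?case using Pdiff[OF iv compl(2)] by simp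
    next
      case (union A)
      then have A: "A i \<in> sets borel" for i using eq by auto
      note A' = sets_borel_lebesgue[OF A]
      have "P (cl (\<lambda>x. \<Sum>i<n. indicator (A i \<inter> {-r..r}) x))" for n
        using cl_sum[of "{..<n}" "\<lambda>i. indicator (A i \<inter> {-r..r})"] Psum[of "{..<n}" "\<lambda>i. cl (indicator (A i \<inter> {-r..r}))"]
          union(3) A' by (simp add: indicator_Int_interval_L2)
      moreover have "(\<lambda>n. cl (\<lambda>x. \<Sum>i<n. indicator (A i \<inter> {-r..r}) x)) \<longlonglongrightarrow> cl (indicator ((\<Union>i. A i) \<inter> {-r..r}))"
      proof (rule l2_dominated_convergence[OF indicator_interval_L2[of "-r" r]])
        have disj: "disjoint_family (\<lambda>i. A i \<inter> {-r..r})"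
          using union(1) by (auto simp: disjoint_family_on_def)
        have s: "(\<Sum>i<n. indicator (A i \<inter> {-r..r}) x :: real) = indicator (\<Union>i<n. A i \<inter> {-r..r}) x" for n x
          using disj by (subst indicator_UN_disjoint) (auto simp: disjoint_family_on_def)
        show "(\<lambda>x. \<Sum>i<n. indicator (A i \<inter> {-r..r}) x :: real) \<in> borel_measurable lebesgue" for n
          by (intro borel_measurable_sum borel_measurable_indicator) (use A' in auto)
        have "(\<Union>i. A i) \<in> sets lebesgue" using A' by auto
        then show "(indicator ((\<Union>i. A i) \<inter> {-r..r}) :: real \<Rightarrow> real) \<in> borel_measurable lebesgue"
          by (intro borel_measurable_indicator) auto
        show "AE x in lebesgue. \<bar>\<Sum>i<n. indicator (A i \<inter> {-r..r}) x :: real\<bar> \<le> \<bar>indicator {-r..r} x\<bar>" for n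
          unfolding s by (auto simp: indicator_def)
        have "(\<lambda>n. indicator (\<Union>i<n. A i \<inter> {-r..r}) x :: real) \<longlonglongrightarrow> indicator (\<Union>i. A i \<inter> {-r..r}) x" for x
          by (rule LIMSEQ_indicator_UN)
        then show "AE x in lebesgue. (\<lambda>n. \<Sum>i<n. indicator (A i \<inter> {-r..r}) x :: real) \<longlonglongrightarrow> indicator ((\<Union>i. A i) \<inter> {-r..r}) x"
          unfolding s by (simp add: Int_UN_distrib2)
      qed
      ultimately show ?case by (rule lim)
    qed
  qed
  \<comment> \<open>The simple approximation is taken for a Borel function, whose level sets are
    covered by \<open>Pset\<close>; \<open>fn a\<close> itself is only Lebesgue measurable.\<close>
  obtain g where g: "g \<in> borel_measurable lborel" "AE x in lborel. fn a x = g x"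
    using completion_ex_borel_measurable_real[OF fn_measurable[of a]] by blast
  have gm [measurable]: "g \<in> borel_measurable borel" using g(1) by simp
  have gL: "g \<in> borel_measurable lebesgue" using g(1) by (rule measurable_completion)
  have g2: "g \<in> L2" "cl g = a"
    using L2_cong_AE[OF fn_L2 gL] cl_cong[OF fn_L2[of a] _ gL] AE_completion[OF g(2)] by auto
  obtain s where s: "\<And>i. simple_function borel (s i)" "\<And>x. (\<lambda>i. s i x) \<longlonglongrightarrow> g x"
      "\<And>i x. dist (s i x) 0 \<le> 2 * dist (g x) 0"
    using borel_measurable_implies_sequence_metric[OF gm, of 0] by auto
  have "P (cl (\<lambda>x. indicator {-real i..real i} x * s i x))" for i
  proof -
    have fin: "finite (range (s i))" using s(1)[of i] by (simp add: simple_function_def)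
    have m: "s i -` {y} \<in> sets borel" for y
      using simple_functionD(2)[OF s(1)[of i], of "{y}"] by simp
    have "indicator {-real i..real i} x * s i x = (\<Sum>y\<in>range (s i). y * indicator ((s i -` {y}) \<inter> {-real i..real i}) x)" for x
    proof -
      have "s i x = (\<Sum>y\<in>range (s i). indicator (s i -` {y}) x *\<^sub>R y)"
        using simple_function_indicator_representation_banach[OF s(1)[of i], of x]
        by (simp only: space_borel UNIV_I Int_UNIV_right simp_thms)
      then have "indicator {-real i..real i} x * s i x = (\<Sum>y\<in>range (s i). indicator {-real i..real i} x * (indicator (s i -` {y}) x *\<^sub>R y))"
        by (simp only: sum_distrib_left)
      also have "\<dots> = (\<Sum>y\<in>range (s i). y * indicator ((s i -` {y}) \<inter> {-real i..real i}) x)"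
        by (rule sum.cong) (auto simp: indicator_inter_arith)
      finally show ?thesis .
    qed
    then have "(\<lambda>x. indicator {-real i..real i} x * s i x) = (\<lambda>x. \<Sum>y\<in>range (s i). y * indicator ((s i -` {y}) \<inter> {-real i..real i}) x)"
      by (rule ext)
    moreover have "P (cl (\<lambda>x. \<Sum>y\<in>range (s i). y * indicator ((s i -` {y}) \<inter> {-real i..real i}) x))"
    proof -
      have L: "(indicator ((s i -` {y}) \<inter> {-real i..real i}) :: real \<Rightarrow> real) \<in> L2" for y
        by (intro indicator_Int_interval_L2 sets_borel_lebesgue m)
      have "P (\<Sum>y\<in>range (s i). cl (\<lambda>x. y * indicator ((s i -` {y}) \<inter> {-real i..real i}) x))"
        by (intro Psum fin) (simp add: cl_scaleR L scale Pset m)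
      then show ?thesis
        using cl_sum[OF fin, of "\<lambda>y x. y * indicator ((s i -` {y}) \<inter> {-real i..real i}) x"] by (simp add: L L2_scale)
    qed
    ultimately show ?thesis by simp
  qed
  moreover have "(\<lambda>i. cl (\<lambda>x. indicator {-real i..real i} x * s i x)) \<longlonglongrightarrow> cl g"
  proof (rule l2_dominated_convergence[OF L2_scale[OF g2(1), of 2] _ gL])
    have "s i \<in> borel_measurable lebesgue" for i
      using borel_measurable_simple_function[OF s(1)[of i]] by (intro measurable_completion) simp
    then show "(\<lambda>x. indicator {-real i..real i} x * s i x) \<in> borel_measurable lebesgue" for i
      by (intro borel_measurable_times borel_measurable_indicator) auto
    show "AE x in lebesgue. \<bar>indicator {-real i..real i} x * s i x\<bar> \<le> \<bar>2 * g x\<bar>" for i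
      using s(3)[of i] by (auto simp: indicator_def abs_mult)
    have "(\<lambda>i. indicator {-real i..real i} x * s i x) \<longlonglongrightarrow> 1 * g x" for x
    proof (rule tendsto_mult[OF tendsto_eventually s(2)])
      show "\<forall>\<^sub>F i in sequentially. indicator {- real i..real i} x = (1::real)"
      proof (rule eventually_sequentiallyI[of "nat \<lceil>\<bar>x\<bar>\<rceil>"])
        fix n assume "nat \<lceil>\<bar>x\<bar>\<rceil> \<le> n"
        then have "\<bar>x\<bar> \<le> real n" by linarith
        then show "indicator {- real n..real n} x = (1::real)" by (auto simp: indicator_def)
      qed
    qed
    then show "AE x in lebesgue. (\<lambda>i. indicator {-real i..real i} x * s i x) \<longlonglongrightarrow> g x" by simp
  qed
  ultimately have "P (cl g)" by (rule lim)
  then show ?thesis by (simp add: g2)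
qed

text \<open>The integrals over bounded Borel sets vanish by the same \<pi>-\<lambda> argument, and
  the sign sets of the function then force the integral of its modulus to vanish. It serves for the
  uniqueness of weak derivatives and for identifying the L2 transform with an integral.\<close>

lemma AE_zero_if_interval_integrals_zero:
  fixes g :: "real \<Rightarrow> real"
  assumes int: "\<And>a b. set_integrable lebesgue {a..b} g"
    and zero: "\<And>a b. (LINT x:{a..b}|lebesgue. g x) = 0"
  shows "AE x in lebesgue. g x = 0"
proof -
  have sub: "set_integrable lebesgue (A \<inter> {-r..r}) g" if "A \<in> sets borel" for A and r :: real
    using int[of "-r" r] by (rule set_integrable_subset) (use that in auto)
  have set0: "(LINT x:(A \<inter> {-r..r})|lebesgue. g x) = 0" if "A \<in> sets borel" for A and r :: real
  proof -
    have eq: "sets (borel :: real measure) = sigma_sets UNIV (range (\<lambda>(a, b). {a..b::real}))"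
      using borel_eq_atLeastAtMost by (metis sets_measure_of top_greatest Pow_UNIV)
    have Int: "Int_stable (range (\<lambda>(a, b). {a..b::real}))"
      by (auto simp: Int_stable_def image_iff)
    have Pw: "range (\<lambda>(a, b). {a..b::real}) \<subseteq> Pow UNIV" by simp
    have "A \<in> sigma_sets UNIV (range (\<lambda>(a, b). {a..b::real}))" using that eq by simp
    with Int Pw show ?thesis
    proof (induction A rule: sigma_sets_induct_disjoint)
      case (basic A)
      then obtain a b where "A = {a..b}" by auto
      then have "A \<inter> {-r..r} = {max a (-r)..min b r}" by auto
      then show ?case using zero by simp
    next
      case empty
      show ?case by (simp add: set_lebesgue_integral_def)
    next
      case (compl A)
      then have A: "A \<in> sets borel" using eq by simp
      have "(A \<inter> {-r..r}) \<union> ((UNIV - A) \<inter> {-r..r}) = {-r..r}" by auto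
      moreover have "(LINT x:((A \<inter> {-r..r}) \<union> ((UNIV - A) \<inter> {-r..r}))|lebesgue. g x) =
          (LINT x:(A \<inter> {-r..r})|lebesgue. g x) + (LINT x:((UNIV - A) \<inter> {-r..r})|lebesgue. g x)"
        by (rule set_integral_Un) (use A in \<open>auto intro!: sub\<close>)
      ultimately show ?case using compl(2) zero by simp
    next
      case (union A)
      then have A: "A i \<in> sets borel" for i using eq by auto
      have "(LINT x:(\<Union>i. A i \<inter> {-r..r})|lebesgue. g x) = (\<Sum>i. (LINT x:(A i \<inter> {-r..r})|lebesgue. g x))"
      proof (rule lebesgue_integral_countable_add)
        show "A i \<inter> {-r..r} \<in> sets lebesgue" for i using A by auto
        show "i \<noteq> j \<Longrightarrow> A i \<inter> {- r..r} \<inter> (A j \<inter> {- r..r}) = {}" for i j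
          using union(1) by (auto simp: disjoint_family_on_def)
        show "set_integrable lebesgue (\<Union>i. A i \<inter> {-r..r}) g"
          using sub[of "\<Union>i. A i" r] A by (simp add: Int_UN_distrib2)
      qed
      then show ?case using union(3) by (simp add: Int_UN_distrib2)
    qed
  qed
  have "AE x in lebesgue. indicator {-real n..real n} x * g x = 0" for n
  proof -
    define f where "f x = indicator {-real n..real n} x * g x" for x
    have f: "integrable lebesgue f"
      using int[of "-real n" "real n"] by (simp add: set_integrable_def f_def[abs_def])
    obtain h where h: "h \<in> borel_measurable lborel" "AE x in lborel. f x = h x"
      using completion_ex_borel_measurable_real[OF borel_measurable_integrable[OF f]] by blast
    have [measurable]: "h \<in> borel_measurable borel" using h(1) by simp
    have fh: "AE x in lebesgue. f x = h x" using AE_completion[OF h(2)] .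
    have "(LINT x|lebesgue. \<bar>f x\<bar>) = 0"
    proof -
      \<comment> \<open>The sign sets are those of the Borel version \<open>h\<close>, so that
        \<open>set0\<close> applies to them; they agree with the sign sets of \<open>f\<close> up to
        a null set.\<close>
      have p: "{x. h x > 0} \<in> sets borel" "{x. h x < 0} \<in> sets borel" by measurable
      have "(LINT x|lebesgue. \<bar>f x\<bar>) = (LINT x|lebesgue. indicator ({x. h x > 0} \<inter> {-real n..real n}) x *\<^sub>R g x -
          indicator ({x. h x < 0} \<inter> {-real n..real n}) x *\<^sub>R g x)"
      proof (rule integral_cong_AE)
        show "(\<lambda>x. \<bar>f x\<bar>) \<in> borel_measurable lebesgue" using f by measurable
        show "(\<lambda>x. indicator ({x. 0 < h x} \<inter> {- real n..real n}) x *\<^sub>R g x -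
          indicator ({x. h x < 0} \<inter> {- real n..real n}) x *\<^sub>R g x) \<in> borel_measurable lebesgue"
          using sub[OF p(1), of "real n"] sub[OF p(2), of "real n"] unfolding set_integrable_def
          by (intro borel_measurable_diff borel_measurable_integrable)
        show "AE x in lebesgue. \<bar>f x\<bar> = indicator ({x. 0 < h x} \<inter> {- real n..real n}) x *\<^sub>R g x -
          indicator ({x. h x < 0} \<inter> {- real n..real n}) x *\<^sub>R g x"
          using fh by eventually_elim (auto simp: f_def indicator_def)
      qed
      also have "\<dots> = (LINT x:({x. h x > 0} \<inter> {-real n..real n})|lebesgue. g x) - (LINT x:({x. h x < 0} \<inter> {-real n..real n})|lebesgue. g x)"
        unfolding set_lebesgue_integral_def
        using sub[OF p(1), of "real n"] sub[OF p(2), of "real n"] unfolding set_integrable_def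
        by (rule Bochner_Integration.integral_diff)
      also have "\<dots> = 0" using set0[OF p(1)] set0[OF p(2)] by simp
      finally show ?thesis .
    qed
    then have "AE x in lebesgue. \<bar>f x\<bar> = 0"
      using integral_nonneg_eq_0_iff_AE[of lebesgue "\<lambda>x. \<bar>f x\<bar>"] f by simp
    then show ?thesis by (simp add: f_def)
  qed
  then have "AE x in lebesgue. \<forall>n. indicator {-real n..real n} x * g x = 0"
    unfolding AE_all_countable by blast
  then show ?thesis
  proof eventually_elim
    case (elim x)
    obtain n where "\<bar>x\<bar> \<le> real n" using real_arch_simple by blast
    then show ?case using elim[rule_format, of n] by (auto simp: indicator_def)
  qed
qed

subsection \<open>The Hartley transform\<close>

text \<open>For \<open>k > 0\<close> an antiderivative on the half line is
  \<open>k * Si (k * x) - (1 - cos (k * x)) / x\<close>, which vanishes at 0 and tends to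
  \<open>k * (pi / 2)\<close> by the Dirichlet integral; evenness doubles it. This explicit integral
  is the source of the Plancherel identity below.\<close>

lemma has_integral_one_minus_cos_over_square:
  fixes k :: real
  shows "has_bochner_integral lebesgue (\<lambda>x. (1 - cos (k * x)) / x\<^sup>2) (pi * \<bar>k\<bar>)"
proof -
  have pos: "has_bochner_integral lborel (\<lambda>x. (1 - cos (k * x)) / x\<^sup>2) (pi * k)" if k: "k > 0" for k :: real
  proof -
    define F where "F x = k * Si (k * x) - (1 - cos (k * x)) / x" for x
    have lt: "(0::ereal) < \<infinity>" by simp
    have 1: "DERIV F x :> (1 - cos (k * x)) / x\<^sup>2" if "0 < ereal x" "ereal x < \<infinity>" for x
    proof -
      have x: "x > 0" using that by simp
      have Si: "((\<lambda>x. Si (k * x)) has_real_derivative sinc (k * x) * k) (at x)"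
        by (rule DERIV_chain2[OF DERIV_Si]) (auto intro!: derivative_eq_intros)
      have "(F has_real_derivative k * (sinc (k * x) * k) - ((k * sin (k * x)) * x - (1 - cos (k * x))) / x\<^sup>2) (at x)"
        unfolding F_def[abs_def] using x
        by (auto intro!: derivative_eq_intros Si simp: power2_eq_square mult.commute[of k "sin (k * x)"])
      moreover have "k * (sinc (k * x) * k) - ((k * sin (k * x)) * x - (1 - cos (k * x))) / x\<^sup>2 = (1 - cos (k * x)) / x\<^sup>2"
        using x k by (simp add: field_simps power2_eq_square)
      ultimately show ?thesis by simp
    qed
    have 2: "isCont (\<lambda>x. (1 - cos (k * x)) / x\<^sup>2) x" if "0 < ereal x" "ereal x < \<infinity>" for x
      using that by (auto intro!: continuous_intros)
    have q: "((\<lambda>x. (1 - cos (k * x)) / x) \<longlongrightarrow> 0) (at 0)"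
    proof -
      have "((\<lambda>x. 1 - cos (k * x)) has_real_derivative 0) (at 0)"
        by (auto intro!: derivative_eq_intros)
      then show ?thesis by (simp add: DERIV_def)
    qed
    have 3: "((F \<circ> real_of_ereal) \<longlongrightarrow> 0) (at_right 0)"
    proof -
      have "((\<lambda>x. k * Si (k * x) - (1 - cos (k * x)) / x) \<longlongrightarrow> k * Si (k * 0) - 0) (at_right 0)"
        by (intro tendsto_intros isCont_tendsto_compose[OF isCont_Si] tendsto_mono[OF at_le q]) auto
      moreover have "Si 0 = 0" unfolding Si_def zero_ereal_def[symmetric] by (rule interval_integral_endpoints_same)
      ultimately have "(F \<longlongrightarrow> 0) (at_right 0)" by (simp add: F_def[abs_def])
      then show ?thesis unfolding zero_ereal_def ereal_tendsto_simps .
    qed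
    have 4: "((F \<circ> real_of_ereal) \<longlongrightarrow> k * (pi/2)) (at_left \<infinity>)"
      unfolding ereal_tendsto_simps
    proof -
      have kx: "filterlim (\<lambda>x. k * x) at_top at_top"
        using k by (intro filterlim_tendsto_pos_mult_at_top[OF tendsto_const]) (auto simp: filterlim_ident)
      have "((\<lambda>x. (1 - cos (k * x)) / x) \<longlongrightarrow> 0) at_top"
      proof (rule tendsto_0_le[where K=2])
        show "((\<lambda>x::real. 1 / x) \<longlongrightarrow> 0) at_top"
          using tendsto_inverse_0_at_top[OF filterlim_ident] by (simp add: inverse_eq_divide)
        show "\<forall>\<^sub>F x in at_top. norm ((1 - cos (k * x)) / x) \<le> norm (1 / x) * 2"
        proof (intro always_eventually allI)
          fix x :: real
          have "\<bar>1 - cos (k * x)\<bar> \<le> 2" using abs_cos_le_one[of "k * x"] by linarith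
          then show "norm ((1 - cos (k * x)) / x) \<le> norm (1 / x) * 2"
            by (simp add: divide_right_mono)
        qed
      qed
      then have "((\<lambda>x. k * Si (k * x) - (1 - cos (k * x)) / x) \<longlongrightarrow> k * (pi/2) - 0) at_top"
        by (intro tendsto_intros filterlim_compose[OF Si_at_top kx])
      then show "(F \<longlongrightarrow> k * (pi/2)) at_top" by (simp add: F_def[abs_def])
    qed
    have nn: "AE x in lborel. 0 < ereal x \<longrightarrow> ereal x < \<infinity> \<longrightarrow> 0 \<le> (1 - cos (k * x)) / x\<^sup>2"
      by auto
    note I = interval_integral_FTC_nonneg[OF lt 1 2 nn 3 4]
    have ein: "einterval 0 \<infinity> = {0<..}" by (auto simp: einterval_def)
    have i1: "integrable lborel (\<lambda>x. indicator {0<..} x *\<^sub>R ((1 - cos (k * x)) / x\<^sup>2))"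
      using I(1) by (simp add: ein set_integrable_def)
    have i2: "(LINT x|lborel. indicator {0<..} x *\<^sub>R ((1 - cos (k * x)) / x\<^sup>2)) = k * (pi/2)"
      using I(2) by (simp add: interval_lebesgue_integral_def ein set_lebesgue_integral_def)
    have "(\<lambda>x::real. indicator {0<..} x *\<^sub>R ((1 - cos (k * x)) / x\<^sup>2)) = (\<lambda>x. indicator {0..} x *\<^sub>R ((1 - cos (k * x)) / x\<^sup>2))"
      by (auto simp: indicator_def fun_eq_iff)
    with i1 i2 have "has_bochner_integral lborel (\<lambda>x. indicator {0..} x *\<^sub>R ((1 - cos (k * x)) / x\<^sup>2)) (k * (pi/2))"
      by (simp add: has_bochner_integral_iff)
    from has_bochner_integral_even_function[OF this] show ?thesis by (simp add: mult.commute)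
  qed
  have "has_bochner_integral lborel (\<lambda>x. (1 - cos (k * x)) / x\<^sup>2) (pi * \<bar>k\<bar>)"
  proof (cases "k = 0")
    case False
    then have "has_bochner_integral lborel (\<lambda>x. (1 - cos (\<bar>k\<bar> * x)) / x\<^sup>2) (pi * \<bar>k\<bar>)" using pos[of "\<bar>k\<bar>"] by simp
    moreover have "cos (\<bar>k\<bar> * x) = cos (k * x)" for x by (simp add: abs_if)
    ultimately show ?thesis by simp
  next
    case True
    have "has_bochner_integral lborel (\<lambda>x::real. 0::real) 0" by (rule has_bochner_integral_zero)
    then show ?thesis using True by simp
  qed
  moreover have "(\<lambda>x. (1 - cos (k * x)) / x\<^sup>2) \<in> borel_measurable lborel"
    by measurable
  ultimately show ?thesis
    by (simp add: has_bochner_integral_iff integrable_completion integral_completion)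
qed

definition cas :: "real \<Rightarrow> real" where "cas y = cos y + sin y"
text \<open>The factor \<open>1 / sqrt (2 * pi)\<close> makes the transform isometric and, as the
  kernel is symmetric in \<open>x\<close> and \<xi>, its own inverse. The integral is meaningful for
  integrable functions only; the transform on all of L2 is generated from its values
  \<open>hiv\<close> on intervals.\<close>

definition hk :: "(real \<Rightarrow> real) \<Rightarrow> real \<Rightarrow> real"
  where "hk f \<xi> = (LINT x|lebesgue. cas (x * \<xi>) * f x) / sqrt (2 * pi)"
definition hiv :: "real \<Rightarrow> real \<Rightarrow> real \<Rightarrow> real"
  where "hiv a b = hk (indicator {a..b})"

lemma abs_cas_le: "\<bar>cas y\<bar> \<le> 2"
  unfolding cas_def using abs_cos_le_one[of y] abs_sin_le_one[of y] by linarith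

lemma continuous_cas [continuous_intros]:
  fixes f :: "real \<Rightarrow> real" shows "continuous_on S f \<Longrightarrow> continuous_on S (\<lambda>x. cas (f x))"
  unfolding cas_def by (intro continuous_intros)

lemma isCont_cas [simp]: "isCont cas y"
  unfolding cas_def[abs_def] by (intro continuous_intros)

lemma cas_measurable [measurable]: "cas \<in> borel_measurable borel"
  unfolding cas_def[abs_def] by measurable

lemma bd_cas: "bd (\<lambda>x. cas (x * \<xi>))"
  by (rule bd_continuous[where K=2]) (auto intro!: continuous_intros abs_cas_le)

lemma integrable_bd_mult:
  assumes "bd p" "integrable lebesgue f" shows "integrable lebesgue (\<lambda>x. p x * f x)"
proof -
  obtain K where K: "\<And>x. \<bar>p x\<bar> \<le> K" using assms(1) by (auto simp: bd_def)
  have "integrable lebesgue (\<lambda>x. K * \<bar>f x\<bar>)" using assms(2) by simp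
  then show ?thesis
  proof (rule Bochner_Integration.integrable_bound)
    show "AE x in lebesgue. norm (p x * f x) \<le> norm (K * \<bar>f x\<bar>)"
    proof (intro AE_I2)
      fix x
      have "\<bar>p x\<bar> * \<bar>f x\<bar> \<le> \<bar>K\<bar> * \<bar>f x\<bar>" using K[of x] by (intro mult_right_mono) auto
      then show "norm (p x * f x) \<le> norm (K * \<bar>f x\<bar>)" by (simp add: abs_mult)
    qed
    show "(\<lambda>x. p x * f x) \<in> borel_measurable lebesgue"
      using assms by (intro borel_measurable_times) (auto simp: bd_def)
  qed
qed

lemma hk_continuous:
  assumes f: "integrable lebesgue f" shows "continuous_on UNIV (hk f)"
proof -
  have "isCont (hk f) \<xi>" for \<xi>
    unfolding isCont_def tendsto_at_iff_sequentially comp_def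
  proof (intro allI impI)
    fix X :: "nat \<Rightarrow> real" assume X: "\<forall>i. X i \<in> UNIV - {\<xi>}" "X \<longlonglongrightarrow> \<xi>"
    have "(\<lambda>n. LINT x|lebesgue. cas (x * X n) * f x) \<longlonglongrightarrow> (LINT x|lebesgue. cas (x * \<xi>) * f x)"
    proof (rule integral_dominated_convergence[where w="\<lambda>x. 2 * \<bar>f x\<bar>"])
      show "AE x in lebesgue. (\<lambda>n. cas (x * X n) * f x) \<longlonglongrightarrow> cas (x * \<xi>) * f x"
        by (intro AE_I2 tendsto_mult tendsto_const isCont_tendsto_compose[OF isCont_cas] X(2))
      show "AE x in lebesgue. norm (cas (x * X n) * f x) \<le> 2 * \<bar>f x\<bar>" for n
        using abs_cas_le by (auto simp: abs_mult intro!: mult_right_mono)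
      show "(\<lambda>x. cas (x * X n) * f x) \<in> borel_measurable lebesgue" for n
        using integrable_bd_mult[OF bd_cas f] by (rule borel_measurable_integrable)
    next
      show "(\<lambda>x. cas (x * \<xi>) * f x) \<in> borel_measurable lebesgue"
        using integrable_bd_mult[OF bd_cas f] by (rule borel_measurable_integrable)
    qed (use f in auto)
    then show "(\<lambda>n. hk f (X n)) \<longlonglongrightarrow> hk f \<xi>"
      unfolding hk_def by (intro tendsto_divide tendsto_const) auto
  qed
  then show ?thesis by (simp add: continuous_at_imp_continuous_on)
qed

lemma hk_cong_AE:
  assumes "AE x in lebesgue. f x = g x" "f \<in> borel_measurable lebesgue" "g \<in> borel_measurable lebesgue"
  shows "hk f \<xi> = hk g \<xi>"
proof -
  have [measurable]: "(\<lambda>x. cas (x * \<xi>)) \<in> borel_measurable lebesgue" using bd_cas by (simp add: bd_def)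
  have "(LINT x|lebesgue. cas (x * \<xi>) * f x) = (LINT x|lebesgue. cas (x * \<xi>) * g x)"
    by (rule integral_cong_AE) (use assms in \<open>auto\<close>)
  then show ?thesis by (simp add: hk_def)
qed

text \<open>Only the symmetry and boundedness of the kernel enter. It yields the self-adjointness of
  the L2 transform and, with \<open>f\<close> integrable, the identification of that transform with
  the integral.\<close>

lemma hk_Fubini:
  assumes f: "integrable lebesgue f"
  shows "(LINT x|lebesgue. f x * hiv c d x) = (LINT \<xi>|lebesgue. indicator {c..d} \<xi> * hk f \<xi>)"
proof -
  \<comment> \<open>Fubini is applied on the product of two copies of \<open>lborel\<close>, hence
    the passage to a Borel version of \<open>f\<close> and back.\<close>
  obtain g where g: "g \<in> borel_measurable lborel" "AE x in lborel. f x = g x"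
    using completion_ex_borel_measurable_real[OF borel_measurable_integrable[OF f]] by blast
  have gm [measurable]: "g \<in> borel_measurable borel" using g(1) by simp
  have gL: "g \<in> borel_measurable lebesgue" using g(1) by (rule measurable_completion)
  have fg: "AE x in lebesgue. f x = g x" using AE_completion[OF g(2)] .
  have fL: "f \<in> borel_measurable lebesgue" using f by simp
  have "integrable lebesgue g" using f fg gL by (simp add: integrable_cong_AE[OF fL gL fg, symmetric])
  then have gi: "integrable lborel g" using g(1) by (simp add: integrable_completion)
  have hkfg: "hk f = hk g" by (rule ext hk_cong_AE fg fL gL)+
  have int: "integrable (lborel \<Otimes>\<^sub>M lborel) (\<lambda>(x, \<xi>). cas (x * \<xi>) * (g x * (indicator {c..d} \<xi> :: real)))"
  proof (rule Bochner_Integration.integrable_bound)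
    show "integrable (lborel \<Otimes>\<^sub>M lborel) (\<lambda>(x, \<xi>). 2 * (g x * (indicator {c..d} \<xi> :: real)))"
    proof (rule lborel_pair.Fubini_integrable)
      show "(\<lambda>(x, \<xi>). 2 * (g x * (indicator {c..d} \<xi> :: real))) \<in> borel_measurable (lborel \<Otimes>\<^sub>M lborel)"
        by measurable
      show "AE x in lborel. integrable lborel (\<lambda>y. case (x, y) of (x, \<xi>) \<Rightarrow> 2 * (g x * (indicator {c..d} \<xi> :: real)))"
        by (auto simp: integrable_real_indicator emeasure_lborel_Icc_eq)
      show "integrable lborel (\<lambda>x. LINT y|lborel. norm (case (x, y) of (x, \<xi>) \<Rightarrow> 2 * (g x * (indicator {c..d} \<xi> :: real))))"
        using gi by (simp add: abs_mult)
    qed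
    show "(\<lambda>(x, \<xi>). cas (x * \<xi>) * (g x * (indicator {c..d} \<xi> :: real))) \<in> borel_measurable (lborel \<Otimes>\<^sub>M lborel)"
      by measurable
    show "AE z in lborel \<Otimes>\<^sub>M lborel. norm (case z of (x, \<xi>) \<Rightarrow> cas (x * \<xi>) * (g x * (indicator {c..d} \<xi> :: real)))
        \<le> norm (case z of (x, \<xi>) \<Rightarrow> 2 * (g x * (indicator {c..d} \<xi> :: real)))"
      by (intro AE_I2) (auto simp: abs_mult split_beta intro!: mult_right_mono abs_cas_le)
  qed
  note Fubini = lborel_pair.Fubini_integral[OF int]
  have "(LINT x|lebesgue. f x * hiv c d x) = (LINT x|lebesgue. g x * hiv c d x)"
  proof (rule integral_cong_AE)
    have "hiv c d \<in> borel_measurable lebesgue"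
      unfolding hiv_def by (intro continuous_lebesgue_measurable hk_continuous)
        (simp add: integrable_real_indicator emeasure_lborel_Icc_eq)
    then show "(\<lambda>x. f x * hiv c d x) \<in> borel_measurable lebesgue" "(\<lambda>x. g x * hiv c d x) \<in> borel_measurable lebesgue"
      using fL gL by auto
  qed (use fg in auto)
  also have "\<dots> = (LINT x|lborel. (LINT \<xi>|lborel. cas (x * \<xi>) * (g x * (indicator {c..d} \<xi> :: real)))) / sqrt (2 * pi)"
  proof -
    have h: "hiv c d \<in> borel_measurable lborel"
      unfolding hiv_def using borel_measurable_continuous_onI[OF hk_continuous[of "indicator {c..d}"]]
      by (simp add: integrable_real_indicator emeasure_lborel_Icc_eq)
    have e: "g x * hiv c d x = (LINT \<xi>|lborel. cas (x * \<xi>) * (g x * (indicator {c..d} \<xi> :: real))) / sqrt (2 * pi)" for x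
    proof -
      have "hiv c d x = (LINT \<xi>|lborel. cas (\<xi> * x) * indicator {c..d} \<xi>) / sqrt (2 * pi)"
        unfolding hiv_def hk_def by (subst integral_completion) measurable
      then show ?thesis by (simp add: ac_simps)
    qed
    show ?thesis
      using h by (subst integral_completion) (auto simp: e)
  qed
  also have "\<dots> = (LINT \<xi>|lborel. (LINT x|lborel. cas (x * \<xi>) * (g x * (indicator {c..d} \<xi> :: real)))) / sqrt (2 * pi)"
    using Fubini by simp
  also have "\<dots> = (LINT \<xi>|lborel. indicator {c..d} \<xi> * hk g \<xi>)"
  proof -
    have "indicator {c..d} \<xi> * hk g \<xi> = (LINT x|lborel. cas (x * \<xi>) * (g x * (indicator {c..d} \<xi> :: real))) / sqrt (2 * pi)" for \<xi>
    proof -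
      have "(LINT x|lborel. cas (x * \<xi>) * (g x * (indicator {c..d} \<xi> :: real))) = (LINT x|lborel. indicator {c..d} \<xi> * (cas (x * \<xi>) * g x))"
        by (rule Bochner_Integration.integral_cong) auto
      also have "\<dots> = indicator {c..d} \<xi> * (LINT x|lborel. cas (x * \<xi>) * g x)"
        by (rule integral_mult_right_zero)
      finally show ?thesis
        unfolding hk_def by (subst integral_completion) simp_all
    qed
    then show ?thesis by simp
  qed
  also have "\<dots> = (LINT \<xi>|lebesgue. indicator {c..d} \<xi> * hk g \<xi>)"
  proof -
    have "hk g \<in> borel_measurable lborel"
      using hk_continuous[OF \<open>integrable lebesgue g\<close>] by (auto intro: borel_measurable_continuous_onI)
    then show ?thesis by (subst integral_completion) auto
  qed
  finally show ?thesis using hkfg by simp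
qed

lemma measure_interval_Int:
  fixes a b c d :: real assumes "a \<le> b" "c \<le> d"
  shows "(LINT x|lebesgue. indicator {a..b} x * indicator {c..d} x) = max 0 (min b d - max a c)"
proof -
  have "(LINT x|lebesgue. (indicator {a..b} x * indicator {c..d} x :: real)) = (LINT x|lebesgue. indicator {max a c..min b d} x)"
    by (rule Bochner_Integration.integral_cong) (auto simp: indicator_def)
  also have "\<dots> = measure lebesgue {max a c..min b d}" by simp
  also have "\<dots> = max 0 (min b d - max a c)" by (cases "max a c \<le> min b d") auto
  finally show ?thesis .
qed

lemma indicator_interval_integrable [simp]: "integrable lebesgue (indicator {a..b::real} :: real \<Rightarrow> real)"
  by (simp add: integrable_real_indicator emeasure_lborel_Icc_eq)

lemma hiv_continuous: "continuous_on UNIV (hiv a b)"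
  unfolding hiv_def by (intro hk_continuous) simp

lemma hiv_measurable [measurable]: "hiv a b \<in> borel_measurable lebesgue"
  by (intro continuous_lebesgue_measurable hiv_continuous)

lemma hiv_eq:
  assumes "a \<le> b" "\<xi> \<noteq> 0"
  shows "hiv a b \<xi> = ((sin (b * \<xi>) - cos (b * \<xi>)) - (sin (a * \<xi>) - cos (a * \<xi>))) / (\<xi> * sqrt (2 * pi))"
proof -
  have "(LINT x|lebesgue. cas (x * \<xi>) * indicator {a..b} x) = (LINT x|lborel. cas (x * \<xi>) * indicator {a..b} x)"
    by (rule integral_completion) measurable
  also have "\<dots> = (sin (b * \<xi>) - cos (b * \<xi>)) / \<xi> - (sin (a * \<xi>) - cos (a * \<xi>)) / \<xi>"
  proof (rule integral_FTC_Icc_real[OF assms(1)])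
    fix x
    have "((\<lambda>x. (sin (x * \<xi>) - cos (x * \<xi>)) / \<xi>) has_real_derivative (cos (x * \<xi>) * \<xi> + sin (x * \<xi>) * \<xi>) / \<xi>) (at x)"
      using assms(2) by (auto intro!: derivative_eq_intros)
    then show "((\<lambda>x. (sin (x * \<xi>) - cos (x * \<xi>)) / \<xi>) has_real_derivative cas (x * \<xi>)) (at x)"
      using assms(2) by (simp add: cas_def add_divide_distrib)
    show "isCont (\<lambda>x. cas (x * \<xi>)) x"
      unfolding cas_def by (intro continuous_intros)
  qed
  finally show ?thesis
    using assms(2) by (simp add: hiv_def hk_def diff_divide_distrib)
qed

lemma hiv_empty: "b < a \<Longrightarrow> hiv a b = (\<lambda>\<xi>. 0)" "b < a \<Longrightarrow> iv a b = 0"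
proof -
  assume "b < a"
  then have e: "{a..b} = {}" by simp
  show "hiv a b = (\<lambda>\<xi>. 0)" by (simp add: hiv_def hk_def e fun_eq_iff)
  have "(indicator {} :: real \<Rightarrow> real) = (\<lambda>x. 0)" by auto
  then show "iv a b = 0" by (simp add: iv_def e cl_zero)
qed

lemma integrable_one_minus_cos: "integrable lebesgue (\<lambda>x. (1 - cos (k * x)) / x\<^sup>2)"
  and integral_one_minus_cos: "(LINT x|lebesgue. (1 - cos (k * x)) / x\<^sup>2) = pi * \<bar>k\<bar>"
  using has_integral_one_minus_cos_over_square[of k] by (auto simp: has_bochner_integral_iff)

lemma AE_nonzero: "AE x::real in lebesgue. x \<noteq> 0"
  by (intro AE_completion AE_lborel_singleton)

text \<open>The squared numerator of the closed form is at most twice the squared distance of two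
  points of the unit circle, that is, at most \<open>4 * (1 - cos ((b - a) * x))\<close>. Divided by
  \<open>x^2\<close> this has already been integrated.\<close>

lemma hiv_L2 [simp]: "hiv a b \<in> L2"
proof (cases "a \<le> b")
  case True
  show ?thesis
  proof (rule L2I[OF hiv_measurable])
    have "integrable lebesgue (\<lambda>x. 4 * ((1 - cos ((b - a) * x)) / x\<^sup>2))"
      by (intro integrable_mult_right integrable_one_minus_cos)
    then show "integrable lebesgue (\<lambda>x. (hiv a b x)\<^sup>2)"
    proof (rule Bochner_Integration.integrable_bound)
      show "(\<lambda>x. (hiv a b x)\<^sup>2) \<in> borel_measurable lebesgue" by measurable
      show "AE x in lebesgue. norm ((hiv a b x)\<^sup>2) \<le> norm (4 * ((1 - cos ((b - a) * x)) / x\<^sup>2))"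
        using AE_nonzero
      proof eventually_elim
        case (elim x)
        define s where "s = sin (b * x) - sin (a * x)"
        define c where "c = cos (b * x) - cos (a * x)"
        have sc: "s\<^sup>2 + c\<^sup>2 = 2 * (1 - cos ((b - a) * x))"
        proof -
          have "s\<^sup>2 + c\<^sup>2 = ((sin (b * x))\<^sup>2 + (cos (b * x))\<^sup>2) + ((sin (a * x))\<^sup>2 + (cos (a * x))\<^sup>2)
            - 2 * (cos (b * x) * cos (a * x) + sin (b * x) * sin (a * x))"
            unfolding s_def c_def power2_eq_square by algebra
          also have "\<dots> = 2 - 2 * cos (b * x - a * x)" by (simp add: cos_diff)
          finally show ?thesis by (simp add: left_diff_distrib)
        qed
        have "(s - c)\<^sup>2 \<le> 2 * (s\<^sup>2 + c\<^sup>2)"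
          using zero_le_power2[of "s + c"] by (simp add: power2_eq_square algebra_simps)
        then have "(s - c)\<^sup>2 \<le> 4 * (1 - cos ((b - a) * x))" using sc by simp
        moreover have "hiv a b x = (s - c) / (x * sqrt (2 * pi))"
          using hiv_eq[OF True elim] by (simp add: s_def c_def algebra_simps)
        then have "(hiv a b x)\<^sup>2 = ((s - c)\<^sup>2 / x\<^sup>2) / (2 * pi)"
          by (simp add: power_divide power_mult_distrib)
        moreover have "((s - c)\<^sup>2 / x\<^sup>2) / (2 * pi) \<le> (s - c)\<^sup>2 / x\<^sup>2"
        proof -
          have "1 \<le> 2 * pi" using pi_gt3 by simp
          then have "((s - c)\<^sup>2 / x\<^sup>2) / (2 * pi) \<le> ((s - c)\<^sup>2 / x\<^sup>2) / 1"
            by (intro divide_left_mono) auto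
          then show ?thesis by simp
        qed
        moreover have "(s - c)\<^sup>2 / x\<^sup>2 \<le> 4 * (1 - cos ((b - a) * x)) / x\<^sup>2"
          using calculation(1) by (intro divide_right_mono) auto
        ultimately show ?case by simp
      qed
    qed
  qed
qed (simp add: hiv_empty)

text \<open>Plancherel on intervals. Adding the values at \<xi> and -\<xi> removes the mixed
  products of sine and cosine and leaves four quotients of the type (1 - cos (k x)) / x^2. Their
  integrals combine to |b - c| + |a - d| - |b - d| - |a - c|, which is twice the length of the
  overlap.\<close>

lemma hiv_inner: "(LINT \<xi>|lebesgue. hiv a b \<xi> * hiv c d \<xi>) = (LINT x|lebesgue. indicator {a..b} x * indicator {c..d} x)"
proof (cases "a \<le> b \<and> c \<le> d")
  case True
  then have ab: "a \<le> b" and cd: "c \<le> d" by auto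
  define q where "q k x = (1 - cos (k * x)) / x\<^sup>2" for k x :: real
  have qi: "integrable lebesgue (q k)" "(LINT x|lebesgue. q k x) = pi * \<bar>k\<bar>" for k
    unfolding q_def[abs_def] using integrable_one_minus_cos integral_one_minus_cos by auto
  have i: "integrable lebesgue (\<lambda>\<xi>. hiv a b \<xi> * hiv c d \<xi>)"
    by (intro L2_mult_integrable hiv_L2)
  define P where "P \<xi> = hiv a b \<xi> * hiv c d \<xi>" for \<xi>
  have Pi: "integrable lebesgue P" using i by (simp add: P_def[abs_def])
  have P': "(LINT \<xi>|lebesgue. P (- \<xi>)) = (LINT \<xi>|lebesgue. P \<xi>)" "integrable lebesgue (\<lambda>\<xi>. P (- \<xi>))"
    using integral_affine[of "-1" P 0] integrable_affine[of "-1" P 0] Pi by auto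
  have "AE x in lebesgue. P x + P (- x) = (1 / pi) * (q (b - c) x + q (a - d) x - q (b - d) x - q (a - c) x)"
    using AE_nonzero
  proof eventually_elim
    case (elim x)
    have "P x + P (- x) = (2 * ((sin (b*x) - sin (a*x)) * (sin (d*x) - sin (c*x)) + (cos (b*x) - cos (a*x)) * (cos (d*x) - cos (c*x)))) / (x\<^sup>2 * (2 * pi))"
    proof -
      have r: "sqrt (2 * pi) * sqrt (2 * pi) = 2 * pi" by simp
      have eq: "hiv a b x * hiv c d x + hiv a b (- x) * hiv c d (- x)
        = (((sin (b*x) - cos (b*x)) - (sin (a*x) - cos (a*x))) * ((sin (d*x) - cos (d*x)) - (sin (c*x) - cos (c*x)))
         + ((- sin (b*x) - cos (b*x)) - (- sin (a*x) - cos (a*x))) * ((- sin (d*x) - cos (d*x)) - (- sin (c*x) - cos (c*x)))) / ((x * sqrt (2 * pi)) * (x * sqrt (2 * pi)))"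
        using elim by (simp add: hiv_eq[OF ab] hiv_eq[OF cd] add_divide_distrib)
      have d: "(x * sqrt (2 * pi)) * (x * sqrt (2 * pi)) = x\<^sup>2 * (2 * pi)"
        using r by (simp add: power2_eq_square ac_simps)
      show ?thesis unfolding P_def eq d
        by (rule arg_cong2[where f="(/)"]) (auto simp: algebra_simps)
    qed
    also have "2 * ((sin (b*x) - sin (a*x)) * (sin (d*x) - sin (c*x)) + (cos (b*x) - cos (a*x)) * (cos (d*x) - cos (c*x)))
      = 2 * (cos (b*x - d*x) - cos (b*x - c*x) - cos (a*x - d*x) + cos (a*x - c*x))"
      by (simp add: cos_diff algebra_simps)
    also have "2 * (cos (b*x - d*x) - cos (b*x - c*x) - cos (a*x - d*x) + cos (a*x - c*x)) / (x\<^sup>2 * (2 * pi))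
       = (1 / pi) * (q (b - c) x + q (a - d) x - q (b - d) x - q (a - c) x)"
      using elim by (simp add: q_def left_diff_distrib field_simps)
    finally show ?case .
  qed
  then have "(LINT x|lebesgue. P x + P (- x)) = (LINT x|lebesgue. (1 / pi) * (q (b - c) x + q (a - d) x - q (b - d) x - q (a - c) x))"
    by (rule integral_cong_AE[rotated 2]) (use Pi P'(2) qi(1) in auto)
  also have "\<dots> = (1 / pi) * (pi * \<bar>b - c\<bar> + pi * \<bar>a - d\<bar> - pi * \<bar>b - d\<bar> - pi * \<bar>a - c\<bar>)"
    by (simp add: qi Bochner_Integration.integral_add Bochner_Integration.integral_diff)
  also have "\<dots> = \<bar>b - c\<bar> + \<bar>a - d\<bar> - \<bar>b - d\<bar> - \<bar>a - c\<bar>"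
    by (simp add: field_simps)
  also have "\<dots> = 2 * max 0 (min b d - max a c)"
    using ab cd by (auto simp: abs_if max_def min_def)
  finally have "2 * (LINT x|lebesgue. P x) = 2 * max 0 (min b d - max a c)"
    using Pi P' by (simp add: Bochner_Integration.integral_add)
  then show ?thesis by (simp add: P_def measure_interval_Int[OF ab cd])
next
  case False
  then show ?thesis
  proof (cases "b < a")
    case True then have "{a..b} = {}" by simp
    then show ?thesis by (simp only: hiv_empty[OF True]) simp
  next
    case b: False
    with False have "d < c" by simp
    then show ?thesis by (simp only: hiv_empty[OF \<open>d < c\<close>]) simp
  qed
qed

text \<open>The graph of the transform, as the closed linear span of its values on intervals. With a
  relation nothing has to be shown well defined in advance: preservation of inner products follows
  by induction and gives single-valuedness, and the density of intervals gives totality.\<close>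

inductive hrel :: "l2 \<Rightarrow> l2 \<Rightarrow> bool" where
  iv: "hrel (iv a b) (cl (hiv a b))"
| add: "hrel u u' \<Longrightarrow> hrel v v' \<Longrightarrow> hrel (u + v) (u' + v')"
| scale: "hrel u u' \<Longrightarrow> hrel (r *\<^sub>R u) (r *\<^sub>R u')"
| lim: "(\<And>n::nat. hrel (X n) (Y n)) \<Longrightarrow> X \<longlonglongrightarrow> u \<Longrightarrow> Y \<longlonglongrightarrow> u' \<Longrightarrow> hrel u u'"

lemma hrel_inner_iv: "hrel u u' \<Longrightarrow> inner u' (cl (hiv c d)) = inner u (iv c d)"
proof (induction rule: hrel.induct)
  case (iv a b)
  show ?case unfolding iv_def by (simp add: inner_cl hiv_inner)
next
  case (lim X Y u u')
  have "(\<lambda>n. inner (Y n) (cl (hiv c d))) \<longlonglongrightarrow> inner u' (cl (hiv c d))"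
    by (intro tendsto_inner lim tendsto_const)
  moreover have "(\<lambda>n. inner (X n) (iv c d)) \<longlonglongrightarrow> inner u (iv c d)"
    by (intro tendsto_inner lim tendsto_const)
  ultimately show ?case using lim by (simp add: LIMSEQ_unique)
qed (auto simp: inner_add_left)

text \<open>Induction on the second pair, with \<open>hrel_inner_iv\<close>, an induction on the
  first pair, as base case. Isometry and uniqueness of the image are read off from this
  identity.\<close>

lemma hrel_inner: "hrel v v' \<Longrightarrow> hrel u u' \<Longrightarrow> inner u' v' = inner u v"
proof (induction rule: hrel.induct)
  case (iv a b)
  then show ?case by (rule hrel_inner_iv)
next
  case (lim X Y v v')
  have "(\<lambda>n. inner u' (Y n)) \<longlonglongrightarrow> inner u' v'"
    by (intro tendsto_inner lim tendsto_const)
  moreover have "(\<lambda>n. inner u (X n)) \<longlonglongrightarrow> inner u v"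
    by (intro tendsto_inner lim tendsto_const)
  ultimately show ?case using lim by (simp add: LIMSEQ_unique)
qed (auto simp: inner_add_right)

lemma hrel_diff: "hrel u u' \<Longrightarrow> hrel v v' \<Longrightarrow> hrel (u - v) (u' - v')"
  using hrel.add[of u u' "(-1) *\<^sub>R v" "(-1) *\<^sub>R v'"] hrel.scale[of v v' "-1"] by simp

lemma hrel_norm: "hrel u u' \<Longrightarrow> norm u' = norm u"
  by (simp add: norm_eq_sqrt_inner hrel_inner)

lemma hrel_unique: "hrel u u' \<Longrightarrow> hrel u u'' \<Longrightarrow> u' = u''"
  using hrel_norm[OF hrel_diff[of u u' u u'']] by simp

lemma hrel_ex: "\<exists>u'. hrel u u'"
proof (rule l2_interval_induct[where P="\<lambda>u. \<exists>u'. hrel u u'"])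
  fix X :: "nat \<Rightarrow> l2" and x
  assume "\<And>n. \<exists>u'. hrel (X n) u'" and X: "X \<longlonglongrightarrow> x"
  then obtain Y where Y: "\<And>n. hrel (X n) (Y n)" by metis
  have "Cauchy X" using X by (rule LIMSEQ_imp_Cauchy)
  moreover have "norm (Y m - Y n) = norm (X m - X n)" for m n
    by (intro hrel_norm hrel_diff Y)
  ultimately have "Cauchy Y" by (simp add: Cauchy_def dist_norm)
  then obtain y where "Y \<longlonglongrightarrow> y" using Cauchy_convergent convergent_def by blast
  then show "\<exists>u'. hrel x u'" using hrel.lim[OF Y X] by blast
qed (auto intro: hrel.intros)

text \<open>
  The Hartley transform replaces the Fourier transform: its kernel \<open>cos + sin\<close> is real, so everything
  stays in the real Hilbert space \<open>l2\<close>.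
\<close>

definition hart :: "l2 \<Rightarrow> l2" where "hart u = (THE u'. hrel u u')"

lemma hrel_hart: "hrel u (hart u)"
  unfolding hart_def using hrel_ex[of u] hrel_unique by (metis theI)

lemma hartI: "hrel u u' \<Longrightarrow> hart u = u'"
  using hrel_unique hrel_hart by blast

lemma hart_iv: "hart (iv a b) = cl (hiv a b)"
  by (intro hartI hrel.iv)

lemma hart_add: "hart (u + v) = hart u + hart v"
  by (intro hartI hrel.add hrel_hart)

lemma hart_scaleR: "hart (c *\<^sub>R u) = c *\<^sub>R hart u"
  by (intro hartI hrel.scale hrel_hart)

lemma norm_hart: "norm (hart u) = norm u"
  by (intro hrel_norm hrel_hart)

lemma inner_hart: "inner (hart u) (hart v) = inner u v"
  by (intro hrel_inner hrel_hart)

lemma bounded_linear_hart: "bounded_linear hart"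
  by (rule bounded_linear_intro[where K=1]) (auto simp: hart_add hart_scaleR norm_hart)

lemma hart_diff: "hart (u - v) = hart u - hart v"
  using bounded_linear_hart by (simp add: linear_simps)

lemma hart_uminus: "hart (- u) = - hart u"
  using bounded_linear_hart by (simp add: linear_simps)

lemma hart_tendsto: "(f \<longlongrightarrow> u) F \<Longrightarrow> ((\<lambda>x. hart (f x)) \<longlongrightarrow> hart u) F"
  by (rule bounded_linear.tendsto[OF bounded_linear_hart])

lemma l2_eqI_intervals: 
  assumes "\<And>c d. inner u (iv c d) = inner v (iv c d)" shows "u = v"
proof -
  have "inner (u - v) w = 0" for w
  proof (rule l2_interval_induct[where P="\<lambda>w. inner (u - v) w = 0"])
    show "inner (u - v) (iv a b) = 0" for a b using assms by (simp add: inner_diff_left)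
    fix X :: "nat \<Rightarrow> l2" and x assume X: "\<And>n. inner (u - v) (X n) = 0" "X \<longlonglongrightarrow> x"
    have "(\<lambda>n. inner (u - v) (X n)) \<longlonglongrightarrow> inner (u - v) x" by (intro tendsto_inner tendsto_const X)
    then show "inner (u - v) x = 0" using X(1) by (simp add: LIMSEQ_const_iff)
  qed (auto simp: inner_add_right)
  from this[of "u - v"] show ?thesis by simp
qed

lemma inner_iv: "inner u (iv c d) = (LINT x|lebesgue. indicator {c..d} x * fn u x)"
  using inner_cl[of "fn u" "indicator {c..d}"] by (simp add: iv_def mult.commute)

lemma hart_selfadjoint_iv: "inner (hart u) (iv c d) = inner u (cl (hiv c d))"
proof (rule l2_interval_induct[where P="\<lambda>u. inner (hart u) (iv c d) = inner u (cl (hiv c d))"])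
  fix a b
  have "inner (hart (iv a b)) (iv c d) = (LINT x|lebesgue. hiv a b x * indicator {c..d} x)"
    unfolding hart_iv by (simp add: iv_def inner_cl)
  also have "\<dots> = (LINT x|lebesgue. indicator {a..b} x * hiv c d x)"
    using hk_Fubini[of "indicator {a..b}" c d] by (simp add: hiv_def[symmetric] mult.commute)
  also have "\<dots> = inner (iv a b) (cl (hiv c d))"
    unfolding iv_def by (simp add: inner_cl)
  finally show "inner (hart (iv a b)) (iv c d) = inner (iv a b) (cl (hiv c d))" .
next
  fix X :: "nat \<Rightarrow> l2" and x
  assume *: "\<And>n. inner (hart (X n)) (iv c d) = inner (X n) (cl (hiv c d))" and X: "X \<longlonglongrightarrow> x"
  have "(\<lambda>n. inner (hart (X n)) (iv c d)) \<longlonglongrightarrow> inner (hart x) (iv c d)"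
    by (intro tendsto_inner tendsto_const hart_tendsto X)
  moreover have "(\<lambda>n. inner (X n) (cl (hiv c d))) \<longlonglongrightarrow> inner x (cl (hiv c d))"
    by (intro tendsto_inner tendsto_const X)
  ultimately show "inner (hart x) (iv c d) = inner x (cl (hiv c d))"
    using * by (simp add: LIMSEQ_unique)
qed (auto simp: hart_add hart_scaleR inner_add_left)

text \<open>Since the kernel is symmetric, the transform is a self-adjoint isometry, hence an involution.\<close>

lemma hart_hart [simp]: "hart (hart u) = u"
proof (rule l2_eqI_intervals)
  fix c d
  have "inner (hart (hart u)) (iv c d) = inner (hart u) (hart (iv c d))"
    by (simp add: hart_selfadjoint_iv hart_iv)
  then show "inner (hart (hart u)) (iv c d) = inner u (iv c d)" by (simp add: inner_hart)
qed

lemma hart_selfadjoint: "inner (hart u) v = inner u (hart v)"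
  using inner_hart[of u "hart v"] by simp

text \<open>Both functions have the same integral over every interval: pair the left one with
  \<open>iv a b\<close>, move the transform over by self-adjointness, and apply Fubini.\<close>

lemma hart_integrable:
  assumes f: "f \<in> L2" "integrable lebesgue f" shows "AE x in lebesgue. fn (hart (cl f)) x = hk f x"
proof -
  have hkm: "hk f \<in> borel_measurable lebesgue"
    by (intro continuous_lebesgue_measurable hk_continuous f)
  have si: "integrable lebesgue (\<lambda>x. indicator {a..b} x * fn u x)" for a b and u :: l2
    by (intro L2_mult_integrable) auto
  have hi: "set_integrable lebesgue {a..b} (hk f)" for a b
    by (intro absolutely_integrable_continuous_real continuous_on_subset[OF hk_continuous[OF f(2)]]) auto
  have hi': "integrable lebesgue (\<lambda>x. indicator {a..b} x * hk f x)" for a b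
    using hi[of a b] by (simp add: set_integrable_def)
  have "AE x in lebesgue. fn (hart (cl f)) x - hk f x = 0"
  proof (rule AE_zero_if_interval_integrals_zero)
    fix a b
    show "set_integrable lebesgue {a..b} (\<lambda>x. fn (hart (cl f)) x - hk f x)"
      unfolding set_integrable_def using si[of a b "hart (cl f)"] hi'[of a b] by (simp add: right_diff_distrib)
    have "(LINT x:{a..b}|lebesgue. fn (hart (cl f)) x - hk f x)
      = (LINT x|lebesgue. indicator {a..b} x * fn (hart (cl f)) x) - (LINT x|lebesgue. indicator {a..b} x * hk f x)"
      unfolding set_lebesgue_integral_def using si[of a b "hart (cl f)"] hi'[of a b] by (simp add: right_diff_distrib)
    also have "(LINT x|lebesgue. indicator {a..b} x * fn (hart (cl f)) x) = inner (cl f) (cl (hiv a b))"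
      by (simp add: inner_iv[symmetric] hart_selfadjoint_iv)
    also have "\<dots> = (LINT x|lebesgue. f x * hiv a b x)" by (simp add: inner_cl f)
    also have "\<dots> = (LINT x|lebesgue. indicator {a..b} x * hk f x)" by (rule hk_Fubini[OF f(2)])
    finally show "(LINT x:{a..b}|lebesgue. fn (hart (cl f)) x - hk f x) = 0" by simp
  qed
  then show ?thesis by eventually_elim simp
qed

lemma hiv_minus: "hiv a b (- \<xi>) = hiv (- b) (- a) \<xi>"
proof -
  have "(LINT x|lebesgue. cas (x * - \<xi>) * indicator {a..b} x) = (LINT x|lebesgue. cas ((0 + -1 * x) * - \<xi>) * indicator {a..b} (0 + -1 * x))"
    by (rule integral_affine[symmetric], simp, rule borel_measurable_integrable, intro integrable_bd_mult bd_cas) simp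
  also have "\<dots> = (LINT x|lebesgue. cas (x * \<xi>) * indicator {-b..-a} x)"
    by (rule Bochner_Integration.integral_cong) (auto simp: indicator_def)
  finally show ?thesis by (simp add: hiv_def hk_def)
qed

lemma rfl_iv: "rfl (iv a b) = iv (- b) (- a)"
proof -
  have "(\<lambda>x. indicator {a..b} (0 + -1 * x) :: real) = indicator {-b..-a}"
    by (auto simp: indicator_def fun_eq_iff)
  then show ?thesis by (simp add: iv_def aff_cl)
qed

lemma l2_eq_operators:
  assumes S: "bounded_linear S" and T: "bounded_linear T" and iv: "\<And>a b. S (iv a b) = T (iv a b)"
  shows "S u = T u"
proof (rule l2_interval_induct[where P="\<lambda>u. S u = T u"])
  fix X :: "nat \<Rightarrow> l2" and x assume *: "\<And>n. S (X n) = T (X n)" "X \<longlonglongrightarrow> x"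
  have "(\<lambda>n. S (X n)) \<longlonglongrightarrow> S x" "(\<lambda>n. T (X n)) \<longlonglongrightarrow> T x"
    using bounded_linear.tendsto[OF S *(2)] bounded_linear.tendsto[OF T *(2)] by auto
  then show "S x = T x" using *(1) by (simp add: LIMSEQ_unique)
qed (auto simp: iv linear_simps[OF S] linear_simps[OF T])

lemma hart_rfl: "hart (rfl u) = rfl (hart u)"
proof (rule l2_eq_operators[where S="\<lambda>u. hart (rfl u)" and T="\<lambda>u. rfl (hart u)"])
  show "bounded_linear (\<lambda>u. hart (rfl u))"
    by (rule bounded_linear_compose[OF bounded_linear_hart bounded_linear_aff]) simp
  show "bounded_linear (\<lambda>u. rfl (hart u))"
    by (rule bounded_linear_compose[OF bounded_linear_aff bounded_linear_hart]) simp
  fix a b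
  show "hart (rfl (iv a b)) = rfl (hart (iv a b))"
    by (simp add: rfl_iv hart_iv aff_cl hiv_minus)
qed

lemma tr_iv: "tr h (iv a b) = iv (a - h) (b - h)"
proof -
  have "(\<lambda>x. indicator {a..b} (x + h) :: real) = indicator {a-h..b-h}"
    by (auto simp: indicator_def fun_eq_iff)
  then show ?thesis by (simp add: iv_def tr_cl)
qed

text \<open>The shift theorem, from cas ((x - h) \<xi>) = cos (h \<xi>) cas (x \<xi>) - sin (h
  \<xi>) cas (- x \<xi>). As the kernel is real, a translation is not a multiplier but couples \<xi>
  with -\<xi>, whence the reflection in the second term.\<close>

lemma hart_tr: "hart (tr h u) = mul (\<lambda>\<xi>. cos (h * \<xi>)) (hart u) - mul (\<lambda>\<xi>. sin (h * \<xi>)) (rfl (hart u))"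
proof (rule l2_eq_operators[where S="\<lambda>u. hart (tr h u)"
      and T="\<lambda>u. mul (\<lambda>\<xi>. cos (h * \<xi>)) (hart u) - mul (\<lambda>\<xi>. sin (h * \<xi>)) (rfl (hart u))"])
  have bc: "bd (\<lambda>\<xi>. cos (h * \<xi>))" and bs: "bd (\<lambda>\<xi>. sin (h * \<xi>))"
    by (intro bd_cos bd_sin continuous_lebesgue_measurable continuous_intros)+
  show "bounded_linear (\<lambda>u. hart (tr h u))"
    by (rule bounded_linear_compose[OF bounded_linear_hart bounded_linear_aff]) simp
  show "bounded_linear (\<lambda>u. mul (\<lambda>\<xi>. cos (h * \<xi>)) (hart u) - mul (\<lambda>\<xi>. sin (h * \<xi>)) (rfl (hart u)))"
    by (intro bounded_linear_sub bounded_linear_compose[OF bounded_linear_mul] bc bs bounded_linear_hart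
        bounded_linear_compose[OF bounded_linear_aff]) simp
  fix a b
  have "hiv (a - h) (b - h) \<xi> = cos (h * \<xi>) * hiv a b \<xi> - sin (h * \<xi>) * hiv a b (- \<xi>)" for \<xi>
  proof -
    have i: "integrable lebesgue (\<lambda>x. cas (x * \<xi>) * indicator {a..b} x)" for \<xi>
      by (intro integrable_bd_mult bd_cas) simp
    have m: "(\<lambda>x. cas (x * \<xi>) * indicator {a - h..b - h} x) \<in> borel_measurable lebesgue"
      by (rule borel_measurable_integrable, intro integrable_bd_mult bd_cas) simp
    have "(LINT x|lebesgue. cas (x * \<xi>) * indicator {a - h..b - h} x)
      = (LINT x|lebesgue. cas ((- h + 1 * x) * \<xi>) * indicator {a - h..b - h} (- h + 1 * x))"
      by (rule integral_affine[symmetric, OF _ m]) simp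
    also have "\<dots> = (LINT x|lebesgue. cos (h * \<xi>) * (cas (x * \<xi>) * indicator {a..b} x) - sin (h * \<xi>) * (cas (x * - \<xi>) * indicator {a..b} x))"
    proof (rule Bochner_Integration.integral_cong)
      fix x
      have "cas ((- h + 1 * x) * \<xi>) = cos (h * \<xi>) * cas (x * \<xi>) - sin (h * \<xi>) * cas (x * - \<xi>)"
      proof -
        have "(- h + 1 * x) * \<xi> = x * \<xi> - h * \<xi>" by (simp add: algebra_simps)
        then show ?thesis by (simp add: cas_def cos_diff sin_diff algebra_simps)
      qed
      moreover have "(indicator {a - h..b - h} (- h + 1 * x) :: real) = indicator {a..b} x"
        by (auto simp: indicator_def)
      ultimately show "cas ((- h + 1 * x) * \<xi>) * indicator {a - h..b - h} (- h + 1 * x) =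
         cos (h * \<xi>) * (cas (x * \<xi>) * indicator {a..b} x) - sin (h * \<xi>) * (cas (x * - \<xi>) * indicator {a..b} x)"
        by (simp add: left_diff_distrib mult.assoc)
    qed simp
    also have "\<dots> = cos (h * \<xi>) * (LINT x|lebesgue. cas (x * \<xi>) * indicator {a..b} x) - sin (h * \<xi>) * (LINT x|lebesgue. cas (x * - \<xi>) * indicator {a..b} x)"
      using i[of \<xi>] i[of "- \<xi>"] by (subst Bochner_Integration.integral_diff) auto
    finally show ?thesis by (simp add: hiv_def hk_def diff_divide_distrib)
  qed
  then have *: "hiv (a - h) (b - h) = (\<lambda>\<xi>. cos (h * \<xi>) * hiv a b \<xi> - sin (h * \<xi>) * hiv a b (- \<xi>))" by (rule ext)
  have L: "(\<lambda>\<xi>. hiv a b (- \<xi>)) \<in> L2" by (simp add: hiv_minus)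
  have r: "rfl (cl (hiv a b)) = cl (\<lambda>\<xi>. hiv a b (- \<xi>))" by (simp add: aff_cl)
  show "hart (tr h (iv a b)) = mul (\<lambda>\<xi>. cos (h * \<xi>)) (hart (iv a b)) - mul (\<lambda>\<xi>. sin (h * \<xi>)) (rfl (hart (iv a b)))"
    unfolding tr_iv hart_iv r mul_cl[OF bc hiv_L2] mul_cl[OF bs L] *
    by (rule cl_diff) (intro L2_bd_mult bc bs L hiv_L2)+
qed

section \<open>Smooth functions\<close>

text \<open>A class of functions in which every member has a derivative belonging to the class
  consists of smooth functions. This replaces formulas for iterated derivatives by the choice of a
  suitable class.\<close>

lemma smooth_coinduct:
  assumes "f \<in> F" and step: "\<And>g. g \<in> F \<Longrightarrow> \<exists>g'\<in>F. \<forall>x. (g has_field_derivative g' x) (at x)"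
  shows "smooth f"
proof -
  have "(deriv ^^ n) f \<in> F" for n
  proof (induction n)
    case (Suc n)
    obtain g' where g': "g' \<in> F" "\<And>x. ((deriv ^^ n) f has_field_derivative g' x) (at x)"
      using step[OF Suc] by blast
    then have "deriv ((deriv ^^ n) f) = g'" by (intro ext DERIV_imp_deriv)
    then show ?case using g'(1) by simp
  qed (simp add: assms)
  then have "(deriv ^^ n) f field_differentiable (at x)" for n x
    using step[of "(deriv ^^ n) f"] unfolding field_differentiable_def by blast
  then show ?thesis unfolding smooth_def by blast
qed

lemma smooth_deriv: "smooth f \<Longrightarrow> smooth (deriv f)"
proof -
  assume f: "smooth f"
  have "(deriv ^^ n) (deriv f) = (deriv ^^ Suc n) f" for n
    by (simp only: funpow_Suc_right comp_def)
  with f show ?thesis unfolding smooth_def by presburger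
qed

lemma smooth_DERIV: "smooth f \<Longrightarrow> (f has_field_derivative deriv f x) (at x)"
proof -
  assume "smooth f"
  then have "(deriv ^^ 0) f field_differentiable (at x)" unfolding smooth_def by blast
  then show ?thesis by (simp add: field_differentiable_derivI)
qed

lemma smooth_continuous: "smooth f \<Longrightarrow> continuous_on UNIV f"
  by (rule DERIV_continuous_on) (rule has_field_derivative_at_within[OF smooth_DERIV])

text \<open>The derivative of a product is a sum of products, so closure under both operations is
  needed for a class that is stable under differentiation.\<close>

inductive_set smooth_alg :: "(real \<Rightarrow> real) set" where
  base: "smooth f \<Longrightarrow> f \<in> smooth_alg"
| add: "f \<in> smooth_alg \<Longrightarrow> g \<in> smooth_alg \<Longrightarrow> (\<lambda>x. f x + g x) \<in> smooth_alg"
| mult: "f \<in> smooth_alg \<Longrightarrow> g \<in> smooth_alg \<Longrightarrow> (\<lambda>x. f x * g x) \<in> smooth_alg"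

lemma smooth_alg_smooth: "f \<in> smooth_alg \<Longrightarrow> smooth f"
proof (rule smooth_coinduct[where F=smooth_alg])
  show "\<exists>g'\<in>smooth_alg. \<forall>x. (g has_field_derivative g' x) (at x)" if "g \<in> smooth_alg" for g
    using that
  proof (induction rule: smooth_alg.induct)
    case (base f)
    then show ?case using smooth_alg.base[OF smooth_deriv] smooth_DERIV by blast
  next
    case (add f g)
    then obtain f' g' where "f' \<in> smooth_alg" "g' \<in> smooth_alg"
      and d: "\<And>x. (f has_field_derivative f' x) (at x)" "\<And>x. (g has_field_derivative g' x) (at x)" by blast
    then show ?case
      by (intro bexI[of _ "\<lambda>x. f' x + g' x"] allI) (auto intro: smooth_alg.intros DERIV_add)
  next
    case (mult f g)
    then obtain f' g' where "f' \<in> smooth_alg" "g' \<in> smooth_alg"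
      and d: "\<And>x. (f has_field_derivative f' x) (at x)" "\<And>x. (g has_field_derivative g' x) (at x)" by blast
    then show ?case using mult(1,2)
      by (intro bexI[of _ "\<lambda>x. f' x * g x + g' x * f x"] allI) (auto intro: smooth_alg.intros DERIV_mult)
  qed
qed

lemma smooth_add: "smooth f \<Longrightarrow> smooth g \<Longrightarrow> smooth (\<lambda>x. f x + g x)"
  by (rule smooth_alg_smooth[OF smooth_alg.add[OF smooth_alg.base smooth_alg.base]])

lemma smooth_mult: "smooth f \<Longrightarrow> smooth g \<Longrightarrow> smooth (\<lambda>x. f x * g x)"
  by (rule smooth_alg_smooth[OF smooth_alg.mult[OF smooth_alg.base smooth_alg.base]])

lemma smooth_const: "smooth (\<lambda>x. c)"
proof (rule smooth_coinduct[where F="range (\<lambda>c x. c)"])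
  fix g :: "real \<Rightarrow> real" assume "g \<in> range (\<lambda>c x. c)"
  then obtain c where "g = (\<lambda>x. c)" by blast
  then show "\<exists>g'\<in>range (\<lambda>c x. c). \<forall>x. (g has_field_derivative g' x) (at x)"
    by (intro bexI[of _ "\<lambda>x. 0"]) auto
qed blast

lemma smooth_affine:
  assumes "smooth f" shows "smooth (\<lambda>x. f (c * x + d))"
proof (rule smooth_coinduct[where F="{\<lambda>x. k * g (c * x + d) | k g. smooth g}"])
  show "(\<lambda>x. f (c * x + d)) \<in> {\<lambda>x. k * g (c * x + d) | k g. smooth g}"
    by (rule CollectI, rule exI[of _ 1], rule exI[of _ f]) (simp add: assms)
  fix h assume "h \<in> {\<lambda>x. k * g (c * x + d) | k g. smooth g}"
  then obtain k g where g: "h = (\<lambda>x. k * g (c * x + d))" "smooth g" by blast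
  have "(h has_field_derivative (k * c) * deriv g (c * x + d)) (at x)" for x
    unfolding g(1) by (auto intro!: derivative_eq_intros DERIV_chain2[OF smooth_DERIV[OF g(2)]])
  then show "\<exists>g'\<in>{\<lambda>x. k * g (c * x + d) | k g. smooth g}. \<forall>x. (h has_field_derivative g' x) (at x)"
    using smooth_deriv[OF g(2)] by (intro bexI[of _ "\<lambda>x. (k * c) * deriv g (c * x + d)"]) blast+
qed

text \<open>The class for the coinduction is the class of functions that are locally equal to a
  smooth one. It is made for functions glued from pieces, as in
  \<open>ex_smooth_interpolation\<close>.\<close>

lemma smooth_locally:
  assumes "\<And>x. \<exists>\<epsilon>>0. \<exists>g. smooth g \<and> (\<forall>y. \<bar>y - x\<bar> < \<epsilon> \<longrightarrow> f y = g y)"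
  shows "smooth f"
proof (rule smooth_coinduct[where F="{f. \<forall>x. \<exists>\<epsilon>>0. \<exists>g. smooth g \<and> (\<forall>y. \<bar>y - x\<bar> < \<epsilon> \<longrightarrow> f y = g y)}"])
  show "f \<in> {f. \<forall>x. \<exists>\<epsilon>>0. \<exists>g. smooth g \<and> (\<forall>y. \<bar>y - x\<bar> < \<epsilon> \<longrightarrow> f y = g y)}" using assms by blast
  fix f :: "real \<Rightarrow> real" assume "f \<in> {f. \<forall>x. \<exists>\<epsilon>>0. \<exists>g. smooth g \<and> (\<forall>y. \<bar>y - x\<bar> < \<epsilon> \<longrightarrow> f y = g y)}"
  then have f: "\<exists>\<epsilon>>0. \<exists>g. smooth g \<and> (\<forall>y. \<bar>y - x\<bar> < \<epsilon> \<longrightarrow> f y = g y)" for x by blast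
  have key: "(f has_field_derivative deriv g y) (at y)"
    if "smooth g" "\<forall>y. \<bar>y - x\<bar> < \<epsilon> \<longrightarrow> f y = g y" "\<bar>y - x\<bar> < \<epsilon>" for g x \<epsilon> y
  proof (rule has_field_derivative_transform_within_open[OF smooth_DERIV[OF that(1)]])
    show "open (ball x \<epsilon>)" "y \<in> ball x \<epsilon>" using that(3) by (auto simp: dist_real_def abs_minus_commute)
    show "\<And>z. z \<in> ball x \<epsilon> \<Longrightarrow> g z = f z" using that(2) by (auto simp: dist_real_def abs_minus_commute)
  qed
  have "(f has_field_derivative deriv f x) (at x)" for x
  proof -
    obtain \<epsilon> g where "\<epsilon> > 0" "smooth g" "\<forall>y. \<bar>y - x\<bar> < \<epsilon> \<longrightarrow> f y = g y" using f[of x] by blast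
    then have "(f has_field_derivative deriv g x) (at x)" using key[of g x \<epsilon> x] by simp
    then show ?thesis by (simp add: DERIV_imp_deriv)
  qed
  moreover have "\<exists>\<epsilon>>0. \<exists>g. smooth g \<and> (\<forall>y. \<bar>y - x\<bar> < \<epsilon> \<longrightarrow> deriv f y = g y)" for x
  proof -
    obtain \<epsilon> g where "\<epsilon> > 0" "smooth g" "\<forall>y. \<bar>y - x\<bar> < \<epsilon> \<longrightarrow> f y = g y" using f[of x] by blast
    then have "smooth (deriv g)" "\<And>y. \<bar>y - x\<bar> < \<epsilon> \<Longrightarrow> deriv f y = deriv g y"
      using key[of g x \<epsilon>] DERIV_imp_deriv smooth_deriv by blast+
    then show ?thesis using \<open>\<epsilon> > 0\<close> by blast
  qed
  ultimately show "\<exists>g'\<in>{f. \<forall>x. \<exists>\<epsilon>>0. \<exists>g. smooth g \<and> (\<forall>y. \<bar>y - x\<bar> < \<epsilon> \<longrightarrow> f y = g y)}.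
      \<forall>x. (f has_field_derivative g' x) (at x)" by blast
qed

section \<open>Flat functions, smooth steps and cutoffs\<close>

definition flat :: "nat \<Rightarrow> real \<Rightarrow> real"
  where "flat n x = (if x > 0 then exp (- (1 / x)) / x ^ n else 0)"

text \<open>Differentiating exp (-1/x) produces powers of 1/x. With these powers built into
  \<open>flat n\<close> the derivative of \<open>flat n\<close> combines \<open>flat (n + 1)\<close>
  and \<open>flat (n + 2)\<close>, so the span is stable under differentiation, also at 0.\<close>

inductive_set flat_span :: "(real \<Rightarrow> real) set" where
  base: "flat n \<in> flat_span"
| add: "f \<in> flat_span \<Longrightarrow> g \<in> flat_span \<Longrightarrow> (\<lambda>x. f x + g x) \<in> flat_span"
| scale: "f \<in> flat_span \<Longrightarrow> (\<lambda>x. c * f x) \<in> flat_span"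

lemma flat_tendsto_0: "(flat n \<longlongrightarrow> 0) (at 0)"
proof (rule filterlim_split_at)
  show "(flat n \<longlongrightarrow> 0) (at_left 0)"
    by (rule tendsto_eventually) (auto simp: flat_def eventually_at_filter)
  have "((\<lambda>y::real. y ^ n / exp y) \<longlongrightarrow> 0) at_top" by (rule tendsto_power_div_exp_0)
  then have "((\<lambda>x::real. (inverse x) ^ n / exp (inverse x)) \<longlongrightarrow> 0) (at_right 0)"
    by (rule filterlim_compose[OF _ filterlim_inverse_at_top_right])
  then show "(flat n \<longlongrightarrow> 0) (at_right 0)"
    by (rule Lim_transform_eventually)
      (auto simp: flat_def eventually_at_filter exp_minus field_simps inverse_eq_divide power_divide)
qed

lemma flat_deriv: "(flat n has_field_derivative flat (n + 2) x + (- real n) * flat (n + 1) x) (at x)"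
proof -
  consider "x > 0" | "x = 0" | "x < 0" by linarith
  then show ?thesis
  proof cases
    case 1
    have "((\<lambda>x. exp (- (1 / x)) / x ^ n) has_field_derivative
        (exp (- (1 / x)) * (1 / x\<^sup>2) * x ^ n - exp (- (1 / x)) * (real n * x ^ (n - 1))) / (x ^ n * x ^ n)) (at x)"
      using 1 by (auto intro!: derivative_eq_intros simp: power2_eq_square)
    moreover have "(exp (- (1 / x)) * (1 / x\<^sup>2) * x ^ n - exp (- (1 / x)) * (real n * x ^ (n - 1))) / (x ^ n * x ^ n)
        = exp (- (1 / x)) / x ^ (n + 2) + (- real n) * (exp (- (1 / x)) / x ^ (n + 1))"
      using 1 by (cases n) (auto simp: field_simps power2_eq_square)
    ultimately have "((\<lambda>x. exp (- (1 / x)) / x ^ n) has_field_derivative flat (n + 2) x + (- real n) * flat (n + 1) x) (at x)"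
      using 1 by (simp add: flat_def)
    then show ?thesis
      by (rule has_field_derivative_transform_within_open[where S="{0<..}"]) (use 1 in \<open>auto simp: flat_def\<close>)
  next
    case 2
    have "((\<lambda>h. (flat n (0 + h) - flat n 0) / h) \<longlongrightarrow> 0) (at 0)"
      by (rule Lim_transform_eventually[OF flat_tendsto_0[of "n + 1"]]) (auto simp: flat_def eventually_at_filter field_simps)
    then show ?thesis using 2 by (simp add: DERIV_def flat_def)
  next
    case 3
    have "((\<lambda>x. 0) has_field_derivative flat (n + 2) x + (- real n) * flat (n + 1) x) (at x)"
      using 3 by (simp add: flat_def)
    then show ?thesis
      by (rule has_field_derivative_transform_within_open[where S="{..<0}"]) (use 3 in \<open>auto simp: flat_def\<close>)
  qed
qed

lemma smooth_flat: "smooth (flat n)"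
proof (rule smooth_coinduct[where F=flat_span])
  show "flat n \<in> flat_span" by (rule flat_span.base)
  show "\<exists>g'\<in>flat_span. \<forall>x. (g has_field_derivative g' x) (at x)" if "g \<in> flat_span" for g
    using that
  proof (induction rule: flat_span.induct)
    case (base n)
    have "(\<lambda>x. flat (n + 2) x + (- real n) * flat (n + 1) x) \<in> flat_span" by (intro flat_span.intros)
    then show ?case by (rule bexI[rotated]) (intro allI flat_deriv)
  next
    case (add f g)
    then obtain f' g' where "f' \<in> flat_span" "g' \<in> flat_span"
      and d: "\<And>x. (f has_field_derivative f' x) (at x)" "\<And>x. (g has_field_derivative g' x) (at x)" by blast
    then show ?case
      by (intro bexI[of _ "\<lambda>x. f' x + g' x"] allI) (auto intro: flat_span.intros DERIV_add)
  next
    case (scale f c)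
    then obtain f' where "f' \<in> flat_span"
      and d: "\<And>x. (f has_field_derivative f' x) (at x)" by blast
    then show ?case
      by (intro bexI[of _ "\<lambda>x. c * f' x"] allI) (auto intro: flat_span.intros DERIV_cmult)
  qed
qed

text \<open>The step is the primitive of a bump supported in [0, 1], divided by its total mass; the
  bump is a product of two reflected copies of exp (-1/x).\<close>

lemma ex_smooth_step:
  obtains S :: "real \<Rightarrow> real" where "smooth S" "\<And>x. x \<le> 0 \<Longrightarrow> S x = 0" "\<And>x. x \<ge> 1 \<Longrightarrow> S x = 1"
    "\<And>x. 0 \<le> S x" "\<And>x. S x \<le> 1"
proof -
  define \<beta> where "\<beta> x = flat 0 x * flat 0 ((-1) * x + 1)" for x
  have sm: "smooth \<beta>"
    unfolding \<beta>_def[abs_def] by (intro smooth_mult smooth_flat smooth_affine)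
  then have cont: "continuous_on S \<beta>" for S
    using smooth_continuous continuous_on_subset by blast
  have \<beta>0: "\<beta> x = 0" if "x \<le> 0 \<or> x \<ge> 1" for x using that by (auto simp: \<beta>_def flat_def)
  have \<beta>pos: "\<beta> x > 0" if "0 < x" "x < 1" for x using that by (auto simp: \<beta>_def flat_def)
  have \<beta>nn: "\<beta> x \<ge> 0" for x by (auto simp: \<beta>_def flat_def)
  \<comment> \<open>The integral starts at -1, so that 0 is an interior point and the derivative
    there is two-sided; the bump vanishes on [-1, 0].\<close>
  define B where "B x = integral {-1..x} \<beta>" for x
  have B0: "B x = 0" if "x \<le> 0" for x
  proof -
    have "integral {-1..x} \<beta> = integral {-1..x} (\<lambda>x. 0)"
      by (rule integral_cong) (use that \<beta>0 in auto)
    then show ?thesis by (simp add: B_def)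
  qed
  have dB: "(B has_field_derivative \<beta> x) (at x)" for x
  proof (cases "x < 0")
    case True
    have "((\<lambda>x. 0) has_field_derivative \<beta> x) (at x)" using True \<beta>0 by simp
    then show ?thesis
      by (rule has_field_derivative_transform_within_open[where S="{..<0}"]) (use True B0 in auto)
  next
    case False
    have "((\<lambda>u. integral {-1..u} \<beta>) has_real_derivative \<beta> x) (at x within {-1..x+1})"
      by (rule integral_has_real_derivative[OF cont]) (use False in auto)
    then have "(B has_real_derivative \<beta> x) (at x within {-1..x+1})" by (simp add: B_def[abs_def])
    moreover have "at x within {-1..x+1} = at x" using False by (intro at_within_interior) (auto simp: interior_atLeastAtMost_real)
    ultimately show ?thesis by simp
  qed
  have Bmono: "B x \<le> B y" if "x \<le> y" for x y
    by (rule DERIV_nonneg_imp_nondecreasing[OF that]) (use dB \<beta>nn in blast)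
  have B1: "B x = B 1" if x: "x \<ge> 1" for x
  proof (cases "x = 1")
    case False
    then have "1 < x" using x by simp
    from MVT2[OF this dB] obtain z where "1 < z" "z < x" "B x - B 1 = (x - 1) * \<beta> z" by blast
    then show ?thesis using \<beta>0[of z] by simp
  qed simp
  have pos: "B 1 > 0"
  proof -
    have "(0::real) < 1" by simp
    from MVT2[OF this dB] obtain z where "0 < z" "z < 1" "B 1 - B 0 = (1 - 0) * \<beta> z" by blast
    then show ?thesis using \<beta>pos[of z] B0[of 0] by simp
  qed
  have smB: "smooth (\<lambda>x. (1 / B 1) * B x)"
  proof -
    have "smooth B"
    proof (rule smooth_coinduct[where F="insert B {f. smooth f}"])
      show "\<exists>g'\<in>insert B {f. smooth f}. \<forall>x. (g has_field_derivative g' x) (at x)" if "g \<in> insert B {f. smooth f}" for g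
        using that dB sm smooth_deriv smooth_DERIV by blast
    qed simp
    then show ?thesis by (intro smooth_mult smooth_const)
  qed
  show ?thesis
  proof (rule that[of "\<lambda>x. (1 / B 1) * B x"])
    show "smooth (\<lambda>x. (1 / B 1) * B x)" by (rule smB)
    show "(1 / B 1) * B x = 0" if "x \<le> 0" for x using B0[OF that] by simp
    show "(1 / B 1) * B x = 1" if "x \<ge> 1" for x using B1[OF that] pos by simp
    have "B x \<ge> 0" for x using B0[of x] Bmono[of 0 x] B0[of 0] by (cases "x \<le> 0") auto
    then show "0 \<le> (1 / B 1) * B x" for x using pos by simp
    have "B x \<le> B 1" for x using B1[of x] Bmono[of x 1] by (cases "x \<ge> 1") auto
    then show "(1 / B 1) * B x \<le> 1" for x using pos by simp
  qed
qed

lemma test_function_approx_interval: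
  assumes "a \<le> b"
  obtains \<eta> :: "nat \<Rightarrow> real \<Rightarrow> real" where "\<And>n. test_function (\<eta> n)"
    "\<And>n x. \<bar>\<eta> n x\<bar> \<le> indicator {a - 1..b + 1} x"
    "\<And>x. (\<lambda>n. \<eta> n x) \<longlonglongrightarrow> indicator {a..b} x"
proof -
  obtain S :: "real \<Rightarrow> real" where S: "smooth S" "\<And>x. x \<le> 0 \<Longrightarrow> S x = 0" "\<And>x. x \<ge> 1 \<Longrightarrow> S x = 1"
    "\<And>x. 0 \<le> S x" "\<And>x. S x \<le> 1" using ex_smooth_step by blast
  \<comment> \<open>A step rising on [a - 1/(n+1), a] times a step falling on [b, b + 1/(n+1)]. The
    product is 1 on [a, b], and its support stays in [a - 1, b + 1] for all \<open>n\<close>, which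
    provides the dominating function.\<close>
  define \<eta> where "\<eta> n x = S (real (Suc n) * x + (1 - real (Suc n) * a)) * S ((- real (Suc n)) * x + (1 + real (Suc n) * b))" for n x
  have zero: "\<eta> n x = 0" if "x \<le> a - 1 / real (Suc n) \<or> x \<ge> b + 1 / real (Suc n)" for n x
  proof -
    have "real (Suc n) * x + (1 - real (Suc n) * a) \<le> 0 \<or> (- real (Suc n)) * x + (1 + real (Suc n) * b) \<le> 0"
      using that by (auto simp: field_simps)
    then show ?thesis unfolding \<eta>_def using S(2) by auto
  qed
  have one: "\<eta> n x = 1" if "a \<le> x" "x \<le> b" for n x
  proof -
    have "real (Suc n) * a \<le> real (Suc n) * x" "real (Suc n) * x \<le> real (Suc n) * b"
      using that by (auto intro!: mult_left_mono simp del: of_nat_Suc)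
    then show ?thesis unfolding \<eta>_def using S(3) by (simp del: of_nat_Suc)
  qed
  have inv: "1 / real (Suc n) \<le> 1" for n by simp
  show ?thesis
  proof (rule that[of \<eta>])
    show "test_function (\<eta> n)" for n
      unfolding test_function_def
    proof
      show "smooth (\<eta> n)" unfolding \<eta>_def[abs_def] by (intro smooth_mult smooth_affine S)
      show "\<exists>R. \<forall>x. R < \<bar>x\<bar> \<longrightarrow> \<eta> n x = 0"
      proof (intro exI[of _ "\<bar>a\<bar> + \<bar>b\<bar> + 1"] allI impI zero)
        fix x assume "\<bar>a\<bar> + \<bar>b\<bar> + 1 < \<bar>x\<bar>"
        then show "x \<le> a - 1 / real (Suc n) \<or> x \<ge> b + 1 / real (Suc n)"
          using inv[of n] by linarith
      qed
    qed
    show "\<bar>\<eta> n x\<bar> \<le> indicator {a - 1..b + 1} x" for n x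
    proof (cases "x \<in> {a - 1..b + 1}")
      case True
      have "\<bar>\<eta> n x\<bar> \<le> 1 * 1" unfolding \<eta>_def abs_mult by (intro mult_mono) (use S in auto)
      then show ?thesis using True by simp
    next
      case False
      then have "x < a - 1 \<or> x > b + 1" by auto
      then have "\<eta> n x = 0" using inv[of n] by (intro zero) linarith
      then show ?thesis by simp
    qed
    show "(\<lambda>n. \<eta> n x) \<longlonglongrightarrow> indicator {a..b} x" for x
    proof (cases "x \<in> {a..b}")
      case True
      then show ?thesis using one by simp
    next
      case False
      define d where "d = max (a - x) (x - b)"
      have "d > 0" using False by (auto simp: d_def)
      then obtain N where N: "inverse (real (Suc N)) < d" using reals_Archimedean by blast
      have "\<eta> n x = 0" if "n \<ge> N" for n
      proof (rule zero)
        have "1 / real (Suc n) \<le> 1 / real (Suc N)" using that by (intro divide_left_mono) auto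
        then have "1 / real (Suc n) < d" using N by (simp add: inverse_eq_divide)
        then show "x \<le> a - 1 / real (Suc n) \<or> x \<ge> b + 1 / real (Suc n)"
          by (auto simp: d_def less_max_iff_disj)
      qed
      then have "\<forall>\<^sub>F n in sequentially. \<eta> n x = 0" by (auto simp: eventually_sequentially)
      then have "(\<lambda>n. \<eta> n x) \<longlonglongrightarrow> 0" by (rule tendsto_eventually)
      then show ?thesis using False by simp
    qed
  qed
qed

text \<open>Testing with smooth cutoffs that converge to the indicator of an interval shows that
  \<open>g\<close> and \<open>h\<close> have the same integral over every interval. Without
  uniqueness nothing could be said about the function selected by \<open>weak_deriv\<close>.\<close>

lemma weak_deriv_unique:
  assumes "has_weak_deriv f g" "has_weak_deriv f h" shows "AE x in lebesgue. g x = h x"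
proof -
  have gi: "set_integrable lebesgue {a..b} g" and hi: "set_integrable lebesgue {a..b} h" for a b
    using assms by (auto simp: has_weak_deriv_def L1_loc_def)
  have loc: "integrable lebesgue (\<lambda>x. indicator {a..b} x * (g x - h x))" for a b
    using gi[of a b] hi[of a b] unfolding set_integrable_def by (simp add: right_diff_distrib)
  have "AE x in lebesgue. g x - h x = 0"
  proof (rule AE_zero_if_interval_integrals_zero)
    fix a b :: real
    show "set_integrable lebesgue {a..b} (\<lambda>x. g x - h x)" using loc by (simp add: set_integrable_def)
    show "(LINT x:{a..b}|lebesgue. g x - h x) = 0"
    proof (cases "a \<le> b")
      case True
      obtain \<eta> where \<eta>: "\<And>n. test_function (\<eta> n)" "\<And>n x. \<bar>\<eta> n x\<bar> \<le> indicator {a - 1..b + 1} x"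
        "\<And>x. (\<lambda>n. \<eta> n x) \<longlonglongrightarrow> indicator {a..b} x"
        using test_function_approx_interval[OF True] by blast
      define w where "w x = indicator {a-1..b+1} x * (g x - h x)" for x
      have w: "integrable lebesgue w" unfolding w_def[abs_def] by (rule loc)
      have \<eta>m: "\<eta> n \<in> borel_measurable lebesgue" for n
        using \<eta>(1)[of n] by (intro continuous_lebesgue_measurable smooth_continuous) (simp add: test_function_def)
      have \<eta>w: "\<eta> n x * w x = \<eta> n x * (g x - h x)" for n x
        using \<eta>(2)[of n x] by (cases "x \<in> {a - 1..b + 1}") (auto simp: w_def)
      have "\<bar>\<eta> n x\<bar> \<le> 1" for n x
        using \<eta>(2)[of n x] by (cases "x \<in> {a - 1..b + 1}") auto
      then have bd: "bd (\<eta> n)" for n by (rule bdI[OF \<eta>m, where K=1])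
      have "(\<lambda>n. LINT x|lebesgue. \<eta> n x * w x) \<longlonglongrightarrow> (LINT x|lebesgue. indicator {a..b} x * w x)"
      proof (rule integral_dominated_convergence[where w="\<lambda>x. \<bar>w x\<bar>"])
        show "(\<lambda>x. indicator {a..b} x * w x) \<in> borel_measurable lebesgue" using w by (intro borel_measurable_times borel_measurable_indicator) auto
        show "(\<lambda>x. \<eta> n x * w x) \<in> borel_measurable lebesgue" for n using w \<eta>m by (intro borel_measurable_times) auto
        show "integrable lebesgue (\<lambda>x. \<bar>w x\<bar>)" using w by simp
        show "AE x in lebesgue. (\<lambda>n. \<eta> n x * w x) \<longlonglongrightarrow> indicator {a..b} x * w x"
          by (intro AE_I2 tendsto_mult \<eta>(3) tendsto_const)
        show "AE x in lebesgue. norm (\<eta> n x * w x) \<le> \<bar>w x\<bar>" for n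
          using \<open>\<And>n x. \<bar>\<eta> n x\<bar> \<le> 1\<close> by (auto simp: abs_mult intro!: mult_left_le_one_le)
      qed
      moreover have "(LINT x|lebesgue. \<eta> n x * w x) = 0" for n
      proof -
        obtain R where R: "\<And>x. R < \<bar>x\<bar> \<Longrightarrow> \<eta> n x = 0" using \<eta>(1)[of n] by (auto simp: test_function_def)
        have i: "integrable lebesgue (\<lambda>x. k x * \<eta> n x)" if "set_integrable lebesgue {a-1..b+1} k" for k
        proof -
          have "integrable lebesgue (\<lambda>x. \<eta> n x * (indicator {a-1..b+1} x * k x))"
            by (rule integrable_bd_mult[OF bd]) (use that in \<open>simp add: set_integrable_def\<close>)
          moreover have "\<eta> n x * (indicator {a-1..b+1} x * k x) = k x * \<eta> n x" for x
            using \<eta>(2)[of n x] by (cases "x \<in> {a - 1..b + 1}") auto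
          ultimately show ?thesis by simp
        qed
        have "(LINT x|lebesgue. \<eta> n x * w x) = (LINT x|lebesgue. g x * \<eta> n x - h x * \<eta> n x)"
          unfolding \<eta>w by (simp add: algebra_simps)
        also have "\<dots> = (LINT x|lebesgue. g x * \<eta> n x) - (LINT x|lebesgue. h x * \<eta> n x)"
          by (rule Bochner_Integration.integral_diff) (intro i gi hi)+
        also have "\<dots> = 0" using assms \<eta>(1)[of n] by (simp add: has_weak_deriv_def)
        finally show ?thesis .
      qed
      ultimately have "(LINT x|lebesgue. indicator {a..b} x * w x) = 0"
        by (simp add: LIMSEQ_const_iff)
      moreover have "indicator {a..b} x * w x = indicator {a..b} x * (g x - h x)" for x
        by (auto simp: w_def indicator_def)
      ultimately show ?thesis by (simp add: set_lebesgue_integral_def)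
    next
      case False
      then have "indicator {a..b} x *\<^sub>R (g x - h x) = 0" for x by simp
      then show ?thesis unfolding set_lebesgue_integral_def by (simp only: integral_zero)
    qed
  qed
  then show ?thesis by eventually_elim simp
qed

section \<open>Differentiation in the mean\<close>

lemma has_vector_derivative_iff_quotient:
  fixes f :: "real \<Rightarrow> 'a::real_normed_vector"
  shows "(f has_vector_derivative d) (at t) \<longleftrightarrow> ((\<lambda>s. (f s - f t) /\<^sub>R (s - t)) \<longlongrightarrow> d) (at t)"
proof -
  have ev: "\<forall>\<^sub>F s in at t. norm (f s - f t - (s - t) *\<^sub>R d) / norm (s - t) = norm ((f s - f t) /\<^sub>R (s - t) - d)"
    unfolding eventually_at_filter
  proof (intro always_eventually allI impI)
    fix s assume st: "s \<noteq> t"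
    have "(f s - f t) /\<^sub>R (s - t) - d = (f s - f t - (s - t) *\<^sub>R d) /\<^sub>R (s - t)"
      using st by (simp add: scaleR_diff_right)
    then show "norm (f s - f t - (s - t) *\<^sub>R d) / norm (s - t) = norm ((f s - f t) /\<^sub>R (s - t) - d)"
      by (simp add: divide_inverse mult.commute)
  qed
  have "(f has_vector_derivative d) (at t) \<longleftrightarrow> ((\<lambda>s. norm (f s - f t - (s - t) *\<^sub>R d) / norm (s - t)) \<longlongrightarrow> 0) (at t)"
    unfolding has_vector_derivative_def has_derivative_iff_norm
    by (simp add: bounded_linear_scaleR_left)
  also have "\<dots> \<longleftrightarrow> ((\<lambda>s. norm ((f s - f t) /\<^sub>R (s - t) - d)) \<longlongrightarrow> 0) (at t)"
    by (rule tendsto_cong[OF ev])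
  also have "\<dots> \<longleftrightarrow> ((\<lambda>s. (f s - f t) /\<^sub>R (s - t)) \<longlongrightarrow> d) (at t)"
    by (simp add: tendsto_norm_zero_iff LIM_zero_iff)
  finally show ?thesis .
qed

lemma abs_cos_diff_le: "\<bar>cos u - cos v\<bar> \<le> \<bar>u - v\<bar>" for u v :: real
proof -
  have "\<bar>cos u - cos v\<bar> = 2 * (\<bar>sin ((u + v) / 2)\<bar> * \<bar>sin ((v - u) / 2)\<bar>)"
    unfolding cos_diff_cos by (simp add: abs_mult)
  also have "\<dots> \<le> 2 * (1 * \<bar>(v - u) / 2\<bar>)"
    by (intro mult_left_mono mult_mono abs_sin_le_one abs_sin_x_le_abs_x) auto
  finally show ?thesis by simp
qed

lemma abs_sin_diff_le: "\<bar>sin u - sin v\<bar> \<le> \<bar>u - v\<bar>" for u v :: real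
proof -
  have "\<bar>sin u - sin v\<bar> = 2 * (\<bar>sin ((u - v) / 2)\<bar> * \<bar>cos ((u + v) / 2)\<bar>)"
    unfolding sin_diff_sin by (simp add: abs_mult)
  also have "\<dots> \<le> 2 * (\<bar>(u - v) / 2\<bar> * 1)"
    by (intro mult_left_mono mult_mono abs_cos_le_one abs_sin_x_le_abs_x) auto
  finally show ?thesis by simp
qed

lemma mul_quotient:
  assumes "bd p" "bd q" shows "(mul p a - mul q a) /\<^sub>R r = cl (\<lambda>x. ((p x - q x) / r) * fn a x)"
proof -
  have "(mul p a - mul q a) /\<^sub>R r = inverse r *\<^sub>R cl (\<lambda>x. p x * fn a x - q x * fn a x)"
    unfolding mul_def using assms by (simp add: cl_diff L2_bd_mult)
  also have "\<dots> = cl (\<lambda>x. inverse r * (p x * fn a x - q x * fn a x))"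
    by (rule cl_scaleR[symmetric]) (intro L2_diff L2_bd_mult assms fn_L2)
  also have "(\<lambda>x. inverse r * (p x * fn a x - q x * fn a x)) = (\<lambda>x. ((p x - q x) / r) * fn a x)"
    by (auto simp: field_simps)
  finally show ?thesis .
qed

lemma mul_mul_unbounded:
  assumes p: "bd p" and q: "(\<lambda>x. q x * fn a x) \<in> L2"
  shows "mul p (mul q a) = cl (\<lambda>x. p x * (q x * fn a x))"
  unfolding mul_def[of q] by (rule mul_cl[OF p q])

text \<open>The difference quotients of cos (t \<phi>) are bounded by |\<phi>|, so dominated
  convergence needs only that the product of \<phi> with \<open>fn a\<close> is in L2. The phase may
  thus be unbounded: it is the identity for translations and \<sigma> for the free
  evolution.\<close>

lemma mul_cos_has_vector_derivative:
  assumes \<phi>: "\<phi> \<in> borel_measurable lebesgue" and L: "(\<lambda>x. \<phi> x * fn a x) \<in> L2"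
  shows "((\<lambda>t. mul (\<lambda>x. cos (t * \<phi> x)) a) has_vector_derivative - mul (\<lambda>x. sin (t * \<phi> x)) (mul \<phi> a)) (at t)"
proof -
  have m: "(\<lambda>x. s * \<phi> x) \<in> borel_measurable lebesgue" for s
    by (intro borel_measurable_times borel_measurable_const \<phi>)
  note bc = bd_cos[OF m] and bs = bd_sin[OF m]
  have eq: "- mul (\<lambda>x. sin (t * \<phi> x)) (mul \<phi> a) = cl (\<lambda>x. - sin (t * \<phi> x) * (\<phi> x * fn a x))"
    unfolding mul_mul_unbounded[OF bs L] using cl_uminus[OF L2_bd_mult[OF bs[of t] L]] by simp
  show ?thesis
    unfolding has_vector_derivative_iff_quotient mul_quotient[OF bc bc] eq
  proof (rule l2_dominated_convergence_at[OF L])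
    show "(\<lambda>x. (cos (s * \<phi> x) - cos (t * \<phi> x)) / (s - t) * fn a x) \<in> borel_measurable lebesgue" for s
      using bc[of s] bc[of t] by (intro borel_measurable_times borel_measurable_divide borel_measurable_diff fn_measurable bd_measurable) auto
    show "(\<lambda>x. - sin (t * \<phi> x) * (\<phi> x * fn a x)) \<in> borel_measurable lebesgue"
      using bs[of t] by (intro borel_measurable_times borel_measurable_uminus fn_measurable bd_measurable \<phi>)
    show "AE x in lebesgue. \<bar>(cos (s * \<phi> x) - cos (t * \<phi> x)) / (s - t) * fn a x\<bar> \<le> \<bar>\<phi> x * fn a x\<bar>" for s
    proof (intro AE_I2)
      fix x
      have "\<bar>cos (s * \<phi> x) - cos (t * \<phi> x)\<bar> \<le> \<bar>s - t\<bar> * \<bar>\<phi> x\<bar>"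
        using abs_cos_diff_le[of "s * \<phi> x" "t * \<phi> x"] by (simp add: left_diff_distrib[symmetric] abs_mult)
      then have "\<bar>cos (s * \<phi> x) - cos (t * \<phi> x)\<bar> / \<bar>s - t\<bar> \<le> \<bar>\<phi> x\<bar>"
        by (cases "s = t") (auto simp: divide_le_eq mult.commute)
      then have "\<bar>cos (s * \<phi> x) - cos (t * \<phi> x)\<bar> / \<bar>s - t\<bar> * \<bar>fn a x\<bar> \<le> \<bar>\<phi> x\<bar> * \<bar>fn a x\<bar>"
        by (intro mult_right_mono) auto
      then show "\<bar>(cos (s * \<phi> x) - cos (t * \<phi> x)) / (s - t) * fn a x\<bar> \<le> \<bar>\<phi> x * fn a x\<bar>"
        by (simp add: abs_mult)
    qed
    have "((\<lambda>s. (cos (s * \<phi> x) - cos (t * \<phi> x)) / (s - t)) \<longlongrightarrow> - sin (t * \<phi> x) * \<phi> x) (at t)" for x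
    proof -
      have "((\<lambda>s. cos (s * \<phi> x)) has_real_derivative - sin (t * \<phi> x) * \<phi> x) (at t)"
        by (auto intro!: derivative_eq_intros)
      then show ?thesis by (simp add: has_field_derivative_iff)
    qed
    then have "((\<lambda>s. (cos (s * \<phi> x) - cos (t * \<phi> x)) / (s - t) * fn a x) \<longlongrightarrow> (- sin (t * \<phi> x) * \<phi> x) * fn a x) (at t)" for x
      by (intro tendsto_mult tendsto_const)
    then show "AE x in lebesgue. ((\<lambda>s. (cos (s * \<phi> x) - cos (t * \<phi> x)) / (s - t) * fn a x) \<longlongrightarrow> - sin (t * \<phi> x) * (\<phi> x * fn a x)) (at t)"
      by (intro AE_I2) (simp add: mult.assoc)
  qed
qed

lemma mul_sin_has_vector_derivative:
  assumes \<phi>: "\<phi> \<in> borel_measurable lebesgue" and L: "(\<lambda>x. \<phi> x * fn a x) \<in> L2"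
  shows "((\<lambda>t. mul (\<lambda>x. sin (t * \<phi> x)) a) has_vector_derivative mul (\<lambda>x. cos (t * \<phi> x)) (mul \<phi> a)) (at t)"
proof -
  have m: "(\<lambda>x. s * \<phi> x) \<in> borel_measurable lebesgue" for s
    by (intro borel_measurable_times borel_measurable_const \<phi>)
  note bc = bd_cos[OF m] and bs = bd_sin[OF m]
  show ?thesis
    unfolding has_vector_derivative_iff_quotient mul_quotient[OF bs bs] mul_mul_unbounded[OF bc L]
  proof (rule l2_dominated_convergence_at[OF L])
    show "(\<lambda>x. (sin (s * \<phi> x) - sin (t * \<phi> x)) / (s - t) * fn a x) \<in> borel_measurable lebesgue" for s
      using bs[of s] bs[of t] by (intro borel_measurable_times borel_measurable_divide borel_measurable_diff fn_measurable bd_measurable) auto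
    show "(\<lambda>x. cos (t * \<phi> x) * (\<phi> x * fn a x)) \<in> borel_measurable lebesgue"
      using bc[of t] by (intro borel_measurable_times fn_measurable bd_measurable \<phi>)
    show "AE x in lebesgue. \<bar>(sin (s * \<phi> x) - sin (t * \<phi> x)) / (s - t) * fn a x\<bar> \<le> \<bar>\<phi> x * fn a x\<bar>" for s
    proof (intro AE_I2)
      fix x
      have "\<bar>sin (s * \<phi> x) - sin (t * \<phi> x)\<bar> \<le> \<bar>s - t\<bar> * \<bar>\<phi> x\<bar>"
        using abs_sin_diff_le[of "s * \<phi> x" "t * \<phi> x"] by (simp add: left_diff_distrib[symmetric] abs_mult)
      then have "\<bar>sin (s * \<phi> x) - sin (t * \<phi> x)\<bar> / \<bar>s - t\<bar> \<le> \<bar>\<phi> x\<bar>"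
        by (cases "s = t") (auto simp: divide_le_eq mult.commute)
      then have "\<bar>sin (s * \<phi> x) - sin (t * \<phi> x)\<bar> / \<bar>s - t\<bar> * \<bar>fn a x\<bar> \<le> \<bar>\<phi> x\<bar> * \<bar>fn a x\<bar>"
        by (intro mult_right_mono) auto
      then show "\<bar>(sin (s * \<phi> x) - sin (t * \<phi> x)) / (s - t) * fn a x\<bar> \<le> \<bar>\<phi> x * fn a x\<bar>"
        by (simp add: abs_mult)
    qed
    have "((\<lambda>s. (sin (s * \<phi> x) - sin (t * \<phi> x)) / (s - t)) \<longlongrightarrow> cos (t * \<phi> x) * \<phi> x) (at t)" for x
    proof -
      have "((\<lambda>s. sin (s * \<phi> x)) has_real_derivative cos (t * \<phi> x) * \<phi> x) (at t)"
        by (auto intro!: derivative_eq_intros)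
      then show ?thesis by (simp add: has_field_derivative_iff)
    qed
    then have "((\<lambda>s. (sin (s * \<phi> x) - sin (t * \<phi> x)) / (s - t) * fn a x) \<longlongrightarrow> (cos (t * \<phi> x) * \<phi> x) * fn a x) (at t)" for x
      by (intro tendsto_mult tendsto_const)
    then show "AE x in lebesgue. ((\<lambda>s. (sin (s * \<phi> x) - sin (t * \<phi> x)) / (s - t) * fn a x) \<longlongrightarrow> cos (t * \<phi> x) * (\<phi> x * fn a x)) (at t)"
      by (intro AE_I2) (simp add: mult.assoc)
  qed
qed

lemma mul_family_tendsto:
  fixes t :: real
  assumes m: "\<And>s. p s \<in> borel_measurable lebesgue" and K: "\<And>s x. \<bar>p s x\<bar> \<le> K"
    and lim: "\<And>x. ((\<lambda>s. p s x) \<longlongrightarrow> p t x) (at t)"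
  shows "((\<lambda>s. mul (p s) a) \<longlongrightarrow> mul (p t) a) (at t)"
  unfolding mul_def
proof (rule l2_dominated_convergence_at[OF L2_scale[OF fn_L2[of a], of K]])
  show "AE x in lebesgue. \<bar>p s x * fn a x\<bar> \<le> \<bar>K * fn a x\<bar>" for s
  proof (intro AE_I2)
    fix x
    have "\<bar>p s x\<bar> * \<bar>fn a x\<bar> \<le> \<bar>K\<bar> * \<bar>fn a x\<bar>"
      using K[of s x] by (intro mult_right_mono) auto
    then show "\<bar>p s x * fn a x\<bar> \<le> \<bar>K * fn a x\<bar>" by (simp add: abs_mult)
  qed
  show "AE x in lebesgue. ((\<lambda>s. p s x * fn a x) \<longlongrightarrow> p t x * fn a x) (at t)"
    by (intro AE_I2 tendsto_mult lim tendsto_const)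
qed (intro borel_measurable_times m fn_measurable)+

text \<open>The generator of the translation group, as a limit in L2. It is equivalent to weak
  differentiability but more convenient: difference quotients pass through multiplications,
  reflections and the Hartley transform.\<close>

definition D :: "l2 \<Rightarrow> l2 \<Rightarrow> bool"
  where "D f g \<longleftrightarrow> ((\<lambda>h. (tr h f - f) /\<^sub>R h) \<longlongrightarrow> g) (at 0)"

definition xm :: "l2 \<Rightarrow> l2" where "xm = mul (\<lambda>\<xi>. \<xi>)"
definition xdom :: "l2 \<Rightarrow> bool" where "xdom a \<longleftrightarrow> (\<lambda>\<xi>. \<xi> * fn a \<xi>) \<in> L2"

lemma id_lebesgue_measurable: "(\<lambda>x::real. x) \<in> borel_measurable lebesgue"
  by (rule measurable_completion) simp

lemma fn_xm: "xdom a \<Longrightarrow> AE \<xi> in lebesgue. fn (xm a) \<xi> = \<xi> * fn a \<xi>"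
  unfolding xm_def xdom_def by (rule fn_mul)

lemma xdom_rfl: "xdom a \<Longrightarrow> xdom (rfl a)"
proof -
  assume a: "xdom a"
  have "(\<lambda>\<xi>. - ((0 + -1 * \<xi>) * fn a (0 + -1 * \<xi>))) \<in> L2"
    by (intro L2_minus L2_affine[where f="\<lambda>\<xi>. \<xi> * fn a \<xi>"]) (use a in \<open>auto simp: xdom_def\<close>)
  then have L: "(\<lambda>\<xi>. \<xi> * fn a (- \<xi>)) \<in> L2" by simp
  have "AE \<xi> in lebesgue. \<xi> * fn a (- \<xi>) = \<xi> * fn (rfl a) \<xi>"
    using fn_rfl[of a] by eventually_elim simp
  then show ?thesis
    unfolding xdom_def
    by (rule L2_cong_AE[OF L, rotated]) (intro borel_measurable_times id_lebesgue_measurable fn_measurable)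
qed

lemma rfl_xm: "xdom a \<Longrightarrow> rfl (xm a) = - xm (rfl a)"
proof -
  assume a: "xdom a"
  show ?thesis
    using fn_rfl[of "xm a"] AE_affine[OF _ fn_xm[OF a], of "-1" 0, simplified] fn_xm[OF xdom_rfl[OF a]] fn_rfl[of a] fn_uminus[of "xm (rfl a)"]
    unfolding l2_eq_iff by eventually_elim simp
qed

lemma D_add: "D f g \<Longrightarrow> D f' g' \<Longrightarrow> D (f + f') (g + g')"
proof -
  assume "D f g" "D f' g'"
  then have "((\<lambda>h. (tr h f - f) /\<^sub>R h + (tr h f' - f') /\<^sub>R h) \<longlongrightarrow> g + g') (at 0)"
    unfolding D_def by (rule tendsto_add)
  moreover have "(tr h f - f) /\<^sub>R h + (tr h f' - f') /\<^sub>R h = (tr h (f + f') - (f + f')) /\<^sub>R h" for h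
    by (simp add: aff_add scaleR_right_distrib[symmetric])
  ultimately show ?thesis unfolding D_def by simp
qed

lemma D_scaleR: "D f g \<Longrightarrow> D (c *\<^sub>R f) (c *\<^sub>R g)"
proof -
  assume "D f g"
  then have "((\<lambda>h. c *\<^sub>R ((tr h f - f) /\<^sub>R h)) \<longlongrightarrow> c *\<^sub>R g) (at 0)"
    unfolding D_def by (rule tendsto_scaleR[OF tendsto_const])
  then show ?thesis unfolding D_def by (simp add: aff_scaleR scaleR_diff_right mult.commute)
qed

text \<open>Differentiating the shift theorem at \<open>h = 0\<close> shows what \<open>dx\<close>
  must be on the transform side: multiplication by -\<xi> after a reflection. Thus
  \<open>dom\<close> is the Sobolev space H1, described in frequency.\<close>

definition dom :: "l2 \<Rightarrow> bool" where "dom f \<longleftrightarrow> xdom (hart f)"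
definition dx :: "l2 \<Rightarrow> l2" where "dx f = hart (- xm (rfl (hart f)))"

lemma D_dx:
  assumes "dom f" shows "D f (dx f)"
proof -
  have x: "(\<lambda>\<xi>. \<xi> * fn (hart f) \<xi>) \<in> L2" "(\<lambda>\<xi>. \<xi> * fn (rfl (hart f)) \<xi>) \<in> L2"
    using assms xdom_rfl by (auto simp: dom_def xdom_def)
  have "((\<lambda>h. mul (\<lambda>\<xi>. cos (h * \<xi>)) (hart f) - mul (\<lambda>\<xi>. sin (h * \<xi>)) (rfl (hart f))) has_vector_derivative
      (- mul (\<lambda>\<xi>. sin (0 * \<xi>)) (mul (\<lambda>\<xi>. \<xi>) (hart f)) - mul (\<lambda>\<xi>. cos (0 * \<xi>)) (mul (\<lambda>\<xi>. \<xi>) (rfl (hart f))))) (at 0)"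
    by (intro has_vector_derivative_diff mul_cos_has_vector_derivative mul_sin_has_vector_derivative x id_lebesgue_measurable)
  then have "((\<lambda>h. hart (tr h f)) has_vector_derivative - xm (rfl (hart f))) (at 0)"
    by (simp add: hart_tr mul_zero mul_one xm_def)
  then have "((\<lambda>h. hart (hart (tr h f))) has_vector_derivative dx f) (at 0)"
    unfolding dx_def by (rule bounded_linear.has_vector_derivative[OF bounded_linear_hart])
  then show ?thesis
    unfolding has_vector_derivative_iff_quotient D_def by (simp add: aff_id)
qed

text \<open>On the transform side the difference quotients converge in norm by assumption and
  pointwise by differentiating cosine and sine. The two limits agree, so the pointwise limit, which
  contains the unbounded factor \<xi>, is in L2.\<close>

lemma D_imp_dom:
  assumes "D f g" shows "dom f" "dx f = g"
proof -
  define h where "h n = inverse (real (Suc n))" for n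
  have h0: "h n \<noteq> 0" for n by (simp add: h_def)
  have hlim: "filterlim h (at 0) sequentially"
    unfolding filterlim_at using h0 LIMSEQ_inverse_real_of_nat by (auto simp: h_def[abs_def] eventually_sequentially)
  have lim1: "(\<lambda>n. hart ((tr (h n) f - f) /\<^sub>R h n)) \<longlonglongrightarrow> hart g"
    by (intro hart_tendsto filterlim_compose[OF _ hlim]) (use assms in \<open>simp add: D_def\<close>)
  have eq: "hart ((tr (h n) f - f) /\<^sub>R h n) =
      cl (\<lambda>\<xi>. ((cos (h n * \<xi>) - 1) / h n) * fn (hart f) \<xi> - (sin (h n * \<xi>) / h n) * fn (rfl (hart f)) \<xi>)" for n
  proof -
    have bc: "bd (\<lambda>\<xi>. cos (h n * \<xi>))" and bs: "bd (\<lambda>\<xi>. sin (h n * \<xi>))"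
      by (intro bd_cos bd_sin continuous_lebesgue_measurable continuous_intros)+
    have "hart ((tr (h n) f - f) /\<^sub>R h n) = (mul (\<lambda>\<xi>. cos (h n * \<xi>)) (hart f) - mul (\<lambda>\<xi>. 1) (hart f)) /\<^sub>R h n
        - (mul (\<lambda>\<xi>. sin (h n * \<xi>)) (rfl (hart f)) - mul (\<lambda>\<xi>. 0) (rfl (hart f))) /\<^sub>R h n"
      by (simp add: hart_scaleR hart_diff hart_tr mul_one mul_zero scaleR_diff_right)
    also have "\<dots> = cl (\<lambda>\<xi>. ((cos (h n * \<xi>) - 1) / h n) * fn (hart f) \<xi>) - cl (\<lambda>\<xi>. (sin (h n * \<xi>) - 0) / h n * fn (rfl (hart f)) \<xi>)"
      unfolding mul_quotient[OF bc bd_const] mul_quotient[OF bs bd_const] ..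
    also have "\<dots> = cl (\<lambda>\<xi>. ((cos (h n * \<xi>) - 1) / h n) * fn (hart f) \<xi> - (sin (h n * \<xi>) - 0) / h n * fn (rfl (hart f)) \<xi>)"
    proof (rule cl_diff[symmetric])
      have "bd (\<lambda>\<xi>. (cos (h n * \<xi>) - 1) / h n)" using bd_mult[OF bd_const[of "inverse (h n)"] bd_diff[OF bc bd_const[of 1]]] by (simp add: divide_inverse mult.commute)
      then show "(\<lambda>\<xi>. (cos (h n * \<xi>) - 1) / h n * fn (hart f) \<xi>) \<in> L2" by (intro L2_bd_mult fn_L2)
      have "bd (\<lambda>\<xi>. (sin (h n * \<xi>) - 0) / h n)" using bd_mult[OF bd_const[of "inverse (h n)"] bs] by (simp add: divide_inverse mult.commute)
      then show "(\<lambda>\<xi>. (sin (h n * \<xi>) - 0) / h n * fn (rfl (hart f)) \<xi>) \<in> L2" by (intro L2_bd_mult fn_L2)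
    qed
    finally show ?thesis by simp
  qed
  have pw: "AE \<xi> in lebesgue. (\<lambda>n. fn (hart ((tr (h n) f - f) /\<^sub>R h n)) \<xi>) \<longlonglongrightarrow> - (\<xi> * fn (rfl (hart f)) \<xi>)"
  proof -
    define q where "q n \<xi> = ((cos (h n * \<xi>) - 1) / h n) * fn (hart f) \<xi> - (sin (h n * \<xi>) / h n) * fn (rfl (hart f)) \<xi>" for n \<xi>
    have q: "q n \<in> L2" for n
    proof -
      have bc: "bd (\<lambda>\<xi>. cos (h n * \<xi>))" and bs: "bd (\<lambda>\<xi>. sin (h n * \<xi>))"
        by (intro bd_cos bd_sin continuous_lebesgue_measurable continuous_intros)+
      have "bd (\<lambda>\<xi>. inverse (h n) * (cos (h n * \<xi>) - 1))" "bd (\<lambda>\<xi>. inverse (h n) * sin (h n * \<xi>))"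
        by (intro bd_mult bd_const bd_diff bc bs)+
      then have "(\<lambda>\<xi>. (inverse (h n) * (cos (h n * \<xi>) - 1)) * fn (hart f) \<xi> - (inverse (h n) * sin (h n * \<xi>)) * fn (rfl (hart f)) \<xi>) \<in> L2"
        by (intro L2_diff L2_bd_mult fn_L2)
      then show ?thesis unfolding q_def[abs_def] by (simp add: divide_inverse mult.commute)
    qed
    have eq': "hart ((tr (h n) f - f) /\<^sub>R h n) = cl (q n)" for n
      unfolding eq q_def[abs_def] ..
    have "AE \<xi> in lebesgue. \<forall>n. fn (cl (q n)) \<xi> = q n \<xi>"
      unfolding AE_all_countable using fn_cl[OF q] by blast
    then show ?thesis
    proof eventually_elim
      case (elim \<xi>)
      have c: "(\<lambda>n. (cos (h n * \<xi>) - 1) / h n) \<longlonglongrightarrow> 0"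
      proof (rule filterlim_compose[OF _ hlim, where g="\<lambda>h. (cos (h * \<xi>) - 1) / h"])
        have "((\<lambda>h. cos (h * \<xi>)) has_real_derivative 0) (at 0)" by (auto intro!: derivative_eq_intros)
        then show "((\<lambda>h. (cos (h * \<xi>) - 1) / h) \<longlongrightarrow> 0) (at 0)" by (simp add: has_field_derivative_iff)
      qed
      have s: "(\<lambda>n. sin (h n * \<xi>) / h n) \<longlonglongrightarrow> \<xi>"
      proof (rule filterlim_compose[OF _ hlim, where g="\<lambda>h. sin (h * \<xi>) / h"])
        have "((\<lambda>h. sin (h * \<xi>)) has_real_derivative \<xi>) (at 0)" by (auto intro!: derivative_eq_intros)
        then show "((\<lambda>h. sin (h * \<xi>) / h) \<longlongrightarrow> \<xi>) (at 0)" by (simp add: has_field_derivative_iff)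
      qed
      have "(\<lambda>n. q n \<xi>) \<longlonglongrightarrow> 0 * fn (hart f) \<xi> - \<xi> * fn (rfl (hart f)) \<xi>"
        unfolding q_def by (intro tendsto_intros c s)
      then show ?case unfolding eq' elim[rule_format] by simp
    qed
  qed
  have m: "(\<lambda>\<xi>. - (\<xi> * fn (rfl (hart f)) \<xi>)) \<in> borel_measurable lebesgue"
    by (intro borel_measurable_uminus borel_measurable_times id_lebesgue_measurable fn_measurable)
  note * = l2_limit_unique_AE[OF lim1 m pw]
  have L: "(\<lambda>\<xi>. \<xi> * fn (rfl (hart f)) \<xi>) \<in> L2" using L2_minus[OF *(1)] by simp
  then have "xdom (rfl (hart f))" by (simp add: xdom_def)
  from xdom_rfl[OF this] show "dom f" by (simp add: dom_def rfl_rfl)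
  have "hart g = - xm (rfl (hart f))" using * cl_uminus[OF L] by (simp add: xm_def mul_def)
  then have "dx f = hart (hart g)" by (simp add: dx_def)
  then show "dx f = g" by simp
qed

lemma dom_add: "dom f \<Longrightarrow> dom g \<Longrightarrow> dom (f + g)" and dx_add: "dom f \<Longrightarrow> dom g \<Longrightarrow> dx (f + g) = dx f + dx g"
  using D_imp_dom[OF D_add[OF D_dx D_dx]] by auto

lemma dom_scaleR: "dom f \<Longrightarrow> dom (c *\<^sub>R f)" and dx_scaleR: "dom f \<Longrightarrow> dx (c *\<^sub>R f) = c *\<^sub>R dx f"
  using D_imp_dom[OF D_scaleR[OF D_dx]] by auto

lemma dom_diff: "dom f \<Longrightarrow> dom g \<Longrightarrow> dom (f - g)" and dx_diff: "dom f \<Longrightarrow> dom g \<Longrightarrow> dx (f - g) = dx f - dx g"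
  using dom_add[of f "(-1) *\<^sub>R g"] dx_add[of f "(-1) *\<^sub>R g"] dom_scaleR[of g "-1"] dx_scaleR[of g "-1"] by auto

lemma dom_zero: "dom 0" and dx_zero: "dx 0 = 0"
proof -
  have "D 0 0" unfolding D_def using aff_scaleR[of 1 _ 0 0] by simp
  then show "dom 0" "dx 0 = 0" using D_imp_dom by auto
qed

lemma hart_dx: "hart (dx f) = - xm (rfl (hart f))"
  by (simp add: dx_def)

lemma rfl_hart_dx: "dom f \<Longrightarrow> rfl (hart (dx f)) = xm (hart f)"
proof -
  assume "dom f"
  then have x: "xdom (hart f)" by (simp add: dom_def)
  have "rfl (hart (dx f)) = - rfl (xm (rfl (hart f)))"
    unfolding hart_dx using aff_scaleR[of "-1" 0 "-1" "xm (rfl (hart f))"] by simp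
  also have "\<dots> = xm (rfl (rfl (hart f)))" using rfl_xm[OF xdom_rfl[OF x]] by simp
  finally show ?thesis by (simp add: rfl_rfl)
qed

lemma norm_dx: "dom f \<Longrightarrow> norm (dx f) = norm (xm (hart f))"
  using rfl_hart_dx[of f] norm_aff[of "-1" 0 "hart (dx f)"] norm_hart[of "dx f"] by simp

text \<open>The 2 under the root is the mass term 2 u1 of the linearised equation. With this weight
  the quadratic part of the energy becomes a plain sum of squares of L2 norms.\<close>

definition mw :: "real \<Rightarrow> real" where "mw \<xi> = sqrt (\<xi>\<^sup>2 + 2)"

lemma mw_power2 [simp]: "(mw \<xi>)\<^sup>2 = \<xi>\<^sup>2 + 2"
  by (simp add: mw_def add_nonneg_nonneg)

lemma mw_pos [simp]: "mw \<xi> > 0"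
  by (simp add: mw_def add_nonneg_pos)

lemma mw_nonzero [simp]: "mw \<xi> \<noteq> 0"
  using mw_pos[of \<xi>] by linarith

lemma mw_minus [simp]: "mw (- \<xi>) = mw \<xi>"
  by (simp add: mw_def)

lemma continuous_mw: "continuous_on UNIV mw"
  unfolding mw_def[abs_def] by (intro continuous_intros)

lemma mw_measurable: "mw \<in> borel_measurable lebesgue"
  by (intro continuous_lebesgue_measurable continuous_mw)

lemma mw_ge: "\<bar>\<xi>\<bar> \<le> mw \<xi>" "1 \<le> mw \<xi>"
  unfolding mw_def by (auto intro!: real_le_rsqrt)

lemma mw_L2_iff: "(\<lambda>\<xi>. mw \<xi> * fn a \<xi>) \<in> L2 \<longleftrightarrow> xdom a"
proof
  assume "(\<lambda>\<xi>. mw \<xi> * fn a \<xi>) \<in> L2"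
  then show "xdom a"
    unfolding xdom_def
    by (rule L2_bound[where K=1])
      (auto simp: abs_mult intro!: mult_right_mono borel_measurable_times id_lebesgue_measurable less_imp_le[THEN abs_of_nonneg[symmetric, THEN ord_le_eq_trans[OF mw_ge(1)]]])
next
  assume "xdom a"
  then have i: "integrable lebesgue (\<lambda>\<xi>. (\<xi> * fn a \<xi>)\<^sup>2 + 2 * (fn a \<xi>)\<^sup>2)"
    by (auto simp: xdom_def L2_integrable)
  show "(\<lambda>\<xi>. mw \<xi> * fn a \<xi>) \<in> L2"
  proof (rule L2I)
    have "(\<lambda>\<xi>. (mw \<xi> * fn a \<xi>)\<^sup>2) = (\<lambda>\<xi>. (\<xi> * fn a \<xi>)\<^sup>2 + 2 * (fn a \<xi>)\<^sup>2)"
      by (simp add: power_mult_distrib distrib_right)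
    then show "integrable lebesgue (\<lambda>\<xi>. (mw \<xi> * fn a \<xi>)\<^sup>2)" using i by simp
  qed (intro borel_measurable_times mw_measurable fn_measurable)
qed

lemma norm_mul_mw: "xdom a \<Longrightarrow> (norm (mul mw a))\<^sup>2 = (norm (xm a))\<^sup>2 + 2 * (norm a)\<^sup>2"
proof -
  assume x: "xdom a"
  then have L: "(\<lambda>\<xi>. mw \<xi> * fn a \<xi>) \<in> L2" "(\<lambda>\<xi>. \<xi> * fn a \<xi>) \<in> L2" by (auto simp: mw_L2_iff xdom_def)
  have "(norm (mul mw a))\<^sup>2 = (LINT \<xi>|lebesgue. (mw \<xi> * fn a \<xi>)\<^sup>2)"
    unfolding mul_def by (rule norm_cl_power2[OF L(1)])
  also have "\<dots> = (LINT \<xi>|lebesgue. (\<xi> * fn a \<xi>)\<^sup>2 + 2 * (fn a \<xi>)\<^sup>2)"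
    by (simp add: power_mult_distrib distrib_right)
  also have "\<dots> = (LINT \<xi>|lebesgue. (\<xi> * fn a \<xi>)\<^sup>2) + (LINT \<xi>|lebesgue. 2 * (fn a \<xi>)\<^sup>2)"
    by (rule Bochner_Integration.integral_add) (use L in \<open>auto simp: L2_integrable\<close>)
  also have "(LINT \<xi>|lebesgue. (\<xi> * fn a \<xi>)\<^sup>2) = (norm (xm a))\<^sup>2"
    unfolding xm_def mul_def by (rule norm_cl_power2[OF L(2), symmetric])
  also have "(LINT \<xi>|lebesgue. 2 * (fn a \<xi>)\<^sup>2) = 2 * (norm a)\<^sup>2"
    by (simp add: norm_l2_power2)
  finally show ?thesis .
qed

text \<open>The energy norm of \<open>H\<^sup>1\<close>, for which the free evolution is isometric.\<close>

definition nH :: "l2 \<Rightarrow> real" where "nH f = norm (mul mw (hart f))"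

lemma nH_power2: "dom f \<Longrightarrow> (nH f)\<^sup>2 = (norm (dx f))\<^sup>2 + 2 * (norm f)\<^sup>2"
  by (simp add: nH_def dom_def norm_mul_mw norm_dx norm_hart)

lemma nH_nonneg [simp]: "0 \<le> nH f"
  by (simp add: nH_def)

lemma norm_le_nH: "dom f \<Longrightarrow> norm f \<le> nH f"
  by (rule power2_le_imp_le) (auto simp: nH_power2)

lemma norm_dx_le_nH: "dom f \<Longrightarrow> norm (dx f) \<le> nH f"
  by (rule power2_le_imp_le) (auto simp: nH_power2)

subsection \<open>The Sobolev embedding\<close>

lemma inverse_mw_L2: "(\<lambda>\<xi>. 1 / mw \<xi>) \<in> L2"
proof (rule L2I)
  have "set_integrable lborel (einterval (-\<infinity>) \<infinity>) (\<lambda>x::real. inverse (1 + x\<^sup>2))"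
    by (rule integrable_inverse_1_plus_square)
  then have "integrable lborel (\<lambda>x::real. inverse (1 + x\<^sup>2))"
    by (simp add: set_integrable_def einterval_def)
  then have "integrable lebesgue (\<lambda>x::real. inverse (1 + x\<^sup>2))"
    by (subst integrable_completion) simp_all
  then show "integrable lebesgue (\<lambda>\<xi>. (1 / mw \<xi>)\<^sup>2)"
  proof (rule Bochner_Integration.integrable_bound)
    show "(\<lambda>\<xi>. (1 / mw \<xi>)\<^sup>2) \<in> borel_measurable lebesgue"
      by (intro borel_measurable_power borel_measurable_divide borel_measurable_const mw_measurable)
    show "AE x in lebesgue. norm ((1 / mw x)\<^sup>2) \<le> norm (inverse (1 + x\<^sup>2))"
    proof (intro AE_I2)
      fix x :: real
      have "1 / (x\<^sup>2 + 2) \<le> 1 / (1 + x\<^sup>2)"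
        by (intro frac_le) (auto intro: add_pos_nonneg)
      then show "norm ((1 / mw x)\<^sup>2) \<le> norm (inverse (1 + x\<^sup>2))"
        by (simp add: power_divide inverse_eq_divide)
    qed
  qed
qed (intro borel_measurable_divide borel_measurable_const mw_measurable)

text \<open>On \<open>dom\<close> the transform \<open>hart f\<close> is integrable, and since
  \<open>hart\<close> is an involution its integral transform is a continuous representative of
  \<open>f\<close>. \<open>CS\<close> is the constant of the embedding into bounded functions: 2
  bounds the kernel, and the factor \<open>1 / sqrt (2 * pi)\<close> is estimated by 1.\<close>

definition rep :: "l2 \<Rightarrow> real \<Rightarrow> real" where "rep f = hk (fn (hart f))"
definition CS :: real where "CS = 2 * norm (cl (\<lambda>\<xi>. 1 / mw \<xi>))"

lemma CS_nonneg [simp]: "0 \<le> CS"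
  by (simp add: CS_def)

text \<open>Cauchy-Schwarz for the factorisation (1 / mw) * (mw * a); in one dimension 1 / mw is
  square integrable.\<close>

lemma integrable_fn_xdom:
  assumes "xdom a" shows "integrable lebesgue (fn a)" "(LINT x|lebesgue. \<bar>fn a x\<bar>) \<le> norm (cl (\<lambda>\<xi>. 1 / mw \<xi>)) * norm (mul mw a)"
proof -
  have L: "(\<lambda>\<xi>. mw \<xi> * fn a \<xi>) \<in> L2" using assms by (simp add: mw_L2_iff)
  have "integrable lebesgue (\<lambda>\<xi>. (1 / mw \<xi>) * (mw \<xi> * fn a \<xi>))"
    by (rule L2_mult_integrable[OF inverse_mw_L2 L])
  then show "integrable lebesgue (fn a)" by simp
  have La: "(\<lambda>\<xi>. \<bar>mw \<xi> * fn a \<xi>\<bar>) \<in> L2"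
    by (rule L2_bound[OF L, where K=1]) (use L in \<open>auto dest: L2_measurable\<close>)
  have "(LINT x|lebesgue. \<bar>fn a x\<bar>) = (LINT x|lebesgue. (1 / mw x) * \<bar>mw x * fn a x\<bar>)"
    by (simp add: abs_mult less_imp_le)
  also have "\<dots> = inner (cl (\<lambda>\<xi>. 1 / mw \<xi>)) (cl (\<lambda>\<xi>. \<bar>mw \<xi> * fn a \<xi>\<bar>))"
    by (rule inner_cl[symmetric, OF inverse_mw_L2 La])
  also have "\<dots> \<le> norm (cl (\<lambda>\<xi>. 1 / mw \<xi>)) * norm (cl (\<lambda>\<xi>. \<bar>mw \<xi> * fn a \<xi>\<bar>))"
    by (rule norm_cauchy_schwarz)
  also have "norm (cl (\<lambda>\<xi>. \<bar>mw \<xi> * fn a \<xi>\<bar>)) = norm (mul mw a)"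
    unfolding mul_def by (intro antisym norm_cl_le) (use L La in \<open>auto dest: L2_measurable\<close>)
  finally show "(LINT x|lebesgue. \<bar>fn a x\<bar>) \<le> norm (cl (\<lambda>\<xi>. 1 / mw \<xi>)) * norm (mul mw a)" .
qed

lemma rep_continuous: "dom f \<Longrightarrow> continuous_on UNIV (rep f)"
  unfolding rep_def dom_def by (intro hk_continuous integrable_fn_xdom)

lemma fn_rep: "dom f \<Longrightarrow> AE x in lebesgue. fn f x = rep f x"
  using hart_integrable[of "fn (hart f)"] integrable_fn_xdom[of "hart f"] by (simp add: rep_def dom_def)

lemma rep_bound: "dom f \<Longrightarrow> \<bar>rep f x\<bar> \<le> CS * nH f"
proof -
  assume f: "dom f"
  then have i: "integrable lebesgue (fn (hart f))" by (simp add: dom_def integrable_fn_xdom)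
  have ic: "integrable lebesgue (\<lambda>y. cas (y * x) * fn (hart f) y)" by (intro integrable_bd_mult bd_cas i)
  have "\<bar>LINT y|lebesgue. cas (y * x) * fn (hart f) y\<bar> \<le> (LINT y|lebesgue. \<bar>cas (y * x) * fn (hart f) y\<bar>)"
    by (rule integral_abs_bound)
  also have "\<dots> \<le> (LINT y|lebesgue. 2 * \<bar>fn (hart f) y\<bar>)"
  proof (rule integral_mono)
    show "integrable lebesgue (\<lambda>y. \<bar>cas (y * x) * fn (hart f) y\<bar>)" using ic by (rule integrable_abs)
    show "integrable lebesgue (\<lambda>y. 2 * \<bar>fn (hart f) y\<bar>)" using i by simp
    show "\<bar>cas (y * x) * fn (hart f) y\<bar> \<le> 2 * \<bar>fn (hart f) y\<bar>" for y
      unfolding abs_mult by (intro mult_right_mono abs_cas_le) simp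
  qed
  also have "\<dots> \<le> CS * nH f"
    using integrable_fn_xdom(2)[of "hart f"] f by (simp add: CS_def nH_def dom_def)
  finally have *: "\<bar>LINT y|lebesgue. cas (y * x) * fn (hart f) y\<bar> \<le> CS * nH f" .
  have "1 \<le> sqrt (2 * pi)" using pi_gt3 by simp
  then have "\<bar>LINT y|lebesgue. cas (y * x) * fn (hart f) y\<bar> / sqrt (2 * pi) \<le> \<bar>LINT y|lebesgue. cas (y * x) * fn (hart f) y\<bar> / 1"
    by (intro divide_left_mono) auto
  then show ?thesis using * by (simp add: rep_def hk_def)
qed

lemma bd_rep: "dom f \<Longrightarrow> bd (rep f)"
  by (rule bd_continuous[OF rep_continuous rep_bound])

lemma rep_L2: "dom f \<Longrightarrow> rep f \<in> L2" and cl_rep: "dom f \<Longrightarrow> cl (rep f) = f"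
proof -
  assume f: "dom f"
  have m: "rep f \<in> borel_measurable lebesgue" by (intro continuous_lebesgue_measurable rep_continuous f)
  show "rep f \<in> L2" by (rule L2_cong_AE[OF fn_L2 m fn_rep[OF f]])
  show "cl (rep f) = f" using cl_cong[OF fn_L2 fn_rep[OF f] m] by simp
qed

lemma continuous_AE_eq:
  fixes u v :: "real \<Rightarrow> real"
  assumes "continuous_on UNIV u" "continuous_on UNIV v" "AE x in lebesgue. u x = v x"
  shows "u = v"
proof -
  have o: "open {x. u x \<noteq> v x}"
    by (rule open_Collect_neq) (use assms in auto)
  have "{x. u x \<noteq> v x} \<in> null_sets lebesgue"
    using assms(3) o by (simp add: AE_iff_null_sets)
  then have "negligible {x. u x \<noteq> v x}" by (simp add: negligible_iff_null_sets)
  then have "{x. u x \<noteq> v x} = {}" using open_not_negligible[OF o] by blast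
  then show ?thesis by auto
qed

lemma rep_eqI: "dom f \<Longrightarrow> continuous_on UNIV w \<Longrightarrow> AE x in lebesgue. fn f x = w x \<Longrightarrow> rep f = w"
proof (rule continuous_AE_eq[OF rep_continuous])
  assume "dom f" "AE x in lebesgue. fn f x = w x"
  from fn_rep[OF this(1)] this(2) show "AE x in lebesgue. rep f x = w x" by eventually_elim simp
qed

lemma rep_add: "dom f \<Longrightarrow> dom g \<Longrightarrow> rep (f + g) = (\<lambda>x. rep f x + rep g x)"
proof (rule rep_eqI)
  assume f: "dom f" and g: "dom g"
  show "continuous_on UNIV (\<lambda>x. rep f x + rep g x)" using f g by (intro continuous_intros rep_continuous)
  show "AE x in lebesgue. fn (f + g) x = rep f x + rep g x"
    using fn_add[of f g] fn_rep[OF f] fn_rep[OF g] by eventually_elim simp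
qed (rule dom_add)

lemma rep_scaleR: "dom f \<Longrightarrow> rep (c *\<^sub>R f) = (\<lambda>x. c * rep f x)"
proof (rule rep_eqI)
  assume f: "dom f"
  show "continuous_on UNIV (\<lambda>x. c * rep f x)" using f by (intro continuous_intros rep_continuous)
  show "AE x in lebesgue. fn (c *\<^sub>R f) x = c * rep f x"
    using fn_scaleR[of c f] fn_rep[OF f] by eventually_elim simp
qed (rule dom_scaleR)

lemma rep_diff: "dom f \<Longrightarrow> dom g \<Longrightarrow> rep (f - g) = (\<lambda>x. rep f x - rep g x)"
  using rep_add[of f "(-1) *\<^sub>R g"] rep_scaleR[of g "-1"] dom_scaleR[of g "-1"] by simp

text \<open>The fundamental theorem of calculus for the L2 derivative. Pairing the difference
  quotient with the indicator of [a, b] and moving the translation onto the indicator leaves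
  difference quotients of a primitive of \<open>rep f\<close> at the two ends, where
  \<open>rep f\<close> is continuous.\<close>

lemma rep_increment:
  assumes f: "dom f" and ab: "a \<le> b"
  shows "rep f b - rep f a = inner (dx f) (iv a b)"
proof -
  define u where "u = rep f"
  have u: "continuous_on S u" for S unfolding u_def using rep_continuous[OF f] continuous_on_subset by blast
  have int: "inner f (iv c d) = integral {c..d} u" for c d
  proof -
    have "inner f (iv c d) = (LINT x|lebesgue. indicator {c..d} x * u x)"
      unfolding inner_iv
    proof (rule integral_cong_AE)
      show "AE x in lebesgue. indicator {c..d} x * fn f x = indicator {c..d} x * u x"
        using fn_rep[OF f] by eventually_elim (simp add: u_def)
      show "(\<lambda>x. indicator {c..d} x * u x) \<in> borel_measurable lebesgue"
        by (intro borel_measurable_times borel_measurable_indicator continuous_lebesgue_measurable u) auto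
      show "(\<lambda>x. indicator {c..d} x * fn f x) \<in> borel_measurable lebesgue"
        by (intro borel_measurable_times borel_measurable_indicator fn_measurable) auto
    qed
    also have "\<dots> = integral {c..d} u"
      using set_lebesgue_integral_eq_integral(2)[OF absolutely_integrable_continuous_real[OF u[of "{c..d}"]]]
      by (simp add: set_lebesgue_integral_def)
    finally show ?thesis .
  qed
  \<comment> \<open>The primitive starts at \<open>a - 1\<close>, so that the shifts by at most 1/2
    considered below do not leave its domain.\<close>
  define G where "G y = integral {a - 1..y} u" for y
  have G: "(G has_real_derivative u y) (at y)" if "a - 1 < y" "y < b + 1" for y
  proof -
    have "((\<lambda>y. integral {a - 1..y} u) has_real_derivative u y) (at y within {a - 1..b + 1})"
      by (rule integral_has_real_derivative[OF u]) (use that in auto)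
    moreover have "at y within {a - 1..b + 1} = at y" using that by (intro at_within_interior) (auto simp: interior_atLeastAtMost_real)
    ultimately show ?thesis by (simp add: G_def[abs_def])
  qed
  have Gd: "integral {c..d} u = G d - G c" if "a - 1 \<le> c" "c \<le> d" for c d
    using Henstock_Kurzweil_Integration.integral_combine[OF that integrable_continuous_real[OF u]] by (simp add: G_def)
  have "((\<lambda>s. G (s + b)) has_real_derivative u b) (at 0)" "((\<lambda>s. G (s + a)) has_real_derivative u a) (at 0)"
    using G[of b] G[of a] ab DERIV_shift[of G _ 0 b] DERIV_shift[of G _ 0 a] by simp_all
  then have "((\<lambda>s. G (b + s) - G (a + s)) has_real_derivative (u b - u a)) (at 0)"
    unfolding add.commute[of b] add.commute[of a] by (rule DERIV_diff)
  then have "((\<lambda>s. (G (b + s) - G (a + s) - (G b - G a)) / s) \<longlongrightarrow> u b - u a) (at 0)"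
    by (simp add: has_field_derivative_iff)
  moreover have "\<forall>\<^sub>F s in at 0. (G (b + s) - G (a + s) - (G b - G a)) / s = inner ((tr s f - f) /\<^sub>R s) (iv a b)"
    unfolding eventually_at_le
  proof (intro exI[of _ "1/2"] conjI ballI impI, simp)
    fix s :: real assume s: "s \<noteq> 0 \<and> dist s 0 \<le> 1/2"
    have "inner (tr s f) (iv a b) = inner f (tr (- s) (iv a b))" using inner_aff_left[of 1 s f "iv a b"] by simp
    also have "\<dots> = integral {a + s..b + s} u" by (simp add: tr_iv int)
    also have "\<dots> = G (b + s) - G (a + s)" by (rule Gd) (use s ab in \<open>auto simp: dist_real_def\<close>)
    finally have "inner (tr s f) (iv a b) = G (b + s) - G (a + s)" .
    moreover have "inner f (iv a b) = G b - G a" unfolding int by (rule Gd) (use ab in auto)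
    ultimately show "(G (b + s) - G (a + s) - (G b - G a)) / s = inner ((tr s f - f) /\<^sub>R s) (iv a b)"
      by (simp add: inner_diff_left divide_inverse mult.commute)
  qed
  ultimately have "((\<lambda>s. inner ((tr s f - f) /\<^sub>R s) (iv a b)) \<longlongrightarrow> u b - u a) (at 0)"
    by (rule Lim_transform_eventually)
  moreover have "((\<lambda>s. inner ((tr s f - f) /\<^sub>R s) (iv a b)) \<longlongrightarrow> inner (dx f) (iv a b)) (at 0)"
    using D_dx[OF f] unfolding D_def by (intro tendsto_inner tendsto_const)
  ultimately show ?thesis
    unfolding u_def[symmetric] by (rule tendsto_unique[OF trivial_limit_at])
qed

subsection \<open>Product rules\<close>

lemma bd_shift: "bd p \<Longrightarrow> bd (\<lambda>x. p (x + h))"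
proof -
  assume p: "bd p"
  have "(\<lambda>x. p (h + 1 * x)) \<in> borel_measurable lebesgue"
    using measurable_compose[OF affine_measurable_lebesgue[of 1 h] bd_measurable[OF p]] by simp
  then show ?thesis using p by (auto simp: bd_def add.commute)
qed

lemma tr_mul:
  assumes p: "bd p" shows "tr h (mul p a) = mul (\<lambda>x. p (x + h)) (tr h a)"
  using fn_tr[of h "mul p a"] AE_affine[OF _ fn_mul_bd[OF p, of a], of 1 h, simplified]
    fn_mul_bd[OF bd_shift[OF p, of h], of "tr h a"] fn_tr[of h a]
  unfolding l2_eq_iff by eventually_elim (simp add: add.commute)

lemma mul_tendsto_joint:
  fixes t :: real
  assumes m: "\<And>s. p s \<in> borel_measurable lebesgue" and K: "\<And>s x. \<bar>p s x\<bar> \<le> K"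
    and lim: "\<And>x. ((\<lambda>s. p s x) \<longlongrightarrow> p t x) (at t)" and a: "(a \<longlongrightarrow> b) (at t)"
  shows "((\<lambda>s. mul (p s) (a s)) \<longlongrightarrow> mul (p t) b) (at t)"
proof -
  have bd: "bd (p s)" for s by (rule bdI[OF m K])
  have "((\<lambda>s. mul (p s) (a s - b)) \<longlongrightarrow> 0) (at t)"
  proof (rule tendsto_0_le[where K=K])
    show "((\<lambda>s. a s - b) \<longlongrightarrow> 0) (at t)" using a by (simp add: LIM_zero_iff)
    show "\<forall>\<^sub>F s in at t. norm (mul (p s) (a s - b)) \<le> norm (a s - b) * K"
      using norm_mul_le[OF m K] by (simp add: mult.commute)
  qed
  from tendsto_add[OF this mul_family_tendsto[OF m K lim, of b]]
  have "((\<lambda>s. mul (p s) (a s - b) + mul (p s) b) \<longlongrightarrow> mul (p t) b) (at t)" by simp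
  moreover have "mul (p s) (a s - b) + mul (p s) b = mul (p s) (a s)" for s
    using mul_add[OF bd[of s], of "a s - b" b] by simp
  ultimately show ?thesis by simp
qed

lemma mul_diff: "bd p \<Longrightarrow> mul p (a - b) = mul p a - mul p b"
  by (rule bounded_linear.linear[OF bounded_linear_mul, THEN linear_diff])

lemma mul_uminus: "bd p \<Longrightarrow> mul p (- a) = - mul p a"
  by (rule bounded_linear.linear[OF bounded_linear_mul, THEN linear_neg])

text \<open>Discrete Leibniz rule: p(x + h) multiplies the quotient of \<open>f\<close>, and the
  quotient of \<open>p\<close> multiplies \<open>f\<close>. The limit of the second term is kept as
  a hypothesis because it is obtained in different ways for a differentiable \<open>p\<close> and
  for an H1 function \<open>p\<close>.\<close>

lemma D_mul:
  assumes p: "continuous_on UNIV p" "\<And>x. \<bar>p x\<bar> \<le> K" and f: "dom f"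
    and k: "((\<lambda>h. cl (\<lambda>x. ((p (x + h) - p x) / h) * fn f x)) \<longlongrightarrow> k) (at 0)"
  shows "D (mul p f) (mul p (dx f) + k)"
proof -
  have bp: "bd p" by (rule bd_continuous[OF p])
  have bps: "bd (\<lambda>x. p (x + h))" for h by (rule bd_shift[OF bp])
  have pc: "isCont p x" for x using p(1) by (simp add: continuous_on_eq_continuous_at)
  have "(tr h (mul p f) - mul p f) /\<^sub>R h = mul (\<lambda>x. p (x + h)) ((tr h f - f) /\<^sub>R h) + cl (\<lambda>x. ((p (x + h) - p x) / h) * fn f x)" for h
  proof -
    have eq: "tr h (mul p f) - mul p f = mul (\<lambda>x. p (x + h)) (tr h f - f) + (mul (\<lambda>x. p (x + h)) f - mul p f)"
      by (simp add: tr_mul[OF bp] mul_diff[OF bps])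
    show ?thesis
      unfolding eq scaleR_right_distrib mul_scaleR[OF bps] mul_quotient[OF bps[of h] bp, of h f] ..
  qed
  moreover have "((\<lambda>h. mul (\<lambda>x. p (x + h)) ((tr h f - f) /\<^sub>R h)) \<longlongrightarrow> mul (\<lambda>x. p (x + 0)) (dx f)) (at 0)"
  proof (rule mul_tendsto_joint[where p="\<lambda>h x. p (x + h)" and K=K])
    show "(\<lambda>x. p (x + h)) \<in> borel_measurable lebesgue" for h using bps[of h] by (rule bd_measurable)
    show "((\<lambda>h. (tr h f - f) /\<^sub>R h) \<longlongrightarrow> dx f) (at 0)" using D_dx[OF f] by (simp add: D_def)
    show "((\<lambda>s. p (x + s)) \<longlongrightarrow> p (x + 0)) (at 0)" for x
      by (rule isCont_tendsto_compose[OF pc]) (intro tendsto_intros)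
  qed (rule p(2))
  ultimately show ?thesis unfolding D_def using k by (auto intro: tendsto_add)
qed

lemma abs_difference_quotient_le:
  fixes p :: "real \<Rightarrow> real"
  assumes "\<And>y. (p has_real_derivative p' y) (at y)" "\<And>y. \<bar>y - x\<bar> \<le> \<bar>h\<bar> \<Longrightarrow> \<bar>p' y\<bar> \<le> K"
  shows "\<bar>(p (x + h) - p x) / h\<bar> \<le> K"
proof (cases "h = 0")
  case True
  then show ?thesis using assms(2)[of x] by simp
next
  case False
  have "\<exists>z. \<bar>z - x\<bar> \<le> \<bar>h\<bar> \<and> p (x + h) - p x = h * p' z"
  proof (cases "h > 0")
    case True
    then have "x < x + h" by simp
    from MVT2[OF this assms(1)] obtain z where "x < z" "z < x + h" "p (x + h) - p x = h * p' z" by auto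
    then show ?thesis by (intro exI[of _ z]) auto
  next
    case F: False
    then have "x + h < x" using False by simp
    from MVT2[OF this assms(1)] obtain z where z: "x + h < z" "z < x" "p x - p (x + h) = (x - (x + h)) * p' z" by auto
    then have "p (x + h) - p x = h * p' z" by simp
    then show ?thesis using z by (intro exI[of _ z]) auto
  qed
  then obtain z where z: "\<bar>z - x\<bar> \<le> \<bar>h\<bar>" "p (x + h) - p x = h * p' z" by blast
  then show ?thesis using False assms(2)[OF z(1)] by simp
qed

lemma DERIV_continuous_on_UNIV: "(\<And>y. (p has_real_derivative p' y) (at y)) \<Longrightarrow> continuous_on UNIV p"
  by (meson DERIV_isCont continuous_at_imp_continuous_on)

lemma D_mul_smooth:
  assumes p: "\<And>y. (p has_real_derivative p' y) (at y)" "\<And>y. \<bar>p y\<bar> \<le> K" "\<And>y. \<bar>p' y\<bar> \<le> K'"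
    and m: "p' \<in> borel_measurable lebesgue" and f: "dom f"
  shows "dom (mul p f)" "dx (mul p f) = mul p (dx f) + mul p' f" "rep (mul p f) = (\<lambda>x. p x * rep f x)"
proof -
  have cp: "continuous_on UNIV p" by (rule DERIV_continuous_on_UNIV[OF p(1)])
  have bp: "bd p" by (rule bd_continuous[OF cp p(2)])
  have "((\<lambda>h. cl (\<lambda>x. ((p (x + h) - p x) / h) * fn f x)) \<longlongrightarrow> cl (\<lambda>x. p' x * fn f x)) (at 0)"
  proof (rule l2_dominated_convergence_at[OF L2_scale[OF fn_L2[of f], of K']])
    show "(\<lambda>x. ((p (x + h) - p x) / h) * fn f x) \<in> borel_measurable lebesgue" for h
      using bd_shift[OF bp, of h] bp
      by (intro borel_measurable_times borel_measurable_divide borel_measurable_diff borel_measurable_const fn_measurable bd_measurable) auto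
    show "(\<lambda>x. p' x * fn f x) \<in> borel_measurable lebesgue" by (intro borel_measurable_times m fn_measurable)
    show "AE x in lebesgue. \<bar>((p (x + h) - p x) / h) * fn f x\<bar> \<le> \<bar>K' * fn f x\<bar>" for h
    proof (intro AE_I2)
      fix x
      have K0: "K' \<ge> 0" using p(3)[of 0] by linarith
      have "\<bar>(p (x + h) - p x) / h\<bar> \<le> K'" by (rule abs_difference_quotient_le[OF p(1) p(3)])
      then have "\<bar>(p (x + h) - p x) / h\<bar> * \<bar>fn f x\<bar> \<le> K' * \<bar>fn f x\<bar>" by (intro mult_right_mono) auto
      then show "\<bar>((p (x + h) - p x) / h) * fn f x\<bar> \<le> \<bar>K' * fn f x\<bar>" using K0 by (simp add: abs_mult)
    qed
    have "((\<lambda>h. (p (x + h) - p x) / h) \<longlongrightarrow> p' x) (at 0)" for x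
      using p(1)[of x] by (simp add: DERIV_def)
    then show "AE x in lebesgue. ((\<lambda>h. ((p (x + h) - p x) / h) * fn f x) \<longlongrightarrow> p' x * fn f x) (at 0)"
      by (intro AE_I2 tendsto_mult tendsto_const)
  qed
  then have "((\<lambda>h. cl (\<lambda>x. ((p (x + h) - p x) / h) * fn f x)) \<longlongrightarrow> mul p' f) (at 0)"
    by (simp add: mul_def)
  from D_mul[OF cp p(2) f this] have DD: "D (mul p f) (mul p (dx f) + mul p' f)" .
  then show d: "dom (mul p f)" and "dx (mul p f) = mul p (dx f) + mul p' f" by (rule D_imp_dom)+
  show "rep (mul p f) = (\<lambda>x. p x * rep f x)"
  proof (rule rep_eqI[OF d])
    show "continuous_on UNIV (\<lambda>x. p x * rep f x)" by (intro continuous_on_mult cp rep_continuous f)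
    show "AE x in lebesgue. fn (mul p f) x = p x * rep f x"
      using fn_mul_bd[OF bp, of f] fn_rep[OF f] by eventually_elim simp
  qed
qed

text \<open>The quotient of \<open>rep u\<close> need not converge pointwise, but its product with
  \<open>f\<close> can be read as the bounded function \<open>rep f\<close> multiplying the L2
  quotient of \<open>u\<close>, which converges by the definition of \<open>D\<close>.\<close>

lemma D_mul_rep:
  assumes u: "dom u" and f: "dom f"
  shows "dom (mul (rep u) f)" "dx (mul (rep u) f) = mul (rep u) (dx f) + mul (rep f) (dx u)"
    "rep (mul (rep u) f) = (\<lambda>x. rep u x * rep f x)"
proof -
  have eq: "cl (\<lambda>x. ((rep u (x + h) - rep u x) / h) * fn f x) = mul (rep f) ((tr h u - u) /\<^sub>R h)" for h
    unfolding mul_def[of "rep f"]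
  proof (rule cl_cong)
    show m: "(\<lambda>x. rep f x * fn ((tr h u - u) /\<^sub>R h) x) \<in> borel_measurable lebesgue"
      by (intro borel_measurable_times fn_measurable bd_measurable bd_rep f)
    have b: "bd (\<lambda>x. inverse h * (rep u (x + h) - rep u x))"
      by (intro bd_mult bd_const bd_diff bd_shift bd_rep u)
    then show "(\<lambda>x. ((rep u (x + h) - rep u x) / h) * fn f x) \<in> L2"
      using L2_bd_mult[OF b, of "fn f"] by (simp add: divide_inverse mult.commute)
    show "AE x in lebesgue. (rep u (x + h) - rep u x) / h * fn f x = rep f x * fn ((tr h u - u) /\<^sub>R h) x"
      using fn_rep[OF f] fn_rep[OF u] AE_affine[OF _ fn_rep[OF u], of 1 h, simplified] fn_tr[of h u]
        fn_diff[of "tr h u" u] fn_scaleR[of "inverse h" "tr h u - u"]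
      by eventually_elim (simp add: divide_inverse mult.commute add.commute)
  qed
  have "((\<lambda>h. mul (rep f) ((tr h u - u) /\<^sub>R h)) \<longlongrightarrow> mul (rep f) (dx u)) (at 0)"
    by (rule bounded_linear.tendsto[OF bounded_linear_mul[OF bd_rep[OF f]]]) (use D_dx[OF u] in \<open>simp add: D_def\<close>)
  then have "((\<lambda>h. cl (\<lambda>x. ((rep u (x + h) - rep u x) / h) * fn f x)) \<longlongrightarrow> mul (rep f) (dx u)) (at 0)"
    unfolding eq .
  from D_mul[OF rep_continuous[OF u] rep_bound[OF u] f this]
  have DD: "D (mul (rep u) f) (mul (rep u) (dx f) + mul (rep f) (dx u))" .
  then show d: "dom (mul (rep u) f)" and "dx (mul (rep u) f) = mul (rep u) (dx f) + mul (rep f) (dx u)"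
    by (rule D_imp_dom)+
  show "rep (mul (rep u) f) = (\<lambda>x. rep u x * rep f x)"
  proof (rule rep_eqI[OF d])
    show "continuous_on UNIV (\<lambda>x. rep u x * rep f x)" by (intro continuous_on_mult rep_continuous u f)
    show "AE x in lebesgue. fn (mul (rep u) f) x = rep u x * rep f x"
      using fn_mul_bd[OF bd_rep[OF u], of f] fn_rep[OF f] by eventually_elim simp
  qed
qed

lemma inner_xm: 
  assumes "xdom a" "xdom b" shows "inner (xm a) b = inner a (xm b)"
proof -
  have m: "(\<lambda>\<xi>. \<xi> * fn c \<xi>) \<in> borel_measurable lebesgue" for c
    by (intro borel_measurable_times id_lebesgue_measurable fn_measurable)
  have "inner (xm a) b = (LINT x|lebesgue. (x * fn a x) * fn b x)"
    by (rule inner_l2_cong[OF fn_xm[OF assms(1)] _ m]) auto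
  also have "\<dots> = (LINT x|lebesgue. fn a x * (x * fn b x))" by (simp add: ac_simps)
  also have "\<dots> = inner a (xm b)"
    by (rule inner_l2_cong[OF _ fn_xm[OF assms(2)] _ m, symmetric]) auto
  finally show ?thesis .
qed

text \<open>Integration by parts on the transform side: \<open>xm\<close> is symmetric,
  \<open>rfl\<close> is symmetric and anticommutes with \<open>xm\<close>, and the composition of
  the two is therefore antisymmetric.\<close>

lemma inner_dx: 
  assumes f: "dom f" and g: "dom g" shows "inner (dx f) g = - inner f (dx g)"
proof -
  define a where "a = hart f"
  define b where "b = hart g"
  have ab: "xdom a" "xdom b" using f g by (auto simp: a_def b_def dom_def)
  have "inner (dx f) g = - inner (xm (rfl a)) b"
    using inner_hart[of "dx f" g] by (simp add: hart_dx a_def b_def)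
  also have "\<dots> = - inner a (rfl (xm b))"
    using inner_xm[OF xdom_rfl[OF ab(1)] ab(2)] by (simp add: inner_rfl_left)
  also have "\<dots> = inner a (xm (rfl b))" using rfl_xm[OF ab(2)] by simp
  also have "\<dots> = - inner f (dx g)"
    using inner_hart[of f "dx g"] by (simp add: hart_dx a_def b_def)
  finally show ?thesis .
qed

lemma dom_rfl: "dom f \<Longrightarrow> dom (rfl f)" and dx_rfl: "dom f \<Longrightarrow> dx (rfl f) = - rfl (dx f)"
  and rep_rfl: "dom f \<Longrightarrow> rep (rfl f) = (\<lambda>x. rep f (- x))"
proof -
  assume f: "dom f"
  then have x: "xdom (hart f)" by (simp add: dom_def)
  show d: "dom (rfl f)" using xdom_rfl[OF x] by (simp add: dom_def hart_rfl)
  have "rfl (dx f) = hart (rfl (hart (dx f)))"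
    by (simp add: hart_rfl)
  also have "\<dots> = hart (xm (hart f))" by (simp add: rfl_hart_dx[OF f])
  finally show "dx (rfl f) = - rfl (dx f)"
    by (simp add: dx_def[of "rfl f"] hart_rfl rfl_rfl hart_uminus)
  show "rep (rfl f) = (\<lambda>x. rep f (- x))"
  proof (rule rep_eqI[OF d])
    show "continuous_on UNIV (\<lambda>x. rep f (- x))"
      by (rule continuous_on_compose2[OF rep_continuous[OF f]]) (auto intro: continuous_intros)
    show "AE x in lebesgue. fn (rfl f) x = rep f (- x)"
      using fn_rfl[of f] AE_affine[OF _ fn_rep[OF f], of "-1" 0, simplified] by eventually_elim simp
  qed
qed

lemma tr_tr: "tr s (tr h f) = tr (h + s) f"
  using aff_aff[of 1 1 s h f] by simp

lemma tr_diff: "tr s (a - b) = tr s a - tr s b"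
  by (rule bounded_linear.linear[OF bounded_linear_aff, THEN linear_diff]) simp

lemma tr_tendsto: "(f \<longlongrightarrow> u) F \<Longrightarrow> ((\<lambda>x. tr s (f x)) \<longlongrightarrow> tr s u) F"
  by (rule bounded_linear.tendsto[OF bounded_linear_aff]) simp

lemma dom_tr: "dom f \<Longrightarrow> dom (tr s f)" and dx_tr: "dom f \<Longrightarrow> dx (tr s f) = tr s (dx f)"
  and rep_tr: "dom f \<Longrightarrow> rep (tr s f) = (\<lambda>x. rep f (x + s))"
proof -
  assume f: "dom f"
  have "((\<lambda>h. tr s ((tr h f - f) /\<^sub>R h)) \<longlongrightarrow> tr s (dx f)) (at 0)"
    by (rule tr_tendsto) (use D_dx[OF f] in \<open>simp add: D_def\<close>)
  then have "D (tr s f) (tr s (dx f))"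
    unfolding D_def by (simp add: aff_scaleR tr_diff tr_tr add.commute)
  then show d: "dom (tr s f)" and "dx (tr s f) = tr s (dx f)" by (rule D_imp_dom)+
  show "rep (tr s f) = (\<lambda>x. rep f (x + s))"
  proof (rule rep_eqI[OF d])
    show "continuous_on UNIV (\<lambda>x. rep f (x + s))"
      by (rule continuous_on_compose2[OF rep_continuous[OF f]]) (auto intro: continuous_intros)
    show "AE x in lebesgue. fn (tr s f) x = rep f (x + s)"
      using fn_tr[of s f] AE_affine[OF _ fn_rep[OF f], of 1 s, simplified] by eventually_elim (simp add: add.commute)
  qed
qed

lemma tr_tendsto_id: "((\<lambda>s. tr s f) \<longlongrightarrow> f) (at 0)"
proof -
  have m: "(\<lambda>\<xi>. h * \<xi>) \<in> borel_measurable lebesgue" for h :: real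
    by (intro continuous_lebesgue_measurable continuous_intros)
  have "((\<lambda>h. mul (\<lambda>\<xi>. cos (h * \<xi>)) (hart f) - mul (\<lambda>\<xi>. sin (h * \<xi>)) (rfl (hart f)))
     \<longlongrightarrow> mul (\<lambda>\<xi>. cos (0 * \<xi>)) (hart f) - mul (\<lambda>\<xi>. sin (0 * \<xi>)) (rfl (hart f))) (at 0)"
  proof (intro tendsto_diff mul_family_tendsto[where p="\<lambda>h \<xi>. cos (h * \<xi>)" and K=1] mul_family_tendsto[where p="\<lambda>h \<xi>. sin (h * \<xi>)" and K=1])
    show "((\<lambda>s. cos (s * x)) \<longlongrightarrow> cos (0 * x)) (at 0)" "((\<lambda>s. sin (s * x)) \<longlongrightarrow> sin (0 * x)) (at 0)" for x :: real
      by (intro tendsto_intros)+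
  qed (auto intro: bd_measurable[OF bd_cos[OF m]] bd_measurable[OF bd_sin[OF m]])
  then have "((\<lambda>h. hart (tr h f)) \<longlongrightarrow> hart f) (at 0)"
    by (simp add: hart_tr mul_one mul_zero)
  from hart_tendsto[OF this] show ?thesis by simp
qed

lemma tr_has_vector_derivative:
  assumes f: "dom f" shows "((\<lambda>s. tr s f) has_vector_derivative tr t (dx f)) (at t)"
proof -
  have "((\<lambda>h. tr t ((tr h f - f) /\<^sub>R h)) \<longlongrightarrow> tr t (dx f)) (at 0)"
    by (rule tr_tendsto) (use D_dx[OF f] in \<open>simp add: D_def\<close>)
  then have "((\<lambda>h. (tr (t + h) f - tr t f) /\<^sub>R (t + h - t)) \<longlongrightarrow> tr t (dx f)) (at 0)"
    by (simp add: aff_scaleR tr_diff tr_tr add.commute)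
  then show ?thesis unfolding has_vector_derivative_iff_quotient by (rule LIM_offset_zero_cancel)
qed

subsection \<open>Weak derivatives\<close>

text \<open>A square integrable \<open>w\<close> bounding the derivative on unit neighbourhoods
  dominates the difference quotients by the mean value theorem, so the classical derivative is the
  limit in L2.\<close>

lemma D_classical:
  assumes d: "\<And>y. (f has_real_derivative f' y) (at y)" and m: "f' \<in> borel_measurable lebesgue"
    and fL: "f \<in> L2" and wL: "w \<in> L2" and w: "\<And>x y. \<bar>y - x\<bar> \<le> 1 \<Longrightarrow> \<bar>f' y\<bar> \<le> w x"
  shows "f' \<in> L2" "dom (cl f)" "dx (cl f) = cl f'" "rep (cl f) = f"
proof -
  show f'L: "f' \<in> L2"
    by (rule L2_bound[OF wL m, where K=1]) (use w in \<open>auto intro!: AE_I2 intro: order_trans[OF _ abs_ge_self]\<close>)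
  \<comment> \<open>The bound by \<open>w\<close> reaches only to distance 1. Larger
    \<open>h\<close>, irrelevant for the limit, get the value 0 so that the domination holds for
    every \<open>h\<close>.\<close>
  define q where "q h x = (if \<bar>h\<bar> \<le> 1 then (f (x + h) - f x) / h else 0)" for h x
  have fs: "(\<lambda>x. f (x + h)) \<in> L2" for h using L2_affine[of 1 f h] fL by (simp add: add.commute)
  have qm: "q h \<in> borel_measurable lebesgue" for h
    unfolding q_def[abs_def] using fs[of h] fL
    by (cases "\<bar>h\<bar> \<le> 1") (auto intro!: borel_measurable_divide borel_measurable_diff L2_measurable)
  have "((\<lambda>h. cl (q h)) \<longlongrightarrow> cl f') (at 0)"
  proof (rule l2_dominated_convergence_at[OF wL qm m])
    show "AE x in lebesgue. \<bar>q h x\<bar> \<le> \<bar>w x\<bar>" for h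
    proof (intro AE_I2)
      fix x
      show "\<bar>q h x\<bar> \<le> \<bar>w x\<bar>"
      proof (cases "\<bar>h\<bar> \<le> 1")
        case True
        then have "\<bar>(f (x + h) - f x) / h\<bar> \<le> w x"
          by (intro abs_difference_quotient_le[OF d]) (auto intro: w)
        then show ?thesis using True by (simp add: q_def)
      qed (simp add: q_def)
    qed
    show "AE x in lebesgue. ((\<lambda>h. q h x) \<longlongrightarrow> f' x) (at 0)"
    proof (intro AE_I2)
      fix x
      have "((\<lambda>h. (f (x + h) - f x) / h) \<longlongrightarrow> f' x) (at 0)" using d[of x] by (simp add: DERIV_def)
      then show "((\<lambda>h. q h x) \<longlongrightarrow> f' x) (at 0)"
        by (rule Lim_transform_eventually) (auto simp: q_def eventually_at dist_real_def intro!: exI[of _ 1])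
    qed
  qed
  moreover have "\<forall>\<^sub>F h in at 0. cl (q h) = (tr h (cl f) - cl f) /\<^sub>R h"
    unfolding eventually_at
  proof (intro exI[of _ 1] conjI ballI impI, simp)
    fix h :: real assume "h \<noteq> 0 \<and> dist h 0 < 1"
    then have "cl (q h) = cl (\<lambda>x. inverse h * (f (x + h) - f x))"
      by (simp add: q_def[abs_def] dist_real_def divide_inverse mult.commute)
    also have "\<dots> = (tr h (cl f) - cl f) /\<^sub>R h"
      by (simp add: cl_scaleR L2_diff fs fL cl_diff tr_cl)
    finally show "cl (q h) = (tr h (cl f) - cl f) /\<^sub>R h" .
  qed
  ultimately have "D (cl f) (cl f')" unfolding D_def by (rule Lim_transform_eventually)
  then show dd: "dom (cl f)" and "dx (cl f) = cl f'" by (rule D_imp_dom)+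
  show "rep (cl f) = f"
    by (rule rep_eqI[OF dd DERIV_continuous_on_UNIV[OF d] fn_cl[OF fL]])
qed

lemma test_function_L2:
  assumes "test_function \<eta>"
  shows "\<eta> \<in> L2" "deriv \<eta> \<in> L2" "dom (cl \<eta>)" "dx (cl \<eta>) = cl (deriv \<eta>)"
proof -
  obtain R where R: "\<And>x. R < \<bar>x\<bar> \<Longrightarrow> \<eta> x = 0" and sm: "smooth \<eta>" using assms by (auto simp: test_function_def)
  have c: "continuous_on S \<eta>" "continuous_on S (deriv \<eta>)" for S
    using smooth_continuous[OF sm] smooth_continuous[OF smooth_deriv[OF sm]] continuous_on_subset by blast+
  have R': "deriv \<eta> x = 0" if "R < \<bar>x\<bar>" for x
  proof -
    have "((\<lambda>x. 0) has_real_derivative 0) (at x)" by simp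
    then have "(\<eta> has_real_derivative 0) (at x)"
    proof (rule has_field_derivative_transform_within_open)
      show "open {x. R < \<bar>x\<bar>}" by (intro open_Collect_less continuous_intros)
    qed (use that R in auto)
    then show ?thesis by (rule DERIV_imp_deriv)
  qed
  have comp: "\<exists>B. \<forall>x. \<bar>g x\<bar> \<le> B * indicator {-\<bar>R\<bar>..\<bar>R\<bar>} x" if g: "continuous_on UNIV g" "\<And>x. R < \<bar>x\<bar> \<Longrightarrow> g x = 0" for g :: "real \<Rightarrow> real"
  proof -
    have "bounded (g ` {-\<bar>R\<bar>..\<bar>R\<bar>})"
      by (intro compact_imp_bounded compact_continuous_image continuous_on_subset[OF g(1)]) auto
    then obtain B where "\<forall>y\<in>g ` {-\<bar>R\<bar>..\<bar>R\<bar>}. norm y \<le> B" unfolding bounded_iff by blast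
    then have B: "\<bar>g x\<bar> \<le> B" if "x \<in> {-\<bar>R\<bar>..\<bar>R\<bar>}" for x using that by simp
    have "\<bar>g x\<bar> \<le> B * indicator {-\<bar>R\<bar>..\<bar>R\<bar>} x" for x
      using B[of x] g(2)[of x] by (cases "x \<in> {-\<bar>R\<bar>..\<bar>R\<bar>}") auto
    then show ?thesis by blast
  qed
  have L: "g \<in> L2" if g: "continuous_on UNIV g" "\<And>x. R < \<bar>x\<bar> \<Longrightarrow> g x = 0" for g :: "real \<Rightarrow> real"
  proof -
    obtain B where B: "\<And>x. \<bar>g x\<bar> \<le> B * indicator {-\<bar>R\<bar>..\<bar>R\<bar>} x" using comp[OF g] by blast
    show ?thesis
      by (rule L2_bound[OF indicator_interval_L2[of "-\<bar>R\<bar>" "\<bar>R\<bar>"] continuous_lebesgue_measurable[OF g(1)], where K=B])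
        (use B in \<open>auto intro!: AE_I2\<close>)
  qed
  show eL: "\<eta> \<in> L2" by (rule L[OF c(1) R])
  show "deriv \<eta> \<in> L2" by (rule L[OF c(2) R'])
  obtain B where B: "\<And>x. \<bar>deriv \<eta> x\<bar> \<le> B * indicator {-\<bar>R\<bar>..\<bar>R\<bar>} x" using comp[OF c(2) R'] by blast
  have B0: "B \<ge> 0" using B[of 0] by (auto split: split_indicator_asm)
  have w: "\<bar>deriv \<eta> y\<bar> \<le> B * indicator {-(\<bar>R\<bar>+1)..\<bar>R\<bar>+1} x" if "\<bar>y - x\<bar> \<le> 1" for x y
  proof (cases "y \<in> {-\<bar>R\<bar>..\<bar>R\<bar>}")
    case True
    then have "x \<in> {-(\<bar>R\<bar>+1)..\<bar>R\<bar>+1}" using that by auto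
    then show ?thesis using B[of y] True by simp
  next
    case False
    then have "deriv \<eta> y = 0" using B[of y] by simp
    then show ?thesis using B0 by simp
  qed
  show "dom (cl \<eta>)" "dx (cl \<eta>) = cl (deriv \<eta>)"
    by (rule D_classical[OF smooth_DERIV[OF sm] continuous_lebesgue_measurable[OF c(2)] eL L2_scale[OF indicator_interval_L2] w]; assumption)+
qed

lemma test_function_diff: "test_function \<eta> \<Longrightarrow> test_function \<zeta> \<Longrightarrow> test_function (\<lambda>x. \<eta> x + c * \<zeta> x)"
  unfolding test_function_def
proof (elim conjE exE, intro conjI)
  fix R R' assume "\<forall>x. R < \<bar>x\<bar> \<longrightarrow> \<eta> x = 0" "\<forall>x. R' < \<bar>x\<bar> \<longrightarrow> \<zeta> x = 0"
  then show "\<exists>R. \<forall>x. R < \<bar>x\<bar> \<longrightarrow> \<eta> x + c * \<zeta> x = 0" by (intro exI[of _ "max R R'"]) auto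
qed (intro smooth_add smooth_mult smooth_const)

lemma test_function_shift: "test_function \<eta> \<Longrightarrow> test_function (\<lambda>x. \<eta> (x + s))"
  unfolding test_function_def
proof (elim conjE exE, intro conjI)
  assume "smooth \<eta>"
  from smooth_affine[OF this, of 1 s] show "smooth (\<lambda>x. \<eta> (x + s))" by simp
  fix R assume "\<forall>x. R < \<bar>x\<bar> \<longrightarrow> \<eta> x = 0"
  then show "\<exists>R. \<forall>x. R < \<bar>x\<bar> \<longrightarrow> \<eta> (x + s) = 0" by (intro exI[of _ "R + \<bar>s\<bar>"]) auto
qed

lemma test_functions_dense: "\<exists>\<eta>. test_function \<eta> \<and> norm (u - cl \<eta>) < \<epsilon>" if "\<epsilon> > 0"
proof -
  have "\<forall>\<epsilon>>0. \<exists>\<eta>. test_function \<eta> \<and> norm (u - cl \<eta>) < \<epsilon>"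
  proof (rule l2_interval_induct[where P="\<lambda>u. \<forall>\<epsilon>>0. \<exists>\<eta>. test_function \<eta> \<and> norm (u - cl \<eta>) < \<epsilon>"])
    fix a b :: real
    show "\<forall>\<epsilon>>0. \<exists>\<eta>. test_function \<eta> \<and> norm (iv a b - cl \<eta>) < \<epsilon>"
    proof (cases "a \<le> b")
      case True
      obtain \<eta> where \<eta>: "\<And>n. test_function (\<eta> n)" "\<And>n x. \<bar>\<eta> n x\<bar> \<le> indicator {a - 1..b + 1} x"
        "\<And>x. (\<lambda>n. \<eta> n x) \<longlonglongrightarrow> indicator {a..b} x"
        using test_function_approx_interval[OF True] by blast
      have "(\<lambda>n. cl (\<eta> n)) \<longlonglongrightarrow> iv a b"
        unfolding iv_def
      proof (rule l2_dominated_convergence[OF indicator_interval_L2[of "a-1" "b+1"]])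
        show "\<eta> n \<in> borel_measurable lebesgue" for n using test_function_L2(1)[OF \<eta>(1)] by (rule L2_measurable)
        show "AE x in lebesgue. \<bar>\<eta> n x\<bar> \<le> \<bar>indicator {a - 1..b + 1} x\<bar>" for n using \<eta>(2) by (intro AE_I2) auto
        show "AE x in lebesgue. (\<lambda>n. \<eta> n x) \<longlonglongrightarrow> indicator {a..b} x" using \<eta>(3) by (intro AE_I2)
      qed (rule L2_measurable, simp)
      show ?thesis
      proof (intro allI impI)
        fix \<epsilon> :: real assume "\<epsilon> > 0"
        from LIMSEQ_D[OF \<open>(\<lambda>n. cl (\<eta> n)) \<longlonglongrightarrow> iv a b\<close> this]
        obtain n where "norm (cl (\<eta> n) - iv a b) < \<epsilon>" by blast
        then show "\<exists>\<eta>. test_function \<eta> \<and> norm (iv a b - cl \<eta>) < \<epsilon>"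
          using \<eta>(1)[of n] by (auto simp: norm_minus_commute)
      qed
    next
      case False
      have "test_function (\<lambda>x. 0)" by (simp add: test_function_def smooth_const)
      then show ?thesis using False by (auto simp: hiv_empty cl_zero intro!: exI[of _ "\<lambda>x. 0"])
    qed
  next
    fix u v assume u: "\<forall>\<epsilon>>0. \<exists>\<eta>. test_function \<eta> \<and> norm (u - cl \<eta>) < \<epsilon>" and v: "\<forall>\<epsilon>>0. \<exists>\<eta>. test_function \<eta> \<and> norm (v - cl \<eta>) < \<epsilon>"
    show "\<forall>\<epsilon>>0. \<exists>\<eta>. test_function \<eta> \<and> norm ((u + v) - cl \<eta>) < \<epsilon>"
    proof (intro allI impI)
      fix \<epsilon> :: real assume "\<epsilon> > 0"
      then have "\<epsilon> / 2 > 0" by simp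
      obtain \<eta> where \<eta>: "test_function \<eta>" "norm (u - cl \<eta>) < \<epsilon> / 2" using u \<open>\<epsilon> / 2 > 0\<close> by blast
      obtain \<zeta> where \<zeta>: "test_function \<zeta>" "norm (v - cl \<zeta>) < \<epsilon> / 2" using v \<open>\<epsilon> / 2 > 0\<close> by blast
      have "cl (\<lambda>x. \<eta> x + 1 * \<zeta> x) = cl \<eta> + cl \<zeta>" using test_function_L2(1) \<eta>(1) \<zeta>(1) by (simp add: cl_add)
      then have eq: "(u + v) - cl (\<lambda>x. \<eta> x + 1 * \<zeta> x) = (u - cl \<eta>) + (v - cl \<zeta>)" by simp
      have "norm ((u + v) - cl (\<lambda>x. \<eta> x + 1 * \<zeta> x)) < \<epsilon>"
        unfolding eq using norm_triangle_ineq[of "u - cl \<eta>" "v - cl \<zeta>"] \<eta>(2) \<zeta>(2) by linarith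
      then show "\<exists>\<eta>. test_function \<eta> \<and> norm ((u + v) - cl \<eta>) < \<epsilon>" using test_function_diff[OF \<eta>(1) \<zeta>(1)] by blast
    qed
  next
    fix c u assume u: "\<forall>\<epsilon>>0. \<exists>\<eta>. test_function \<eta> \<and> norm (u - cl \<eta>) < \<epsilon>"
    show "\<forall>\<epsilon>>0. \<exists>\<eta>. test_function \<eta> \<and> norm (c *\<^sub>R u - cl \<eta>) < \<epsilon>"
    proof (intro allI impI)
      fix \<epsilon> :: real assume "\<epsilon> > 0"
      then have "\<epsilon> / (\<bar>c\<bar> + 1) > 0" by simp
      then obtain \<eta> where \<eta>: "test_function \<eta>" "norm (u - cl \<eta>) < \<epsilon> / (\<bar>c\<bar> + 1)" using u by blast
      have z: "test_function (\<lambda>x. 0)" by (simp add: test_function_def smooth_const)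
      have "cl (\<lambda>x. 0 + c * \<eta> x) = c *\<^sub>R cl \<eta>" using test_function_L2(1) \<eta>(1) by (simp add: cl_scaleR)
      then have "norm (c *\<^sub>R u - cl (\<lambda>x. 0 + c * \<eta> x)) = \<bar>c\<bar> * norm (u - cl \<eta>)" by (simp add: scaleR_diff_right[symmetric])
      also have "\<dots> \<le> (\<bar>c\<bar> + 1) * norm (u - cl \<eta>)" by (intro mult_right_mono) auto
      also have "\<dots> < \<epsilon>" using \<eta>(2) by (simp add: pos_less_divide_eq mult.commute add_nonneg_pos)
      finally show "\<exists>\<eta>. test_function \<eta> \<and> norm (c *\<^sub>R u - cl \<eta>) < \<epsilon>" using test_function_diff[OF z \<eta>(1)] by blast
    qed
  next
    fix X :: "nat \<Rightarrow> l2" and x assume X: "\<And>n. \<forall>\<epsilon>>0. \<exists>\<eta>. test_function \<eta> \<and> norm (X n - cl \<eta>) < \<epsilon>" "X \<longlonglongrightarrow> x"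
    show "\<forall>\<epsilon>>0. \<exists>\<eta>. test_function \<eta> \<and> norm (x - cl \<eta>) < \<epsilon>"
    proof (intro allI impI)
      fix \<epsilon> :: real assume "\<epsilon> > 0"
      then have e: "\<epsilon> / 2 > 0" by simp
      obtain n where n: "norm (X n - x) < \<epsilon> / 2" using LIMSEQ_D[OF X(2) e] by blast
      obtain \<eta> where \<eta>: "test_function \<eta>" "norm (X n - cl \<eta>) < \<epsilon> / 2" using X(1) e by blast
      have "norm (x - cl \<eta>) < \<epsilon>"
        using norm_triangle_ineq[of "x - X n" "X n - cl \<eta>"] n \<eta>(2) by (simp add: norm_minus_commute)
      then show "\<exists>\<eta>. test_function \<eta> \<and> norm (x - cl \<eta>) < \<epsilon>" using \<eta>(1) by blast
    qed
  qed
  then show ?thesis using that by blast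
qed

text \<open>Duality on a dense set: approximate \<open>v\<close> itself by test functions. It turns
  the weak formulation, which sees test functions only, into norm estimates.\<close>

lemma norm_le_if_test_functions:
  assumes "\<And>\<eta>. test_function \<eta> \<Longrightarrow> \<bar>inner v (cl \<eta>)\<bar> \<le> K * norm (cl \<eta>)" "K \<ge> 0"
  shows "norm v \<le> K"
proof -
  have "(norm v)\<^sup>2 \<le> K * norm v + (norm v + K) * \<epsilon>" if \<epsilon>: "\<epsilon> > 0" for \<epsilon>
  proof -
    obtain \<eta> where \<eta>: "test_function \<eta>" "norm (v - cl \<eta>) < \<epsilon>" using test_functions_dense[OF \<epsilon>] by blast
    have "(norm v)\<^sup>2 = inner v (cl \<eta>) + inner v (v - cl \<eta>)"
      by (simp add: inner_diff_right power2_norm_eq_inner)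
    also have "\<dots> \<le> K * norm (cl \<eta>) + norm v * norm (v - cl \<eta>)"
      using assms(1)[OF \<eta>(1)] norm_cauchy_schwarz[of v "v - cl \<eta>"] by linarith
    also have "\<dots> \<le> K * (norm v + \<epsilon>) + norm v * \<epsilon>"
    proof (intro add_mono mult_left_mono)
      show "norm (cl \<eta>) \<le> norm v + \<epsilon>"
        using norm_triangle_ineq3[of v "cl \<eta>"] \<eta>(2) by linarith
    qed (use \<eta>(2) assms(2) in auto)
    finally show ?thesis by (simp add: algebra_simps)
  qed
  then have *: "(norm v)\<^sup>2 \<le> K * norm v + \<epsilon>" if "\<epsilon> > 0" for \<epsilon>
  proof -
    have p: "norm v + K + 1 > 0" using assms(2) by (simp add: add_nonneg_pos)
    have "(norm v)\<^sup>2 \<le> K * norm v + (norm v + K) * (\<epsilon> / (norm v + K + 1))"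
      using that p by (intro \<open>\<And>\<epsilon>. \<epsilon> > 0 \<Longrightarrow> _\<close>) auto
    also have "(norm v + K) * (\<epsilon> / (norm v + K + 1)) \<le> \<epsilon>"
      using that p by (simp add: divide_le_eq algebra_simps)
    finally show ?thesis by simp
  qed
  have "(norm v)\<^sup>2 \<le> K * norm v" by (rule field_le_epsilon) (rule *)
  then show ?thesis using assms(2) by (cases "norm v = 0") (auto simp: power2_eq_square)
qed

lemma L2_L1_loc: "f \<in> L2 \<Longrightarrow> f \<in> L1_loc"
  unfolding L1_loc_def set_integrable_def using L2_mult_integrable[OF indicator_interval_L2] by simp

lemma has_weak_deriv_if_D:
  assumes "f \<in> L2" "g \<in> L2" "dom (cl f)" "dx (cl f) = cl g" shows "has_weak_deriv f g"
  unfolding has_weak_deriv_def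
proof (intro conjI allI impI L2_L1_loc assms)
  fix \<eta> assume "test_function \<eta>"
  note t = test_function_L2[OF this]
  have "(LINT x|lebesgue. f x * deriv \<eta> x) = inner (cl f) (dx (cl \<eta>))" using t assms by (simp add: inner_cl)
  also have "\<dots> = - inner (cl g) (cl \<eta>)" using inner_dx[OF assms(3) t(3)] assms(4) by simp
  also have "\<dots> = - (LINT x|lebesgue. g x * \<eta> x)" using t assms by (simp add: inner_cl)
  finally show "(LINT x|lebesgue. f x * deriv \<eta> x) = - (LINT x|lebesgue. g x * \<eta> x)" .
qed

text \<open>Weak derivatives are strong in L2. For a test class \<open>E\<close> the function
  \<theta> has derivative <tr s G - G, E>, so by duality the norm of tr h F - F - h G is at most |h|
  times the supremum of |tr s G - G| over |s| <= |h|. This supremum tends to 0 because translation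
  is continuous in L2.\<close>

lemma D_if_has_weak_deriv:
  assumes f: "f \<in> L2" and g: "g \<in> L2" and w: "has_weak_deriv f g" shows "dom (cl f)" "dx (cl f) = cl g"
proof -
  define F where "F = cl f"
  define G where "G = cl g"
  have key: "norm (tr h F - F - h *\<^sub>R G) \<le> \<epsilon> * \<bar>h\<bar>" if \<epsilon>: "\<epsilon> \<ge> 0" and bound: "\<And>s. \<bar>s\<bar> \<le> \<bar>h\<bar> \<Longrightarrow> norm (tr s G - G) \<le> \<epsilon>" for h \<epsilon>
  proof (rule norm_le_if_test_functions)
    fix \<eta> assume t: "test_function \<eta>"
    define E where "E = cl \<eta>"
    have E: "dom E" using test_function_L2(3)[OF t] by (simp add: E_def)
    define \<theta> where "\<theta> s = inner F (tr (- s) E) - s * inner G E" for s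
    have d: "(\<theta> has_real_derivative inner (tr s G - G) E) (at s)" for s
    proof -
      have ts: "test_function (\<lambda>x. \<eta> (x + - s))" by (rule test_function_shift[OF t])
      have trE: "tr (- s) E = cl (\<lambda>x. \<eta> (x + - s))" unfolding E_def by (rule tr_cl[OF test_function_L2(1)[OF t]])
      have "inner F (dx (tr (- s) E)) = - inner G (tr (- s) E)"
        using w ts test_function_L2[OF ts] f g unfolding trE F_def G_def by (simp add: inner_cl has_weak_deriv_def)
      then have FG: "- inner F (tr (- s) (dx E)) = inner (tr s G) E"
        using inner_aff_left[of 1 s G E] by (simp add: dx_tr[OF E])
      have "((\<lambda>s. tr s E) has_vector_derivative tr (- s) (dx E)) (at (- s))"
        by (rule tr_has_vector_derivative[OF E])
      then have "((\<lambda>s. tr (- s) E) has_vector_derivative - tr (- s) (dx E)) (at s)"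
        using vector_diff_chain_at[of uminus "-1" s "\<lambda>s. tr s E" "tr (- s) (dx E)"]
        by (simp add: comp_def has_vector_derivative_minus)
      then have "((\<lambda>s. inner F (tr (- s) E)) has_vector_derivative inner F (- tr (- s) (dx E))) (at s)"
        by (rule bounded_linear.has_vector_derivative[OF bounded_linear_inner_right])
      then have "((\<lambda>s. inner F (tr (- s) E)) has_real_derivative inner (tr s G) E) (at s)"
        using FG by (simp add: has_real_derivative_iff_has_vector_derivative)
      then show ?thesis unfolding \<theta>_def[abs_def] inner_diff_left
        by (auto intro!: derivative_eq_intros)
    qed
    have "\<bar>\<theta> h - \<theta> 0\<bar> \<le> (\<epsilon> * norm E) * \<bar>h\<bar>"
    proof -
      have "norm (\<theta> h - \<theta> 0) \<le> (\<epsilon> * norm E) * norm (h - 0)"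
      proof (rule field_differentiable_bound[where S="{-\<bar>h\<bar>..\<bar>h\<bar>}" and f'="\<lambda>s. inner (tr s G - G) E"])
        show "(\<theta> has_real_derivative inner (tr z G - G) E) (at z within {-\<bar>h\<bar>..\<bar>h\<bar>})" for z
          by (rule has_field_derivative_at_within[OF d])
        show "norm (inner (tr z G - G) E) \<le> \<epsilon> * norm E" if "z \<in> {-\<bar>h\<bar>..\<bar>h\<bar>}" for z
        proof -
          have "norm (inner (tr z G - G) E) \<le> norm (tr z G - G) * norm E" using Cauchy_Schwarz_ineq2 by simp
          also have "\<dots> \<le> \<epsilon> * norm E" using bound[of z] that by (intro mult_right_mono) auto
          finally show ?thesis .
        qed
      qed auto
      then show ?thesis by simp
    qed
    moreover have "\<theta> h - \<theta> 0 = inner (tr h F - F - h *\<^sub>R G) E"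
      using inner_aff_left[of 1 h F E] by (simp add: \<theta>_def inner_diff_left aff_id)
    ultimately show "\<bar>inner (tr h F - F - h *\<^sub>R G) (cl \<eta>)\<bar> \<le> \<epsilon> * \<bar>h\<bar> * norm (cl \<eta>)"
      by (simp add: E_def mult.commute mult.left_commute)
  qed (use \<epsilon> in simp)
  have "D F G"
    unfolding D_def
  proof (rule LIM_I)
    fix r :: real assume r: "r > 0"
    obtain d where d: "d > 0" "\<And>s. s \<noteq> 0 \<Longrightarrow> \<bar>s\<bar> < d \<Longrightarrow> norm (tr s G - G) < r / 2"
      using LIM_D[OF tr_tendsto_id[of G], of "r / 2"] r by auto
    show "\<exists>s>0. \<forall>x. x \<noteq> 0 \<and> norm (x - 0) < s \<longrightarrow> norm ((tr x F - F) /\<^sub>R x - G) < r"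
    proof (intro exI[of _ d] conjI allI impI d(1))
      fix h :: real assume h: "h \<noteq> 0 \<and> norm (h - 0) < d"
      have "norm (tr h F - F - h *\<^sub>R G) \<le> (r / 2) * \<bar>h\<bar>"
      proof (rule key)
        show "norm (tr s G - G) \<le> r / 2" if "\<bar>s\<bar> \<le> \<bar>h\<bar>" for s
          using d(2)[of s] that h r by (cases "s = 0") (auto simp: aff_id)
      qed (use r in simp)
      then have "norm (tr h F - F - h *\<^sub>R G) / \<bar>h\<bar> \<le> r / 2" using h by (simp add: pos_divide_le_eq)
      moreover have "(tr h F - F) /\<^sub>R h - G = (tr h F - F - h *\<^sub>R G) /\<^sub>R h"
        using h by (simp add: scaleR_diff_right)
      then have "norm ((tr h F - F) /\<^sub>R h - G) = norm (tr h F - F - h *\<^sub>R G) / \<bar>h\<bar>"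
        by (simp only: norm_scaleR abs_inverse divide_inverse mult.commute)
      ultimately have "norm ((tr h F - F) /\<^sub>R h - G) \<le> r / 2" by simp
      then show "norm ((tr h F - F) /\<^sub>R h - G) < r" using r by simp
    qed
  qed
  then show "dom (cl f)" "dx (cl f) = cl g" using D_imp_dom by (auto simp: F_def G_def)
qed

lemma H1_iff: "f \<in> H1 \<longleftrightarrow> f \<in> L2 \<and> dom (cl f)"
proof
  assume "f \<in> H1"
  then show "f \<in> L2 \<and> dom (cl f)" unfolding H1_def using D_if_has_weak_deriv by blast
next
  assume f: "f \<in> L2 \<and> dom (cl f)"
  then have "has_weak_deriv f (fn (dx (cl f)))" by (intro has_weak_deriv_if_D) auto
  then show "f \<in> H1" unfolding H1_def using f fn_L2 by blast
qed

lemma L1_loc_measurable: "f \<in> L1_loc \<Longrightarrow> f \<in> borel_measurable lebesgue"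
proof -
  assume f: "f \<in> L1_loc"
  have m: "(\<lambda>x. indicator {-real n..real n} x *\<^sub>R f x) \<in> borel_measurable lebesgue" for n
    using f unfolding L1_loc_def set_integrable_def by (intro borel_measurable_integrable) blast
  have l: "(\<lambda>n. indicator {-real n..real n} x *\<^sub>R f x) \<longlonglongrightarrow> f x" for x
  proof (rule tendsto_eventually, rule eventually_sequentiallyI[of "nat \<lceil>\<bar>x\<bar>\<rceil>"])
    fix n assume "nat \<lceil>\<bar>x\<bar>\<rceil> \<le> n"
    then have "\<bar>x\<bar> \<le> real n" by linarith
    then show "indicator {-real n..real n} x *\<^sub>R f x = f x" by (auto simp: indicator_def)
  qed
  show ?thesis by (rule borel_measurable_LIMSEQ_real[OF l m])
qed

text \<open>Existence of a weak derivative comes from \<open>dx\<close>; uniqueness then carries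
  square integrability and the class over to the function that the choice in
  \<open>weak_deriv\<close> happens to return.\<close>

lemma weak_deriv_H1:
  assumes "f \<in> H1" shows "weak_deriv f \<in> L2" "cl (weak_deriv f) = dx (cl f)"
proof -
  have f: "f \<in> L2" "dom (cl f)" using assms by (auto simp: H1_iff)
  have w: "has_weak_deriv f (fn (dx (cl f)))" by (intro has_weak_deriv_if_D f) auto
  then have w': "has_weak_deriv f (weak_deriv f)" unfolding weak_deriv_def by (rule someI[of "has_weak_deriv f"])
  have m: "weak_deriv f \<in> borel_measurable lebesgue"
    using w' by (intro L1_loc_measurable) (simp add: has_weak_deriv_def)
  note ae = weak_deriv_unique[OF w w']
  show "weak_deriv f \<in> L2" by (rule L2_cong_AE[OF fn_L2 m ae])
  show "cl (weak_deriv f) = dx (cl f)" using cl_cong[OF fn_L2 ae m] by simp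
qed

lemma X_norm_eq:
  assumes "f \<in> H1 \<times> L2"
  shows "(X_norm f)\<^sup>2 = (norm (cl (fst f)))\<^sup>2 + (norm (dx (cl (fst f))))\<^sup>2 + (norm (cl (snd f)))\<^sup>2" "0 \<le> X_norm f"
proof -
  have f: "fst f \<in> H1" "fst f \<in> L2" "snd f \<in> L2" using assms by (auto simp: H1_iff mem_Times_iff)
  show "0 \<le> X_norm f" by (simp add: X_norm_def)
  show "(X_norm f)\<^sup>2 = (norm (cl (fst f)))\<^sup>2 + (norm (dx (cl (fst f))))\<^sup>2 + (norm (cl (snd f)))\<^sup>2"
    using f weak_deriv_H1[OF f(1)] by (simp add: X_norm_def H1_norm_def norm_cl[symmetric] add_nonneg_nonneg)
qed

section \<open>The Fourier transform and the free evolution\<close>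

text \<open>\<open>ft (hart f)\<close> is the Fourier transform of \<open>f\<close>: up to the factor \<open>sqrt (2 * pi)\<close>, its real and imaginary parts are the even part and
  minus the odd part of the Hartley transform.\<close>

definition ft :: "(real \<Rightarrow> real) \<Rightarrow> real \<Rightarrow> complex"
  where "ft a \<xi> = of_real (sqrt (2 * pi)) * Complex ((a \<xi> + a (- \<xi>)) / 2) ((a (- \<xi>) - a \<xi>) / 2)"

lemma cmod_ft_diff: "(cmod (ft a \<xi> - ft b \<xi>))\<^sup>2 = pi * ((a \<xi> - b \<xi>)\<^sup>2 + (a (- \<xi>) - b (- \<xi>))\<^sup>2)"
proof -
  have "ft a \<xi> - ft b \<xi> = of_real (sqrt (2 * pi)) * Complex (((a \<xi> - b \<xi>) + (a (- \<xi>) - b (- \<xi>))) / 2) (((a (- \<xi>) - b (- \<xi>)) - (a \<xi> - b \<xi>)) / 2)"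
    by (simp add: ft_def complex_eq_iff right_diff_distrib[symmetric] diff_divide_distrib add_divide_distrib)
  then have "(cmod (ft a \<xi> - ft b \<xi>))\<^sup>2 = (2 * pi) * ((((a \<xi> - b \<xi>) + (a (- \<xi>) - b (- \<xi>))) / 2)\<^sup>2 + (((a (- \<xi>) - b (- \<xi>)) - (a \<xi> - b \<xi>)) / 2)\<^sup>2)"
    by (simp add: norm_mult power_mult_distrib cmod_power2)
  also have "\<dots> = pi * ((a \<xi> - b \<xi>)\<^sup>2 + (a (- \<xi>) - b (- \<xi>))\<^sup>2)"
    by (simp add: power2_eq_square field_simps)
  finally show ?thesis .
qed

lemma ft_measurable:
  assumes "a \<in> borel_measurable lebesgue" shows "ft a \<in> borel_measurable lebesgue"
proof -
  have "(\<lambda>\<xi>. a (0 + -1 * \<xi>)) \<in> borel_measurable lebesgue"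
    using measurable_compose[OF affine_measurable_lebesgue[of "-1" 0] assms] by simp
  then have m: "(\<lambda>\<xi>. a (- \<xi>)) \<in> borel_measurable lebesgue" by simp
  have "ft a = (\<lambda>\<xi>. of_real (sqrt (2 * pi)) * (of_real ((a \<xi> + a (- \<xi>)) / 2) + \<i> * of_real ((a (- \<xi>) - a \<xi>) / 2)))"
    by (simp add: ft_def fun_eq_iff Complex_eq)
  also have "\<dots> \<in> borel_measurable lebesgue"
    using assms m by measurable
  finally show ?thesis .
qed

lemma nn_integral_ft_diff:
  assumes a: "a \<in> L2" and b: "b \<in> L2"
  shows "(\<integral>\<^sup>+\<xi>. ennreal ((cmod (ft a \<xi> - ft b \<xi>))\<^sup>2) \<partial>lebesgue) = ennreal (2 * pi * (norm (cl a - cl b))\<^sup>2)"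
proof -
  define d where "d \<xi> = a \<xi> - b \<xi>" for \<xi>
  have d: "d \<in> L2" unfolding d_def[abs_def] by (intro L2_diff a b)
  have d': "(\<lambda>\<xi>. d (- \<xi>)) \<in> L2" using L2_affine[of "-1" d 0] d by simp
  have "(LINT \<xi>|lebesgue. (d (- \<xi>))\<^sup>2) = (LINT \<xi>|lebesgue. (d \<xi>)\<^sup>2)"
    using integral_affine[of "-1" "\<lambda>\<xi>. (d \<xi>)\<^sup>2" 0] L2_integrable[OF d] by simp
  then have "(LINT \<xi>|lebesgue. pi * ((d \<xi>)\<^sup>2 + (d (- \<xi>))\<^sup>2)) = 2 * pi * (norm (cl d))\<^sup>2"
    using L2_integrable[OF d] L2_integrable[OF d'] by (simp add: norm_cl_power2[OF d])
  moreover have "cl d = cl a - cl b" unfolding d_def[abs_def] by (rule cl_diff[OF a b])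
  moreover have "(\<integral>\<^sup>+\<xi>. ennreal (pi * ((d \<xi>)\<^sup>2 + (d (- \<xi>))\<^sup>2)) \<partial>lebesgue) = ennreal (LINT \<xi>|lebesgue. pi * ((d \<xi>)\<^sup>2 + (d (- \<xi>))\<^sup>2))"
    by (rule nn_integral_eq_integral) (use L2_integrable[OF d] L2_integrable[OF d'] in auto)
  ultimately show ?thesis by (simp add: cmod_ft_diff d_def)
qed

lemma truncated_fourier_integral:
  assumes f: "f \<in> L2"
  shows "(LINT x:{-R..R}|lebesgue. cis (- (x * \<xi>)) * complex_of_real (f x)) = ft (hk (\<lambda>x. indicator {-R..R} x * f x)) \<xi>"
proof -
  define g where "g x = indicator {-R..R} x * f x" for x
  have g: "integrable lebesgue g" unfolding g_def[abs_def] by (rule L2_mult_integrable) (auto simp: f)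
  have m: "(\<lambda>x. x * \<xi>) \<in> borel_measurable lebesgue"
    by (intro continuous_lebesgue_measurable continuous_intros)
  have ic: "integrable lebesgue (\<lambda>x. cos (x * \<xi>) * g x)" and iss: "integrable lebesgue (\<lambda>x. sin (x * \<xi>) * g x)"
    by (intro integrable_bd_mult bd_cos bd_sin m g)+
  have "(LINT x:{-R..R}|lebesgue. cis (- (x * \<xi>)) * complex_of_real (f x))
      = (LINT x|lebesgue. of_real (cos (x * \<xi>) * g x) + \<i> * of_real (- (sin (x * \<xi>) * g x)))"
    unfolding set_lebesgue_integral_def
    by (rule Bochner_Integration.integral_cong) (auto simp: g_def complex_eq_iff)
  also have "\<dots> = of_real (LINT x|lebesgue. cos (x * \<xi>) * g x) + \<i> * of_real (- (LINT x|lebesgue. sin (x * \<xi>) * g x))"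
  proof -
    have "(LINT x|lebesgue. of_real (p x) + \<i> * of_real (- q x)) = of_real (LINT x|lebesgue. p x) + \<i> * of_real (- (LINT x|lebesgue. q x))"
      if "integrable lebesgue p" "integrable lebesgue q" for p q :: "real \<Rightarrow> real"
      using that by (subst Bochner_Integration.integral_add) auto
    from this[OF ic iss] show ?thesis .
  qed
  also have "\<dots> = ft (hk g) \<xi>"
  proof -
    have s1: "(LINT x|lebesgue. cas (x * \<xi>) * g x) = (LINT x|lebesgue. cos (x * \<xi>) * g x) + (LINT x|lebesgue. sin (x * \<xi>) * g x)"
      unfolding cas_def distrib_right by (rule Bochner_Integration.integral_add[OF ic iss])
    have s2: "(LINT x|lebesgue. cas (x * - \<xi>) * g x) = (LINT x|lebesgue. cos (x * \<xi>) * g x) - (LINT x|lebesgue. sin (x * \<xi>) * g x)"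
      using Bochner_Integration.integral_diff[OF ic iss] by (simp add: cas_def left_diff_distrib)
    show ?thesis
      unfolding ft_def hk_def s1 s2 by (simp add: complex_eq_iff field_simps)
  qed
  finally show ?thesis by (simp add: g_def[abs_def])
qed

lemma truncation_tendsto:
  assumes f: "f \<in> L2"
  shows "((\<lambda>R. cl (\<lambda>x. indicator {-R..R} x * f x)) \<longlongrightarrow> cl f) at_top"
proof (rule tendsto_at_topI_sequentially)
  fix X :: "nat \<Rightarrow> real" assume X: "filterlim X at_top sequentially"
  show "(\<lambda>n. cl (\<lambda>x. indicator {-X n..X n} x * f x)) \<longlonglongrightarrow> cl f"
  proof (rule l2_dominated_convergence[OF f])
    show "(\<lambda>x. indicator {- X n..X n} x * f x) \<in> borel_measurable lebesgue" for n
      using f by (intro borel_measurable_times borel_measurable_indicator L2_measurable) auto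
    show "f \<in> borel_measurable lebesgue" using f by (rule L2_measurable)
    show "AE x in lebesgue. \<bar>indicator {- X n..X n} x * f x\<bar> \<le> \<bar>f x\<bar>" for n
      by (intro AE_I2) (auto simp: indicator_def)
    show "AE x in lebesgue. (\<lambda>n. indicator {- X n..X n} x * f x) \<longlonglongrightarrow> f x"
    proof (intro AE_I2 tendsto_eventually)
      fix x
      have "\<forall>\<^sub>F n in sequentially. \<bar>x\<bar> \<le> X n" using X by (simp add: filterlim_at_top)
      then show "\<forall>\<^sub>F n in sequentially. indicator {- X n..X n} x * f x = f x"
        by eventually_elim (auto simp: indicator_def)
    qed
  qed
qed

text \<open>The truncated Fourier integral is \<open>ft\<close> of the Hartley integral of the
  truncated function. Since \<open>hart\<close> is isometric and \<open>ft\<close> preserves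
  distances up to the factor 2 * pi in the square, convergence of the truncations suffices.\<close>

lemma has_fourier_ft:
  assumes f: "f \<in> L2" shows "has_fourier f (ft (fn (hart (cl f))))"
proof -
  define a where "a = fn (hart (cl f))"
  have aL: "a \<in> L2" "cl a = hart (cl f)" by (auto simp: a_def)
  have zL: "(\<lambda>x. 0) \<in> L2" by simp
  have ft0: "ft (\<lambda>x. 0) \<xi> = 0" for \<xi> by (simp add: ft_def complex_eq_iff)
  have m: "ft a \<in> borel_measurable lebesgue" by (rule ft_measurable[OF L2_measurable[OF aL(1)]])
  have i: "integrable lebesgue (\<lambda>\<xi>. (cmod (ft a \<xi>))\<^sup>2)"
  proof (rule integrableI_nonneg)
    show "(\<lambda>\<xi>. (cmod (ft a \<xi>))\<^sup>2) \<in> borel_measurable lebesgue" using m by measurable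
    show "(\<integral>\<^sup>+ x. ennreal ((cmod (ft a x))\<^sup>2) \<partial>lebesgue) < \<infinity>"
      using nn_integral_ft_diff[OF aL(1) zL] by (simp add: ft0)
  qed simp
  define fR where "fR R x = indicator {-R..R} x * f x" for R x
  have fR: "integrable lebesgue (fR R)" "fR R \<in> L2" for R
  proof -
    show "integrable lebesgue (fR R)" unfolding fR_def[abs_def] by (rule L2_mult_integrable) (auto simp: f)
    show "fR R \<in> L2"
    proof (rule L2_bound[OF f, where K=1])
      show "fR R \<in> borel_measurable lebesgue"
        unfolding fR_def[abs_def] using L2_measurable[OF f] by (intro borel_measurable_times borel_measurable_indicator) auto
      show "AE x in lebesgue. \<bar>fR R x\<bar> \<le> 1 * \<bar>f x\<bar>"
        by (intro AE_I2) (auto simp: fR_def indicator_def)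
    qed
  qed
  have hkm: "hk (fR R) \<in> borel_measurable lebesgue" for R
    by (intro continuous_lebesgue_measurable hk_continuous fR)
  have hkL: "hk (fR R) \<in> L2" "cl (hk (fR R)) = hart (cl (fR R))" for R
    using L2_cong_AE[OF fn_L2 hkm hart_integrable[OF fR(2,1)]] cl_cong[OF fn_L2 hart_integrable[OF fR(2,1)] hkm] by simp_all
  have lim: "((\<lambda>R. ennreal (2 * pi * (norm (cl (hk (fR R)) - cl a))\<^sup>2)) \<longlongrightarrow> ennreal (2 * pi * (norm (hart (cl f) - hart (cl f)))\<^sup>2)) at_top"
    unfolding hkL aL by (intro tendsto_ennrealI tendsto_intros hart_tendsto) (use truncation_tendsto[OF f] in \<open>simp add: fR_def[abs_def]\<close>)
  have "((\<lambda>R. \<integral>\<^sup>+\<xi>. ennreal ((cmod ((LINT x:{-R..R}|lebesgue. cis (- (x * \<xi>)) * complex_of_real (f x)) - ft a \<xi>))\<^sup>2) \<partial>lebesgue) \<longlongrightarrow> 0) at_top"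
  proof -
    have "(\<lambda>x. indicator {-R..R} x * f x) = fR R" for R by (simp add: fR_def[abs_def])
    then show ?thesis unfolding truncated_fourier_integral[OF f]
      using lim by (simp add: nn_integral_ft_diff hkL(1) aL(1))
  qed
  with m i show ?thesis unfolding has_fourier_def a_def[symmetric] by blast
qed

text \<open>Both candidates are L2 limits of the same truncated integrals. The argument stays with
  nonnegative integrals, in which the condition is phrased. It fixes the choice made in
  \<open>fourier\<close> up to null sets.\<close>

lemma has_fourier_unique:
  assumes f: "f \<in> L2" and g: "has_fourier f g" and h: "has_fourier f h"
  shows "AE \<xi> in lebesgue. g \<xi> = h \<xi>"
proof -
  define F where "F R \<xi> = (LINT x:{-R..R}|lebesgue. cis (- (x * \<xi>)) * complex_of_real (f x))" for R \<xi>
  have Fm: "F R \<in> borel_measurable lebesgue" for R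
  proof -
    have "integrable lebesgue (\<lambda>x. indicator {-R..R} x * f x)" by (rule L2_mult_integrable) (auto simp: f)
    then show ?thesis
      unfolding F_def[abs_def] truncated_fourier_integral[OF f] by (intro ft_measurable continuous_lebesgue_measurable hk_continuous)
  qed
  have gm: "g \<in> borel_measurable lebesgue" and hm: "h \<in> borel_measurable lebesgue"
    using g h by (auto simp: has_fourier_def)
  define I where "I k R = (\<integral>\<^sup>+\<xi>. ennreal ((cmod (F R \<xi> - k \<xi>))\<^sup>2) \<partial>lebesgue)" for k R
  have lim: "(I g \<longlongrightarrow> 0) at_top" "(I h \<longlongrightarrow> 0) at_top"
    using g h by (simp_all add: has_fourier_def I_def[abs_def] F_def)
  have bound: "(\<integral>\<^sup>+\<xi>. ennreal ((cmod (g \<xi> - h \<xi>))\<^sup>2) \<partial>lebesgue) \<le> 2 * I g R + 2 * I h R" for R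
  proof -
    have pw: "(cmod (g \<xi> - h \<xi>))\<^sup>2 \<le> 2 * (cmod (F R \<xi> - g \<xi>))\<^sup>2 + 2 * (cmod (F R \<xi> - h \<xi>))\<^sup>2" for \<xi>
    proof -
      have "cmod (g \<xi> - h \<xi>) \<le> cmod (F R \<xi> - g \<xi>) + cmod (F R \<xi> - h \<xi>)"
        using norm_triangle_ineq4[of "F R \<xi> - h \<xi>" "F R \<xi> - g \<xi>"] by simp
      then have "(cmod (g \<xi> - h \<xi>))\<^sup>2 \<le> (cmod (F R \<xi> - g \<xi>) + cmod (F R \<xi> - h \<xi>))\<^sup>2" by (intro power_mono) auto
      also have "\<dots> \<le> 2 * (cmod (F R \<xi> - g \<xi>))\<^sup>2 + 2 * (cmod (F R \<xi> - h \<xi>))\<^sup>2"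
        using sum_squares_bound[of "cmod (F R \<xi> - g \<xi>)" "cmod (F R \<xi> - h \<xi>)"] unfolding power2_sum by linarith
      finally show ?thesis .
    qed
    have "(\<integral>\<^sup>+\<xi>. ennreal ((cmod (g \<xi> - h \<xi>))\<^sup>2) \<partial>lebesgue) \<le>
        (\<integral>\<^sup>+\<xi>. 2 * ennreal ((cmod (F R \<xi> - g \<xi>))\<^sup>2) + 2 * ennreal ((cmod (F R \<xi> - h \<xi>))\<^sup>2) \<partial>lebesgue)"
    proof (intro nn_integral_mono)
      fix \<xi>
      have "2 * ennreal b + 2 * ennreal c = ennreal (2 * b + 2 * c)" if "b \<ge> 0" "c \<ge> 0" for b c
        using that by (simp add: ennreal_plus ennreal_mult)
      then show "ennreal ((cmod (g \<xi> - h \<xi>))\<^sup>2) \<le> 2 * ennreal ((cmod (F R \<xi> - g \<xi>))\<^sup>2) + 2 * ennreal ((cmod (F R \<xi> - h \<xi>))\<^sup>2)"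
        using ennreal_leI[OF pw[of \<xi>]] by simp
    qed
    also have "\<dots> = 2 * I g R + 2 * I h R"
      unfolding I_def using Fm[of R] gm hm by (subst nn_integral_add) (auto simp: nn_integral_cmult)
    finally show ?thesis .
  qed
  have "((\<lambda>R. 2 * I g R + 2 * I h R) \<longlongrightarrow> 2 * 0 + 2 * 0) at_top"
    by (intro tendsto_add ennreal_tendsto_cmult lim) auto
  then have "(\<integral>\<^sup>+\<xi>. ennreal ((cmod (g \<xi> - h \<xi>))\<^sup>2) \<partial>lebesgue) \<le> 2 * 0 + 2 * 0"
    by (rule tendsto_lowerbound) (auto intro!: always_eventually bound)
  then have "(\<integral>\<^sup>+\<xi>. ennreal ((cmod (g \<xi> - h \<xi>))\<^sup>2) \<partial>lebesgue) = 0" by simp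
  then have "AE \<xi> in lebesgue. ennreal ((cmod (g \<xi> - h \<xi>))\<^sup>2) = 0"
    using gm hm by (subst (asm) nn_integral_0_iff_AE) auto
  then show ?thesis by eventually_elim simp
qed

lemma fourier_AE:
  assumes f: "f \<in> L2" shows "AE \<xi> in lebesgue. fourier f \<xi> = ft (fn (hart (cl f))) \<xi>"
proof -
  have "has_fourier f (fourier f)" unfolding fourier_def by (rule someI[of "has_fourier f", OF has_fourier_ft[OF f]])
  then show ?thesis by (rule has_fourier_unique[OF f _ has_fourier_ft[OF f]])
qed

section \<open>The free evolution in Hartley coordinates\<close>

definition \<sigma> :: "real \<Rightarrow> real" where "\<sigma> \<xi> = \<xi> * mw \<xi>"

lemma \<sigma>_minus [simp]: "\<sigma> (- \<xi>) = - \<sigma> \<xi>"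
  by (simp add: \<sigma>_def)

lemma \<sigma>_measurable: "\<sigma> \<in> borel_measurable lebesgue"
  unfolding \<sigma>_def[abs_def] by (intro borel_measurable_times id_lebesgue_measurable mw_measurable)

lemma freq_eq: "freq \<xi> = \<bar>\<xi>\<bar> * mw \<xi>"
  by (simp add: freq_def mw_def)

text \<open>Cosine and sin(x)/x are even, so the phase \<open>freq\<close>, which contains |\<xi>|,
  may be replaced by the odd phase \<sigma>. The quotient by \<open>freq\<close> becomes a quotient
  by \<open>mw\<close>, which never vanishes.\<close>

lemma cos_freq: "cos (freq \<xi> * t) = cos (t * \<sigma> \<xi>)"
  by (simp add: freq_eq \<sigma>_def abs_if ac_simps)

lemma sin_freq: "\<xi> * sin (freq \<xi> * t) / freq \<xi> = sin (t * \<sigma> \<xi>) / mw \<xi>"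
  by (simp add: freq_eq \<sigma>_def abs_if ac_simps)

abbreviation ct :: "real \<Rightarrow> real \<Rightarrow> real" where "ct t \<equiv> \<lambda>\<xi>. cos (t * \<sigma> \<xi>)"
abbreviation st :: "real \<Rightarrow> real \<Rightarrow> real" where "st t \<equiv> \<lambda>\<xi>. sin (t * \<sigma> \<xi>)"

lemma t\<sigma>_measurable: "(\<lambda>\<xi>. t * \<sigma> \<xi>) \<in> borel_measurable lebesgue"
  by (intro borel_measurable_times borel_measurable_const \<sigma>_measurable)

lemma bd_ct [simp]: "bd (ct t)" and bd_st [simp]: "bd (st t)"
  by (intro bd_cos bd_sin t\<sigma>_measurable)+

text \<open>
  In the variables \<open>(A, B) = (mw * hart u\<^sub>1, rfl (hart u\<^sub>2))\<close> the free group is the rotation by the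
  angle \<open>t * \<sigma> \<xi>\<close> at the frequency \<open>\<xi>\<close>.
\<close>

definition TT :: "state \<Rightarrow> l2 \<times> l2"
  where "TT f = (mul mw (hart (cl (fst f))), rfl (hart (cl (snd f))))"

definition U :: "real \<Rightarrow> l2 \<times> l2 \<Rightarrow> l2 \<times> l2"
  where "U t z = (mul (ct t) (fst z) - mul (st t) (snd z), mul (st t) (fst z) + mul (ct t) (snd z))"

lemma bd_inverse_mw: "bd (\<lambda>\<xi>. 1 / mw \<xi>)"
  by (rule bdI[where K=1]) (use mw_ge in \<open>auto simp: less_imp_le intro!: borel_measurable_divide borel_measurable_const mw_measurable\<close>)

text \<open>\<open>u1\<close> and \<open>u2\<close> invert \<open>TT\<close>. They are defined on
  all of \<open>l2 \<times> l2\<close>, and \<open>u1\<close> always lands in \<open>dom\<close>,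
  because division by \<open>mw\<close> is bounded and gains one derivative.\<close>

definition u1 :: "l2 \<times> l2 \<Rightarrow> l2" where "u1 z = hart (mul (\<lambda>\<xi>. 1 / mw \<xi>) (fst z))"
definition u2 :: "l2 \<times> l2 \<Rightarrow> l2" where "u2 z = hart (rfl (snd z))"

lemma mw_inverse_mw: "(\<lambda>\<xi>. mw \<xi> * fn (mul (\<lambda>\<xi>. 1 / mw \<xi>) a) \<xi>) \<in> L2" "mul mw (mul (\<lambda>\<xi>. 1 / mw \<xi>) a) = a"
proof -
  have ae: "AE \<xi> in lebesgue. mw \<xi> * fn (mul (\<lambda>\<xi>. 1 / mw \<xi>) a) \<xi> = fn a \<xi>"
    using fn_mul_bd[OF bd_inverse_mw, of a] by eventually_elim simp
  have m: "(\<lambda>\<xi>. mw \<xi> * fn (mul (\<lambda>\<xi>. 1 / mw \<xi>) a) \<xi>) \<in> borel_measurable lebesgue"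
    by (intro borel_measurable_times mw_measurable fn_measurable)
  have ae': "AE \<xi> in lebesgue. fn a \<xi> = mw \<xi> * fn (mul (\<lambda>\<xi>. 1 / mw \<xi>) a) \<xi>"
    using ae by eventually_elim simp
  show "(\<lambda>\<xi>. mw \<xi> * fn (mul (\<lambda>\<xi>. 1 / mw \<xi>) a) \<xi>) \<in> L2" by (rule L2_cong_AE[OF fn_L2 m ae'])
  show "mul mw (mul (\<lambda>\<xi>. 1 / mw \<xi>) a) = a"
    unfolding mul_def[of mw] using cl_cong[OF fn_L2 ae' m] by simp
qed

lemma inverse_mw_mw:
  assumes "(\<lambda>\<xi>. mw \<xi> * fn a \<xi>) \<in> L2" shows "mul (\<lambda>\<xi>. 1 / mw \<xi>) (mul mw a) = a"
  using fn_mul_bd[OF bd_inverse_mw, of "mul mw a"] fn_mul[OF assms]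
  unfolding l2_eq_iff by eventually_elim simp

lemma dom_u1: "dom (u1 z)"
  using mw_inverse_mw(1)[of "fst z"] by (simp add: dom_def u1_def mw_L2_iff)

lemma u1_TT: "f \<in> H1 \<times> L2 \<Longrightarrow> u1 (TT f) = cl (fst f)"
  by (simp add: u1_def TT_def inverse_mw_mw mw_L2_iff dom_def[symmetric] H1_iff mem_Times_iff)

lemma u2_TT: "u2 (TT f) = cl (snd f)"
  by (simp add: u2_def TT_def rfl_rfl)

lemma TT_surj: "(fn (u1 z), fn (u2 z)) \<in> H1 \<times> L2" "TT (fn (u1 z), fn (u2 z)) = z"
  by (simp_all add: H1_iff dom_u1) (simp add: TT_def u1_def u2_def mw_inverse_mw(2) rfl_rfl hart_rfl[symmetric])

lemma norm_u: "(norm z)\<^sup>2 = (nH (u1 z))\<^sup>2 + (norm (u2 z))\<^sup>2"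
  by (cases z) (simp add: norm_prod_def nH_def u1_def u2_def mw_inverse_mw(2) norm_hart norm_aff add_nonneg_nonneg)

lemma U_0: "U 0 z = z"
  by (simp add: U_def mul_one mul_zero)

lemma U_U: "U s (U t z) = U (s + t) z"
proof -
  have c: "ct (s + t) = (\<lambda>\<xi>. ct s \<xi> * ct t \<xi> + - (st s \<xi> * st t \<xi>))" and s: "st (s + t) = (\<lambda>\<xi>. st s \<xi> * ct t \<xi> + ct s \<xi> * st t \<xi>)"
    by (simp_all add: distrib_right cos_add sin_add)
  have b: "bd (\<lambda>\<xi>. ct s \<xi> * ct t \<xi>)" "bd (\<lambda>\<xi>. st s \<xi> * st t \<xi>)" "bd (\<lambda>\<xi>. - (st s \<xi> * st t \<xi>))" "bd (\<lambda>\<xi>. st s \<xi> * ct t \<xi>)" "bd (\<lambda>\<xi>. ct s \<xi> * st t \<xi>)"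
    by (auto intro!: bd_mult bd_uminus)
  have "mul (ct (s + t)) a = mul (ct s) (mul (ct t) a) - mul (st s) (mul (st t) a)" for a
    unfolding c mul_add_left[OF b(1,3)] mul_uminus_left[OF b(2)] by (simp add: mul_mul)
  moreover have "mul (st (s + t)) a = mul (st s) (mul (ct t) a) + mul (ct s) (mul (st t) a)" for a
    unfolding s mul_add_left[OF b(4,5)] by (simp add: mul_mul)
  ultimately show ?thesis
    by (simp add: U_def mul_add mul_diff)
qed

lemma U_add: "U t (z + w) = U t z + U t w"
  by (simp add: U_def mul_add prod_eq_iff)

lemma U_scaleR: "U t (c *\<^sub>R z) = c *\<^sub>R U t z"
  by (simp add: U_def mul_scaleR prod_eq_iff scaleR_right_distrib scaleR_diff_right)

lemma inner_U: "inner (U t z) w = inner z (U (- t) w)"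
proof -
  have s: "mul (st (- t)) a = - mul (st t) a" for a using mul_uminus_left[OF bd_st[of t]] by simp
  show ?thesis
    by (cases z; cases w) (simp add: U_def s inner_add_left inner_add_right inner_diff_left inner_diff_right inner_mul_right mul_uminus_left)
qed

lemma norm_U: "norm (U t z) = norm z"
  by (simp add: norm_eq_sqrt_inner inner_U U_U U_0)

lemma bounded_linear_U: "bounded_linear (U t)"
  by (rule bounded_linear_intro[where K=1]) (auto simp: U_add U_scaleR norm_U)

lemma U_diff: "U t (z - w) = U t z - U t w"
  by (rule bounded_linear.linear[OF bounded_linear_U, THEN linear_diff])

text \<open>The group is continuous strongly, not in operator norm. A moving argument is admissible
  because each \<open>U s\<close> is an isometry.\<close>

lemma U_tendsto:
  assumes "(z \<longlongrightarrow> w) (at t)" shows "((\<lambda>s. U s (z s)) \<longlongrightarrow> U t w) (at t)"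
proof -
  have "((\<lambda>s. U s w) \<longlongrightarrow> U t w) (at t)"
  proof -
    have c: "((\<lambda>s. ct s x) \<longlongrightarrow> ct t x) (at t)" and s: "((\<lambda>s. st s x) \<longlongrightarrow> st t x) (at t)" for x
      by (intro tendsto_intros)+
    have "((\<lambda>s. mul (ct s) a) \<longlongrightarrow> mul (ct t) a) (at t)" "((\<lambda>s. mul (st s) a) \<longlongrightarrow> mul (st t) a) (at t)" for a
      by (rule mul_family_tendsto[where K=1, OF bd_measurable[OF bd_ct] abs_cos_le_one c],
          rule mul_family_tendsto[where K=1, OF bd_measurable[OF bd_st] abs_sin_le_one s])
    then show ?thesis unfolding U_def by (intro tendsto_Pair tendsto_diff tendsto_add)
  qed
  moreover have "((\<lambda>s. U s (z s - w)) \<longlongrightarrow> 0) (at t)"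
  proof (rule tendsto_0_le[where K=1])
    show "((\<lambda>s. z s - w) \<longlongrightarrow> 0) (at t)" using assms by (simp add: LIM_zero_iff)
  qed (simp add: norm_U)
  ultimately have "((\<lambda>s. U s (z s - w) + U s w) \<longlongrightarrow> 0 + U t w) (at t)" by (intro tendsto_add)
  then show ?thesis by (simp add: U_diff)
qed

lemma continuous_U:
  assumes "continuous_on UNIV z" shows "continuous_on UNIV (\<lambda>s. U s (z s))"
  using assms U_tendsto by (auto simp: continuous_on_def)

lemma continuous_U_uminus:
  assumes "continuous_on UNIV z" shows "continuous_on UNIV (\<lambda>s. U (t - s) (z s))"
proof -
  have "continuous_on UNIV (\<lambda>s. U s (z (t - s)))"
    by (intro continuous_U continuous_on_compose2[OF assms]) (auto intro: continuous_intros)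
  then have "continuous_on UNIV (\<lambda>s. U (t - s) (z (t - (t - s))))"
    by (rule continuous_on_compose2) (auto intro: continuous_intros)
  then show ?thesis by simp
qed

text \<open>A value of \<open>ft\<close> at \<xi> encodes the Hartley transform at both \<xi> and
  -\<xi>. Each complex identity therefore amounts to a real identity at \<xi> and at -\<xi>, and as
  it is to hold almost everywhere the two are interchanged by the reflection. What remains is the
  rotation by t \<sigma>(\<xi>) in the weighted coordinates.\<close>

lemma TT_eq_U_iff:
  assumes f: "f \<in> H1 \<times> L2" and g: "g \<in> H1 \<times> L2"
  shows "((AE \<xi> in lebesgue. fourier (fst g) \<xi> =
        of_real (cos (freq \<xi> * t)) * fourier (fst f) \<xi>
        + \<i> * of_real (\<xi> * sin (freq \<xi> * t) / freq \<xi>) * fourier (snd f) \<xi>) \<and>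
    (AE \<xi> in lebesgue. fourier (snd g) \<xi> =
        \<i> * of_real (\<xi> * (\<xi>\<^sup>2 + 2) * sin (freq \<xi> * t) / freq \<xi>) * fourier (fst f) \<xi>
        + of_real (cos (freq \<xi> * t)) * fourier (snd f) \<xi>)) \<longleftrightarrow> TT g = U t (TT f)"
proof -
  define a b c d where "a = hart (cl (fst f))" and "b = hart (cl (snd f))" and "c = hart (cl (fst g))" and "d = hart (cl (snd g))"
  have L: "fst f \<in> L2" "snd f \<in> L2" "fst g \<in> L2" "snd g \<in> L2" using f g by (auto simp: H1_iff mem_Times_iff)
  have xd: "(\<lambda>\<xi>. mw \<xi> * fn a \<xi>) \<in> L2" "(\<lambda>\<xi>. mw \<xi> * fn c \<xi>) \<in> L2"
    using f g by (auto simp: a_def c_def mw_L2_iff dom_def[symmetric] H1_iff mem_Times_iff)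
  note F = fourier_AE[OF L(1), folded a_def] fourier_AE[OF L(2), folded b_def] fourier_AE[OF L(3), folded c_def] fourier_AE[OF L(4), folded d_def]
  have ftI: "ft p \<xi> = ft q \<xi> \<longleftrightarrow> p \<xi> = q \<xi> \<and> p (- \<xi>) = q (- \<xi>)" for p q \<xi>
    unfolding ft_def by (auto simp: complex_eq_iff)
  have ft1: "of_real (cos (freq \<xi> * t)) * ft p \<xi> + \<i> * of_real (\<xi> * sin (freq \<xi> * t) / freq \<xi>) * ft q \<xi>
      = ft (\<lambda>\<xi>. ct t \<xi> * p \<xi> - st t \<xi> / mw \<xi> * q (- \<xi>)) \<xi>" for p q \<xi>
    unfolding cos_freq sin_freq by (simp add: ft_def complex_eq_iff field_simps)
  have sf: "\<xi> * (\<xi>\<^sup>2 + 2) * sin (freq \<xi> * t) / freq \<xi> = mw \<xi> * st t \<xi>" for \<xi>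
  proof -
    have "\<xi> * (\<xi>\<^sup>2 + 2) * sin (freq \<xi> * t) / freq \<xi> = (mw \<xi>)\<^sup>2 * (\<xi> * sin (freq \<xi> * t) / freq \<xi>)" by simp
    also have "\<dots> = mw \<xi> * st t \<xi>" unfolding sin_freq by (simp only: power2_eq_square) simp
    finally show ?thesis .
  qed
  have ft2: "\<i> * of_real (\<xi> * (\<xi>\<^sup>2 + 2) * sin (freq \<xi> * t) / freq \<xi>) * ft p \<xi> + of_real (cos (freq \<xi> * t)) * ft q \<xi>
      = ft (\<lambda>\<xi>. - (mw \<xi> * st t \<xi> * p (- \<xi>)) + ct t \<xi> * q \<xi>) \<xi>" for p q \<xi>
    unfolding cos_freq sf by (simp add: ft_def complex_eq_iff field_simps)
  have e1: "(AE \<xi> in lebesgue. fourier (fst g) \<xi> =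
        of_real (cos (freq \<xi> * t)) * fourier (fst f) \<xi>
        + \<i> * of_real (\<xi> * sin (freq \<xi> * t) / freq \<xi>) * fourier (snd f) \<xi>) \<longleftrightarrow>
      (AE \<xi> in lebesgue. fn c \<xi> = ct t \<xi> * fn a \<xi> - st t \<xi> / mw \<xi> * fn b (- \<xi>))" (is "?l1 \<longleftrightarrow> ?r1")
  proof
    assume ?l1
    then show ?r1 using F(1-3)
    proof eventually_elim
      case (elim \<xi>)
      show ?case using elim(1) unfolding elim(2-4) ft1 ftI by simp
    qed
  next
    assume r: ?r1
    show ?l1 using r AE_affine[OF _ r, of "-1" 0, simplified] F(1-3)
    proof eventually_elim
      case (elim \<xi>)
      show ?case unfolding elim(3-5) ft1 ftI using elim(1,2) by simp
    qed
  qed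
  have e2: "(AE \<xi> in lebesgue. fourier (snd g) \<xi> =
        \<i> * of_real (\<xi> * (\<xi>\<^sup>2 + 2) * sin (freq \<xi> * t) / freq \<xi>) * fourier (fst f) \<xi>
        + of_real (cos (freq \<xi> * t)) * fourier (snd f) \<xi>) \<longleftrightarrow>
      (AE \<xi> in lebesgue. fn d \<xi> = - (mw \<xi> * st t \<xi> * fn a (- \<xi>)) + ct t \<xi> * fn b \<xi>)" (is "?l2 \<longleftrightarrow> ?r2")
  proof
    assume ?l2
    then show ?r2 using F(1,2,4)
    proof eventually_elim
      case (elim \<xi>)
      show ?case using elim(1) unfolding elim(2-4) ft2 ftI by simp
    qed
  next
    assume r: ?r2
    show ?l2 using r AE_affine[OF _ r, of "-1" 0, simplified] F(1,2,4)
    proof eventually_elim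
      case (elim \<xi>)
      show ?case unfolding elim(3-5) ft2 ftI using elim(1,2) by simp
    qed
  qed
  have A: "?r1 \<longleftrightarrow> mul mw c = mul (ct t) (mul mw a) - mul (st t) (rfl b)"
  proof
    assume ?r1
    then show "mul mw c = mul (ct t) (mul mw a) - mul (st t) (rfl b)"
      using fn_mul[OF xd(2)] fn_mul[OF xd(1)] fn_mul_bd[OF bd_ct, of t "mul mw a"] fn_mul_bd[OF bd_st, of t "rfl b"] fn_rfl[of b]
        fn_diff[of "mul (ct t) (mul mw a)" "mul (st t) (rfl b)"]
      unfolding l2_eq_iff by eventually_elim (simp add: field_simps)
  next
    assume eq: "mul mw c = mul (ct t) (mul mw a) - mul (st t) (rfl b)"
    show ?r1
      using eq[unfolded l2_eq_iff] fn_mul[OF xd(2)] fn_mul[OF xd(1)] fn_mul_bd[OF bd_ct, of t "mul mw a"] fn_mul_bd[OF bd_st, of t "rfl b"] fn_rfl[of b]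
        fn_diff[of "mul (ct t) (mul mw a)" "mul (st t) (rfl b)"]
      by eventually_elim (simp add: field_simps)
  qed
  have B: "?r2 \<longleftrightarrow> rfl d = mul (st t) (mul mw a) + mul (ct t) (rfl b)"
  proof
    assume r: ?r2
    show "rfl d = mul (st t) (mul mw a) + mul (ct t) (rfl b)"
      using AE_affine[OF _ r, of "-1" 0, simplified] fn_rfl[of d] fn_mul[OF xd(1)] fn_mul_bd[OF bd_st, of t "mul mw a"] fn_mul_bd[OF bd_ct, of t "rfl b"] fn_rfl[of b]
        fn_add[of "mul (st t) (mul mw a)" "mul (ct t) (rfl b)"]
      unfolding l2_eq_iff by eventually_elim simp
  next
    assume eq: "rfl d = mul (st t) (mul mw a) + mul (ct t) (rfl b)"
    have "AE \<xi> in lebesgue. fn d (- \<xi>) = mw \<xi> * st t \<xi> * fn a \<xi> + ct t \<xi> * fn b (- \<xi>)"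
      using eq[unfolded l2_eq_iff] fn_rfl[of d] fn_mul[OF xd(1)] fn_mul_bd[OF bd_st, of t "mul mw a"] fn_mul_bd[OF bd_ct, of t "rfl b"] fn_rfl[of b]
        fn_add[of "mul (st t) (mul mw a)" "mul (ct t) (rfl b)"]
      by eventually_elim simp
    from AE_affine[OF _ this, of "-1" 0, simplified] show ?r2 by eventually_elim simp
  qed
  show ?thesis unfolding e1 e2 A B
    by (simp add: TT_def U_def a_def b_def c_def d_def)
qed

text \<open>Surjectivity of \<open>TT\<close> gives a state meeting the condition under the choice
  operator, so the chosen state meets it as well; by \<open>TT_eq_U_iff\<close> its coordinates are
  then known.\<close>

lemma free_group_TT:
  assumes f: "f \<in> H1 \<times> L2" shows "free_group t f \<in> H1 \<times> L2" "TT (free_group t f) = U t (TT f)"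
proof -
  define z where "z = U t (TT f)"
  have "free_group t f \<in> H1 \<times> L2 \<and> TT (free_group t f) = U t (TT f)"
    unfolding free_group_def
  proof (rule someI2[where a="(fn (u1 z), fn (u2 z))"])
    show "(fn (u1 z), fn (u2 z)) \<in> H1 \<times> L2 \<and>
    (AE \<xi> in lebesgue. fourier (fst (fn (u1 z), fn (u2 z))) \<xi> =
        of_real (cos (freq \<xi> * t)) * fourier (fst f) \<xi>
        + \<i> * of_real (\<xi> * sin (freq \<xi> * t) / freq \<xi>) * fourier (snd f) \<xi>) \<and>
    (AE \<xi> in lebesgue. fourier (snd (fn (u1 z), fn (u2 z))) \<xi> =
        \<i> * of_real (\<xi> * (\<xi>\<^sup>2 + 2) * sin (freq \<xi> * t) / freq \<xi>) * fourier (fst f) \<xi>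
        + of_real (cos (freq \<xi> * t)) * fourier (snd f) \<xi>)"
      using TT_surj[of z] TT_eq_U_iff[OF f TT_surj(1)[of z], of t] by (simp only: z_def)
  next
    fix g assume g: "g \<in> H1 \<times> L2 \<and>
    (AE \<xi> in lebesgue. fourier (fst g) \<xi> =
        of_real (cos (freq \<xi> * t)) * fourier (fst f) \<xi>
        + \<i> * of_real (\<xi> * sin (freq \<xi> * t) / freq \<xi>) * fourier (snd f) \<xi>) \<and>
    (AE \<xi> in lebesgue. fourier (snd g) \<xi> =
        \<i> * of_real (\<xi> * (\<xi>\<^sup>2 + 2) * sin (freq \<xi> * t) / freq \<xi>) * fourier (fst f) \<xi>
        + of_real (cos (freq \<xi> * t)) * fourier (snd f) \<xi>)"
    then show "g \<in> H1 \<times> L2 \<and> TT g = U t (TT f)"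
      using TT_eq_U_iff[OF f, of g t] by blast
  qed
  then show "free_group t f \<in> H1 \<times> L2" "TT (free_group t f) = U t (TT f)" by auto
qed

section \<open>The nonlinearity\<close>

definition dH :: "real \<Rightarrow> real" where "dH x = (1 - (H x)\<^sup>2) / sqrt 2"

lemma H_abs_less: "\<bar>H x\<bar> < 1"
  unfolding H_def using tanh_real_bounds[of "x / sqrt 2"] by auto

lemma H_abs_le: "\<bar>H x\<bar> \<le> 1"
  using H_abs_less[of x] by simp

lemma H_power2_less: "(H x)\<^sup>2 < 1"
  using H_abs_less[of x] by (simp add: abs_square_less_1)

lemma H_DERIV: "(H has_real_derivative dH x) (at x)"
  unfolding dH_def by (rule H_has_derivs(1))

lemma dH_DERIV: "(dH has_real_derivative (- H x + (H x) ^ 3)) (at x)"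
  unfolding dH_def[abs_def] by (rule H_has_derivs(2))

lemma continuous_H [continuous_intros]: "continuous_on S H"
  using DERIV_continuous_on_UNIV[OF H_DERIV] continuous_on_subset by blast

lemma continuous_dH [continuous_intros]: "continuous_on S dH"
  using DERIV_continuous_on_UNIV[OF dH_DERIV] continuous_on_subset by blast

lemma H_measurable [measurable]: "H \<in> borel_measurable lebesgue"
  by (intro continuous_lebesgue_measurable continuous_H)

lemma dH_pos: "0 < dH x"
  using H_power2_less[of x] by (simp add: dH_def)

lemma dH_le_1: "dH x \<le> 1"
proof -
  have "(1 - (H x)\<^sup>2) / sqrt 2 \<le> 1 / sqrt 2" by (intro divide_right_mono) auto
  also have "1 / sqrt 2 \<le> (1::real)" by simp
  finally show ?thesis by (simp add: dH_def)
qed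

lemma dH_abs_le: "\<bar>dH x\<bar> \<le> 1"
  using dH_pos[of x] dH_le_1[of x] by simp

lemma bd_H [simp]: "bd H"
  by (rule bd_continuous[OF continuous_H H_abs_le])

lemma bd_dH [simp]: "bd dH"
  by (rule bd_continuous[OF continuous_dH dH_abs_le])

lemma mul_diff_left: "bd p \<Longrightarrow> bd q \<Longrightarrow> mul (\<lambda>x. p x - q x) a = mul p a - mul q a"
  using mul_add_left[of p "\<lambda>x. - q x" a] by (simp add: mul_uminus_left bd_uminus)

definition sq :: "l2 \<Rightarrow> l2" where "sq u = mul (rep u) u"

definition Fu :: "l2 \<Rightarrow> l2"
  where "Fu u = 3 *\<^sub>R mul (\<lambda>x. (H x)\<^sup>2 - 1) u + mul (rep u) (sq u) + 3 *\<^sub>R mul H (sq u)"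

text \<open>With F(x, u) = 3 u (H^2 - 1) + u^2 (u + 3 H), \<open>gco\<close> is the partial
  derivative of F in u, and \<open>kco\<close> is the partial derivative of F in x divided by u. So
  \<open>dFu\<close> is the chain rule for F(x, u(x)).\<close>

definition gco :: "(real \<Rightarrow> real) \<Rightarrow> real \<Rightarrow> real"
  where "gco r x = 3 * ((H x)\<^sup>2 - 1) + 3 * (r x)\<^sup>2 + 6 * H x * r x"
definition kco :: "(real \<Rightarrow> real) \<Rightarrow> real \<Rightarrow> real"
  where "kco r x = 6 * H x * dH x + 3 * dH x * r x"

definition dFu :: "l2 \<Rightarrow> l2"
  where "dFu u = mul (gco (rep u)) (dx u) + mul (kco (rep u)) u"

lemma sq:
  assumes "dom u" shows "dom (sq u)" "dx (sq u) = 2 *\<^sub>R mul (rep u) (dx u)" "rep (sq u) = (\<lambda>x. (rep u x)\<^sup>2)"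
  using D_mul_rep[OF assms assms] by (simp_all add: sq_def power2_eq_square scaleR_2)

lemma bd_gco: "bd r \<Longrightarrow> bd (gco r)"
  unfolding gco_def[abs_def] by (intro bd_add bd_mult bd_diff bd_power bd_const bd_H)

lemma bd_kco: "bd r \<Longrightarrow> bd (kco r)"
  unfolding kco_def[abs_def] by (intro bd_add bd_mult bd_const bd_H bd_dH)

lemma fn_H_power: "bd (\<lambda>x. (H x)\<^sup>2 - 1)"
  by (intro bd_diff bd_power bd_const bd_H)

lemma Fu:
  assumes u: "dom u" shows "dom (Fu u)" "dx (Fu u) = dFu u" "rep (Fu u) = nonlin (rep u)"
proof -
  have p: "((\<lambda>x. (H x)\<^sup>2 - 1) has_real_derivative 2 * H y * dH y) (at y)" for y
    using H_DERIV[of y] by (auto intro!: derivative_eq_intros simp: power2_eq_square)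
  have pb: "\<bar>(H y)\<^sup>2 - 1\<bar> \<le> 1" for y using H_power2_less[of y] by (simp add: abs_if)
  have pb': "\<bar>2 * H y * dH y\<bar> \<le> 2" for y
    using mult_mono[OF H_abs_le dH_abs_le, of y y] by (simp add: abs_mult)
  have pm: "(\<lambda>y. 2 * H y * dH y) \<in> borel_measurable lebesgue"
    by (intro continuous_lebesgue_measurable continuous_intros)
  have dHm: "dH \<in> borel_measurable lebesgue" by (intro continuous_lebesgue_measurable continuous_dH)
  note 1 = D_mul_smooth[OF p pb pb' pm u]
  note s = sq[OF u]
  note 2 = D_mul_rep[OF u s(1)]
  note 3 = D_mul_smooth[OF H_DERIV H_abs_le dH_abs_le dHm s(1)]
  show d: "dom (Fu u)"
    unfolding Fu_def by (intro dom_add dom_scaleR 1 2 3)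
  show "rep (Fu u) = nonlin (rep u)"
    unfolding Fu_def rep_add[OF dom_add[OF dom_scaleR[OF 1(1)] 2(1)] dom_scaleR[OF 3(1)]]
      rep_add[OF dom_scaleR[OF 1(1)] 2(1)] rep_scaleR[OF 1(1)] rep_scaleR[OF 3(1)] 1(3) 2(3) 3(3) s(3)
    by (simp add: nonlin_def fun_eq_iff power2_eq_square algebra_simps)
  have b: "bd (rep u)" by (rule bd_rep[OF u])
  have bp': "bd (\<lambda>x. 2 * H x * dH x)" by (rule bd_continuous[OF _ pb']) (intro continuous_intros)
  \<comment> \<open>The product rules leave several nested multiplication operators; comparing
    representatives pointwise reduces the claim to a polynomial identity.\<close>
  have "AE x in lebesgue. fn (dx (Fu u)) x = fn (dFu u) x"
  proof -
    have e1: "dx (Fu u) = 3 *\<^sub>R (mul (\<lambda>x. (H x)\<^sup>2 - 1) (dx u) + mul (\<lambda>x. 2 * H x * dH x) u)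
        + (mul (rep u) (2 *\<^sub>R mul (rep u) (dx u)) + mul (\<lambda>x. (rep u x)\<^sup>2) (dx u))
        + 3 *\<^sub>R (mul H (2 *\<^sub>R mul (rep u) (dx u)) + mul dH (sq u))"
      unfolding Fu_def by (simp add: dx_add dx_scaleR dom_add dom_scaleR 1 2 3 s)
    show ?thesis
      unfolding e1 dFu_def
      using fn_add[of "3 *\<^sub>R (mul (\<lambda>x. (H x)\<^sup>2 - 1) (dx u) + mul (\<lambda>x. 2 * H x * dH x) u)
        + (mul (rep u) (2 *\<^sub>R mul (rep u) (dx u)) + mul (\<lambda>x. (rep u x)\<^sup>2) (dx u))" "3 *\<^sub>R (mul H (2 *\<^sub>R mul (rep u) (dx u)) + mul dH (sq u))"]
       fn_add[of "3 *\<^sub>R (mul (\<lambda>x. (H x)\<^sup>2 - 1) (dx u) + mul (\<lambda>x. 2 * H x * dH x) u)" "mul (rep u) (2 *\<^sub>R mul (rep u) (dx u)) + mul (\<lambda>x. (rep u x)\<^sup>2) (dx u)"]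
       fn_scaleR[of 3 "mul (\<lambda>x. (H x)\<^sup>2 - 1) (dx u) + mul (\<lambda>x. 2 * H x * dH x) u"]
       fn_scaleR[of 3 "mul H (2 *\<^sub>R mul (rep u) (dx u)) + mul dH (sq u)"]
       fn_add[of "mul (\<lambda>x. (H x)\<^sup>2 - 1) (dx u)" "mul (\<lambda>x. 2 * H x * dH x) u"]
       fn_add[of "mul (rep u) (2 *\<^sub>R mul (rep u) (dx u))" "mul (\<lambda>x. (rep u x)\<^sup>2) (dx u)"]
       fn_add[of "mul H (2 *\<^sub>R mul (rep u) (dx u))" "mul dH (sq u)"]
       fn_mul_bd[OF fn_H_power, of "dx u"] fn_mul_bd[OF bp', of u]
       fn_mul_bd[OF b, of "2 *\<^sub>R mul (rep u) (dx u)"] fn_scaleR[of 2 "mul (rep u) (dx u)"] fn_mul_bd[OF b, of "dx u"]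
       fn_mul_bd[OF bd_power[OF b, of 2], of "dx u"] fn_mul_bd[OF bd_H, of "2 *\<^sub>R mul (rep u) (dx u)"]
       fn_mul_bd[OF bd_dH, of "sq u"] fn_mul_bd[OF b, of u, folded sq_def] fn_rep[OF u]
       fn_add[of "mul (gco (rep u)) (dx u)" "mul (kco (rep u)) u"] fn_mul_bd[OF bd_gco[OF b], of "dx u"] fn_mul_bd[OF bd_kco[OF b], of u]
      by (eventually_elim) (simp add: gco_def kco_def power2_eq_square algebra_simps)
  qed
  then show "dx (Fu u) = dFu u" by (simp add: l2_eq_iff)
qed

text \<open>Four contributions: \<open>gco\<close> at one point, the increment of \<open>gco\<close>
  against the derivative, \<open>kco\<close> at one point, and the increment of \<open>kco\<close>.
  Here \<open>CS * R\<close> bounds the functions themselves.\<close>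

definition Lip :: "real \<Rightarrow> real"
  where "Lip R = (3 + 3 * (CS * R)\<^sup>2 + 6 * (CS * R)) + (6 * (CS * R) + 6) * CS * R + (6 + 3 * (CS * R)) + 3 * CS * R"

text \<open>Write the difference as g(u) w' + (g(u) - g(v)) v' + k(u) w + (k(u) - k(v)) v with w = u
  - v. The coefficients are polynomials in bounded functions, so the Sobolev embedding bounds them
  and their increments uniformly, and only v', w', v, w are measured in L2.\<close>

lemma dFu_lipschitz:
  assumes u: "dom u" "nH u \<le> R" and v: "dom v" "nH v \<le> R"
  shows "norm (dFu u - dFu v) \<le> Lip R * nH (u - v)"
proof -
  define M where "M = CS * R"
  define w where "w = u - v"
  have R: "0 \<le> R" using u(2) nH_nonneg order_trans by blast
  then have M: "0 \<le> M" by (simp add: M_def)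
  have w: "dom w" unfolding w_def by (rule dom_diff[OF u(1) v(1)])
  have ru: "\<bar>rep u x\<bar> \<le> M" for x
    using rep_bound[OF u(1), of x] mult_left_mono[OF u(2) CS_nonneg] by (simp add: M_def)
  have rv: "\<bar>rep v x\<bar> \<le> M" for x
    using rep_bound[OF v(1), of x] mult_left_mono[OF v(2) CS_nonneg] by (simp add: M_def)
  have rw: "rep w x = rep u x - rep v x" for x unfolding w_def using rep_diff[OF u(1) v(1)] by simp
  have rwb: "\<bar>rep u x - rep v x\<bar> \<le> CS * nH w" for x using rep_bound[OF w, of x] by (simp add: rw)
  have bu: "bd (rep u)" and bv: "bd (rep v)" using bd_rep u v by auto
  note bg = bd_gco[OF bu] bd_gco[OF bv] and bk = bd_kco[OF bu] bd_kco[OF bv]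
  have bg2: "bd (\<lambda>x. gco (rep u) x - gco (rep v) x)" and bk2: "bd (\<lambda>x. kco (rep u) x - kco (rep v) x)"
    by (intro bd_diff bg bk)+
  have eq: "dFu u - dFu v = mul (gco (rep u)) (dx w) + mul (\<lambda>x. gco (rep u) x - gco (rep v) x) (dx v)
      + mul (kco (rep u)) w + mul (\<lambda>x. kco (rep u) x - kco (rep v) x) v"
    unfolding dFu_def w_def dx_diff[OF u(1) v(1)]
    by (simp add: mul_diff[OF bg(1)] mul_diff[OF bk(1)] mul_diff_left[OF bg] mul_diff_left[OF bk])
  have r2: "\<bar>rep u x\<bar>\<^sup>2 \<le> M\<^sup>2" for x using ru[of x] by (intro power_mono) auto
  have g1: "\<bar>gco (rep u) x\<bar> \<le> 3 + 3 * M\<^sup>2 + 6 * M" for x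
  proof -
    have "\<bar>3 * ((H x)\<^sup>2 - 1)\<bar> \<le> 3" using H_power2_less[of x] by (simp add: abs_if)
    moreover have "\<bar>3 * (rep u x)\<^sup>2\<bar> \<le> 3 * M\<^sup>2" using r2[of x] by simp
    moreover have "\<bar>6 * H x * rep u x\<bar> \<le> 6 * M"
      using mult_mono[OF H_abs_le[of x] ru[of x]] by (simp add: abs_mult)
    ultimately show ?thesis unfolding gco_def by linarith
  qed
  have g2: "\<bar>gco (rep u) x - gco (rep v) x\<bar> \<le> (6 * M + 6) * (CS * nH w)" for x
  proof -
    have "gco (rep u) x - gco (rep v) x = (3 * (rep u x + rep v x) + 6 * H x) * (rep u x - rep v x)"
      by (simp add: gco_def power2_eq_square algebra_simps)
    moreover have "\<bar>3 * (rep u x + rep v x) + 6 * H x\<bar> \<le> 6 * M + 6"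
    proof (rule abs_leI)
      note b = abs_le_D1[OF ru[of x]] abs_le_D2[OF ru[of x]] abs_le_D1[OF rv[of x]] abs_le_D2[OF rv[of x]] abs_le_D1[OF H_abs_le[of x]] abs_le_D2[OF H_abs_le[of x]]
      show "3 * (rep u x + rep v x) + 6 * H x \<le> 6 * M + 6" using b by simp
      show "- (3 * (rep u x + rep v x) + 6 * H x) \<le> 6 * M + 6" using b by simp
    qed
    ultimately show ?thesis
      using mult_mono[OF _ rwb[of x], of "\<bar>3 * (rep u x + rep v x) + 6 * H x\<bar>" "6 * M + 6"] M by (simp add: abs_mult)
  qed
  have k1: "\<bar>kco (rep u) x\<bar> \<le> 6 + 3 * M" for x
  proof -
    have "\<bar>6 * H x * dH x\<bar> \<le> 6" using mult_mono[OF H_abs_le[of x] dH_abs_le[of x]] by (simp add: abs_mult)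
    moreover have "\<bar>3 * dH x * rep u x\<bar> \<le> 3 * M"
      using mult_mono[OF dH_abs_le[of x] ru[of x]] by (simp add: abs_mult)
    ultimately show ?thesis unfolding kco_def by linarith
  qed
  have k2: "\<bar>kco (rep u) x - kco (rep v) x\<bar> \<le> 3 * (CS * nH w)" for x
  proof -
    have "kco (rep u) x - kco (rep v) x = 3 * (dH x * (rep u x - rep v x))" by (simp add: kco_def algebra_simps)
    then show ?thesis using mult_mono[OF dH_abs_le[of x] rwb[of x]] by (simp add: abs_mult)
  qed
  have n: "norm (dx w) \<le> nH w" "norm w \<le> nH w" "norm (dx v) \<le> R" "norm v \<le> R"
    using norm_dx_le_nH norm_le_nH w v by (auto intro: order_trans)
  have tri: "norm (a + b + c + d) \<le> norm a + norm b + norm c + norm d" for a b c d :: l2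
    using norm_triangle_ineq[of "a + b + c" d] norm_triangle_ineq[of "a + b" c] norm_triangle_ineq[of a b] by linarith
  have "norm (dFu u - dFu v) \<le> norm (mul (gco (rep u)) (dx w)) + norm (mul (\<lambda>x. gco (rep u) x - gco (rep v) x) (dx v))
      + norm (mul (kco (rep u)) w) + norm (mul (\<lambda>x. kco (rep u) x - kco (rep v) x) v)"
    unfolding eq by (rule tri)
  also have "\<dots> \<le> (3 + 3 * M\<^sup>2 + 6 * M) * nH w + ((6 * M + 6) * (CS * nH w)) * R + (6 + 3 * M) * nH w + (3 * (CS * nH w)) * R"
  proof (intro add_mono)
    show "norm (mul (gco (rep u)) (dx w)) \<le> (3 + 3 * M\<^sup>2 + 6 * M) * nH w"
      by (rule order_trans[OF norm_mul_le[OF bd_measurable[OF bg(1)] g1] mult_left_mono[OF n(1)]])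
        (intro mult_nonneg_nonneg add_nonneg_nonneg; simp add: M)
    show "norm (mul (\<lambda>x. gco (rep u) x - gco (rep v) x) (dx v)) \<le> ((6 * M + 6) * (CS * nH w)) * R"
      by (rule order_trans[OF norm_mul_le[OF bd_measurable[OF bg2] g2] mult_left_mono[OF n(3)]])
        (intro mult_nonneg_nonneg add_nonneg_nonneg; simp add: M)
    show "norm (mul (kco (rep u)) w) \<le> (6 + 3 * M) * nH w"
      by (rule order_trans[OF norm_mul_le[OF bd_measurable[OF bk(1)] k1] mult_left_mono[OF n(2)]])
        (intro mult_nonneg_nonneg add_nonneg_nonneg; simp add: M)
    show "norm (mul (\<lambda>x. kco (rep u) x - kco (rep v) x) v) \<le> (3 * (CS * nH w)) * R"
      by (rule order_trans[OF norm_mul_le[OF bd_measurable[OF bk2] k2] mult_left_mono[OF n(4)]])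
        (intro mult_nonneg_nonneg add_nonneg_nonneg; simp add: M)
  qed
  also have "\<dots> = Lip R * nH w" by (simp add: Lip_def M_def algebra_simps)
  finally show ?thesis by (simp add: w_def)
qed

text \<open>The state (0, \<partial>x F(u1)) in the coordinates of \<open>TT\<close>.\<close>

definition N :: "l2 \<times> l2 \<Rightarrow> l2 \<times> l2" where "N z = (0, rfl (hart (dFu (u1 z))))"

lemma u1_diff: "u1 (z - w) = u1 z - u1 w"
  by (simp add: u1_def mul_diff[OF bd_inverse_mw] hart_diff)

lemma u2_diff: "u2 (z - w) = u2 z - u2 w"
  by (simp add: u2_def hart_diff linear_diff[OF bounded_linear.linear[OF bounded_linear_aff]])

lemma nH_u1_le: "nH (u1 z) \<le> norm z"
  by (rule power2_le_imp_le) (simp_all add: norm_u)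

lemma norm_u2_le: "norm (u2 z) \<le> norm z"
  by (rule power2_le_imp_le) (simp_all add: norm_u)

lemma rfl_diff: "rfl (a - b) = rfl a - rfl b"
  by (simp add: linear_diff[OF bounded_linear.linear[OF bounded_linear_aff]])

lemma N_lipschitz:
  assumes "norm z \<le> R" "norm w \<le> R" shows "norm (N z - N w) \<le> Lip R * norm (z - w)"
proof -
  have L: "0 \<le> Lip R" unfolding Lip_def
    using order_trans[OF norm_ge_zero assms(1)] by (intro add_nonneg_nonneg mult_nonneg_nonneg) auto
  have "norm (N z - N w) = norm (dFu (u1 z) - dFu (u1 w))"
    by (simp add: N_def norm_prod_def rfl_diff[symmetric] hart_diff[symmetric] norm_aff norm_hart)
  also have "\<dots> \<le> Lip R * nH (u1 z - u1 w)"
    by (rule dFu_lipschitz) (use assms nH_u1_le dom_u1 order_trans in blast)+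
  also have "\<dots> \<le> Lip R * norm (z - w)"
    unfolding u1_diff[symmetric] by (intro mult_left_mono nH_u1_le L)
  finally show ?thesis .
qed

lemma u1_0: "u1 0 = 0"
  using u1_diff[of 0 0] by simp

lemma mul_0_right: "bd p \<Longrightarrow> mul p 0 = 0"
  using mul_diff[of p 0 0] by simp

lemma N_0: "N 0 = 0"
proof -
  have b: "bd (rep 0)" by (rule bd_rep[OF dom_zero])
  have "dFu 0 = 0" by (simp add: dFu_def dx_zero mul_0_right bd_gco[OF b] bd_kco[OF b])
  then show ?thesis using hart_diff[of 0 0] rfl_diff[of 0 0] by (simp add: N_def u1_0[unfolded zero_prod_def] zero_prod_def)
qed

text \<open>\<open>nonlin\<close> is applied to an arbitrary representative and
  \<open>weak_deriv\<close> is a choice. Both ambiguities disappear in the class: \<open>Fu\<close>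
  gives the class of the function and \<open>weak_deriv_H1\<close> that of its derivative.\<close>

lemma N_eq_TT:
  assumes f: "f \<in> H1 \<times> L2"
  shows "((\<lambda>x. 0), weak_deriv (nonlin (fst f))) \<in> H1 \<times> L2" "TT ((\<lambda>x. 0), weak_deriv (nonlin (fst f))) = N (TT f)"
proof -
  define u where "u = cl (fst f)"
  have f1: "fst f \<in> L2" "dom u" using f by (auto simp: H1_iff mem_Times_iff u_def)
  have ae: "AE x in lebesgue. rep (Fu u) x = nonlin (fst f) x"
    using fn_rep[OF f1(2)] fn_cl[OF f1(1)] unfolding Fu(3)[OF f1(2)] u_def[symmetric]
    by eventually_elim (simp add: nonlin_def)
  have m: "nonlin (fst f) \<in> borel_measurable lebesgue"
    using L2_measurable[OF f1(1)] unfolding nonlin_def[abs_def] by measurable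
  have L: "nonlin (fst f) \<in> L2" by (rule L2_cong_AE[OF rep_L2[OF Fu(1)[OF f1(2)]] m ae])
  have e: "cl (nonlin (fst f)) = Fu u"
    using cl_cong[OF rep_L2[OF Fu(1)[OF f1(2)]] ae m] cl_rep[OF Fu(1)[OF f1(2)]] by simp
  have h: "nonlin (fst f) \<in> H1" using L e Fu(1)[OF f1(2)] by (simp add: H1_iff)
  have z: "(\<lambda>x. 0) \<in> H1" by (simp add: H1_iff cl_zero dom_zero)
  show "((\<lambda>x. 0), weak_deriv (nonlin (fst f))) \<in> H1 \<times> L2" using z weak_deriv_H1(1)[OF h] by simp
  have "hart 0 = 0" using hart_diff[of 0 0] by simp
  moreover have "mul mw 0 = 0" using norm_mul_mw[of "hart 0"] nH_power2[OF dom_zero] by (simp add: nH_def dx_zero \<open>hart 0 = 0\<close>)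
  ultimately show "TT ((\<lambda>x. 0), weak_deriv (nonlin (fst f))) = N (TT f)"
    using weak_deriv_H1(2)[OF h] by (simp add: TT_def[of "(\<lambda>x. 0, weak_deriv (nonlin (fst f)))"] N_def u1_TT[OF f] u_def[symmetric] e Fu(2)[OF f1(2)] cl_zero)
qed

section \<open>The Duhamel equation as an ordinary differential equation\<close>

text \<open>The sign in front of an integral over an ordinary interval is the same encoding of
  orientation as in \<open>has_X_integral\<close>.\<close>

definition J :: "(real \<Rightarrow> 'a::banach) \<Rightarrow> real \<Rightarrow> 'a"
  where "J f t = sgn t *\<^sub>R integral {min 0 t..max 0 t} f"

lemma J_0 [simp]: "J f 0 = 0"
  by (simp add: J_def)

lemma J_has_vector_derivative:
  assumes f: "continuous_on UNIV f" shows "(J f has_vector_derivative f t) (at t)"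
proof -
  define b where "b = \<bar>t\<bar> + 1"
  have i: "f integrable_on {c..d}" for c d
    by (intro integrable_continuous_real continuous_on_subset[OF f]) auto
  have eq: "integral {-b..s} f - integral {-b..0} f = J f s" if "s \<in> {-b<..<b}" for s
  proof (cases "s \<ge> 0")
    case True
    have "integral {-b..0} f + integral {0..s} f = integral {-b..s} f"
      by (rule Henstock_Kurzweil_Integration.integral_combine[OF _ True i]) (simp add: b_def)
    then show ?thesis using True by (cases "s = 0") (auto simp: J_def algebra_simps)
  next
    case False
    then have s: "s \<le> 0" "-b \<le> s" using that by auto
    have "integral {-b..s} f + integral {s..0} f = integral {-b..0} f"
      by (rule Henstock_Kurzweil_Integration.integral_combine[OF s(2,1) i])
    then show ?thesis using False by (auto simp: J_def algebra_simps)
  qed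
  have tb: "t \<in> {-b<..<b}" by (auto simp: b_def)
  have "((\<lambda>s. integral {-b..s} f) has_vector_derivative f t) (at t within {-b..b})"
    by (rule integral_has_vector_derivative[OF continuous_on_subset[OF f]]) (use tb in auto)
  moreover have "at t within {-b..b} = at t" using tb by (intro at_within_interior) (auto simp: interior_atLeastAtMost_real)
  ultimately have "((\<lambda>s. integral {-b..s} f - integral {-b..0} f) has_vector_derivative f t - 0) (at t)"
    by (intro has_vector_derivative_diff has_vector_derivative_const) simp
  then have "((\<lambda>s. integral {-b..s} f - integral {-b..0} f) has_vector_derivative f t) (at t)" by simp
  then show ?thesis
    by (rule has_vector_derivative_transform_within_open[where S="{-b<..<b}"]) (use tb eq in auto)
qed

lemma continuous_on_vector_derivative_UNIV:
  "(\<And>t. (f has_vector_derivative f' t) (at t)) \<Longrightarrow> continuous_on UNIV f"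
  by (meson continuous_at_imp_continuous_on has_vector_derivative_continuous)

text \<open>Integration of an exponential weight of rate \<open>l\<close> gains the factor 1 / l.
  This gain produces the contraction below.\<close>

lemma J_norm_le_exp:
  assumes f: "continuous_on UNIV f" and K: "\<And>s. norm (f s) \<le> K * exp (l * \<bar>s\<bar>)" "0 \<le> K" and l: "0 < l"
  shows "norm (J f t) \<le> K / l * exp (l * \<bar>t\<bar>)"
proof (cases "t = 0")
  case True
  then show ?thesis using K l by simp
next
  case False
  have *: "norm (J f (s * t) - J f (s * 0)) \<le> K / l * exp (l * t) - K / l * exp (l * 0)"
    if "t > 0" "s = 1 \<or> s = -1" for s t :: real
  proof (rule differentiable_bound_general[where f="\<lambda>t. J f (s * t)" and f'="\<lambda>t. s *\<^sub>R f (s * t)" and \<phi>'="\<lambda>t. K * exp (l * t)"])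
    have sd: "((\<lambda>t. s * t) has_vector_derivative s) (at x)" for x
      unfolding has_real_derivative_iff_has_vector_derivative[symmetric] by (auto intro!: derivative_eq_intros)
    have d: "((\<lambda>t. J f (s * t)) has_vector_derivative s *\<^sub>R f (s * x)) (at x)" for x
      using sd vector_diff_chain_at[of "\<lambda>t. s * t" s x "J f" "f (s * x)"] J_has_vector_derivative[OF f]
      by (simp add: comp_def)
    then show "((\<lambda>t. J f (s * t)) has_vector_derivative s *\<^sub>R f (s * x)) (at x)" for x .
    show "continuous_on {0..t} (\<lambda>t. J f (s * t))"
      using continuous_on_vector_derivative_UNIV[OF d] continuous_on_subset by blast
    show "continuous_on {0..t} (\<lambda>t. K / l * exp (l * t))" by (intro continuous_intros)
    show "((\<lambda>t. K / l * exp (l * t)) has_vector_derivative K * exp (l * x)) (at x)" for x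
      unfolding has_real_derivative_iff_has_vector_derivative[symmetric]
      using l by (auto intro!: derivative_eq_intros)
    show "norm (s *\<^sub>R f (s * x)) \<le> K * exp (l * x)" if "0 < x" for x
      using K(1)[of "s * x"] that \<open>s = 1 \<or> s = -1\<close> by auto
  qed (rule that)
  have "norm (J f t) \<le> K / l * exp (l * \<bar>t\<bar>) - K / l"
    using *[of t 1] *[of "-t" "-1"] False by (cases "t > 0") auto
  moreover have "0 \<le> K / l" using K l by simp
  ultimately show ?thesis by linarith
qed

text \<open>Picard iteration in a weighted supremum norm (Bielecki): functions growing at most like
  exp (l |t|) are represented as bounded continuous functions, and for large \<open>l\<close> the
  integral operator is a contraction on the whole line at once, without continuation of local
  solutions.\<close>

lemma global_lipschitz_ode:
  fixes G :: "real \<Rightarrow> 'a::banach \<Rightarrow> 'a"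
  assumes cont: "\<And>v. continuous_on UNIV v \<Longrightarrow> continuous_on UNIV (\<lambda>t. G t (v t))"
    and lip: "\<And>t x y. norm (G t x - G t y) \<le> L * norm (x - y)" and L: "L > 0" and zero: "\<And>t. G t 0 = 0"
  shows "\<exists>v. v 0 = x0 \<and> (\<forall>t. (v has_vector_derivative G t (v t)) (at t))"
proof -
  \<comment> \<open>The contraction factor is L / l = 1/2.\<close>
  define l where "l = 2 * L"
  have l: "l > 0" using L by (simp add: l_def)
  define V where "V w t = exp (l * \<bar>t\<bar>) *\<^sub>R apply_bcontfun w t" for w :: "real \<Rightarrow>\<^sub>C 'a" and t
  have Vc: "continuous_on UNIV (V w)" for w
    unfolding V_def[abs_def] by (intro continuous_intros) auto
  have Gc: "continuous_on UNIV (\<lambda>s. G s (V w s))" for w by (rule cont[OF Vc])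
  define \<Phi> where "\<Phi> w t = exp (- (l * \<bar>t\<bar>)) *\<^sub>R (x0 + J (\<lambda>s. G s (V w s)) t)" for w t
  have Jc: "continuous_on UNIV (J (\<lambda>s. G s (V w s)))" for w
    by (rule continuous_on_vector_derivative_UNIV[OF J_has_vector_derivative[OF Gc]])
  have \<Phi>b: "\<Phi> w \<in> bcontfun" for w
  proof (rule bcontfun_normI)
    show "continuous_on UNIV (\<Phi> w)" unfolding \<Phi>_def[abs_def] by (intro continuous_intros Jc)
    fix t
    have "norm (J (\<lambda>s. G s (V w s)) t) \<le> (L * norm w) / l * exp (l * \<bar>t\<bar>)"
    proof (rule J_norm_le_exp[OF Gc _ _ l])
      fix s
      have "norm (G s (V w s)) \<le> L * norm (V w s)" using lip[of s "V w s" 0] by (simp add: zero)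
      also have "norm (V w s) \<le> exp (l * \<bar>s\<bar>) * norm w"
        unfolding V_def by (simp add: norm_bounded)
      finally show "norm (G s (V w s)) \<le> L * norm w * exp (l * \<bar>s\<bar>)" using L by (simp add: ac_simps)
    qed (use L in simp)
    then have "norm (x0 + J (\<lambda>s. G s (V w s)) t) \<le> norm x0 * exp (l * \<bar>t\<bar>) + (L * norm w) / l * exp (l * \<bar>t\<bar>)"
    proof (intro norm_triangle_le add_mono)
      have "norm x0 * 1 \<le> norm x0 * exp (l * \<bar>t\<bar>)" using l by (intro mult_left_mono) auto
      then show "norm x0 \<le> norm x0 * exp (l * \<bar>t\<bar>)" by simp
    qed
    then have "exp (- (l * \<bar>t\<bar>)) * norm (x0 + J (\<lambda>s. G s (V w s)) t) \<le> exp (- (l * \<bar>t\<bar>)) * ((norm x0 + (L * norm w) / l) * exp (l * \<bar>t\<bar>))"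
      by (intro mult_left_mono) (auto simp: algebra_simps)
    also have "\<dots> = norm x0 + (L * norm w) / l" by (simp add: exp_minus field_simps)
    finally show "norm (\<Phi> w t) \<le> norm x0 + (L * norm w) / l" by (simp add: \<Phi>_def)
  qed
  have ap: "apply_bcontfun (Bcontfun (\<Phi> w)) = \<Phi> w" for w by (rule Bcontfun_inverse[OF \<Phi>b])
  have "\<exists>!w. Bcontfun (\<Phi> w) = w"
  proof (rule banach_fix_type[where c="1/2"], simp_all, intro allI)
    fix w w'
    show "dist (Bcontfun (\<Phi> w)) (Bcontfun (\<Phi> w')) * 2 \<le> dist w w'"
    proof -
      have "dist (Bcontfun (\<Phi> w)) (Bcontfun (\<Phi> w')) \<le> dist w w' / 2"
      proof (rule dist_bound)
        fix t
        have gd: "continuous_on UNIV (\<lambda>s. G s (V w s) - G s (V w' s))" by (intro continuous_on_diff Gc)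
        have "J (\<lambda>s. G s (V w s)) t - J (\<lambda>s. G s (V w' s)) t = J (\<lambda>s. G s (V w s) - G s (V w' s)) t"
          unfolding J_def scaleR_diff_right[symmetric]
          by (subst integral_diff) (auto intro!: integrable_continuous_real continuous_on_subset[OF Gc])
        moreover have "norm (J (\<lambda>s. G s (V w s) - G s (V w' s)) t) \<le> (L * dist w w') / l * exp (l * \<bar>t\<bar>)"
        proof (rule J_norm_le_exp[OF gd _ _ l])
          fix s
          have "norm (G s (V w s) - G s (V w' s)) \<le> L * norm (V w s - V w' s)" by (rule lip)
          also have "norm (V w s - V w' s) \<le> exp (l * \<bar>s\<bar>) * dist w w'"
            unfolding V_def scaleR_diff_right[symmetric] by (simp add: dist_norm[symmetric] dist_bounded)
          finally show "norm (G s (V w s) - G s (V w' s)) \<le> L * dist w w' * exp (l * \<bar>s\<bar>)" using L by (simp add: ac_simps)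
        qed (use L in simp)
        ultimately have *: "norm (J (\<lambda>s. G s (V w s)) t - J (\<lambda>s. G s (V w' s)) t) \<le> (dist w w' / 2) * exp (l * \<bar>t\<bar>)"
          using L by (simp add: l_def)
        have "dist (\<Phi> w t) (\<Phi> w' t) = exp (- (l * \<bar>t\<bar>)) * norm (J (\<lambda>s. G s (V w s)) t - J (\<lambda>s. G s (V w' s)) t)"
          by (simp add: \<Phi>_def dist_norm scaleR_diff_right[symmetric])
        also have "\<dots> \<le> exp (- (l * \<bar>t\<bar>)) * ((dist w w' / 2) * exp (l * \<bar>t\<bar>))"
          using * by (intro mult_left_mono) auto
        also have "\<dots> = dist w w' / 2" by (simp add: exp_minus field_simps)
        finally show "dist (apply_bcontfun (Bcontfun (\<Phi> w)) t) (apply_bcontfun (Bcontfun (\<Phi> w')) t) \<le> dist w w' / 2"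
          by (simp add: ap)
      qed
      then show ?thesis by simp
    qed
  qed
  then obtain w where w: "Bcontfun (\<Phi> w) = w" by blast
  have fx: "V w t = x0 + J (\<lambda>s. G s (V w s)) t" for t
  proof -
    have "V w t = exp (l * \<bar>t\<bar>) *\<^sub>R \<Phi> w t" unfolding V_def using ap[of w] w by simp
    then show ?thesis by (simp add: \<Phi>_def exp_minus)
  qed
  have "(V w has_vector_derivative 0 + G t (V w t)) (at t)" for t
    by (subst fx[abs_def]) (intro has_vector_derivative_add has_vector_derivative_const J_has_vector_derivative Gc)
  then show ?thesis using fx[of 0] by (intro exI[of _ "V w"]) simp
qed

text \<open>From 0 the function y exp (-K |t|) is nonincreasing in both time directions;
  \<open>s = -1\<close> stands for the reversed one.\<close>

lemma gronwall:
  fixes y y' :: "real \<Rightarrow> real"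
  assumes d: "\<And>t. (y has_real_derivative y' t) (at t)" and b: "\<And>t. \<bar>t\<bar> \<le> T \<Longrightarrow> \<bar>y' t\<bar> \<le> K * y t" and t: "\<bar>t\<bar> \<le> T"
  shows "y t \<le> y 0 * exp (K * \<bar>t\<bar>)"
proof -
  have *: "y (s * t) * exp (- (K * t)) \<le> y (s * 0) * exp (- (K * 0))" if "0 \<le> t" "t \<le> T" "s = 1 \<or> s = -1" for s t
  proof (rule DERIV_nonpos_imp_nonincreasing[OF that(1)])
    fix x assume x: "0 \<le> x" "x \<le> t"
    have "((\<lambda>t. y (s * t)) has_real_derivative y' (s * x) * s) (at x)"
      by (rule DERIV_chain2[OF d]) (auto intro!: derivative_eq_intros)
    then have "((\<lambda>t. y (s * t) * exp (- (K * t))) has_real_derivative (y' (s * x) * s) * exp (- (K * x)) + (exp (- (K * x)) * (- K)) * y (s * x)) (at x)"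
      by (rule DERIV_mult) (auto intro!: derivative_eq_intros)
    moreover have "y' (s * x) * s \<le> K * y (s * x)"
      using b[of "s * x"] x that(2,3) by auto
    then have "(y' (s * x) * s) * exp (- (K * x)) + (exp (- (K * x)) * (- K)) * y (s * x) \<le> 0"
      using mult_right_mono[of "y' (s * x) * s" "K * y (s * x)" "exp (- (K * x))"] by (simp add: algebra_simps)
    ultimately show "\<exists>z. ((\<lambda>t. y (s * t) * exp (- (K * t))) has_real_derivative z) (at x) \<and> z \<le> 0" by blast
  qed
  have "y t * exp (- (K * \<bar>t\<bar>)) \<le> y 0"
    using *[of t 1] *[of "-t" "-1"] t by (cases "t \<ge> 0") auto
  then have "y t * exp (- (K * \<bar>t\<bar>)) * exp (K * \<bar>t\<bar>) \<le> y 0 * exp (K * \<bar>t\<bar>)" by (intro mult_right_mono) auto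
  then show ?thesis by (simp add: exp_minus field_simps)
qed

text \<open>Radial retraction onto the ball of radius \<open>R\<close>. Composition with it makes
  the locally Lipschitz \<open>N\<close> globally Lipschitz without changing it on the ball.\<close>

definition trunc :: "real \<Rightarrow> 'a::real_normed_vector \<Rightarrow> 'a"
  where "trunc R z = (if norm z \<le> R then z else (R / norm z) *\<^sub>R z)"

lemma norm_trunc: "0 \<le> R \<Longrightarrow> norm (trunc R z) \<le> R"
  by (auto simp: trunc_def)

lemma trunc_lipschitz:
  assumes R: "0 < R" shows "norm (trunc R z - trunc R w) \<le> 2 * norm (z - w)"
proof -
  have mixed: "norm ((R / norm z) *\<^sub>R z - w) \<le> 2 * norm (z - w)" if "norm z > R" "norm w \<le> R" for z w :: 'a
  proof -
    have "(R / norm z) *\<^sub>R z - w = (R / norm z - 1) *\<^sub>R z + (z - w)" by (simp add: algebra_simps)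
    then have "norm ((R / norm z) *\<^sub>R z - w) \<le> norm ((R / norm z - 1) *\<^sub>R z) + norm (z - w)" by (simp only: norm_triangle_ineq)
    also have "norm ((R / norm z - 1) *\<^sub>R z) = norm z - R"
      unfolding norm_scaleR using that(1) R by (auto simp: abs_if field_simps)
    also have "norm z - R \<le> norm (z - w)" using norm_triangle_ineq2[of z w] that(2) by simp
    finally show ?thesis by simp
  qed
  consider "norm z \<le> R" "norm w \<le> R" | "norm z > R" "norm w \<le> R" | "norm z \<le> R" "norm w > R" | "norm z > R" "norm w > R" by linarith
  then show ?thesis
  proof cases
    case 1 then show ?thesis by (simp add: trunc_def)
  next
    case 2 then show ?thesis using mixed[of z w] by (simp add: trunc_def)
  next
    case 3 then show ?thesis using mixed[of w z] by (simp add: trunc_def norm_minus_commute)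
  next
    case 4
    then have pos: "norm z > 0" "norm w > 0" using R by linarith+
    have "(R / norm z) *\<^sub>R z - (R / norm w) *\<^sub>R w = (R / norm z) *\<^sub>R (z - w) + (R / norm z - R / norm w) *\<^sub>R w"
      by (simp add: algebra_simps)
    then have "norm ((R / norm z) *\<^sub>R z - (R / norm w) *\<^sub>R w) \<le> norm ((R / norm z) *\<^sub>R (z - w)) + norm ((R / norm z - R / norm w) *\<^sub>R w)"
      by (simp only: norm_triangle_ineq)
    also have "norm ((R / norm z - R / norm w) *\<^sub>R w) = R / norm z * \<bar>norm w - norm z\<bar>"
    proof -
      have "(R / norm z - R / norm w) * norm w = R / norm z * (norm w - norm z)" using pos by (simp add: field_simps)
      then have "\<bar>R / norm z - R / norm w\<bar> * norm w = R / norm z * \<bar>norm w - norm z\<bar>"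
        using R pos by (metis abs_mult abs_norm_cancel abs_of_pos divide_pos_pos)
      then show ?thesis by simp
    qed
    also have "\<dots> \<le> R / norm z * norm (z - w)"
      using norm_triangle_ineq3[of z w] R by (intro mult_left_mono) (auto simp: abs_minus_commute)
    also have "norm ((R / norm z) *\<^sub>R (z - w)) = R / norm z * norm (z - w)" using R by simp
    also have "R / norm z * norm (z - w) + R / norm z * norm (z - w) \<le> 1 * norm (z - w) + 1 * norm (z - w)"
      using 4 R pos by (intro add_mono mult_right_mono) (auto simp: divide_le_eq)
    finally show ?thesis using 4 by (simp add: trunc_def)
  qed
qed

lemma truncated_solution_ex:
  assumes R: "0 < R"
  shows "\<exists>v. v 0 = z0 \<and> (\<forall>t. (v has_vector_derivative U (- t) (N (trunc R (U t (v t))))) (at t))"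
proof -
  define G where "G t v = U (- t) (N (trunc R (U t v)))" for t v
  have Lp: "0 \<le> Lip R" unfolding Lip_def using R by (intro add_nonneg_nonneg mult_nonneg_nonneg) auto
  have Nl: "norm (N (trunc R z) - N (trunc R w)) \<le> 2 * Lip R * norm (z - w)" for z w
  proof -
    have "norm (N (trunc R z) - N (trunc R w)) \<le> Lip R * norm (trunc R z - trunc R w)"
      by (rule N_lipschitz) (use R norm_trunc in \<open>auto intro: less_imp_le\<close>)
    also have "\<dots> \<le> Lip R * (2 * norm (z - w))" by (intro mult_left_mono trunc_lipschitz R Lp)
    finally show ?thesis by (simp add: ac_simps)
  qed
  have Nc: "continuous_on UNIV (\<lambda>z. N (trunc R z))"
  proof (rule lipschitz_on_continuous_on[where L="2 * Lip R"], rule lipschitz_onI)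
    show "dist (N (trunc R x)) (N (trunc R y)) \<le> 2 * Lip R * dist x y" for x y using Nl by (simp add: dist_norm)
  qed (use Lp in simp)
  have "\<exists>v. v 0 = z0 \<and> (\<forall>t. (v has_vector_derivative G t (v t)) (at t))"
  proof (rule global_lipschitz_ode[where L="2 * Lip R + 1"])
    fix v :: "real \<Rightarrow> l2 \<times> l2" assume v: "continuous_on UNIV v"
    have "continuous_on UNIV (\<lambda>t. N (trunc R (U t (v t))))"
      by (rule continuous_on_compose2[OF Nc continuous_U[OF v]]) auto
    from continuous_U_uminus[OF this, of 0] show "continuous_on UNIV (\<lambda>t. G t (v t))" by (simp add: G_def)
  next
    fix t x y
    have "norm (G t x - G t y) = norm (N (trunc R (U t x)) - N (trunc R (U t y)))"
      by (simp add: G_def U_diff[symmetric] norm_U)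
    also have "\<dots> \<le> 2 * Lip R * norm (U t x - U t y)" by (rule Nl)
    also have "\<dots> \<le> (2 * Lip R + 1) * norm (x - y)" by (simp add: U_diff[symmetric] norm_U mult_right_mono)
    finally show "norm (G t x - G t y) \<le> (2 * Lip R + 1) * norm (x - y)" .
  next
    have U0: "U s 0 = 0" for s using U_diff[of s 0 0] by simp
    show "G t 0 = 0" for t using R by (simp add: G_def U0 trunc_def N_0)
  qed (use Lp in simp)
  then show ?thesis by (simp add: G_def)
qed

lemma DERIV_norm_power2:
  fixes v :: "real \<Rightarrow> 'a::real_inner"
  assumes "(v has_vector_derivative v') (at t)"
  shows "((\<lambda>t. (norm (v t))\<^sup>2) has_real_derivative 2 * inner (v t) v') (at t)"
proof -
  have "((\<lambda>t. inner (v t) (v t)) has_vector_derivative inner (v t) v' + inner v' (v t)) (at t)"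
    by (rule bounded_bilinear.has_vector_derivative[OF bounded_bilinear_inner assms assms])
  then show ?thesis
    by (simp add: power2_norm_eq_inner has_real_derivative_iff_has_vector_derivative inner_commute)
qed

text \<open>Solutions on \<open>[-T, T]\<close> in the interaction picture; the derivative outside is irrelevant.\<close>

lemma solution_unique:
  assumes v: "\<And>t. (v has_vector_derivative v' t) (at t)" "\<And>t. \<bar>t\<bar> \<le> T \<Longrightarrow> v' t = U (- t) (N (U t (v t)))"
    and w: "\<And>t. (w has_vector_derivative w' t) (at t)" "\<And>t. \<bar>t\<bar> \<le> T \<Longrightarrow> w' t = U (- t) (N (U t (w t)))"
    and eq: "v 0 = w 0" and t: "\<bar>t\<bar> \<le> T"
  shows "v t = w t"
proof -
  have vc: "continuous_on UNIV v" and wc: "continuous_on UNIV w"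
    using v(1) w(1) continuous_on_vector_derivative_UNIV by auto
  have "bounded (v ` {-T..T})" "bounded (w ` {-T..T})"
    by (intro compact_imp_bounded compact_continuous_image continuous_on_subset[OF vc] continuous_on_subset[OF wc]; simp)+
  then obtain B C where B: "\<forall>x\<in>v ` {-T..T}. norm x \<le> B" and C: "\<forall>x\<in>w ` {-T..T}. norm x \<le> C"
    unfolding bounded_iff by blast
  define R where "R = max B C"
  have bv: "norm (v s) \<le> R" and bw: "norm (w s) \<le> R" if "\<bar>s\<bar> \<le> T" for s
    using B C that by (auto simp: R_def abs_le_iff le_max_iff_disj)
  have R: "0 \<le> R" using bv[OF t] norm_ge_zero order_trans by blast
  define d where "d s = v s - w s" for s
  have dd: "(d has_vector_derivative v' s - w' s) (at s)" for s
    unfolding d_def[abs_def] by (intro has_vector_derivative_diff v w)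
  have "(norm (d t))\<^sup>2 \<le> (norm (d 0))\<^sup>2 * exp (2 * Lip R * \<bar>t\<bar>)"
  proof (rule gronwall[OF DERIV_norm_power2[OF dd] _ t])
    fix s assume s: "\<bar>s\<bar> \<le> T"
    have "norm (v' s - w' s) = norm (N (U s (v s)) - N (U s (w s)))"
      by (simp add: v(2)[OF s] w(2)[OF s] U_diff[symmetric] norm_U)
    also have "\<dots> \<le> Lip R * norm (U s (v s) - U s (w s))"
      by (rule N_lipschitz) (simp_all add: norm_U bv bw s)
    also have "\<dots> = Lip R * norm (d s)" by (simp add: U_diff[symmetric] norm_U d_def)
    finally have n: "norm (v' s - w' s) \<le> Lip R * norm (d s)" .
    have "\<bar>2 * inner (d s) (v' s - w' s)\<bar> \<le> 2 * (norm (d s) * norm (v' s - w' s))"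
      using Cauchy_Schwarz_ineq2[of "d s" "v' s - w' s"] by (simp add: abs_mult)
    also have "\<dots> \<le> 2 * (norm (d s) * (Lip R * norm (d s)))" using n by (intro mult_left_mono) auto
    finally show "\<bar>2 * inner (d s) (v' s - w' s)\<bar> \<le> 2 * Lip R * (norm (d s))\<^sup>2" by (simp add: power2_eq_square ac_simps)
  qed
  then show ?thesis using eq by (simp add: d_def)
qed

section \<open>Conservation of energy and global solutions\<close>

lemma inner_u1: "inner h (u1 z) = inner (mul (\<lambda>\<xi>. 1 / mw \<xi>) (hart h)) (fst z)"
  by (simp add: u1_def hart_selfadjoint[symmetric] inner_mul_right[OF bd_inverse_mw])

lemma inner_dx_u2: "dom h \<Longrightarrow> inner (dx h) (u2 z) = inner (xm (hart h)) (snd z)"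
  by (simp add: u2_def hart_selfadjoint[symmetric] inner_rfl_left[symmetric] rfl_hart_dx)

lemma mul_st_minus: "mul (st (- t)) a = - mul (st t) a"
  using mul_uminus_left[OF bd_st[of t]] by simp

text \<open>The equation \<partial>t u1 = \<partial>x u2, tested with a fixed \<open>h\<close> in
  \<open>dom\<close>. The group is moved onto (k, 0), where \<open>k\<close> is the transform of
  \<open>h\<close> divided by \<open>mw\<close>; there it can be differentiated, because \<sigma> k
  = \<xi> times the transform of \<open>h\<close> is in L2. The forcing drops out as its first
  component is 0.\<close>

lemma weak_equation:
  assumes v: "(v has_vector_derivative U (- t) (0, p)) (at t)" and h: "dom h"
  shows "((\<lambda>t. inner h (u1 (U t (v t)))) has_real_derivative - inner (dx h) (u2 (U t (v t)))) (at t)"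
proof -
  define k where "k = mul (\<lambda>\<xi>. 1 / mw \<xi>) (hart h)"
  define q where "q = xm (hart h)"
  have xd: "xdom (hart h)" using h by (simp add: dom_def)
  have ae: "AE \<xi> in lebesgue. \<xi> * fn (hart h) \<xi> = \<sigma> \<xi> * fn k \<xi>"
    using fn_mul_bd[OF bd_inverse_mw, of "hart h"] by eventually_elim (simp add: k_def \<sigma>_def)
  have m: "(\<lambda>\<xi>. \<sigma> \<xi> * fn k \<xi>) \<in> borel_measurable lebesgue"
    by (intro borel_measurable_times \<sigma>_measurable fn_measurable)
  have L: "(\<lambda>\<xi>. \<sigma> \<xi> * fn k \<xi>) \<in> L2" using L2_cong_AE[OF _ m ae] xd by (simp add: xdom_def)
  have \<sigma>k: "mul \<sigma> k = q" unfolding mul_def q_def xm_def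
    using cl_cong[OF _ ae m] xd by (simp add: xdom_def)
  have eq: "inner h (u1 (U s w)) = inner (mul (ct s) k, - mul (st s) k) w" for s w
  proof -
    have "inner h (u1 (U s w)) = inner (U s w) (k, 0)" by (cases "U s w") (simp add: inner_u1 k_def inner_commute)
    also have "\<dots> = inner w (U (- s) (k, 0))" by (rule inner_U)
    also have "U (- s) (k, 0) = (mul (ct s) k, - mul (st s) k)"
      by (simp add: U_def mul_0_right mul_st_minus[of s, simplified] mul_uminus_left)
    finally show ?thesis by (simp add: inner_commute)
  qed
  have d: "((\<lambda>s. (mul (ct s) k, - mul (st s) k)) has_vector_derivative (- mul (st t) q, - mul (ct t) q)) (at t)"
    using mul_cos_has_vector_derivative[OF \<sigma>_measurable L, of t] mul_sin_has_vector_derivative[OF \<sigma>_measurable L, of t]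
    unfolding \<sigma>k by (intro has_vector_derivative_Pair has_vector_derivative_minus)
  have "((\<lambda>s. inner (mul (ct s) k, - mul (st s) k) (v s)) has_vector_derivative
     inner (mul (ct t) k, - mul (st t) k) (U (- t) (0, p)) + inner (- mul (st t) q, - mul (ct t) q) (v t)) (at t)"
    by (rule bounded_bilinear.has_vector_derivative[OF bounded_bilinear_inner d v])
  moreover have "inner (mul (ct t) k, - mul (st t) k) (U (- t) (0, p)) = 0"
    unfolding eq[symmetric] U_U by (simp add: U_0 inner_u1)
  moreover have "inner (- mul (st t) q, - mul (ct t) q) (v t) = - inner (dx h) (u2 (U t (v t)))"
  proof -
    have "(- mul (st t) q, - mul (ct t) q) = U (- t) (0, - q)"
      by (simp add: U_def mul_0_right mul_st_minus[of t, simplified] mul_uminus mul_uminus_left)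
    then have "inner (- mul (st t) q, - mul (ct t) q) (v t) = inner (0, - q) (U t (v t))"
      using inner_U[of "-t" "(0, - q)" "v t"] by simp
    also have "\<dots> = - inner q (snd (U t (v t)))" by (cases "U t (v t)") simp
    finally show ?thesis by (simp add: inner_dx_u2[OF h] q_def)
  qed
  ultimately show ?thesis by (simp add: eq has_real_derivative_iff_has_vector_derivative)
qed

text \<open>The test function is the increment \<open>w\<close> itself, frozen in time. Since
  \<open>dx w\<close> stays bounded, this gives Holder continuity of exponent 1/2 in L2; when
  moreover \<open>dx w\<close> tends to 0, the squared norm is o(|t - s|).\<close>

lemma u1_increment:
  assumes v: "\<And>t. (v has_vector_derivative U (- t) (0, p t)) (at t)"
    and B: "\<And>\<tau>. \<bar>\<tau> - s\<bar> \<le> \<bar>t - s\<bar> \<Longrightarrow> norm (u2 (U \<tau> (v \<tau>))) \<le> B"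
  defines "w \<equiv> u1 (U t (v t)) - u1 (U s (v s))"
  shows "(norm w)\<^sup>2 \<le> \<bar>t - s\<bar> * (norm (dx w) * B)"
proof -
  have w: "dom w" unfolding w_def by (intro dom_diff dom_u1)
  define \<theta> where "\<theta> \<tau> = inner w (u1 (U \<tau> (v \<tau>)))" for \<tau>
  have "norm (\<theta> t - \<theta> s) \<le> (norm (dx w) * B) * norm (t - s)"
  proof (rule field_differentiable_bound[where S="{min s t..max s t}" and f'="\<lambda>\<tau>. - inner (dx w) (u2 (U \<tau> (v \<tau>)))"])
    show "(\<theta> has_real_derivative - inner (dx w) (u2 (U \<tau> (v \<tau>)))) (at \<tau> within {min s t..max s t})" for \<tau>
      unfolding \<theta>_def[abs_def] by (rule has_field_derivative_at_within[OF weak_equation[OF v w]])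
    fix \<tau> assume "\<tau> \<in> {min s t..max s t}"
    then have "norm (u2 (U \<tau> (v \<tau>))) \<le> B" by (intro B) auto
    then have "norm (dx w) * norm (u2 (U \<tau> (v \<tau>))) \<le> norm (dx w) * B" by (intro mult_left_mono) auto
    then show "norm (- inner (dx w) (u2 (U \<tau> (v \<tau>)))) \<le> norm (dx w) * B"
      using Cauchy_Schwarz_ineq2[of "dx w" "u2 (U \<tau> (v \<tau>))"] by simp
  qed auto
  moreover have "\<theta> t - \<theta> s = (norm w)\<^sup>2"
    by (simp add: \<theta>_def w_def inner_diff_right power2_norm_eq_inner)
  ultimately show ?thesis by (simp add: mult.commute)
qed

text \<open>A chain rule although \<open>u1\<close> need not be differentiable in time. The linear
  part is differentiated by \<open>weak_equation\<close> with the fixed test function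
  \<open>f u\<close>; the quadratic remainder is at most C |s - t| |dx w| R by
  \<open>u1_increment\<close>, and \<open>dx w\<close> tends to 0 by continuity in the energy
  norm.\<close>

lemma functional_DERIV:
  assumes v: "\<And>t. (v has_vector_derivative U (- t) (0, p t)) (at t)"
    and dom: "\<And>u. dom u \<Longrightarrow> dom (f u)"
    and C: "\<And>R. \<exists>C\<ge>0. \<forall>u w. dom u \<longrightarrow> dom w \<longrightarrow> nH u \<le> R \<longrightarrow> nH w \<le> R \<longrightarrow>
       \<bar>\<Phi> w - \<Phi> u - inner (f u) (w - u)\<bar> \<le> C * (norm (w - u))\<^sup>2"
  shows "((\<lambda>t. \<Phi> (u1 (U t (v t)))) has_real_derivative - inner (dx (f (u1 (U t (v t))))) (u2 (U t (v t)))) (at t)"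
proof -
  define z where "z \<tau> = U \<tau> (v \<tau>)" for \<tau>
  define R where "R = norm (v t) + 1"
  have vc: "continuous_on UNIV v" by (rule continuous_on_vector_derivative_UNIV[OF v])
  have zc: "continuous_on UNIV z" unfolding z_def[abs_def] by (rule continuous_U[OF vc])
  obtain C where C0: "C \<ge> 0" and C: "\<And>u w. dom u \<Longrightarrow> dom w \<Longrightarrow> nH u \<le> R \<Longrightarrow> nH w \<le> R \<Longrightarrow>
       \<bar>\<Phi> w - \<Phi> u - inner (f u) (w - u)\<bar> \<le> C * (norm (w - u))\<^sup>2" using C[of R] by blast
  have "((\<lambda>s. norm (z s)) \<longlongrightarrow> norm (z t)) (at t)" using zc by (intro tendsto_norm) (auto simp: continuous_on_def)
  then have "\<forall>\<^sub>F s in at t. norm (z s) < R" by (rule order_tendstoD) (simp add: z_def norm_U R_def)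
  then obtain d where d: "d > 0" "\<And>s. s \<noteq> t \<Longrightarrow> dist s t < d \<Longrightarrow> norm (z s) < R" unfolding eventually_at by auto
  have zR: "norm (z s) \<le> R" if "\<bar>s - t\<bar> < d" for s
    using d(2)[of s] that by (cases "s = t") (auto simp: dist_real_def z_def norm_U R_def less_imp_le)
  define h where "h = f (u1 (z t))"
  have h: "dom h" unfolding h_def by (intro dom dom_u1)
  define A where "A s = (\<Phi> (u1 (z s)) - \<Phi> (u1 (z t))) / (s - t)" for s
  define B where "B s = (inner h (u1 (z s)) - inner h (u1 (z t))) / (s - t)" for s
  have Blim: "(B \<longlongrightarrow> - inner (dx h) (u2 (z t))) (at t)"
    using weak_equation[OF v h, of t] unfolding has_field_derivative_iff B_def[abs_def] z_def .
  have "((\<lambda>s. A s - B s) \<longlongrightarrow> 0) (at t)"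
  proof (rule tendsto_0_le[where K="C * R"])
    show "((\<lambda>s. norm (z s - z t)) \<longlongrightarrow> 0) (at t)"
      using zc by (intro tendsto_norm_zero) (auto simp: continuous_on_def LIM_zero_iff)
    show "\<forall>\<^sub>F s in at t. norm (A s - B s) \<le> norm (norm (z s - z t)) * (C * R)"
      unfolding eventually_at
    proof (intro exI[of _ d] conjI ballI impI d(1))
      fix s assume s: "s \<noteq> t \<and> dist s t < d"
      define w where "w = u1 (z s) - u1 (z t)"
      have R: "norm (z s) \<le> R" "norm (z t) \<le> R" using zR[of s] zR[of t] s d(1) by (auto simp: dist_real_def)
      have "A s - B s = (\<Phi> (u1 (z s)) - \<Phi> (u1 (z t)) - inner h w) / (s - t)"
        by (simp add: A_def B_def w_def inner_diff_right diff_divide_distrib[symmetric])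
      then have "\<bar>A s - B s\<bar> = \<bar>\<Phi> (u1 (z s)) - \<Phi> (u1 (z t)) - inner h w\<bar> / \<bar>s - t\<bar>" by simp
      also have "\<dots> \<le> (C * (norm w)\<^sup>2) / \<bar>s - t\<bar>"
        unfolding w_def h_def by (intro divide_right_mono C dom_u1 order_trans[OF nH_u1_le] R) simp
      also have "\<dots> \<le> (C * (\<bar>s - t\<bar> * (norm (dx w) * R))) / \<bar>s - t\<bar>"
      proof (intro divide_right_mono mult_left_mono C0)
        show "(norm w)\<^sup>2 \<le> \<bar>s - t\<bar> * (norm (dx w) * R)"
          unfolding w_def z_def
          by (rule u1_increment[OF v]) (use s zR in \<open>auto simp: z_def[symmetric] dist_real_def intro!: order_trans[OF norm_u2_le]\<close>)
      qed simp
      also have "\<dots> = C * (norm (dx w) * R)" using s by simp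
      also have "\<dots> \<le> C * (norm (z s - z t) * R)"
      proof (intro mult_left_mono mult_right_mono C0)
        have "norm (dx w) \<le> nH w" by (rule norm_dx_le_nH) (simp add: w_def dom_diff dom_u1)
        then show "norm (dx w) \<le> norm (z s - z t)" using nH_u1_le[of "z s - z t"] by (simp add: w_def u1_diff)
        show "0 \<le> R" using R(2) norm_ge_zero order_trans by blast
      qed
      finally show "norm (A s - B s) \<le> norm (norm (z s - z t)) * (C * R)" by (simp add: ac_simps)
    qed
  qed
  from tendsto_add[OF this Blim] have "(A \<longlongrightarrow> - inner (dx h) (u2 (z t))) (at t)" by simp
  then show ?thesis unfolding has_field_derivative_iff A_def[abs_def] z_def h_def .
qed

section \<open>The conserved energy\<close>

definition gam :: "(real \<Rightarrow> real) \<Rightarrow> real \<Rightarrow> real"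
  where "gam r x = 3 / 2 * ((H x)\<^sup>2 - 1) + H x * r x + (r x)\<^sup>2 / 4"
text \<open>The integral of the primitive 3/2 (H^2 - 1) u^2 + H u^3 + u^4 / 4 of F in u. The factor
  u^2 is split off, leaving the bounded multiplier \<open>gam\<close>, so that \<open>Gf\<close> is
  a quadratic form with coefficients depending on u and makes sense in \<open>l2\<close>.\<close>

definition Gf :: "l2 \<Rightarrow> real" where "Gf u = inner (mul (gam (rep u)) u) u"
definition En :: "l2 \<times> l2 \<Rightarrow> real" where "En z = (norm z)\<^sup>2 / 2 + Gf (u1 z)"

lemma bd_gam: "bd r \<Longrightarrow> bd (gam r)"
proof -
  assume r: "bd r"
  have "bd (\<lambda>x. 3 / 2 * ((H x)\<^sup>2 - 1) + H x * r x + (r x)\<^sup>2 * (1 / 4))"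
    by (intro bd_add bd_mult bd_diff bd_power bd_const bd_H r)
  then show ?thesis by (simp add: gam_def[abs_def])
qed

lemma inner_rep: "dom u \<Longrightarrow> dom v \<Longrightarrow> inner u v = (LINT x|lebesgue. rep u x * rep v x)"
  using inner_cl[OF rep_L2 rep_L2, of u v] by (simp add: cl_rep)

lemma inner_mul_rep: "bd p \<Longrightarrow> dom u \<Longrightarrow> dom v \<Longrightarrow> inner (mul p u) v = (LINT x|lebesgue. p x * rep u x * rep v x)"
  using inner_cl[OF L2_bd_mult[OF _ rep_L2] rep_L2, of p u v] mul_cl[OF _ rep_L2, of p u] by (simp add: cl_rep)

lemma integrable_rep3: "bd p \<Longrightarrow> dom u \<Longrightarrow> dom v \<Longrightarrow> integrable lebesgue (\<lambda>x. p x * rep u x * rep v x)"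
  by (intro L2_mult_integrable L2_bd_mult rep_L2)

text \<open>The remainder is needed in the L2 norm of w - u, not in the H1 norm, because only the
  former is o(|t - s|) after squaring. This works because the density is a polynomial whose
  coefficients are bounded by the Sobolev embedding.\<close>

lemma Gf_taylor: "\<exists>C\<ge>0. \<forall>u w. dom u \<longrightarrow> dom w \<longrightarrow> nH u \<le> R \<longrightarrow> nH w \<le> R \<longrightarrow>
       \<bar>Gf w - Gf u - inner (Fu u) (w - u)\<bar> \<le> C * (norm (w - u))\<^sup>2"
proof (intro exI[of _ "3/2 + 3 * (CS * \<bar>R\<bar>) + 3/2 * (CS * \<bar>R\<bar>)\<^sup>2"] conjI allI impI)
  define M where "M = CS * \<bar>R\<bar>"
  have M: "0 \<le> M" by (simp add: M_def)
  show "0 \<le> 3/2 + 3 * (CS * \<bar>R\<bar>) + 3/2 * (CS * \<bar>R\<bar>)\<^sup>2" by simp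
  fix u w assume u: "dom u" "nH u \<le> R" and w: "dom w" "nH w \<le> R"
  have r: "\<bar>rep k x\<bar> \<le> M" if "dom k" "nH k \<le> R" for k x
    using rep_bound[OF that(1), of x] mult_left_mono[OF order_trans[OF that(2) abs_ge_self], of CS] by (simp add: M_def)
  \<comment> \<open>The exact Taylor remainder of the quartic density divided by (w - u)^2: for
    instance w^3 - u^3 - 3 u^2 (w - u) = (w - u)^2 (w + 2 u).\<close>
  define b where "b x = 3/2 * ((H x)\<^sup>2 - 1) + H x * (rep w x + 2 * rep u x) + ((rep w x)\<^sup>2 + 2 * rep u x * rep w x + 3 * (rep u x)\<^sup>2) * (1/4)" for x
  have bb: "bd b" unfolding b_def[abs_def] by (intro bd_add bd_mult bd_diff bd_power bd_const bd_H bd_rep u w)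
  have bK: "\<bar>b x\<bar> \<le> 3/2 + 3 * M + 3/2 * M\<^sup>2" for x
  proof -
    have uu: "\<bar>rep u x\<bar> \<le> M" "\<bar>rep w x\<bar> \<le> M" using r u w by auto
    have 1: "\<bar>3/2 * ((H x)\<^sup>2 - 1)\<bar> \<le> 3/2" using H_power2_less[of x] zero_le_power2[of "H x"] by (intro abs_leI) (simp_all add: algebra_simps)
    have "\<bar>H x\<bar> * \<bar>rep w x + 2 * rep u x\<bar> \<le> 1 * (3 * M)"
      using uu by (intro mult_mono H_abs_le) auto
    then have 2: "\<bar>H x * (rep w x + 2 * rep u x)\<bar> \<le> 3 * M" by (simp add: abs_mult)
    have q: "(rep w x)\<^sup>2 \<le> M\<^sup>2" "(rep u x)\<^sup>2 \<le> M\<^sup>2" "\<bar>rep u x * rep w x\<bar> \<le> M\<^sup>2"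
      using power_mono[OF uu(1), of 2] power_mono[OF uu(2), of 2] mult_mono[OF uu] M by (auto simp: abs_mult power2_eq_square)
    have "\<bar>(rep w x)\<^sup>2 + 2 * (rep u x * rep w x) + 3 * (rep u x)\<^sup>2\<bar> \<le> 6 * M\<^sup>2"
    proof (rule abs_leI)
      show "(rep w x)\<^sup>2 + 2 * (rep u x * rep w x) + 3 * (rep u x)\<^sup>2 \<le> 6 * M\<^sup>2" using q by (simp add: abs_le_iff)
      have "0 \<le> (rep w x + rep u x)\<^sup>2" by simp
      then show "- ((rep w x)\<^sup>2 + 2 * (rep u x * rep w x) + 3 * (rep u x)\<^sup>2) \<le> 6 * M\<^sup>2"
        using zero_le_power2[of M] zero_le_power2[of "rep u x"]
        unfolding power2_sum minus_add_distrib mult.assoc mult.commute[of "rep w x"] by linarith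
    qed
    then have 3: "\<bar>((rep w x)\<^sup>2 + 2 * rep u x * rep w x + 3 * (rep u x)\<^sup>2) * (1/4)\<bar> \<le> 3/2 * M\<^sup>2" by (simp add: abs_mult mult.assoc)
    show ?thesis unfolding b_def using 1 2 3 by linarith
  qed
  have d: "dom (w - u)" by (rule dom_diff[OF w(1) u(1)])
  have n: "bd (\<lambda>x. (3 * ((H x)\<^sup>2 - 1) + rep u x * (rep u x + 3 * H x)))"
    by (intro bd_add bd_mult bd_diff bd_power bd_const bd_H bd_rep u)
  have i1: "integrable lebesgue (\<lambda>x. gam (rep w) x * rep w x * rep w x)" by (intro integrable_rep3 bd_gam bd_rep w)
  have i2: "integrable lebesgue (\<lambda>x. gam (rep u) x * rep u x * rep u x)" by (intro integrable_rep3 bd_gam bd_rep u)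
  have i3: "integrable lebesgue (\<lambda>x. rep (Fu u) x * rep (w - u) x)" by (intro L2_mult_integrable rep_L2 Fu u d)
  have "Gf w - Gf u - inner (Fu u) (w - u) =
      (LINT x|lebesgue. gam (rep w) x * rep w x * rep w x - gam (rep u) x * rep u x * rep u x - rep (Fu u) x * rep (w - u) x)"
    using i1 i2 i3 by (simp add: Gf_def inner_mul_rep bd_gam bd_rep u w inner_rep Fu(1) d)
  also have "\<dots> = (LINT x|lebesgue. b x * rep (w - u) x * rep (w - u) x)"
    by (rule Bochner_Integration.integral_cong)
      (simp_all add: gam_def b_def Fu(3)[OF u(1)] nonlin_def rep_diff[OF w(1) u(1)] power2_eq_square field_simps)
  also have "\<dots> = inner (mul b (w - u)) (w - u)" by (simp add: inner_mul_rep bb d)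
  finally have "\<bar>Gf w - Gf u - inner (Fu u) (w - u)\<bar> \<le> norm (mul b (w - u)) * norm (w - u)"
    by (simp add: Cauchy_Schwarz_ineq2)
  also have "\<dots> \<le> ((3/2 + 3 * M + 3/2 * M\<^sup>2) * norm (w - u)) * norm (w - u)"
    by (intro mult_right_mono norm_mul_le bd_measurable[OF bb] bK) simp
  finally show "\<bar>Gf w - Gf u - inner (Fu u) (w - u)\<bar> \<le> (3/2 + 3 * (CS * \<bar>R\<bar>) + 3/2 * (CS * \<bar>R\<bar>)\<^sup>2) * (norm (w - u))\<^sup>2"
    by (simp add: M_def power2_eq_square mult.assoc)
qed

lemma norm_power2_DERIV:
  assumes v: "\<And>t. (v has_vector_derivative U (- t) (0, p t)) (at t)"
  shows "((\<lambda>t. (norm (u1 (U t (v t))))\<^sup>2) has_real_derivative - 2 * inner (dx (u1 (U t (v t)))) (u2 (U t (v t)))) (at t)"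
proof -
  have "((\<lambda>t. (norm (u1 (U t (v t))))\<^sup>2) has_real_derivative - inner (dx (2 *\<^sub>R (u1 (U t (v t))))) (u2 (U t (v t)))) (at t)"
  proof (rule functional_DERIV[OF v, where f="\<lambda>u. 2 *\<^sub>R u"])
    show "\<exists>C\<ge>0. \<forall>u w. dom u \<longrightarrow> dom w \<longrightarrow> nH u \<le> R \<longrightarrow> nH w \<le> R \<longrightarrow>
       \<bar>(norm w)\<^sup>2 - (norm u)\<^sup>2 - inner (2 *\<^sub>R u) (w - u)\<bar> \<le> C * (norm (w - u))\<^sup>2" for R
    proof (intro exI[of _ 1] conjI allI impI)
      fix u w :: l2
      have "(norm w)\<^sup>2 - (norm u)\<^sup>2 - inner (2 *\<^sub>R u) (w - u) = (norm (w - u))\<^sup>2"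
        by (simp add: power2_norm_eq_inner inner_diff_left inner_diff_right inner_commute)
      then show "\<bar>(norm w)\<^sup>2 - (norm u)\<^sup>2 - inner (2 *\<^sub>R u) (w - u)\<bar> \<le> 1 * (norm (w - u))\<^sup>2" by simp
    qed simp
  qed (rule dom_scaleR)
  then show ?thesis by (simp add: dx_scaleR dom_u1)
qed

text \<open>In the interaction picture the quadratic part changes only through the nonlinear
  forcing, at the rate <u2, \<partial>x F(u1)>. By the chain rule \<open>Gf\<close> changes at the
  opposite rate.\<close>

lemma En_DERIV:
  assumes v: "\<And>t. (v has_vector_derivative U (- t) (0, p t)) (at t)" and p: "(0, p t) = N (U t (v t))"
  shows "((\<lambda>t. En (U t (v t))) has_real_derivative 0) (at t)"
proof -
  define z where "z = U t (v t)"
  have 1: "((\<lambda>t. (norm (v t))\<^sup>2 / 2) has_real_derivative (2 * inner (v t) (U (- t) (0, p t))) / 2) (at t)"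
    by (intro DERIV_cdivide DERIV_norm_power2 v)
  have 2: "((\<lambda>t. Gf (u1 (U t (v t)))) has_real_derivative - inner (dx (Fu (u1 z))) (u2 z)) (at t)"
    unfolding z_def by (rule functional_DERIV[OF v Fu(1) Gf_taylor])
  have "inner (v t) (U (- t) (0, p t)) = inner (U t (v t)) (0, p t)" by (simp add: inner_U)
  also have "\<dots> = inner (snd z) (rfl (hart (dFu (u1 z))))" unfolding p by (cases z) (simp add: z_def[symmetric] N_def)
  also have "\<dots> = inner (u2 z) (dx (Fu (u1 z)))"
    by (simp add: u2_def hart_selfadjoint inner_rfl_left Fu(2) dom_u1)
  finally show ?thesis
    using DERIV_add[OF 1 2] by (simp add: En_def norm_U inner_commute)
qed

text \<open>The residual of \<phi>' = (1 - \<phi>^2) / sqrt 2 at \<phi> = H + u; the terms without u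
  cancel because \<open>H\<close> solves this equation.\<close>

definition rr :: "l2 \<Rightarrow> l2"
  where "rr u = dx u + (1 / sqrt 2) *\<^sub>R (2 *\<^sub>R mul H u + sq u)"

lemma mul_H_dom: "dom u \<Longrightarrow> dom (mul H u)" "dom u \<Longrightarrow> dx (mul H u) = mul H (dx u) + mul dH u" "dom u \<Longrightarrow> rep (mul H u) = (\<lambda>x. H x * rep u x)"
proof -
  assume u: "dom u"
  have dHm: "dH \<in> borel_measurable lebesgue" by (intro continuous_lebesgue_measurable continuous_dH)
  show "dom (mul H u)" "dx (mul H u) = mul H (dx u) + mul dH u" "rep (mul H u) = (\<lambda>x. H x * rep u x)"
    by (rule D_mul_smooth[OF H_DERIV H_abs_le dH_abs_le dHm u])+
qed

text \<open>With q = 2 H u + u^2, the density u^2 + gam u^2 equals q^2 / 4 - (1 - H^2) u^2 / 2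
  pointwise, and dH / sqrt 2 = (1 - H^2) / 2.\<close>

lemma potential_identity:
  assumes u: "dom u"
  shows "(norm u)\<^sup>2 + Gf u = (norm (2 *\<^sub>R mul H u + sq u))\<^sup>2 / 4 - inner (mul dH u) u / sqrt 2"
proof -
  define q where "q = 2 *\<^sub>R mul H u + sq u"
  have q: "dom q" unfolding q_def by (intro dom_add dom_scaleR mul_H_dom sq u)
  have rq: "rep q = (\<lambda>x. 2 * (H x * rep u x) + (rep u x)\<^sup>2)"
    unfolding q_def by (simp add: rep_add rep_scaleR dom_scaleR mul_H_dom sq u)
  have i: "integrable lebesgue (\<lambda>x. rep u x * rep u x)" "integrable lebesgue (\<lambda>x. gam (rep u) x * rep u x * rep u x)"
    "integrable lebesgue (\<lambda>x. rep q x * rep q x)" "integrable lebesgue (\<lambda>x. dH x * rep u x * rep u x)"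
    by (intro L2_mult_integrable rep_L2 u q integrable_rep3 bd_gam bd_rep bd_dH)+
  have "(norm u)\<^sup>2 + Gf u = (LINT x|lebesgue. rep u x * rep u x + gam (rep u) x * rep u x * rep u x)"
    using i by (simp add: power2_norm_eq_inner inner_rep u Gf_def inner_mul_rep bd_gam bd_rep)
  also have "\<dots> = (LINT x|lebesgue. rep q x * rep q x / 4 - dH x * rep u x * rep u x / sqrt 2)"
  proof (rule Bochner_Integration.integral_cong, simp)
    fix x
    have "dH x / sqrt 2 = (1 - (H x)\<^sup>2) / 2" by (simp add: dH_def)
    then have "dH x * rep u x * rep u x / sqrt 2 = (1 - (H x)\<^sup>2) / 2 * rep u x * rep u x"
      by (metis (no_types, opaque_lifting) times_divide_eq_left)
    then show "rep u x * rep u x + gam (rep u) x * rep u x * rep u x = rep q x * rep q x / 4 - dH x * rep u x * rep u x / sqrt 2"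
      by (simp add: gam_def rq power2_eq_square field_simps)
  qed
  also have "\<dots> = (norm q)\<^sup>2 / 4 - inner (mul dH u) u / sqrt 2"
    using i by (simp add: power2_norm_eq_inner inner_rep u q inner_mul_rep)
  finally show ?thesis by (simp add: q_def)
qed

lemma norm_state_power2: "(norm z)\<^sup>2 = (norm (dx (u1 z)))\<^sup>2 + 2 * (norm (u1 z))\<^sup>2 + (norm (u2 z))\<^sup>2"
  by (simp add: norm_u nH_power2 dom_u1)

text \<open>Drop the square and use dH <= 1 / sqrt 2. The energy thus controls the derivative and
  \<open>u2\<close> up to the L2 norm of \<open>u1\<close>, which it does not control by itself;
  this is the bound for global existence, where no smallness is available.\<close>

lemma En_lower: "2 * En z \<ge> (norm (u2 z))\<^sup>2 + (norm (dx (u1 z)))\<^sup>2 - (norm (u1 z))\<^sup>2"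
proof -
  define u where "u = u1 z"
  have u: "dom u" by (simp add: u_def dom_u1)
  have "inner (mul dH u) u \<le> norm (mul dH u) * norm u" by (rule norm_cauchy_schwarz)
  also have "\<dots> \<le> (1 / sqrt 2 * norm u) * norm u"
  proof (intro mult_right_mono norm_mul_le)
    show "\<bar>dH x\<bar> \<le> 1 / sqrt 2" for x
      unfolding abs_of_pos[OF dH_pos] unfolding dH_def by (intro divide_right_mono) auto
  qed (auto intro: bd_measurable)
  finally have "inner (mul dH u) u / sqrt 2 \<le> (1 / sqrt 2 * norm u) * norm u / sqrt 2" by (intro divide_right_mono) auto
  then have "inner (mul dH u) u / sqrt 2 \<le> (norm u)\<^sup>2 / 2" by (simp add: power2_eq_square)
  moreover have "2 * En z = (norm z)\<^sup>2 + 2 * Gf u" by (simp add: En_def u_def)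
  ultimately show ?thesis
    using potential_identity[OF u] zero_le_power2[of "norm (2 *\<^sub>R mul H u + sq u)"] norm_state_power2[of z]
    unfolding u_def[symmetric] by linarith
qed

text \<open>Bogomolny's trick: completing the square leaves only the residual of the first order kink equation.\<close>

lemma En_Bogomolny: "2 * En z = (norm (u2 z))\<^sup>2 + (norm (rr (u1 z)))\<^sup>2"
proof -
  define u where "u = u1 z"
  have u: "dom u" by (simp add: u_def dom_u1)
  define q where "q = 2 *\<^sub>R mul H u + sq u"
  have c1: "2 * inner (dx u) (mul H u) = - inner (mul dH u) u"
  proof -
    have "inner (dx u) (mul H u) = - inner u (mul H (dx u) + mul dH u)"
      using inner_dx[OF u mul_H_dom(1)[OF u]] mul_H_dom(2)[OF u] by simp
    moreover have "inner u (mul H (dx u)) = inner (dx u) (mul H u)"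
      using inner_mul_right[OF bd_H, of u "dx u"] by (simp add: inner_commute)
    ultimately show ?thesis by (simp add: inner_add_right inner_commute[of u])
  qed
  \<comment> \<open>The integrand u^2 u' is the derivative of u^3 / 3; integration by parts gives x
    = -2 x for this number.\<close>
  have c2: "inner (dx u) (sq u) = 0"
  proof -
    have "inner (dx u) (sq u) = - inner u (2 *\<^sub>R mul (rep u) (dx u))"
      using inner_dx[OF u sq(1)[OF u]] sq(2)[OF u] by simp
    also have "\<dots> = - 2 * inner (dx u) (sq u)"
      by (simp add: inner_mul_right bd_rep u sq_def[symmetric] inner_commute)
    finally show ?thesis by simp
  qed
  have "(norm (rr u))\<^sup>2 = (norm (dx u))\<^sup>2 + 2 / sqrt 2 * inner (dx u) q + (norm q)\<^sup>2 / 2"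
    unfolding rr_def q_def[symmetric]
    by (simp add: power2_norm_eq_inner inner_add_left inner_add_right inner_commute)
  also have "inner (dx u) q = - inner (mul dH u) u" using c1 c2 by (simp add: q_def inner_add_right)
  finally show ?thesis
    using potential_identity[OF u, folded q_def]
    by (simp add: En_def norm_u nH_power2 u u_def[symmetric] add_divide_distrib)
qed

lemma En_const:
  assumes v: "\<And>t. (v has_vector_derivative U (- t) (0, p t)) (at t)"
    and p: "\<And>t. \<bar>t\<bar> \<le> T \<Longrightarrow> (0, p t) = N (U t (v t))" and t: "\<bar>t\<bar> \<le> T"
  shows "En (U t (v t)) = En (v 0)"
proof -
  have d: "((\<lambda>t. En (U t (v t))) has_real_derivative 0) (at s)" if "\<bar>s\<bar> \<le> T" for s
    by (rule En_DERIV[OF v p[OF that]])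
  consider "t = 0" | "t > 0" | "t < 0" by linarith
  then have "En (U t (v t)) = En (U 0 (v 0))"
  proof cases
    case 2
    then obtain x where "En (U t (v t)) - En (U 0 (v 0)) = (t - 0) * 0"
      using MVT2[of 0 t "\<lambda>t. En (U t (v t))" "\<lambda>_. 0"] d t by auto
    then show ?thesis by simp
  next
    case 3
    then obtain x where "En (U 0 (v 0)) - En (U t (v t)) = (0 - t) * 0"
      using MVT2[of t 0 "\<lambda>t. En (U t (v t))" "\<lambda>_. 0"] d t by auto
    then show ?thesis by simp
  qed simp
  then show ?thesis by (simp add: U_0)
qed

section \<open>Global existence from the a priori bound\<close>

lemma En_nonneg: "0 \<le> En z"
  using En_Bogomolny[of z] zero_le_power2[of "norm (u2 z)"] zero_le_power2[of "norm (rr (u1 z))"] by linarith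

text \<open>The quantity y = |u1|^2 + 2 En bounds |dx u1|^2 + |u2|^2 by \<open>En_lower\<close>, and
  this in turn bounds |y'|, so y grows at most like exp |t|. The factor 3 is 1 for these two terms
  plus 2 for the mass term 2 |u1|^2 of the norm.\<close>

lemma a_priori_bound:
  assumes v: "\<And>t. (v has_vector_derivative U (- t) (0, p t)) (at t)"
    and p: "\<And>t. \<bar>t\<bar> \<le> T \<Longrightarrow> (0, p t) = N (U t (v t))" and t: "\<bar>t\<bar> \<le> T"
  shows "(norm (v t))\<^sup>2 \<le> 3 * (((norm (u1 (v 0)))\<^sup>2 + 2 * En (v 0)) * exp (1 * \<bar>t\<bar>))"
proof -
  define E0 where "E0 = En (v 0)"
  define y where "y t = (norm (u1 (U t (v t))))\<^sup>2 + 2 * E0" for t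
  have E0: "E0 \<ge> 0" by (simp add: E0_def En_nonneg)
  have low: "(norm (u2 (U s (v s))))\<^sup>2 + (norm (dx (u1 (U s (v s)))))\<^sup>2 \<le> y s" if "\<bar>s\<bar> \<le> T" for s
    using En_lower[of "U s (v s)"] En_const[OF v p that] by (simp add: y_def E0_def)
  have "y t \<le> y 0 * exp (1 * \<bar>t\<bar>)"
  proof (rule gronwall[OF _ _ t])
    show "(y has_real_derivative (- 2 * inner (dx (u1 (U s (v s)))) (u2 (U s (v s))) + 0)) (at s)" for s
      unfolding y_def[abs_def] by (intro DERIV_add norm_power2_DERIV[OF v] DERIV_const)
    fix s assume s: "\<bar>s\<bar> \<le> T"
    have "\<bar>- 2 * inner (dx (u1 (U s (v s)))) (u2 (U s (v s))) + 0\<bar> \<le> 2 * (norm (dx (u1 (U s (v s)))) * norm (u2 (U s (v s))))"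
      using Cauchy_Schwarz_ineq2[of "dx (u1 (U s (v s)))" "u2 (U s (v s))"] by (simp add: abs_mult)
    also have "\<dots> \<le> (norm (dx (u1 (U s (v s)))))\<^sup>2 + (norm (u2 (U s (v s))))\<^sup>2"
      using sum_squares_bound[of "norm (dx (u1 (U s (v s))))" "norm (u2 (U s (v s)))"] by (simp add: mult.assoc)
    also have "\<dots> \<le> 1 * y s" using low[OF s] by simp
    finally show "\<bar>- 2 * inner (dx (u1 (U s (v s)))) (u2 (U s (v s))) + 0\<bar> \<le> 1 * y s" .
  qed
  moreover have "(norm (v t))\<^sup>2 \<le> 3 * y t"
  proof -
    have "(norm (v t))\<^sup>2 = (norm (U t (v t)))\<^sup>2" by (simp add: norm_U)
    moreover have "y t = (norm (u1 (U t (v t))))\<^sup>2 + 2 * E0" by (simp only: y_def)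
    ultimately show ?thesis using norm_state_power2[of "U t (v t)"] low[OF t] E0 by linarith
  qed
  moreover have "y 0 = (norm (u1 (v 0)))\<^sup>2 + 2 * En (v 0)" by (simp only: y_def U_0 E0_def)
  ultimately show ?thesis by simp
qed

lemma N_fst: "N z = (0, snd (N z))"
  by (simp add: N_def)

text \<open>Solve the equation truncated at a radius above the a priori bound. Up to the first time
  at which the radius is reached the truncation is inactive, the a priori bound holds, and so the
  radius is not reached.\<close>

lemma solution_on_interval_ex:
  assumes T: "0 \<le> T"
  shows "\<exists>v v'. v 0 = z0 \<and> (\<forall>t. (v has_vector_derivative U (- t) (0, v' t)) (at t)) \<and> (\<forall>t. \<bar>t\<bar> \<le> T \<longrightarrow> (0, v' t) = N (U t (v t)))"
proof -
  define B where "B = 3 * (((norm (u1 z0))\<^sup>2 + 2 * En z0) * exp (1 * T))"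
  have B: "B \<ge> 0" using En_nonneg[of z0] by (simp add: B_def)
  \<comment> \<open>Strictly above the bound valid on [-T, T], so that reaching \<open>R\<close>
    contradicts it.\<close>
  define R where "R = sqrt B + 1"
  have R: "R > 0" using B by (simp add: R_def add_nonneg_pos)
  obtain v where v0: "v 0 = z0" and v: "\<And>t. (v has_vector_derivative U (- t) (N (trunc R (U t (v t))))) (at t)"
    using truncated_solution_ex[OF R] by blast
  define p where "p t = snd (N (trunc R (U t (v t))))" for t
  have vp: "(v has_vector_derivative U (- t) (0, p t)) (at t)" for t
    using v[of t] N_fst[of "trunc R (U t (v t))"] by (simp add: p_def)
  have pN: "(0, p t) = N (U t (v t))" if "norm (v t) \<le> R" for t
    using that N_fst[of "U t (v t)"] by (simp add: p_def trunc_def norm_U)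
  have vc: "continuous_on UNIV v" by (rule continuous_on_vector_derivative_UNIV[OF v])
  have "norm (v t) < R" if t: "\<bar>t\<bar> \<le> T" for t
  proof (rule ccontr)
    assume "\<not> norm (v t) < R"
    \<comment> \<open>The times at which the radius is reached, in both directions. The element
      nearest to 0 plays the role of the first exit time.\<close>
    define S where "S = {s \<in> {-T..T}. R \<le> norm (v s)}"
    have "compact S" unfolding S_def
      by (intro compact_Int_closed[of "{-T..T}" "{s. R \<le> norm (v s)}", unfolded Int_def mem_Collect_eq] closed_Collect_le continuous_intros vc) auto
    moreover have "t \<in> S" using t \<open>\<not> norm (v t) < R\<close> by (auto simp: S_def)
    moreover have "continuous_on S abs" by (intro continuous_intros)
    ultimately obtain s where s: "s \<in> S" "\<And>r. r \<in> S \<Longrightarrow> \<bar>s\<bar> \<le> \<bar>r\<bar>"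
      using continuous_attains_inf[of S abs] by blast
    have sT: "\<bar>s\<bar> \<le> T" using s(1) by (auto simp: S_def)
    have lt: "norm (v r) < R" if "\<bar>r\<bar> < \<bar>s\<bar>" for r
    proof -
      have "r \<notin> S" using s(2)[of r] that by auto
      then show ?thesis using that sT by (auto simp: S_def)
    qed
    have le: "norm (v r) \<le> R" if "\<bar>r\<bar> \<le> \<bar>s\<bar>" for r
    proof (cases "s = 0")
      case True
      then have "r = 0" using that by simp
      \<comment> \<open>For \<open>s = 0\<close> the open interval around 0 is empty and the closure
        argument gives nothing; the initial norm is estimated from \<open>En_lower\<close>
        instead.\<close>
      have "(norm z0)\<^sup>2 \<le> 3 * (((norm (u1 z0))\<^sup>2 + 2 * En z0) * 1)"
        using En_lower[of z0] zero_le_power2[of "norm (u1 z0)"] En_nonneg[of z0] norm_state_power2[of z0] by simp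
      also have "\<dots> \<le> B" unfolding B_def using T En_nonneg[of z0] by (intro mult_left_mono) auto
      finally have "norm z0 \<le> sqrt B" by (intro real_le_rsqrt)
      then show ?thesis using \<open>r = 0\<close> v0 by (simp add: R_def)
    next
      case False
      have "closed {r. norm (v r) \<le> R}" by (intro closed_Collect_le continuous_intros vc)
      moreover have "{-\<bar>s\<bar><..<\<bar>s\<bar>} \<subseteq> {r. norm (v r) \<le> R}" 
      proof
        fix y assume "y \<in> {-\<bar>s\<bar><..<\<bar>s\<bar>}"
        then have "\<bar>y\<bar> < \<bar>s\<bar>" by auto
        then show "y \<in> {r. norm (v r) \<le> R}" using lt[of y] by simp
      qed
      ultimately have "closure {-\<bar>s\<bar><..<\<bar>s\<bar>} \<subseteq> {r. norm (v r) \<le> R}" by (rule closure_minimal[rotated])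
      moreover have "r \<in> {-\<bar>s\<bar>..\<bar>s\<bar>}" using that by auto
      ultimately show ?thesis using False by (auto simp: closure_greaterThanLessThan)
    qed
    have "(norm (v s))\<^sup>2 \<le> 3 * (((norm (u1 (v 0)))\<^sup>2 + 2 * En (v 0)) * exp (1 * \<bar>s\<bar>))"
      by (rule a_priori_bound[OF vp pN[OF le], of "\<bar>s\<bar>"]) auto
    also have "\<dots> \<le> B" unfolding B_def v0 using sT En_nonneg[of z0] by (intro mult_left_mono) auto
    finally have "norm (v s) \<le> sqrt B" by (intro real_le_rsqrt)
    then show False using s(1) by (simp add: S_def R_def)
  qed
  then show ?thesis using v0 vp pN by (intro exI[of _ v] exI[of _ p]) (auto intro: less_imp_le)
qed

text \<open>The truncation radius depends on the length of the interval, so each interval has its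
  own solution; uniqueness makes them agree on overlaps.\<close>

lemma global_solution_ex:
  "\<exists>v. v 0 = z0 \<and> (\<forall>t. (v has_vector_derivative U (- t) (N (U t (v t)))) (at t))"
proof -
  have "\<forall>T. \<exists>v. T \<ge> 0 \<longrightarrow> (v 0 = z0 \<and> (\<exists>v'. (\<forall>t. (v has_vector_derivative v' t) (at t)) \<and> (\<forall>t. \<bar>t\<bar> \<le> T \<longrightarrow> v' t = U (- t) (N (U t (v t))))))"
  proof
    fix T :: real
    show "\<exists>v. T \<ge> 0 \<longrightarrow> (v 0 = z0 \<and> (\<exists>v'. (\<forall>t. (v has_vector_derivative v' t) (at t)) \<and> (\<forall>t. \<bar>t\<bar> \<le> T \<longrightarrow> v' t = U (- t) (N (U t (v t))))))"
    proof (cases "T \<ge> 0")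
      case True
      then obtain v p where v: "v 0 = z0" "\<forall>t. (v has_vector_derivative U (- t) (0, p t)) (at t)" "\<forall>t. \<bar>t\<bar> \<le> T \<longrightarrow> (0, p t) = N (U t (v t))"
        using solution_on_interval_ex by blast
      show ?thesis
        by (intro exI[of _ v] impI conjI v(1) exI[of _ "\<lambda>t. U (- t) (0, p t)"] v(2)) (use v(3) in simp)
    qed simp
  qed
  then obtain V where V: "\<And>T. T \<ge> 0 \<Longrightarrow> V T 0 = z0 \<and> (\<exists>v'. (\<forall>t. (V T has_vector_derivative v' t) (at t)) \<and> (\<forall>t. \<bar>t\<bar> \<le> T \<longrightarrow> v' t = U (- t) (N (U t (V T t)))))"
    by metis
  have agree: "V T t = V T' t" if T: "0 \<le> T" "T \<le> T'" "\<bar>t\<bar> \<le> T" for T T' t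
  proof -
    have T': "0 \<le> T'" using T by simp
    obtain v' where v': "\<And>t. (V T has_vector_derivative v' t) (at t)" "\<And>t. \<bar>t\<bar> \<le> T \<Longrightarrow> v' t = U (- t) (N (U t (V T t)))" using V[OF T(1)] by blast
    obtain w' where w': "\<And>t. (V T' has_vector_derivative w' t) (at t)" "\<And>t. \<bar>t\<bar> \<le> T' \<Longrightarrow> w' t = U (- t) (N (U t (V T' t)))" using V[OF T'] by blast
    show ?thesis
      by (rule solution_unique[OF v' w'(1) w'(2) _ T(3)]) (use V[OF T(1)] V[OF T'] T in auto)
  qed
  \<comment> \<open>The margin 1 makes \<open>V (\<bar>t\<bar> + 1)\<close> a solution on a
    neighbourhood of \<open>t\<close>, as the derivative at \<open>t\<close> requires.\<close>
  define v where "v t = V (\<bar>t\<bar> + 1) t" for t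
  have "(v has_vector_derivative U (- t) (N (U t (v t)))) (at t)" for t
  proof -
    define T where "T = \<bar>t\<bar> + 1"
    have T: "0 \<le> T" by (simp add: T_def)
    obtain v' where v': "\<And>s. (V T has_vector_derivative v' s) (at s)" "\<And>s. \<bar>s\<bar> \<le> T \<Longrightarrow> v' s = U (- s) (N (U s (V T s)))" using V[OF T] by blast
    have "(V T has_vector_derivative U (- t) (N (U t (v t)))) (at t)"
      using v'(1)[of t] v'(2)[of t] by (simp add: T_def v_def)
    then show ?thesis
    proof (rule has_vector_derivative_transform_within_open)
      show "open {-T<..<T}" "t \<in> {-T<..<T}" by (auto simp: T_def)
      fix s assume s: "s \<in> {-T<..<T}"
      then have sT: "\<bar>s\<bar> \<le> T" by auto
      show "V T s = v s"
      proof (cases "T \<le> \<bar>s\<bar> + 1")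
        case True
        then show ?thesis unfolding v_def by (rule agree[OF T _ sT])
      next
        case False
        then show ?thesis unfolding v_def by (intro agree[symmetric]) auto
      qed
    qed
  qed
  moreover have "v 0 = z0" using V[of 1] by (simp add: v_def)
  ultimately show ?thesis by blast
qed

section \<open>Translates of the kink\<close>

text \<open>The derivative of dH is - sqrt 2 H dH and |H| < 1, so the logarithmic derivative of dH
  lies between - sqrt 2 and sqrt 2. This gives a Harnack inequality, by which shifts of the kink are
  compared with dH at the unshifted point.\<close>

lemma exp_dH_mono: "a \<le> b \<Longrightarrow> dH a * exp (sqrt 2 * a) \<le> dH b * exp (sqrt 2 * b)"
  and exp_dH_antimono: "a \<le> b \<Longrightarrow> dH b * exp (- sqrt 2 * b) \<le> dH a * exp (- sqrt 2 * a)"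
proof -
  have e: "(H x) ^ 3 = H x - sqrt 2 * H x * dH x" for x
    by (simp add: dH_def power3_eq_cube power2_eq_square field_simps)
  have "((\<lambda>x. dH x * exp (sqrt 2 * x)) has_real_derivative (sqrt 2 * (1 - H x) * dH x * exp (sqrt 2 * x))) (at x)" for x
    by (rule derivative_eq_intros dH_DERIV refl)+ (simp add: e algebra_simps)
  moreover have "0 \<le> sqrt 2 * (1 - H x) * dH x * exp (sqrt 2 * x)" for x
    using H_abs_le[of x] dH_pos[of x] by (intro mult_nonneg_nonneg) auto
  ultimately show "a \<le> b \<Longrightarrow> dH a * exp (sqrt 2 * a) \<le> dH b * exp (sqrt 2 * b)"
    by (intro DERIV_nonneg_imp_nondecreasing[where f="\<lambda>x. dH x * exp (sqrt 2 * x)"]) blast+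
  have "((\<lambda>x. dH x * exp (- sqrt 2 * x)) has_real_derivative (- (sqrt 2 * (1 + H x) * dH x * exp (- sqrt 2 * x)))) (at x)" for x
    by (rule derivative_eq_intros dH_DERIV refl)+ (simp add: e algebra_simps)
  moreover have "- (sqrt 2 * (1 + H x) * dH x * exp (- sqrt 2 * x)) \<le> 0" for x
    using H_abs_le[of x] dH_pos[of x] by (auto intro!: mult_nonneg_nonneg simp: abs_le_iff)
  ultimately show "a \<le> b \<Longrightarrow> dH b * exp (- sqrt 2 * b) \<le> dH a * exp (- sqrt 2 * a)"
    by (intro DERIV_nonpos_imp_nonincreasing[where f="\<lambda>x. dH x * exp (- sqrt 2 * x)"]) blast+
qed

lemma dH_Harnack: "dH y \<le> exp (sqrt 2 * \<bar>y - x\<bar>) * dH x"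
proof (cases "x \<le> y")
  case True
  have "dH y = dH y * exp (- sqrt 2 * y) * exp (sqrt 2 * y)" by (simp add: mult.assoc exp_add[symmetric])
  also have "\<dots> \<le> dH x * exp (- sqrt 2 * x) * exp (sqrt 2 * y)" by (intro mult_right_mono exp_dH_antimono True) simp
  also have "\<dots> = exp (sqrt 2 * \<bar>y - x\<bar>) * dH x" using True by (simp add: algebra_simps exp_add[symmetric])
  finally show ?thesis .
next
  case False
  have "dH y = dH y * exp (sqrt 2 * y) * exp (- sqrt 2 * y)" by (simp add: mult.assoc exp_add[symmetric])
  also have "\<dots> \<le> dH x * exp (sqrt 2 * x) * exp (- sqrt 2 * y)" using False by (intro mult_right_mono exp_dH_mono) auto
  also have "\<dots> = exp (sqrt 2 * \<bar>y - x\<bar>) * dH x" using False by (simp add: algebra_simps exp_add[symmetric])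
  finally show ?thesis .
qed

text \<open>dH decays like sech^2. Comparison with 1 / mw, already known to be square integrable,
  replaces an integration.\<close>

lemma dH_L2: "dH \<in> L2"
proof (rule L2_bound[OF inverse_mw_L2, where K=8])
  show "dH \<in> borel_measurable lebesgue" by (rule bd_measurable[OF bd_dH])
  have "\<bar>dH x\<bar> \<le> 8 * \<bar>1 / mw x\<bar>" for x
  proof -
    define y where "y = x / sqrt 2"
    have "1 + \<bar>y\<bar> \<le> exp \<bar>y\<bar>" by (rule exp_ge_add_one_self)
    also have "\<dots> \<le> 2 * cosh y" by (cases "y \<ge> 0") (auto simp: cosh_def)
    finally have c: "1 + \<bar>y\<bar> \<le> 2 * cosh y" .
    \<comment> \<open>As x^2 = 2 y^2, the radicand is 2 y^2 + 2 <= 4 (1 + |y|)^2, and 1 + |y| is at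
      most 2 cosh y.\<close>
    have "mw x \<le> sqrt ((2 * (1 + \<bar>y\<bar>))\<^sup>2)"
      unfolding mw_def by (intro real_sqrt_le_mono) (simp add: y_def power2_eq_square algebra_simps)
    then have "mw x \<le> 4 * cosh y" using c by simp
    moreover have "cosh y * 1 \<le> cosh y * cosh y" using cosh_real_ge_1[of y] by (intro mult_left_mono) auto
    ultimately have m: "mw x \<le> 4 * (cosh y)\<^sup>2" unfolding power2_eq_square by linarith
    have "(1 - (H x)\<^sup>2) * (cosh y)\<^sup>2 = (cosh y)\<^sup>2 - (sinh y)\<^sup>2"
      by (simp add: H_def y_def[symmetric] tanh_def power_divide left_diff_distrib)
    also have "\<dots> = 1" by (simp add: cosh_square_eq)
    finally have "1 - (H x)\<^sup>2 = 1 / (cosh y)\<^sup>2" by (simp add: field_simps)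
    moreover have "dH x \<le> 1 - (H x)\<^sup>2"
      using divide_left_mono[of 1 "sqrt 2" "1 - (H x)\<^sup>2"] H_power2_less[of x] by (simp add: dH_def)
    moreover have "1 / (cosh y)\<^sup>2 \<le> 4 / mw x" using m by (simp add: field_simps)
    moreover have "4 / mw x \<le> 8 / mw x" by (intro divide_right_mono) (auto intro: less_imp_le)
    ultimately have "dH x \<le> 8 / mw x" by linarith
    then show ?thesis using mw_pos[of x] unfolding abs_of_pos[OF dH_pos] by (simp add: abs_of_pos)
  qed
  then show "AE x in lebesgue. \<bar>dH x\<bar> \<le> 8 * \<bar>1 / mw x\<bar>" by simp
qed

lemma H_diff_mvt: "\<exists>\<xi>. \<bar>\<xi> - x\<bar> \<le> \<bar>a\<bar> \<and> x + min 0 a \<le> \<xi> \<and> \<xi> \<le> x + max 0 a \<and> H (x + a) - H x = a * dH \<xi>"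
proof -
  consider "a = 0" | "a > 0" | "a < 0" by linarith
  then show ?thesis
  proof cases
    case 2
    then obtain \<xi> where "x < \<xi>" "\<xi> < x + a" "H (x + a) - H x = (x + a - x) * dH \<xi>"
      using MVT2[of x "x + a" H dH] H_DERIV by auto
    then show ?thesis using 2 by (intro exI[of _ \<xi>]) auto
  next
    case 3
    then obtain \<xi> where "x + a < \<xi>" "\<xi> < x" "H x - H (x + a) = (x - (x + a)) * dH \<xi>"
      using MVT2[of "x + a" x H dH] H_DERIV by auto
    then show ?thesis using 3 by (intro exI[of _ \<xi>]) auto
  qed (intro exI[of _ x], simp)
qed

lemma H_diff_le: "\<bar>H (x + a) - H x\<bar> \<le> \<bar>a\<bar> * exp (sqrt 2 * \<bar>a\<bar>) * dH x"
proof -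
  obtain \<xi> where \<xi>: "\<bar>\<xi> - x\<bar> \<le> \<bar>a\<bar>" "H (x + a) - H x = a * dH \<xi>" using H_diff_mvt by blast
  have "dH \<xi> \<le> exp (sqrt 2 * \<bar>\<xi> - x\<bar>) * dH x" by (rule dH_Harnack)
  also have "\<dots> \<le> exp (sqrt 2 * \<bar>a\<bar>) * dH x" using \<xi>(1) dH_pos[of x] by (intro mult_right_mono) auto
  finally have "\<bar>a\<bar> * dH \<xi> \<le> \<bar>a\<bar> * (exp (sqrt 2 * \<bar>a\<bar>) * dH x)" by (intro mult_left_mono) auto
  then show ?thesis using \<xi>(2) dH_pos[of \<xi>] by (simp add: abs_mult mult.assoc)
qed

text \<open>The kink is not in L2, but the difference of two of its translates is, with its
  derivative. These differences make up for the failure of translations to fix the kink.\<close>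

definition shH :: "real \<Rightarrow> real \<Rightarrow> real" where "shH a x = H (x + a) - H x"
definition qa :: "real \<Rightarrow> l2" where "qa a = cl (shH a)"

lemma continuous_shH: "continuous_on UNIV (shH a)"
proof -
  have "continuous_on UNIV (H \<circ> (\<lambda>x. x + a))" by (intro continuous_on_compose continuous_intros)
  then show ?thesis unfolding shH_def[abs_def] comp_def by (intro continuous_intros)
qed

lemma shH_L2: "shH a \<in> L2"
  by (rule L2_bound[OF dH_L2, where K="\<bar>a\<bar> * exp (sqrt 2 * \<bar>a\<bar>)"])
    (use H_diff_le[of _ a] dH_pos in \<open>auto simp: shH_def abs_of_pos intro!: continuous_lebesgue_measurable continuous_shH AE_I2\<close>)

lemma qa: "dom (qa a)" "dx (qa a) = cl (\<lambda>x. dH (x + a) - dH x)" "rep (qa a) = shH a"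
proof -
  define w where "w x = exp (sqrt 2) * (dH (x + a) + dH x)" for x
  have dHs: "(\<lambda>x. dH (x + a)) \<in> L2" using L2_affine[of 1 dH a] dH_L2 by (simp add: add.commute)
  have w: "w \<in> L2" unfolding w_def[abs_def] by (intro L2_scale L2_add dHs dH_L2)
  have 1: "(shH a has_real_derivative (dH (y + a) - dH y)) (at y)" for y
    unfolding shH_def[abs_def]
    using DERIV_shift[of H "dH (y + a)" y a] H_DERIV[of "y + a"] by (intro DERIV_diff H_DERIV) simp
  have 2: "(\<lambda>x. dH (x + a) - dH x) \<in> borel_measurable lebesgue"
    by (intro L2_measurable L2_diff dHs dH_L2)
  have 3: "\<bar>dH (y + a) - dH y\<bar> \<le> w x" if "\<bar>y - x\<bar> \<le> 1" for x y
  proof -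
    have h: "dH (y + c) \<le> exp (sqrt 2) * dH (x + c)" for c
    proof -
      have "dH (y + c) \<le> exp (sqrt 2 * \<bar>y - x\<bar>) * dH (x + c)" using dH_Harnack[of "y + c" "x + c"] by simp
      also have "\<dots> \<le> exp (sqrt 2) * dH (x + c)"
        using that dH_pos[of "x + c"] mult_left_mono[OF that, of "sqrt 2"] by (intro mult_right_mono) auto
      finally show ?thesis .
    qed
    show ?thesis using h[of 0] h[of a] dH_pos[of y] dH_pos[of "y + a"]
      unfolding w_def distrib_left by simp
  qed
  show "dom (qa a)" "dx (qa a) = cl (\<lambda>x. dH (x + a) - dH x)" "rep (qa a) = shH a"
    unfolding qa_def by (rule D_classical[OF 1 2 shH_L2 w 3], assumption)+
qed

lemma fn_dx_qa: "AE x in lebesgue. fn (dx (qa a)) x = dH (x + a) - dH x"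
proof -
  have "(\<lambda>x. dH (x + a)) \<in> L2" using L2_affine[of 1 dH a] dH_L2 by (simp add: add.commute)
  then show ?thesis unfolding qa(2) by (intro fn_cl L2_diff dH_L2)
qed

text \<open>The cocycle law of \<open>qa\<close>. It makes \<open>sh\<close> an action of the
  translations on perturbations.\<close>

lemma qa_add: "qa (a + b) = tr b (qa a) + qa b"
proof -
  have "tr b (qa a) = cl (\<lambda>x. shH a (x + b))" unfolding qa_def by (rule tr_cl[OF shH_L2])
  moreover have "(\<lambda>x. shH a (x + b)) \<in> L2" using L2_affine[of 1 "shH a" b] shH_L2 by (simp add: add.commute)
  ultimately have "tr b (qa a) + qa b = cl (\<lambda>x. shH a (x + b) + shH b x)"
    unfolding qa_def by (simp add: cl_add shH_L2)
  also have "(\<lambda>x. shH a (x + b) + shH b x) = shH (a + b)"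
    by (rule ext) (simp add: shH_def algebra_simps)
  finally show ?thesis by (simp add: qa_def)
qed

lemma qa_0: "qa 0 = 0"
  by (simp add: qa_def shH_def[abs_def] cl_zero)

lemma norm_qa_minus: "norm (qa (- a)) = norm (qa a)"
proof -
  have "qa (- a) = - tr (- a) (qa a)" using qa_add[of a "- a"] qa_0 by (simp add: eq_neg_iff_add_eq_0 add.commute)
  then show ?thesis by (simp add: norm_aff)
qed

text \<open>Since dH = (1 - H^2) / sqrt 2, the difference dH(x + a) - dH(x) is
  \<open>shH a x\<close> times a bounded function. Estimates of \<open>qa\<close> in L2 thus give
  estimates in H1.\<close>

lemma norm_dx_qa_le: "norm (dx (qa a)) \<le> 2 * norm (qa a)"
proof -
  define p where "p x = - (H (x + a) + H x) / sqrt 2" for x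
  have p2: "\<bar>p x\<bar> \<le> 2" for x
  proof -
    have "\<bar>- (H (x + a) + H x)\<bar> / sqrt 2 \<le> 2 / 1"
      using H_abs_le[of x] H_abs_le[of "x + a"] by (intro frac_le) auto
    then show ?thesis by (simp only: p_def abs_divide abs_numeral real_sqrt_abs abs_of_nonneg[OF real_sqrt_ge_zero[OF zero_le_numeral]] div_by_1)
  qed
  have p: "bd p"
    unfolding p_def[abs_def] using bd_shift[OF bd_H, of a]
    by (intro bdI[OF _ p2[unfolded p_def]] borel_measurable_divide borel_measurable_uminus borel_measurable_add bd_measurable bd_H) auto
  have e: "dH (x + a) - dH x = p x * shH a x" for x
    by (simp add: p_def shH_def dH_def diff_divide_distrib[symmetric] power2_eq_square algebra_simps)
  have "dx (qa a) = mul p (qa a)"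
    using fn_mul_bd[OF p, of "qa a"] fn_dx_qa[of a] fn_cl[OF shH_L2, of a] unfolding l2_eq_iff qa_def[symmetric]
    by eventually_elim (simp add: e)
  then show ?thesis using norm_mul_le[OF bd_measurable[OF p] p2, of "qa a"] by simp
qed

lemma norm_qa_le: "\<bar>a\<bar> \<le> 1 \<Longrightarrow> norm (qa a) \<le> \<bar>a\<bar> * (exp (sqrt 2) * norm (cl dH))"
proof -
  assume a: "\<bar>a\<bar> \<le> 1"
  have "norm (qa a) \<le> norm (cl (\<lambda>x. (\<bar>a\<bar> * exp (sqrt 2)) * dH x))"
    unfolding qa_def
  proof (rule norm_cl_le)
    show "shH a \<in> borel_measurable lebesgue" by (rule L2_measurable[OF shH_L2])
    have "\<bar>shH a x\<bar> \<le> \<bar>(\<bar>a\<bar> * exp (sqrt 2)) * dH x\<bar>" for x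
    proof -
      have "\<bar>shH a x\<bar> \<le> \<bar>a\<bar> * exp (sqrt 2 * \<bar>a\<bar>) * dH x" unfolding shH_def by (rule H_diff_le)
      also have "\<dots> \<le> \<bar>a\<bar> * exp (sqrt 2) * dH x"
        using a dH_pos[of x] mult_left_mono[OF a, of "sqrt 2"] by (intro mult_right_mono mult_left_mono) auto
      finally show ?thesis by simp
    qed
    then show "AE x in lebesgue. \<bar>shH a x\<bar> \<le> \<bar>(\<bar>a\<bar> * exp (sqrt 2)) * dH x\<bar>" by simp
  qed (intro L2_scale dH_L2)
  also have "\<dots> = \<bar>a\<bar> * exp (sqrt 2) * norm (cl dH)" by (simp only: cl_scaleR[OF dH_L2] norm_scaleR abs_mult abs_idempotent abs_exp_cancel)
  finally show ?thesis by (simp only: mult.assoc)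
qed

text \<open>On [0, 1] a shift by m = min a 1 moves the argument at most to 2, where dH is still at
  least dH 2, so the kink rises by at least m dH 2 there. Hence two translates close in L2 must have
  close centres.\<close>

lemma min_le_norm_qa: "dH 2 * min \<bar>a\<bar> 1 \<le> norm (qa a)"
proof -
  have main: "dH 2 * min a 1 \<le> norm (qa a)" if a: "a \<ge> 0" for a
  proof -
    define m where "m = min a 1"
    have m: "0 \<le> m" "m \<le> 1" "m \<le> a" using a by (auto simp: m_def)
    have mono: "H y \<le> H z" if "y \<le> z" for y z using that by (simp add: H_def divide_right_mono)
    have "dH 2 * m \<le> shH a x" if x: "x \<in> {0..1}" for x
    proof -
      obtain \<xi> where \<xi>: "x \<le> \<xi>" "\<xi> \<le> x + m" "H (x + m) - H x = m * dH \<xi>" using H_diff_mvt[of x m] m by auto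
      have "H \<xi> \<le> H 2" "0 \<le> H \<xi>" using \<xi> x m mono[of \<xi> 2] mono[of 0 \<xi>] by (auto simp: H_def[of 0])
      then have "(H \<xi>)\<^sup>2 \<le> (H 2)\<^sup>2" by (intro power_mono)
      then have "dH 2 \<le> dH \<xi>" unfolding dH_def by (intro divide_right_mono) auto
      then have "m * dH 2 \<le> m * dH \<xi>" using m by (intro mult_left_mono)
      moreover have "H (x + m) \<le> H (x + a)" using m by (intro mono) auto
      ultimately show ?thesis using \<xi>(3) by (simp add: shH_def mult.commute)
    qed
    then have "norm (cl (\<lambda>x. (dH 2 * m) * indicator {0..1} x)) \<le> norm (cl (shH a))"
      using m dH_pos[of 2]
      by (intro norm_cl_le shH_L2 L2_measurable[OF L2_scale] indicator_interval_L2 AE_I2)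
        (auto simp: indicator_def intro: order_trans[OF _ abs_ge_self])
    then have "dH 2 * m * norm (iv 0 1) \<le> norm (qa a)"
      using m dH_pos[of 2] by (simp add: cl_scaleR iv_def qa_def abs_mult)
    moreover have "(norm (iv 0 1))\<^sup>2 = 1"
    proof -
      have "(norm (iv 0 1))\<^sup>2 = (LINT x|lebesgue. (indicator {0..1::real} x)\<^sup>2)" unfolding iv_def by (rule norm_cl_power2) simp
      also have "\<dots> = (LINT x|lebesgue. indicator {0..1::real} x)"
        by (intro Bochner_Integration.integral_cong) (auto simp: indicator_def)
      also have "\<dots> = 1" by simp
      finally show ?thesis .
    qed
    then have "norm (iv 0 1) = 1" using norm_ge_zero[of "iv 0 1"] by (simp add: power2_eq_1_iff)
    ultimately show ?thesis by (simp add: m_def)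
  qed
  show ?thesis
  proof (cases "a \<ge> 0")
    case True then show ?thesis using main[of a] by simp
  next
    case False then show ?thesis using main[of "- a"] norm_qa_minus[of a] by simp
  qed
qed

section \<open>Static stability of the kink\<close>

lemma fn_rr:
  assumes u: "dom u"
  shows "AE x in lebesgue. fn (rr u) x = fn (dx u) x + (2 * H x * rep u x + (rep u x)\<^sup>2) / sqrt 2"
proof -
  define q where "q = 2 *\<^sub>R mul H u + sq u"
  have q: "dom q" unfolding q_def by (intro dom_add dom_scaleR mul_H_dom sq u)
  have rq: "rep q = (\<lambda>x. 2 * H x * rep u x + (rep u x)\<^sup>2)"
    unfolding q_def by (simp add: rep_add rep_scaleR dom_scaleR mul_H_dom sq u mult.assoc)
  show ?thesis
    using fn_add[of "dx u" "(1 / sqrt 2) *\<^sub>R q"] fn_scaleR[of "1 / sqrt 2" q] fn_rep[OF q]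
    unfolding rr_def q_def[symmetric] by eventually_elim (simp add: rq)
qed

text \<open>The action on perturbations of translating the perturbed kink \<open>H + u\<close>.\<close>

definition sh :: "real \<Rightarrow> l2 \<Rightarrow> l2" where "sh a u = tr a u + qa a"

lemma dom_sh: "dom u \<Longrightarrow> dom (sh a u)"
  unfolding sh_def by (intro dom_add dom_tr qa)

lemma sh_add: "sh b (sh a u) = sh (a + b) u"
  by (simp add: sh_def aff_add tr_tr qa_add add.assoc)

lemma sh_0: "sh 0 u = u"
  by (simp add: sh_def aff_id qa_0)

lemma rep_sh: "dom u \<Longrightarrow> rep (sh a u) x = rep u (x + a) + H (x + a) - H x"
  unfolding sh_def by (simp add: rep_add dom_tr rep_tr qa shH_def)

text \<open>\<open>rr\<close> is the residual of an autonomous equation for H + u, and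
  \<open>sh\<close> translates H + u; so the residual is merely translated and keeps its
  norm.\<close>

lemma rr_sh:
  assumes u: "dom u" shows "rr (sh a u) = tr a (rr u)"
proof -
  have d: "dx (sh a u) = tr a (dx u) + dx (qa a)"
    unfolding sh_def by (simp add: dx_add dom_tr dx_tr qa u)
  have "AE x in lebesgue. fn (dx (sh a u)) x = fn (dx u) (x + a) + (dH (x + a) - dH x)"
    using fn_add[of "tr a (dx u)" "dx (qa a)"] fn_tr[of a "dx u"] fn_dx_qa[of a]
    unfolding d by eventually_elim simp
  moreover have "AE x in lebesgue. fn (rr u) (x + a) = fn (dx u) (x + a) + (2 * H (x + a) * rep u (x + a) + (rep u (x + a))\<^sup>2) / sqrt 2"
    using AE_affine[of 1, OF _ fn_rr[OF u], of a] by (simp add: add.commute)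
  ultimately show ?thesis
    using fn_rr[OF dom_sh[OF u, of a]] fn_tr[of a "rr u"]
    unfolding l2_eq_iff
  proof eventually_elim
    case (elim x)
    then show ?case by (simp add: rep_sh[OF u] dH_def power2_eq_square divide_inverse algebra_simps)
  qed
qed

lemma H_minus: "H (- x) = - H x"
  by (simp add: H_def)

text \<open>The first order kink equation is invariant under \<phi>(x) to -\<phi>(-x), which fixes
  \<open>H\<close>. This carries estimates from the right half line to the left one.\<close>

lemma rr_rfl:
  assumes u: "dom u" shows "rr (- rfl u) = rfl (rr u)"
proof -
  have d: "dom (- rfl u)" using dom_scaleR[OF dom_rfl[OF u], of "- 1"] by simp
  have r: "rep (- rfl u) = (\<lambda>x. - rep u (- x))"
    using rep_scaleR[OF dom_rfl[OF u], of "- 1"] by (simp add: rep_rfl u)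
  have dd: "dx (- rfl u) = rfl (dx u)" using dx_scaleR[OF dom_rfl[OF u], of "- 1"] by (simp add: dx_rfl u)
  have "AE x in lebesgue. fn (rr u) (- x) = fn (dx u) (- x) + (2 * H (- x) * rep u (- x) + (rep u (- x))\<^sup>2) / sqrt 2"
    using AE_affine[of "- 1", OF _ fn_rr[OF u], of 0] by simp
  then show ?thesis
    using fn_rr[OF d] fn_rfl[of "rr u"] fn_rfl[of "dx u"]
    unfolding l2_eq_iff dd r by eventually_elim (simp add: H_minus)
qed

text \<open>On x >= 0 the residual equation w' = r - (2 H w + w^2) / sqrt 2 damps \<open>w\<close>,
  except near 0 where H is small. Differentiating (2 - H) w^2 supplies damping there too, through
  the decrease of the weight, while the condition at 0 removes the boundary term.\<close>

lemma half_line_increment: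
  assumes w: "dom w" and b: "0 \<le> b" and small: "\<And>x. x \<in> {0..b} \<Longrightarrow> \<bar>rep w x\<bar> \<le> 1/8" and w0: "rep w 0 = 0"
  shows "(rep w b)\<^sup>2 + (1/8) * (LINT x|lebesgue. indicator {0..b} x * (rep w x)\<^sup>2) \<le> 32 * (norm (rr w))\<^sup>2"
proof -
  \<comment> \<open>A decreasing weight with values in [1, 2] on the half line: its derivative -dH
    is largest in size just where the factor H in the damping vanishes.\<close>
  define p where "p x = 2 - H x" for x
  define g where "g = mul p (sq w)"
  have pd: "(p has_real_derivative (- dH y)) (at y)" for y
    unfolding p_def[abs_def] by (auto intro!: derivative_eq_intros H_DERIV)
  have p: "\<bar>p y\<bar> \<le> 3" "\<bar>- dH y\<bar> \<le> 1" for y using H_abs_le[of y] dH_abs_le[of y] by (auto simp: p_def)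
  have pm: "(\<lambda>y. - dH y) \<in> borel_measurable lebesgue" by (intro borel_measurable_uminus bd_measurable bd_dH)
  note g = D_mul_smooth[OF pd p pm sq(1)[OF w], folded g_def]
  have bp: "bd p" unfolding p_def[abs_def] by (intro bd_diff bd_const bd_H)
  have bdd: "bd (\<lambda>y. - dH y)" by (intro bd_uminus bd_dH)
  have "rep g b - rep g 0 = (LINT x|lebesgue. indicator {0..b} x * fn (dx g) x)"
    using rep_increment[OF g(1) b] by (simp add: inner_iv)
  moreover have "rep g b = p b * (rep w b)\<^sup>2" "rep g 0 = 0" by (simp_all add: g(3) sq w w0)
  moreover have "(rep w b)\<^sup>2 \<le> p b * (rep w b)\<^sup>2"
    using mult_right_mono[of 1 "p b" "(rep w b)\<^sup>2"] H_abs_le[of b] by (simp add: p_def)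
  moreover have iw: "integrable lebesgue (\<lambda>x. indicator {0..b} x * (rep w x)\<^sup>2)"
    using integrable_real_mult_indicator[OF _ L2_integrable[OF rep_L2[OF w]], of "{0..b}"] by (simp add: mult.commute)
  have "(LINT x|lebesgue. indicator {0..b} x * fn (dx g) x)
      \<le> (LINT x|lebesgue. 32 * (fn (rr w) x)\<^sup>2 - (1/8) * (indicator {0..b} x * (rep w x)\<^sup>2))"
  proof (rule integral_mono_AE)
    show "integrable lebesgue (\<lambda>x. indicator {0..b} x * fn (dx g) x)"
      by (intro L2_mult_integrable) simp_all
    show "integrable lebesgue (\<lambda>x. 32 * (fn (rr w) x)\<^sup>2 - (1/8) * (indicator {0..b} x * (rep w x)\<^sup>2))"
      by (intro Bochner_Integration.integrable_diff integrable_mult_right iw L2_integrable fn_L2)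
    have "AE x in lebesgue. fn (dx g) x = p x * (2 * (rep w x * fn (dx w) x)) - dH x * (rep w x)\<^sup>2"
      using fn_add[of "mul p (2 *\<^sub>R mul (rep w) (dx w))" "mul (\<lambda>y. - dH y) (sq w)"] fn_mul_bd[OF bp, of "2 *\<^sub>R mul (rep w) (dx w)"]
        fn_scaleR[of 2 "mul (rep w) (dx w)"] fn_mul_bd[OF bd_rep[OF w], of "dx w"] fn_mul_bd[OF bdd, of "sq w"] fn_rep[OF sq(1)[OF w]]
      unfolding g(2) sq(2)[OF w] sq(3)[OF w] by eventually_elim simp
    then show "AE x in lebesgue. indicator {0..b} x * fn (dx g) x \<le> 32 * (fn (rr w) x)\<^sup>2 - (1/8) * (indicator {0..b} x * (rep w x)\<^sup>2)"
      using fn_rr[OF w]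
    proof eventually_elim
      case (elim x)
      show ?case
      proof (cases "x \<in> {0..b}")
        case True
        define v where "v = rep w x"
        define h where "h = H x"
        define r where "r = fn (rr w) x"
        have v: "\<bar>v\<bar> \<le> 1/8" using small[OF True] by (simp add: v_def)
        have h: "0 \<le> h" "h \<le> 1" using True H_abs_le[of x] by (auto simp: h_def H_def)
        define s where "s = 1 / sqrt (2::real)"
        have s: "s \<ge> 1/2" "s \<le> 1" by (auto simp: s_def field_simps real_le_lsqrt)
        have e: "fn (dx g) x = 2 * (2 - h) * v * r - s * (1 - h\<^sup>2 + (2 - h) * (4 * h + 2 * v)) * v\<^sup>2"
        proof -
          have d: "fn (dx w) x = r - s * (2 * h * v + v\<^sup>2)" and dHx: "dH x = s * (1 - h\<^sup>2)"
            using elim(2) by (simp_all add: v_def h_def r_def s_def dH_def)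
          then show ?thesis using elim(1) unfolding p_def h_def[symmetric] v_def[symmetric] d dHx
            by (simp add: power2_eq_square algebra_simps)
        qed
        \<comment> \<open>Without \<open>v\<close> this is 1 + 8 h - 5 h^2 >= 1 on [0, 1]; the terms
          with |v| <= 1/8 cost at most 1/2.\<close>
        have "1/2 \<le> 1 - h\<^sup>2 + (2 - h) * (4 * h + 2 * v)"
        proof -
          have "h * h \<le> 1 * h" using h by (intro mult_right_mono) auto
          moreover have "\<bar>(2 - h) * (2 * v)\<bar> \<le> 2 * (1/4)" unfolding abs_mult using h v by (intro mult_mono) auto
          then have "- (1/2) \<le> (2 - h) * (2 * v)" by (simp add: abs_le_iff)
          ultimately show ?thesis using h(1) by (simp add: power2_eq_square algebra_simps)
        qed
        then have "1/2 * (1/2) \<le> s * (1 - h\<^sup>2 + (2 - h) * (4 * h + 2 * v))" using s by (intro mult_mono) auto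
        then have c: "1/4 * v\<^sup>2 \<le> s * (1 - h\<^sup>2 + (2 - h) * (4 * h + 2 * v)) * v\<^sup>2" by (intro mult_right_mono) auto
        have "2 * (2 - h) * v * r \<le> \<bar>2 * (2 - h) * v * r\<bar>" by (rule abs_ge_self)
        also have "\<dots> = (2 - h) * (2 * \<bar>v * r\<bar>)" using h by (simp add: abs_mult)
        also have "\<dots> \<le> 2 * (2 * \<bar>v * r\<bar>)" using h by (intro mult_right_mono) auto
        \<comment> \<open>Young's inequality, spending half of the damping 1/4 v^2 obtained above
          and leaving 1/8 v^2 for the integral.\<close>
        also have "\<dots> \<le> 1/8 * v\<^sup>2 + 32 * r\<^sup>2"
        proof -
          have "0 \<le> (\<bar>v\<bar> - 16 * \<bar>r\<bar>)\<^sup>2" by simp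
          then show ?thesis by (simp add: power2_diff power_mult_distrib abs_mult)
        qed
        finally show ?thesis using True e c by (simp add: v_def[symmetric] r_def[symmetric])
      qed simp
    qed
  qed
  moreover have "(LINT x|lebesgue. 32 * (fn (rr w) x)\<^sup>2 - (1/8) * (indicator {0..b} x * (rep w x)\<^sup>2))
      = 32 * (norm (rr w))\<^sup>2 - (1/8) * (LINT x|lebesgue. indicator {0..b} x * (rep w x)\<^sup>2)"
    using iw L2_integrable[OF fn_L2, of "rr w"] by (simp add: norm_l2_power2)
  ultimately show ?thesis by linarith
qed

text \<open>Continuity argument: at the first point where |w| reaches 1/8 the previous lemma gives
  w^2 <= 32 / 64^2 = 1/128, below (1/8)^2 = 1/64. This is the origin of the threshold 1/64.\<close>

lemma half_line_small:
  assumes w: "dom w" and r: "norm (rr w) \<le> 1/64" and w0: "rep w 0 = 0" and b: "0 \<le> b"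
  shows "\<bar>rep w b\<bar> \<le> 1/8"
proof (rule ccontr)
  assume n: "\<not> \<bar>rep w b\<bar> \<le> 1/8"
  have c: "continuous_on A (rep w)" for A using rep_continuous[OF w] continuous_on_subset by blast
  define S where "S = {0..b} \<inter> {x. 1/8 \<le> \<bar>rep w x\<bar>}"
  have "compact S" unfolding S_def by (intro compact_Int_closed closed_Collect_le continuous_intros c) auto
  moreover have "b \<in> S" using n b by (auto simp: S_def)
  ultimately obtain s where s: "s \<in> S" "\<And>x. x \<in> S \<Longrightarrow> s \<le> x"
    using continuous_attains_inf[of S "\<lambda>x. x"] continuous_on_id by blast
  have s0: "0 \<le> s" "s \<le> b" "1/8 \<le> \<bar>rep w s\<bar>" using s(1) by (auto simp: S_def)
  have "s \<noteq> 0" using s0(3) w0 by auto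
  have lt: "\<bar>rep w x\<bar> < 1/8" if "0 \<le> x" "x < s" for x
    using s(2)[of x] that s0(2) by (force simp: S_def)
  have "closed {x. \<bar>rep w x\<bar> \<le> 1/8}" by (intro closed_Collect_le continuous_intros c)
  moreover have "{0<..<s} \<subseteq> {x. \<bar>rep w x\<bar> \<le> 1/8}" using lt by (auto intro: less_imp_le)
  ultimately have "closure {0<..<s} \<subseteq> {x. \<bar>rep w x\<bar> \<le> 1/8}" by (rule closure_minimal[rotated])
  then have le: "\<bar>rep w x\<bar> \<le> 1/8" if "x \<in> {0..s}" for x
    using that \<open>s \<noteq> 0\<close> s0(1) by (auto simp: closure_greaterThanLessThan)
  have "0 \<le> (LINT x|lebesgue. indicator {0..s} x * (rep w x)\<^sup>2)" by (intro integral_nonneg_AE) auto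
  then have "(rep w s)\<^sup>2 \<le> 32 * (norm (rr w))\<^sup>2" using half_line_increment[OF w s0(1) le w0] by linarith
  moreover have "(norm (rr w))\<^sup>2 \<le> (1/64)\<^sup>2" using r by (intro power_mono) auto
  moreover have "(1/8)\<^sup>2 \<le> \<bar>rep w s\<bar>\<^sup>2" using s0(3) by (intro power_mono) auto
  ultimately show False by (simp add: power2_eq_square)
qed

lemma half_line_bound:
  assumes w: "dom w" and r: "norm (rr w) \<le> 1/64" and w0: "rep w 0 = 0" and b: "0 \<le> b"
  shows "(LINT x|lebesgue. indicator {0..b} x * (rep w x)\<^sup>2) \<le> 256 * (norm (rr w))\<^sup>2"
proof -
  have "(rep w b)\<^sup>2 + (1/8) * (LINT x|lebesgue. indicator {0..b} x * (rep w x)\<^sup>2) \<le> 32 * (norm (rr w))\<^sup>2"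
    by (rule half_line_increment[OF w b _ w0]) (use half_line_small[OF w r w0] in force)
  then show ?thesis using zero_le_power2[of "rep w b"] by linarith
qed

text \<open>Coercivity once the zero of the kink is pinned; the two half lines are related by the symmetry \<open>w(x) \<mapsto> - w(- x)\<close>.\<close>

lemma pinned_stability:
  assumes w: "dom w" and r: "norm (rr w) \<le> 1/64" and w0: "rep w 0 = 0"
  shows "nH w \<le> 120 * norm (rr w)"
proof -
  define v where "v = - rfl w"
  have v: "dom v" unfolding v_def using dom_scaleR[OF dom_rfl[OF w], of "- 1"] by simp
  have rv: "rep v = (\<lambda>x. - rep w (- x))"
    unfolding v_def using rep_scaleR[OF dom_rfl[OF w], of "- 1"] by (simp add: rep_rfl w)
  have rrv: "norm (rr v) = norm (rr w)" unfolding v_def by (simp add: rr_rfl w norm_aff)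
  have v0: "rep v 0 = 0" by (simp add: rv w0)
  have r': "norm (rr v) \<le> 1/64" using r by (simp only: rrv)
  have small: "\<bar>rep w x\<bar> \<le> 1/8" for x
  proof (cases "0 \<le> x")
    case True then show ?thesis by (rule half_line_small[OF w r w0])
  next
    case False then show ?thesis using half_line_small[OF v r' v0, of "- x"] by (simp add: rv)
  qed
  have im: "integrable lebesgue (\<lambda>x. indicator {c..d} x * (rep w x)\<^sup>2)" for c d
    using integrable_real_mult_indicator[OF _ L2_integrable[OF rep_L2[OF w]], of "{c..d}"] by (simp add: mult.commute)
  \<comment> \<open>The half line estimates are for bounded intervals and uniform in the length; the
    truncations carry them to the whole line in the limit.\<close>
  define f where "f n x = indicator {- real n..real n} x * rep w x" for n x
  have fm: "f n \<in> borel_measurable lebesgue" for n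
    unfolding f_def[abs_def] by (intro borel_measurable_times L2_measurable indicator_interval_L2 rep_L2 w)
  have fb: "\<bar>f n x\<bar> \<le> \<bar>rep w x\<bar>" for n x by (simp add: f_def indicator_def)
  have fL: "f n \<in> L2" for n by (rule L2_bound[OF rep_L2[OF w] fm, where K=1]) (simp add: fb)
  have bound: "norm (cl (f n)) \<le> 23 * norm (rr w)" for n
  proof (rule power2_le_imp_le)
    have "(norm (cl (f n)))\<^sup>2 = (LINT x|lebesgue. (f n x)\<^sup>2)" by (rule norm_cl_power2[OF fL])
    also have "\<dots> \<le> (LINT x|lebesgue. indicator {0..real n} x * (rep w x)\<^sup>2 + indicator {- real n..0} x * (rep w x)\<^sup>2)"
      by (intro integral_mono Bochner_Integration.integrable_add im L2_integrable fL)
        (auto simp: f_def indicator_def power_mult_distrib)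
    also have "\<dots> = (LINT x|lebesgue. indicator {0..real n} x * (rep w x)\<^sup>2) + (LINT x|lebesgue. indicator {- real n..0} x * (rep w x)\<^sup>2)"
      by (intro Bochner_Integration.integral_add im)
    also have "(LINT x|lebesgue. indicator {- real n..0} x * (rep w x)\<^sup>2) = (LINT x|lebesgue. indicator {0..real n} x * (rep v x)\<^sup>2)"
    proof -
      have "(LINT x|lebesgue. indicator {- real n..0} (0 + - 1 * x) * (rep w (0 + - 1 * x))\<^sup>2) = (LINT x|lebesgue. indicator {- real n..0} x * (rep w x)\<^sup>2)"
        using borel_measurable_integrable[OF im[of "- real n" 0]]
        by (intro integral_affine[where f="\<lambda>x. indicator {- real n..0} x * (rep w x)\<^sup>2"]) simp_all
      moreover have "indicator {- real n..0} (0 + - 1 * x) = (indicator {0..real n} x :: real)" for x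
        by (auto simp: indicator_def)
      ultimately show ?thesis by (simp add: rv)
    qed
    also have "(LINT x|lebesgue. indicator {0..real n} x * (rep w x)\<^sup>2) + \<dots> \<le> 256 * (norm (rr w))\<^sup>2 + 256 * (norm (rr v))\<^sup>2"
      by (intro add_mono half_line_bound w r w0 v r' v0) auto
    \<comment> \<open>The two half lines contribute 2 * 256 = 512, and 23^2 = 529.\<close>
    also have "\<dots> \<le> (23 * norm (rr w))\<^sup>2" by (simp add: rrv power_mult_distrib)
    finally show "(norm (cl (f n)))\<^sup>2 \<le> (23 * norm (rr w))\<^sup>2" .
  qed simp
  have "(\<lambda>n. cl (f n)) \<longlonglongrightarrow> cl (rep w)"
  proof (rule l2_dominated_convergence[OF rep_L2[OF w] fm L2_measurable[OF rep_L2[OF w]]])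
    have "(\<lambda>n. f n x) \<longlonglongrightarrow> rep w x" for x
    proof (rule tendsto_eventually)
      obtain k where k: "\<bar>x\<bar> \<le> real k" using real_arch_simple by blast
      show "\<forall>\<^sub>F n in sequentially. f n x = rep w x"
        using eventually_ge_at_top[of k]
      proof eventually_elim
        case (elim n)
        then have "\<bar>x\<bar> \<le> real n" using k by linarith
        then have "x \<in> {- real n..real n}" by auto
        then show ?case by (simp add: f_def)
      qed
    qed
    then show "AE x in lebesgue. (\<lambda>n. f n x) \<longlonglongrightarrow> rep w x" by simp
  qed (simp add: fb)
  then have "norm (cl (rep w)) \<le> 23 * norm (rr w)"
    by (intro LIMSEQ_le_const2[OF tendsto_norm]) (auto simp: bound)
  then have nw: "norm w \<le> 23 * norm (rr w)" by (simp add: cl_rep w)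
  have dxw: "dx w = rr w - (1 / sqrt 2) *\<^sub>R (2 *\<^sub>R mul H w + sq w)" by (simp add: rr_def)
  have "norm (sq w) \<le> 1/8 * norm w" unfolding sq_def by (intro norm_mul_le bd_measurable bd_rep w small)
  moreover have "norm (mul H w) \<le> 1 * norm w" by (intro norm_mul_le bd_measurable bd_H H_abs_le)
  moreover have "norm (2 *\<^sub>R mul H w + sq w) \<le> 2 * norm (mul H w) + norm (sq w)"
    using norm_triangle_ineq[of "2 *\<^sub>R mul H w" "sq w"] by simp
  ultimately have a: "norm (2 *\<^sub>R mul H w + sq w) \<le> 17/8 * norm w" by linarith
  have "norm ((1 / sqrt 2) *\<^sub>R (2 *\<^sub>R mul H w + sq w)) = 1 / sqrt 2 * norm (2 *\<^sub>R mul H w + sq w)" by simp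
  also have "\<dots> \<le> 1 * norm (2 *\<^sub>R mul H w + sq w)" by (intro mult_right_mono) auto
  finally have "norm (dx w) \<le> norm (rr w) + 17/8 * norm w"
    using a norm_triangle_ineq4[of "rr w" "(1 / sqrt 2) *\<^sub>R (2 *\<^sub>R mul H w + sq w)"] unfolding dxw by linarith
  \<comment> \<open>1 + 17/8 * 23 < 50. In the final constant, 50^2 + 2 * 23^2 is well below
    120^2.\<close>
  then have dw: "norm (dx w) \<le> 50 * norm (rr w)" using nw norm_ge_zero[of "rr w"] by linarith
  show ?thesis
  proof (rule power2_le_imp_le)
    have "(nH w)\<^sup>2 = (norm (dx w))\<^sup>2 + 2 * (norm w)\<^sup>2" by (rule nH_power2[OF w])
    also have "\<dots> \<le> (50 * norm (rr w))\<^sup>2 + 2 * (23 * norm (rr w))\<^sup>2"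
      using dw nw by (intro add_mono mult_left_mono power_mono) auto
    also have "\<dots> \<le> (120 * norm (rr w))\<^sup>2" by (simp add: power_mult_distrib)
    finally show "(nH w)\<^sup>2 \<le> (120 * norm (rr w))\<^sup>2" .
  qed simp
qed

section \<open>Locating a zero of the perturbed kink\<close>

lemma ex_small_rep:
  assumes u: "dom u" shows "\<exists>x\<ge>a. \<bar>rep u x\<bar> < 1/2"
proof (rule ccontr)
  assume "\<not> ?thesis"
  then have big: "1/2 \<le> \<bar>rep u x\<bar>" if "a \<le> x" for x using that by force
  obtain n :: nat where n: "4 * (norm u)\<^sup>2 < real n" using reals_Archimedean2 by blast
  have "(LINT x|lebesgue. (1/4) * indicator {a..a + real n} x) \<le> (LINT x|lebesgue. (rep u x)\<^sup>2)"
  proof (rule integral_mono)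
    show "integrable lebesgue (\<lambda>x. (1/4) * indicator {a..a + real n} x :: real)"
      by (intro integrable_mult_right integrable_real_indicator) auto
    show "integrable lebesgue (\<lambda>x. (rep u x)\<^sup>2)" by (intro L2_integrable rep_L2 u)
    show "(1/4) * indicator {a..a + real n} x \<le> (rep u x)\<^sup>2" for x
      using power_mono[OF big[of x], of 2] by (auto simp: indicator_def power2_eq_square)
  qed
  moreover have "(LINT x|lebesgue. (rep u x)\<^sup>2) = (norm u)\<^sup>2"
    using norm_cl_power2[OF rep_L2[OF u]] by (simp add: cl_rep u)
  ultimately show False using n by simp
qed

text \<open>Far out on each side |H| exceeds 1/2, while an L2 perturbation is below 1/2 somewhere on
  every half line; the intermediate value theorem applies between two such points. No smallness of
  the perturbation enters.\<close>

lemma ex_kink_zero: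
  assumes u: "dom u" shows "\<exists>\<rho>. H \<rho> + rep u \<rho> = 0"
proof -
  have "\<forall>\<^sub>F y in at_top. 1/2 < tanh (y::real)" by (rule order_tendstoD(1)[OF tanh_real_at_top]) simp
  then obtain Y where Y: "\<And>y. y \<ge> Y \<Longrightarrow> 1/2 < tanh (y::real)" by (auto simp: eventually_at_top_linorder)
  define a where "a = max 0 (Y * sqrt 2)"
  have Ha: "1/2 < H x" if "a \<le> x" for x
    using Y[of "x / sqrt 2"] that by (simp add: H_def a_def field_simps)
  obtain x where x: "a \<le> x" "\<bar>rep u x\<bar> < 1/2" using ex_small_rep[OF u] by blast
  obtain y where y: "a \<le> y" "\<bar>rep (rfl u) y\<bar> < 1/2" using ex_small_rep[OF dom_rfl[OF u]] by blast
  have "0 \<le> H x + rep u x" using Ha[OF x(1)] x(2) by linarith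
  moreover have "H (- y) + rep u (- y) \<le> 0"
    using Ha[OF y(1)] y(2) unfolding H_minus by (simp add: rep_rfl u)
  moreover have "- y \<le> x" using x(1) y(1) by (simp add: a_def)
  moreover have "continuous_on {- y..x} (\<lambda>z. H z + rep u z)"
    using continuous_on_subset[OF rep_continuous[OF u]] by (intro continuous_intros) auto
  ultimately show ?thesis using IVT'[of "\<lambda>z. H z + rep u z" "- y" 0 x] by auto
qed

lemma static_stability:
  assumes u: "dom u" and r: "norm (rr u) \<le> 1/64"
  shows "\<exists>\<rho>. nH (sh \<rho> u) \<le> 120 * norm (rr u)"
proof -
  obtain \<rho> where "H \<rho> + rep u \<rho> = 0" using ex_kink_zero[OF u] by blast
  then have "rep (sh \<rho> u) 0 = 0" by (simp add: rep_sh u H_def[of 0])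
  then have "nH (sh \<rho> u) \<le> 120 * norm (rr (sh \<rho> u))"
    using r by (intro pinned_stability dom_sh u) (simp_all only: rr_sh[OF u] norm_aff simp_thms)
  then show ?thesis by (intro exI[of _ \<rho>]) (simp add: rr_sh u norm_aff)
qed

section \<open>Solutions in the sense of Duhamel\<close>

lemma linear_u1: "linear u1" and linear_u2: "linear u2"
  by (rule linearI; simp add: u1_def u2_def mul_add mul_scaleR bd_inverse_mw hart_add hart_scaleR aff_add aff_scaleR)+

lemma TT_eqI:
  assumes "fst f \<in> L2" "snd f \<in> L2" "cl (fst f) = u1 z" "cl (snd f) = u2 z"
  shows "f \<in> H1 \<times> L2" "TT f = z"
proof -
  show f: "f \<in> H1 \<times> L2" using assms by (simp add: mem_Times_iff H1_iff dom_u1)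
  have "u1 (TT f - z) = 0" "u2 (TT f - z) = 0" using assms by (simp_all add: u1_diff u2_diff u1_TT f u2_TT)
  then have "(norm (TT f - z))\<^sup>2 = 0" using norm_state_power2[of "TT f - z"] by (simp add: dx_zero)
  then show "TT f = z" by simp
qed

lemma TT_simps:
  assumes "f \<in> H1 \<times> L2"
  shows "fst f \<in> L2" "snd f \<in> L2" "cl (fst f) = u1 (TT f)" "cl (snd f) = u2 (TT f)"
  using assms by (auto simp: mem_Times_iff H1_iff u1_TT u2_TT)

lemma TT_add:
  assumes f: "f \<in> H1 \<times> L2" and g: "g \<in> H1 \<times> L2"
  shows "f + g \<in> H1 \<times> L2" "TT (f + g) = TT f + TT g"
  by (rule TT_eqI[of "f + g" "TT f + TT g"];
      simp add: plus_fun_def TT_simps[OF f] TT_simps[OF g] L2_add cl_add linear_add[OF linear_u1] linear_add[OF linear_u2])+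

lemma TT_diff:
  assumes f: "f \<in> H1 \<times> L2" and g: "g \<in> H1 \<times> L2"
  shows "f - g \<in> H1 \<times> L2" "TT (f - g) = TT f - TT g"
  by (rule TT_eqI[of "f - g" "TT f - TT g"];
      simp add: fun_diff_def TT_simps[OF f] TT_simps[OF g] L2_diff cl_diff u1_diff u2_diff)+

lemma state_eq_iff_TT:
  assumes f: "f \<in> H1 \<times> L2" and g: "g \<in> H1 \<times> L2"
  shows "f \<approx> g \<longleftrightarrow> TT f = TT g"
proof -
  have "f \<approx> g \<longleftrightarrow> cl (fst f) = cl (fst g) \<and> cl (snd f) = cl (snd g)"
    unfolding state_eq_def
    by (simp only: cl_eq_iff[OF TT_simps(1)[OF f] TT_simps(1)[OF g]] cl_eq_iff[OF TT_simps(2)[OF f] TT_simps(2)[OF g]])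
  also have "\<dots> \<longleftrightarrow> TT f = TT g"
    using TT_eqI(2)[of f "TT g"] TT_simps[OF f] TT_simps[OF g] by auto
  finally show ?thesis .
qed

text \<open>The energy norm contains the mass term with the factor 2, whence a constant sqrt 2
  between the norms, rounded up to 2.\<close>

lemma X_norm_TT:
  assumes f: "f \<in> H1 \<times> L2"
  shows "X_norm f \<le> norm (TT f)" "norm (TT f) \<le> 2 * X_norm f"
proof -
  note n = norm_state_power2[of "TT f"] X_norm_eq[OF f]
  have e: "u1 (TT f) = cl (fst f)" "u2 (TT f) = cl (snd f)" using TT_simps[OF f] by simp_all
  have p: "0 \<le> (norm (cl (fst f)))\<^sup>2" "0 \<le> (norm (dx (cl (fst f))))\<^sup>2" "0 \<le> (norm (cl (snd f)))\<^sup>2" by simp_all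
  show "X_norm f \<le> norm (TT f)"
  proof (rule power2_le_imp_le)
    show "(X_norm f)\<^sup>2 \<le> (norm (TT f))\<^sup>2" using n p unfolding e by linarith
  qed simp
  have "(2 * X_norm f)\<^sup>2 = 4 * (X_norm f)\<^sup>2" by (simp add: power_mult_distrib)
  then have "(norm (TT f))\<^sup>2 \<le> (2 * X_norm f)\<^sup>2" using n p unfolding e by linarith
  then show "norm (TT f) \<le> 2 * X_norm f" by (rule power2_le_imp_le) (simp add: n(3))
qed

text \<open>\<open>has_X_integral\<close> asks for a constant mesh rather than a general gauge;
  uniform continuity on the compact interval provides it.\<close>

lemma Riemann_sum_uniform:
  fixes g :: "real \<Rightarrow> 'a::banach"
  assumes g: "continuous_on UNIV g" and \<epsilon>: "\<epsilon> > 0"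
  shows "\<exists>d>0. \<forall>p. p tagged_division_of {a..b} \<and> (\<lambda>s. ball s d) fine p \<longrightarrow>
    norm ((\<Sum>(s, K)\<in>p. measure lborel K *\<^sub>R g s) - integral {a..b} g) \<le> \<epsilon> * measure lborel {a..b}"
proof -
  have "uniformly_continuous_on {a..b} g"
    by (intro compact_uniformly_continuous continuous_on_subset[OF g]) auto
  then obtain d where d: "d > 0" "\<And>x y. x \<in> {a..b} \<Longrightarrow> y \<in> {a..b} \<Longrightarrow> dist y x < d \<Longrightarrow> dist (g y) (g x) < \<epsilon>"
    using \<epsilon> unfolding uniformly_continuous_on_def by metis
  have i: "g integrable_on {c..e}" for c e
    by (intro integrable_continuous_real continuous_on_subset[OF g]) auto
  have "norm ((\<Sum>(s, K)\<in>p. measure lborel K *\<^sub>R g s) - integral {a..b} g) \<le> \<epsilon> * measure lborel {a..b}"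
    if p: "p tagged_division_of {a..b}" and fine: "(\<lambda>s. ball s d) fine p" for p
  proof -
    have p': "p tagged_division_of (cbox a b)" using p by simp
    have "(g has_integral (\<Sum>(s, K)\<in>p. integral K g)) (cbox a b)"
      by (rule has_integral_combine_tagged_division_topdown[OF _ p']) (use i in simp)
    then have int: "integral {a..b} g = (\<Sum>(s, K)\<in>p. integral K g)" by (simp add: integral_unique)
    have each: "norm (measure lborel K *\<^sub>R g s - integral K g) \<le> \<epsilon> * measure lborel K" if sK: "(s, K) \<in> p" for s K
    proof -
      obtain c e where K: "K = {c..e}" using tagged_division_ofD(4)[OF p sK] by auto
      have sub: "K \<subseteq> ball s d" "K \<subseteq> {a..b}" "s \<in> K"
        using fineD[OF fine sK] tagged_division_ofD(2,3)[OF p sK] by auto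
      have "((\<lambda>x. g s - g x) has_integral (measure lborel K *\<^sub>R g s - integral K g)) (cbox c e)"
        using has_integral_diff[OF has_integral_const[of "g s" c e], of g "integral K g"] integrable_integral[OF i[of c e]] by (simp add: K)
      then show ?thesis
        unfolding K box_real(2)[symmetric]
      proof (rule has_integral_bound[rotated])
        fix x assume "x \<in> cbox c e"
        then have "x \<in> K" by (simp add: K)
        then have "dist (g s) (g x) < \<epsilon>" using sub by (intro d(2)) auto
        then show "norm (g s - g x) \<le> \<epsilon>" by (simp add: dist_norm)
      qed (use \<epsilon> in simp)
    qed
    have "norm ((\<Sum>(s, K)\<in>p. measure lborel K *\<^sub>R g s) - integral {a..b} g) = norm (\<Sum>(s, K)\<in>p. measure lborel K *\<^sub>R g s - integral K g)"
      unfolding int by (simp add: sum_subtractf case_prod_unfold)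
    also have "\<dots> \<le> (\<Sum>(s, K)\<in>p. \<epsilon> * measure lborel K)"
      unfolding case_prod_unfold by (rule sum_norm_le) (use each in auto)
    also have "\<dots> = \<epsilon> * measure lborel {a..b}"
      using additive_content_tagged_division[OF p'] by (simp add: case_prod_unfold sum_distrib_left[symmetric])
    finally show ?thesis .
  qed
  with d(1) show ?thesis by blast
qed

lemma TT_Riemann_sum:
  fixes c :: real
  assumes w: "\<And>s. w s \<in> H1 \<times> L2" and p: "finite p"
  defines "S \<equiv> ((\<lambda>x. c * (\<Sum>(s, K)\<in>p. measure lborel K * fst (w s) x)), (\<lambda>x. c * (\<Sum>(s, K)\<in>p. measure lborel K * snd (w s) x)))"
  shows "S \<in> H1 \<times> L2" "TT S = c *\<^sub>R (\<Sum>(s, K)\<in>p. measure lborel K *\<^sub>R TT (w s))"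
proof -
  have a: "(\<lambda>x. \<Sum>i\<in>p. measure lborel (snd i) * h (w (fst i)) x) \<in> L2 \<and> cl (\<lambda>x. \<Sum>i\<in>p. measure lborel (snd i) * h (w (fst i)) x) = (\<Sum>i\<in>p. measure lborel (snd i) *\<^sub>R v (TT (w (fst i))))"
    if h: "\<And>s. h (w s) \<in> L2" "\<And>s. cl (h (w s)) = v (TT (w s))" for h :: "state \<Rightarrow> real \<Rightarrow> real" and v
    using cl_sum[OF p, of "\<lambda>i x. measure lborel (snd i) * h (w (fst i)) x"] L2_scale[OF h(1)] cl_scaleR[OF h(1)] by (simp add: h(2))
  note a1 = a[of fst u1, OF TT_simps(1)[OF w] TT_simps(3)[OF w]]
  note a2 = a[of snd u2, OF TT_simps(2)[OF w] TT_simps(4)[OF w]]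
  show "S \<in> H1 \<times> L2" "TT S = c *\<^sub>R (\<Sum>(s, K)\<in>p. measure lborel K *\<^sub>R TT (w s))"
    by (rule TT_eqI[of S "c *\<^sub>R (\<Sum>(s, K)\<in>p. measure lborel K *\<^sub>R TT (w s))"];
      simp add: S_def case_prod_unfold a1 a2 L2_scale cl_scaleR linear_scale[OF linear_u1] linear_sum[OF linear_u1] linear_scale[OF linear_u2] linear_sum[OF linear_u2])+
qed

text \<open>\<open>TT\<close> is linear and its norm equivalent to \<open>X_norm\<close>, so Riemann
  sums of functions become Riemann sums in \<open>l2 \<times> l2\<close>. Both directions are
  needed: one to show that a given process solves the equation, the other for uniqueness.\<close>

lemma has_X_integral_iff:
  assumes w: "\<And>s. w s \<in> H1 \<times> L2" and c: "continuous_on UNIV (\<lambda>s. TT (w s))" and I: "I \<in> H1 \<times> L2"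
  shows "has_X_integral w t I \<longleftrightarrow> TT I = J (\<lambda>s. TT (w s)) t"
proof -
  define g where "g s = TT (w s)" for s
  define a where "a = min 0 t"
  define b where "b = max 0 t"
  define S where "S p = ((\<lambda>x. sgn t * (\<Sum>(s, K)\<in>p. measure lborel K * fst (w s) x)), (\<lambda>x. sgn t * (\<Sum>(s, K)\<in>p. measure lborel K * snd (w s) x)))" for p :: "(real \<times> real set) set"
  have conv: "\<exists>d>0. \<forall>p. p tagged_division_of {a..b} \<and> (\<lambda>s. ball s d) fine p \<longrightarrow> norm (TT (S p) - J g t) < \<epsilon>" if \<epsilon>: "\<epsilon> > 0" for \<epsilon>
  proof -
    define \<epsilon>' where "\<epsilon>' = \<epsilon> / (measure lborel {a..b} + 1)"
    have e': "\<epsilon>' > 0" using \<epsilon> by (simp add: \<epsilon>'_def add_nonneg_pos)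
    obtain d where d: "d > 0" "\<And>p. p tagged_division_of {a..b} \<Longrightarrow> (\<lambda>s. ball s d) fine p \<Longrightarrow>
        norm ((\<Sum>(s, K)\<in>p. measure lborel K *\<^sub>R g s) - integral {a..b} g) \<le> \<epsilon>' * measure lborel {a..b}"
      using Riemann_sum_uniform[OF c[folded g_def] e', of a b] by blast
    have "norm (TT (S p) - J g t) < \<epsilon>" if p: "p tagged_division_of {a..b}" "(\<lambda>s. ball s d) fine p" for p
    proof -
      have "TT (S p) - J g t = sgn t *\<^sub>R ((\<Sum>(s, K)\<in>p. measure lborel K *\<^sub>R g s) - integral {a..b} g)"
        unfolding S_def TT_Riemann_sum(2)[where w=w, OF w tagged_division_of_finite[OF p(1)]]
        by (simp add: J_def a_def b_def g_def scaleR_diff_right)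
      then have "norm (TT (S p) - J g t) \<le> 1 * norm ((\<Sum>(s, K)\<in>p. measure lborel K *\<^sub>R g s) - integral {a..b} g)"
        by (simp only: norm_scaleR) (intro mult_right_mono, auto simp: sgn_if)
      also have "\<dots> \<le> \<epsilon>' * measure lborel {a..b}" using d(2)[OF p] by simp
      also have "\<dots> < \<epsilon>' * (measure lborel {a..b} + 1)" using e' by simp
      also have "\<dots> = \<epsilon>" using add_nonneg_pos[OF measure_nonneg[of lborel "{a..b}"], of 1] by (simp add: \<epsilon>'_def)
      finally show ?thesis .
    qed
    with d(1) show ?thesis by blast
  qed
  have SX: "S p - I \<in> H1 \<times> L2" "TT (S p - I) = TT (S p) - TT I" if "p tagged_division_of {a..b}" for p
    using TT_Riemann_sum(1)[where w=w, OF w tagged_division_of_finite[OF that]] TT_diff[OF _ I] by (auto simp: S_def)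
  have def: "has_X_integral w t I \<longleftrightarrow> (\<forall>\<epsilon>>0. \<exists>d>0. \<forall>p. p tagged_division_of {a..b} \<and> (\<lambda>s. ball s d) fine p \<longrightarrow> X_norm (S p - I) < \<epsilon>)"
    unfolding has_X_integral_def a_def[symmetric] b_def[symmetric] S_def using I w by blast
  show ?thesis
    unfolding def g_def[symmetric]
  proof
    assume eq: "TT I = J g t"
    show "\<forall>\<epsilon>>0. \<exists>d>0. \<forall>p. p tagged_division_of {a..b} \<and> (\<lambda>s. ball s d) fine p \<longrightarrow> X_norm (S p - I) < \<epsilon>"
    proof (intro allI impI)
      fix \<epsilon> :: real assume "\<epsilon> > 0"
      then obtain d where d: "d > 0" "\<And>p. p tagged_division_of {a..b} \<and> (\<lambda>s. ball s d) fine p \<Longrightarrow> norm (TT (S p) - J g t) < \<epsilon>"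
        using conv by blast
      have "X_norm (S p - I) < \<epsilon>" if p: "p tagged_division_of {a..b} \<and> (\<lambda>s. ball s d) fine p" for p
      proof -
        have p': "p tagged_division_of {a..b}" using p by blast
        have "X_norm (S p - I) \<le> norm (TT (S p) - J g t)" using X_norm_TT(1)[OF SX(1)[OF p']] unfolding SX(2)[OF p'] eq .
        then show ?thesis using d(2)[OF p] by (rule le_less_trans)
      qed
      with d(1) show "\<exists>d>0. \<forall>p. p tagged_division_of {a..b} \<and> (\<lambda>s. ball s d) fine p \<longrightarrow> X_norm (S p - I) < \<epsilon>" by blast
    qed
  next
    assume lim: "\<forall>\<epsilon>>0. \<exists>d>0. \<forall>p. p tagged_division_of {a..b} \<and> (\<lambda>s. ball s d) fine p \<longrightarrow> X_norm (S p - I) < \<epsilon>"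
    have "norm (TT I - J g t) \<le> 0"
    proof (rule field_le_epsilon)
      fix \<epsilon> :: real assume \<epsilon>: "\<epsilon> > 0"
      then have e3: "\<epsilon> / 3 > 0" by simp
      obtain d where d: "d > 0" "\<And>p. p tagged_division_of {a..b} \<and> (\<lambda>s. ball s d) fine p \<Longrightarrow> norm (TT (S p) - J g t) < \<epsilon> / 3"
        using conv[OF e3] by blast
      obtain e where e: "e > 0" "\<And>p. p tagged_division_of {a..b} \<and> (\<lambda>s. ball s e) fine p \<Longrightarrow> X_norm (S p - I) < \<epsilon> / 3"
        using lim e3 by blast
      \<comment> \<open>A division fine for both meshes exists, so the two limits can be compared on
        one Riemann sum; otherwise the conditions could hold vacuously.\<close>
      have "gauge (\<lambda>s::real. ball s (min d e))" using d(1) e(1) by (intro gauge_ball) auto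
      then obtain p where p: "p tagged_division_of {a..b}" "(\<lambda>s. ball s (min d e)) fine p"
        by (rule fine_division_exists_real)
      have "ball s (min d e) \<subseteq> ball s d" "ball s (min d e) \<subseteq> ball s e" for s :: real by (auto intro!: subset_ball)
      then have pf: "(\<lambda>s. ball s d) fine p" "(\<lambda>s. ball s e) fine p" using p(2) unfolding fine_def by blast+
      have "norm (TT I - J g t) \<le> norm (TT (S p) - J g t) + norm (TT (S p) - TT I)"
        using norm_triangle_ineq4[of "TT (S p) - J g t" "TT (S p) - TT I"] by simp
      also have "\<dots> \<le> \<epsilon> / 3 + 2 * (\<epsilon> / 3)"
        using d(2)[of p] e(2)[of p] p(1) pf X_norm_TT(2)[OF SX(1)[OF p(1)]] unfolding SX(2)[OF p(1)] by linarith
      finally show "norm (TT I - J g t) \<le> 0 + \<epsilon>" by simp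
    qed
    then show "TT I = J g t" by simp
  qed
qed

lemma continuous_N:
  fixes z :: "real \<Rightarrow> l2 \<times> l2"
  assumes z: "continuous_on UNIV z" shows "continuous_on UNIV (\<lambda>s. N (z s))"
  unfolding continuous_on_def
proof
  fix t :: real
  have zt: "(z \<longlongrightarrow> z t) (at t)" using z by (simp add: continuous_on_def)
  define R where "R = norm (z t) + 1"
  have "\<forall>\<^sub>F s in at t. norm (z s) < R" by (rule order_tendstoD(2)[OF tendsto_norm[OF zt]]) (simp add: R_def)
  then have "\<forall>\<^sub>F s in at t. norm (N (z s) - N (z t)) \<le> Lip R * norm (z s - z t)"
    by eventually_elim (intro N_lipschitz, auto simp: R_def)
  moreover have "((\<lambda>s. Lip R * norm (z s - z t)) \<longlongrightarrow> Lip R * norm (z t - z t)) (at t)" by (intro tendsto_intros zt)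
  then have "((\<lambda>s. Lip R * norm (z s - z t)) \<longlongrightarrow> 0) (at t)" by simp
  ultimately have "((\<lambda>s. N (z s) - N (z t)) \<longlongrightarrow> 0) (at t)" by (rule Lim_null_comparison)
  then show "((\<lambda>s. N (z s)) \<longlongrightarrow> N (z t)) (at t within UNIV)" by (simp add: LIM_zero_iff)
qed

lemma J_linear:
  assumes f: "continuous_on UNIV f" and h: "bounded_linear h" shows "J (\<lambda>s. h (f s)) t = h (J f t)"
proof -
  have "f integrable_on {min 0 t..max 0 t}" by (intro integrable_continuous_real continuous_on_subset[OF f]) auto
  from integral_linear[OF this h] show ?thesis
    by (simp add: J_def comp_def linear_scale[OF bounded_linear.linear[OF h]])
qed

lemma Duhamel_iff_ode:
  assumes z: "continuous_on UNIV z"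
  shows "(\<forall>t. z t = U t (z 0) + J (\<lambda>s. U (t - s) (N (z s))) t) \<longleftrightarrow>
    (\<forall>t. ((\<lambda>t. U (- t) (z t)) has_vector_derivative U (- t) (N (z t))) (at t))"
proof -
  define f where "f s = U (- s) (N (z s))" for s
  have cf: "continuous_on UNIV f" using continuous_U_uminus[OF continuous_N[OF z], of 0] by (simp add: f_def[abs_def])
  have eq: "J (\<lambda>s. U (t - s) (N (z s))) t = U t (J f t)" for t
    using J_linear[OF cf bounded_linear_U[of t], of t] by (simp add: f_def U_U)
  have iff: "z t = U t (z 0) + J (\<lambda>s. U (t - s) (N (z s))) t \<longleftrightarrow> U (- t) (z t) = z 0 + J f t" for t
  proof
    assume "z t = U t (z 0) + J (\<lambda>s. U (t - s) (N (z s))) t"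
    then have "U (- t) (z t) = U (- t) (U t (z 0) + U t (J f t))" by (simp add: eq)
    then show "U (- t) (z t) = z 0 + J f t" by (simp add: U_add U_U U_0)
  next
    assume "U (- t) (z t) = z 0 + J f t"
    then have "U t (U (- t) (z t)) = U t (z 0 + J f t)" by simp
    then show "z t = U t (z 0) + J (\<lambda>s. U (t - s) (N (z s))) t" by (simp add: U_add U_U U_0 eq)
  qed
  show ?thesis
    unfolding iff f_def[symmetric]
  proof
    assume "\<forall>t. U (- t) (z t) = z 0 + J f t"
    then have "(\<lambda>t. U (- t) (z t)) = (\<lambda>t. z 0 + J f t)" by auto
    then show "\<forall>t. ((\<lambda>t. U (- t) (z t)) has_vector_derivative f t) (at t)"
      using has_vector_derivative_add[OF has_vector_derivative_const J_has_vector_derivative[OF cf], of "z 0"] by simp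
  next
    assume d: "\<forall>t. ((\<lambda>t. U (- t) (z t)) has_vector_derivative f t) (at t)"
    have "((\<lambda>t. U (- t) (z t) - J f t) has_vector_derivative 0) (at t within UNIV)" for t
      using has_vector_derivative_diff[OF d[rule_format, of t] J_has_vector_derivative[OF cf, of t]] by simp
    then obtain c where c: "\<And>t. t \<in> UNIV \<Longrightarrow> U (- t) (z t) - J f t = c"
      using has_vector_derivative_zero_constant[of UNIV "\<lambda>t. U (- t) (z t) - J f t"] by auto
    have "c = z 0" using c[of 0] by (simp add: U_0)
    then show "\<forall>t. U (- t) (z t) = z 0 + J f t" using c by (simp add: diff_eq_eq)
  qed
qed

lemma continuous_in_E_H_iff:
  assumes "\<And>t. \<phi> t \<in> E_H"
  shows "continuous_in_E_H \<phi> \<longleftrightarrow> continuous_on UNIV (\<lambda>t. TT (\<phi> t - kink))"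
proof -
  have X: "\<phi> t - kink \<in> H1 \<times> L2" for t using assms by (simp add: E_H_def)
  have d: "\<phi> s - \<phi> t \<in> H1 \<times> L2" "TT (\<phi> s - \<phi> t) = TT (\<phi> s - kink) - TT (\<phi> t - kink)" for s t
    using TT_diff[OF X[of s] X[of t]] by simp_all
  have "((\<lambda>s. X_norm (\<phi> s - \<phi> t)) \<longlongrightarrow> 0) (at t) \<longleftrightarrow> ((\<lambda>s. TT (\<phi> s - kink)) \<longlongrightarrow> TT (\<phi> t - kink)) (at t)" for t
  proof
    assume "((\<lambda>s. X_norm (\<phi> s - \<phi> t)) \<longlongrightarrow> 0) (at t)"
    then have lim: "((\<lambda>s. 2 * X_norm (\<phi> s - \<phi> t)) \<longlongrightarrow> 0) (at t)" by (rule tendsto_mult_right_zero)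
    have "((\<lambda>s. TT (\<phi> s - \<phi> t)) \<longlongrightarrow> 0) (at t)"
      by (rule Lim_null_comparison[OF always_eventually lim]) (intro allI X_norm_TT(2) d(1))
    then have "((\<lambda>s. TT (\<phi> s - kink) - TT (\<phi> t - kink)) \<longlongrightarrow> 0) (at t)" by (simp only: d(2))
    then show "((\<lambda>s. TT (\<phi> s - kink)) \<longlongrightarrow> TT (\<phi> t - kink)) (at t)" by (simp add: LIM_zero_iff)
  next
    assume "((\<lambda>s. TT (\<phi> s - kink)) \<longlongrightarrow> TT (\<phi> t - kink)) (at t)"
    then have lim: "((\<lambda>s. norm (TT (\<phi> s - \<phi> t))) \<longlongrightarrow> 0) (at t)" unfolding d(2) by (intro tendsto_norm_zero) (simp only: LIM_zero_iff)
    have "norm (X_norm (\<phi> s - \<phi> t)) \<le> norm (TT (\<phi> s - \<phi> t))" for s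
      using X_norm_TT(1)[OF d(1)] X_norm_eq(2)[OF d(1)] by (simp only: real_norm_def abs_of_nonneg)
    then show "((\<lambda>s. X_norm (\<phi> s - \<phi> t)) \<longlongrightarrow> 0) (at t)"
      by (intro Lim_null_comparison[OF always_eventually lim]) blast
  qed
  then show ?thesis using assms by (simp add: continuous_in_E_H_def continuous_on_def)
qed

text \<open>Existence and uniqueness in the sense of Duhamel are hereby questions about an ordinary
  differential equation in \<open>l2 \<times> l2\<close>; only membership in \<open>E_H\<close>
  remains to be checked for functions.\<close>

lemma global_solution_iff:
  "global_solution \<phi> \<longleftrightarrow> (\<forall>t. \<phi> t \<in> E_H) \<and> continuous_on UNIV (\<lambda>t. TT (\<phi> t - kink)) \<and>
    (\<forall>t. ((\<lambda>t. U (- t) (TT (\<phi> t - kink))) has_vector_derivative U (- t) (N (TT (\<phi> t - kink)))) (at t))"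
proof -
  have main: "(\<forall>t. \<exists>J. has_X_integral
            (\<lambda>s. free_group (t - s) ((\<lambda>x. 0), weak_deriv (nonlin (fst (\<phi> s - kink))))) t J \<and>
          \<phi> t - kink \<approx> free_group t (\<phi> 0 - kink) + J) \<longleftrightarrow>
    (\<forall>t. ((\<lambda>t. U (- t) (TT (\<phi> t - kink))) has_vector_derivative U (- t) (N (TT (\<phi> t - kink)))) (at t))"
    if E: "\<forall>t. \<phi> t \<in> E_H" and c: "continuous_on UNIV (\<lambda>t. TT (\<phi> t - kink))"
  proof -
    define z where "z t = TT (\<phi> t - kink)" for t
    have X: "\<phi> t - kink \<in> H1 \<times> L2" for t using E by (simp add: E_H_def)
    have cz: "continuous_on UNIV z" using c by (simp add: z_def[abs_def])
    define w where "w t s = free_group (t - s) ((\<lambda>x. 0), weak_deriv (nonlin (fst (\<phi> s - kink))))" for t s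
    have w: "w t s \<in> H1 \<times> L2" "TT (w t s) = U (t - s) (N (z s))" for t s
      unfolding w_def z_def using free_group_TT[OF N_eq_TT(1)[OF X]] N_eq_TT(2)[OF X] by simp_all
    have wc: "continuous_on UNIV (\<lambda>s. TT (w t s))" for t
      unfolding w(2) by (rule continuous_U_uminus[OF continuous_N[OF cz]])
    have "(\<exists>I. has_X_integral (w t) t I \<and> \<phi> t - kink \<approx> free_group t (\<phi> 0 - kink) + I) \<longleftrightarrow>
        z t = U t (z 0) + J (\<lambda>s. U (t - s) (N (z s))) t" for t
    proof
      assume "\<exists>I. has_X_integral (w t) t I \<and> \<phi> t - kink \<approx> free_group t (\<phi> 0 - kink) + I"
      then obtain I where I: "has_X_integral (w t) t I" "\<phi> t - kink \<approx> free_group t (\<phi> 0 - kink) + I" by blast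
      have IX: "I \<in> H1 \<times> L2" using I(1) by (simp add: has_X_integral_def)
      have "TT I = J (\<lambda>s. TT (w t s)) t" using I(1) has_X_integral_iff[OF w(1) wc IX] by simp
      then show "z t = U t (z 0) + J (\<lambda>s. U (t - s) (N (z s))) t"
        using I(2) TT_add[OF free_group_TT(1)[OF X] IX, of t 0]
        by (simp add: state_eq_iff_TT X free_group_TT(2) w(2) z_def)
    next
      assume eq: "z t = U t (z 0) + J (\<lambda>s. U (t - s) (N (z s))) t"
      define I where "I = (fn (u1 (J (\<lambda>s. TT (w t s)) t)), fn (u2 (J (\<lambda>s. TT (w t s)) t)))"
      have I: "I \<in> H1 \<times> L2" "TT I = J (\<lambda>s. TT (w t s)) t" unfolding I_def by (rule TT_surj)+
      have "has_X_integral (w t) t I" using has_X_integral_iff[OF w(1) wc I(1)] I(2) by simp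
      moreover have "\<phi> t - kink \<approx> free_group t (\<phi> 0 - kink) + I"
        using eq TT_add[OF free_group_TT(1)[OF X] I(1), of t 0] I(2)
        by (simp add: state_eq_iff_TT X free_group_TT(2) w(2) z_def)
      ultimately show "\<exists>I. has_X_integral (w t) t I \<and> \<phi> t - kink \<approx> free_group t (\<phi> 0 - kink) + I" by blast
    qed
    then show ?thesis using Duhamel_iff_ode[OF cz] unfolding w_def[abs_def] z_def[abs_def] by simp
  qed
  show ?thesis
    unfolding global_solution_def using main continuous_in_E_H_iff[of \<phi>] by (auto simp: continuous_in_E_H_def[of \<phi>])
qed

section \<open>Membership in the energy space\<close>

lemma test_function_support:
  assumes t: "test_function \<eta>" shows "\<exists>R\<ge>0. \<forall>x. R < \<bar>x\<bar> \<longrightarrow> \<eta> x = 0 \<and> deriv \<eta> x = 0"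
proof -
  obtain R where R: "\<And>x. R < \<bar>x\<bar> \<Longrightarrow> \<eta> x = 0" using t by (auto simp: test_function_def)
  have R': "deriv \<eta> x = 0" if x: "R < \<bar>x\<bar>" for x
  proof (rule DERIV_imp_deriv, rule has_field_derivative_transform_within_open[where f="\<lambda>_. 0" and S="{y. R < \<bar>y\<bar>}"])
    show "open {y. R < \<bar>y\<bar>}" by (intro open_Collect_less continuous_intros)
    show "((\<lambda>_. 0) has_real_derivative 0) (at x)" by simp
  qed (use x R in auto)
  show ?thesis using R R' by (intro exI[of _ "\<bar>R\<bar>"]) auto
qed

text \<open>H itself is outside L2, but its product with a test function is in \<open>dom\<close>;
  the increment of this product over an interval containing the support is 0, and the product rule
  splits it into the two integrals.\<close>

lemma has_weak_deriv_H: "has_weak_deriv H dH"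
  unfolding has_weak_deriv_def
proof (intro conjI allI impI)
  show "H \<in> L1_loc" "dH \<in> L1_loc"
    unfolding L1_loc_def using absolutely_integrable_continuous_real[OF continuous_H] absolutely_integrable_continuous_real[OF continuous_dH] by auto
  fix \<eta> assume t: "test_function \<eta>"
  note tL = test_function_L2[OF t]
  obtain R where R: "R \<ge> 0" "\<And>x. R < \<bar>x\<bar> \<Longrightarrow> \<eta> x = 0" "\<And>x. R < \<bar>x\<bar> \<Longrightarrow> deriv \<eta> x = 0"
    using test_function_support[OF t] by blast
  define g where "g = mul H (cl \<eta>)"
  note g = mul_H_dom[OF tL(3), folded g_def]
  \<comment> \<open>Strictly outside the support, so that the product vanishes at both ends.\<close>
  define b where "b = R + 1"
  have "continuous_on UNIV \<eta>" using t smooth_continuous by (auto simp: test_function_def)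
  then have r: "rep (cl \<eta>) = \<eta>" by (intro rep_eqI tL fn_cl)
  have "rep g b - rep g (- b) = (LINT x|lebesgue. indicator {- b..b} x * fn (dx g) x)"
    using rep_increment[OF g(1), of "- b" b] R(1) by (simp add: inner_iv b_def)
  also have "\<dots> = (LINT x|lebesgue. H x * deriv \<eta> x + dH x * \<eta> x)"
  proof (rule integral_cong_AE)
    show "(\<lambda>x. indicator {- b..b} x * fn (dx g) x) \<in> borel_measurable lebesgue"
      by (intro borel_measurable_times L2_measurable indicator_interval_L2 fn_L2)
    show "(\<lambda>x. H x * deriv \<eta> x + dH x * \<eta> x) \<in> borel_measurable lebesgue"
      by (intro L2_measurable L2_add L2_bd_mult tL bd_H bd_dH)
    show "AE x in lebesgue. indicator {- b..b} x * fn (dx g) x = H x * deriv \<eta> x + dH x * \<eta> x"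
      using fn_add[of "mul H (cl (deriv \<eta>))" "mul dH (cl \<eta>)"] fn_mul_bd[OF bd_H, of "cl (deriv \<eta>)"] fn_mul_bd[OF bd_dH, of "cl \<eta>"]
        fn_cl[OF tL(1)] fn_cl[OF tL(2)]
      unfolding g(2) tL(4)
    proof eventually_elim
      case (elim x)
      show ?case
      proof (cases "x \<in> {- b..b}")
        case False
        then have "R < \<bar>x\<bar>" by (auto simp: b_def)
        then show ?thesis using False R by simp
      qed (simp add: elim)
    qed
  qed
  also have "\<dots> = (LINT x|lebesgue. H x * deriv \<eta> x) + (LINT x|lebesgue. dH x * \<eta> x)"
  proof (rule Bochner_Integration.integral_add)
    show "integrable lebesgue (\<lambda>x. dH x * \<eta> x)" by (intro L2_mult_integrable dH_L2 tL)
    have "integrable lebesgue (\<lambda>x. indicator {- b..b} x * (H x * deriv \<eta> x))"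
      by (intro L2_mult_integrable indicator_interval_L2 L2_bd_mult bd_H tL)
    moreover have "(\<lambda>x. indicator {- b..b} x * (H x * deriv \<eta> x)) = (\<lambda>x. H x * deriv \<eta> x)"
    proof
      fix x
      have "deriv \<eta> x = 0" if "x \<notin> {- b..b}" by (rule R(3)) (use that in \<open>auto simp: b_def\<close>)
      then show "indicator {- b..b} x * (H x * deriv \<eta> x) = H x * deriv \<eta> x"
        by (cases "x \<in> {- b..b}") auto
    qed
    ultimately show "integrable lebesgue (\<lambda>x. H x * deriv \<eta> x)" by simp
  qed
  finally show "(LINT x|lebesgue. H x * deriv \<eta> x) = - (LINT x|lebesgue. dH x * \<eta> x)"
    using R(1) R(2)[of b] R(2)[of "- b"] by (simp add: g(3) r b_def)
qed

lemma has_weak_deriv_add: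
  assumes f: "has_weak_deriv f f'" and g: "has_weak_deriv g g'"
    and i: "\<And>\<eta>. test_function \<eta> \<Longrightarrow> integrable lebesgue (\<lambda>x. f x * deriv \<eta> x) \<and> integrable lebesgue (\<lambda>x. g x * deriv \<eta> x)
      \<and> integrable lebesgue (\<lambda>x. f' x * \<eta> x) \<and> integrable lebesgue (\<lambda>x. g' x * \<eta> x)"
  shows "has_weak_deriv (\<lambda>x. f x + g x) (\<lambda>x. f' x + g' x)"
  using f g i unfolding has_weak_deriv_def L1_loc_def by (auto simp: distrib_right intro!: set_integral_add)

text \<open>The potential condition follows from (H + u)^2 - 1 = - sqrt 2 dH + 2 H u + u^2, where
  u^2 is in L2 because H1 functions are bounded.\<close>

lemma kink_add_in_E_H:
  assumes f: "f \<in> H1 \<times> L2" shows "kink + f \<in> E_H"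
proof -
  define u where "u = fst f"
  note f' = TT_simps[OF f]
  have u: "u \<in> L2" "dom (cl u)" "snd f \<in> L2" using f by (auto simp: u_def H1_iff mem_Times_iff)
  have wu: "has_weak_deriv u (fn (dx (cl u)))" by (intro has_weak_deriv_if_D u) auto
  have iH: "integrable lebesgue (\<lambda>x. H x * deriv \<eta> x)" if t: "test_function \<eta>" for \<eta>
  proof -
    note tL = test_function_L2[OF t]
    obtain R where R: "R \<ge> 0" "\<And>x. R < \<bar>x\<bar> \<Longrightarrow> deriv \<eta> x = 0"
      using test_function_support[OF t] by blast
    have "integrable lebesgue (\<lambda>x. indicator {- R..R} x * (H x * deriv \<eta> x))"
      by (intro L2_mult_integrable indicator_interval_L2 L2_bd_mult bd_H tL)
    moreover have "indicator {- R..R} x * (H x * deriv \<eta> x) = H x * deriv \<eta> x" for x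
    proof -
      have "deriv \<eta> x = 0" if "x \<notin> {- R..R}" by (rule R(2)) (use that in auto)
      then show ?thesis by (cases "x \<in> {- R..R}") auto
    qed
    ultimately show ?thesis by simp
  qed
  have wH: "has_weak_deriv (\<lambda>x. H x + u x) (\<lambda>x. dH x + fn (dx (cl u)) x)"
  proof (rule has_weak_deriv_add[OF has_weak_deriv_H wu])
    fix \<eta> assume t: "test_function \<eta>"
    note tL = test_function_L2(1,2)[OF t]
    show "integrable lebesgue (\<lambda>x. H x * deriv \<eta> x) \<and> integrable lebesgue (\<lambda>x. u x * deriv \<eta> x)
      \<and> integrable lebesgue (\<lambda>x. dH x * \<eta> x) \<and> integrable lebesgue (\<lambda>x. fn (dx (cl u)) x * \<eta> x)"
      by (intro conjI iH[OF t] L2_mult_integrable tL u dH_L2 fn_L2)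
  qed
  have "(\<lambda>x. (H x + u x)\<^sup>2 - 1) \<in> L2"
  proof -
    define v where "v x = - sqrt 2 * dH x + (2 * (H x * u x) + rep (cl u) x * u x)" for x
    have e: "(H x)\<^sup>2 = 1 - sqrt 2 * dH x" for x by (simp add: dH_def)
    have v: "v \<in> L2" unfolding v_def[abs_def] by (intro L2_add L2_scale dH_L2 L2_bd_mult bd_H bd_rep u)
    show ?thesis
    proof (rule L2_cong_AE[OF v])
      show "(\<lambda>x. (H x + u x)\<^sup>2 - 1) \<in> borel_measurable lebesgue"
        by (intro borel_measurable_diff borel_measurable_power borel_measurable_add H_measurable L2_measurable u borel_measurable_const)
      show "AE x in lebesgue. v x = (H x + u x)\<^sup>2 - 1"
        using fn_rep[OF u(2)] fn_cl[OF u(1)]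
        by eventually_elim (simp add: v_def e power2_sum, simp add: power2_eq_square algebra_simps)
    qed
  qed
  moreover have "kink + f - kink = f" by simp
  ultimately show ?thesis
    using wH f u dH_L2 L2_L1_loc[OF u(3)]
    unfolding E_H_def E_def mem_Collect_eq
    by (auto simp: kink_def plus_fun_def u_def[symmetric] has_weak_deriv_def[of "\<lambda>x. H x + u x"] intro!: exI bexI[of _ "\<lambda>x. dH x + fn (dx (cl u)) x"] L2_add)
qed

section \<open>Orbital stability\<close>

text \<open>By the completed square the root of 2 En is at most |u2| + |rr|, and for |z| <= 1 the
  quadratic term of \<open>rr\<close> is at most CS times a linear one. The energy is thus at most
  quadratic in the initial perturbation, which yields a stability bound linear in it.\<close>

lemma energy_small: "\<exists>K\<ge>1. \<forall>z. norm z \<le> 1 \<longrightarrow> sqrt (2 * En z) \<le> K * norm z"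
proof (intro exI[of _ "5 + CS"] conjI allI impI)
  show "1 \<le> 5 + CS" using CS_nonneg by linarith
  fix z :: "l2 \<times> l2" assume z: "norm z \<le> 1"
  define u where "u = u1 z"
  have u: "dom u" by (simp add: u_def dom_u1)
  have uz: "nH u \<le> norm z" unfolding u_def by (rule nH_u1_le)
  have nu: "norm u \<le> norm z" "norm (dx u) \<le> norm z" using norm_le_nH[OF u] norm_dx_le_nH[OF u] uz by auto
  have "\<bar>rep u x\<bar> \<le> CS" for x
    using rep_bound[OF u, of x] mult_left_mono[of "nH u" 1 CS] uz z by simp
  then have "norm (sq u) \<le> CS * norm u" unfolding sq_def by (intro norm_mul_le bd_measurable bd_rep u)
  also have "\<dots> \<le> CS * norm z" by (intro mult_left_mono nu) simp
  finally have s: "norm (sq u) \<le> CS * norm z" .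
  have m: "norm (mul H u) \<le> 1 * norm u" by (intro norm_mul_le bd_measurable bd_H H_abs_le)
  have "norm ((1 / sqrt 2) *\<^sub>R (2 *\<^sub>R mul H u + sq u)) = 1 / sqrt 2 * norm (2 *\<^sub>R mul H u + sq u)" by simp
  also have "\<dots> \<le> 1 * norm (2 *\<^sub>R mul H u + sq u)" by (intro mult_right_mono) auto
  also have "\<dots> \<le> 2 * norm (mul H u) + norm (sq u)" using norm_triangle_ineq[of "2 *\<^sub>R mul H u" "sq u"] by simp
  finally have "norm (rr u) \<le> norm (dx u) + (2 * norm (mul H u) + norm (sq u))"
    unfolding rr_def by (rule order_trans[OF norm_triangle_ineq add_left_mono])
  then have r: "norm (rr u) \<le> 3 * norm z + CS * norm z" using m s nu by linarith
  have "sqrt (2 * En z) \<le> norm (u2 z) + norm (rr u)"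
    unfolding En_Bogomolny u_def[symmetric] by (rule sqrt_sum_squares_le_sum) auto
  then show "sqrt (2 * En z) \<le> (5 + CS) * norm z"
    using r norm_u2_le[of z] norm_ge_zero[of z] unfolding distrib_right by linarith
qed

text \<open>Two nearby states whose kinks have been recentred by \<open>a\<close> and \<open>b\<close>: the translates of \<open>H\<close> must be close.\<close>

lemma recentring_close:
  assumes u: "dom u" "dom w" and a: "nH (sh a u) \<le> M" and b: "nH (sh b w) \<le> M"
    and inc: "(norm (u - w))\<^sup>2 \<le> norm (dx (u - w)) * M"
  shows "dH 2 * min \<bar>b - a\<bar> 1 \<le> 6 * M"
proof -
  define w1 where "w1 = sh a u"
  define w2 where "w2 = sh b w"
  define q where "q = qa (b - a)"
  have d: "dom w1" "dom w2" unfolding w1_def w2_def by (intro dom_sh u)+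
  have M: "0 \<le> M" using order_trans[OF nH_nonneg a] .
  have n: "norm w1 \<le> M" "norm w2 \<le> M" "norm (dx w1) \<le> M" "norm (dx w2) \<le> M"
    using norm_le_nH[OF d(1)] norm_le_nH[OF d(2)] norm_dx_le_nH[OF d(1)] norm_dx_le_nH[OF d(2)] a b by (auto simp: w1_def w2_def)
  have "u = sh (- a) w1" "w = sh (- b) w2" by (simp_all add: w1_def w2_def sh_add sh_0)
  \<comment> \<open>The cocycle law collects the two shifted kinks into a single translate of
    \<open>qa (b - a)\<close>.\<close>
  moreover have "qa (- a) = tr (- b) q + qa (- b)" using qa_add[of "b - a" "- b"] by (simp add: q_def)
  ultimately have e: "u - w = tr (- a) w1 - tr (- b) w2 + tr (- b) q" by (simp add: sh_def)
  have dq: "dom q" by (simp add: q_def qa)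
  have "tr (- b) q = (u - w) - tr (- a) w1 + tr (- b) w2" by (simp add: e)
  then have "norm (tr (- b) q) = norm ((u - w) - tr (- a) w1 + tr (- b) w2)" by simp
  then have "norm (tr (- b) q) \<le> norm (u - w) + norm (tr (- a) w1) + norm (tr (- b) w2)"
    using norm_triangle_ineq[of "(u - w) - tr (- a) w1" "tr (- b) w2"] norm_triangle_ineq4[of "u - w" "tr (- a) w1"] by linarith
  then have q1: "norm q \<le> norm (u - w) + 2 * M" using n by (simp add: norm_aff)
  have "dx (u - w) = tr (- a) (dx w1) - tr (- b) (dx w2) + tr (- b) (dx q)"
    unfolding e by (simp add: dx_add dx_diff dx_tr dom_add dom_diff dom_tr d dq)
  then have "norm (dx (u - w)) \<le> norm (tr (- a) (dx w1)) + norm (tr (- b) (dx w2)) + norm (tr (- b) (dx q))"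
    using norm_triangle_ineq[of "tr (- a) (dx w1) - tr (- b) (dx w2)" "tr (- b) (dx q)"] norm_triangle_ineq4[of "tr (- a) (dx w1)" "tr (- b) (dx w2)"] by simp
  then have "norm (dx (u - w)) \<le> 2 * M + 2 * norm q" using n norm_dx_qa_le[of "b - a"] by (simp add: norm_aff q_def)
  then have "norm (dx (u - w)) \<le> 6 * M + 2 * norm (u - w)" using q1 by linarith
  then have dxM: "norm (dx (u - w)) * M \<le> (6 * M + 2 * norm (u - w)) * M" using M by (intro mult_right_mono)
  \<comment> \<open>The increment bound has become the quadratic inequality n^2 <= 6 M^2 + 2 n M for
    n = |u - w|; completing the square gives 7 M^2, rounded up to 9 M^2.\<close>
  have "(norm (u - w) - M)\<^sup>2 \<le> (3 * M)\<^sup>2"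
  proof -
    have "(6 * M + 2 * norm (u - w)) * M = 6 * M\<^sup>2 + 2 * norm (u - w) * M" by (simp add: power2_eq_square algebra_simps)
    moreover have "(3 * M)\<^sup>2 = 9 * M\<^sup>2" by (simp add: power_mult_distrib)
    ultimately show ?thesis
      using dxM inc zero_le_power2[of M] unfolding power2_diff by linarith
  qed
  then have "norm (u - w) - M \<le> 3 * M" by (rule power2_le_imp_le) (use M in simp)
  then have "norm q \<le> 6 * M" using q1 by linarith
  then show ?thesis using min_le_norm_qa[of "b - a"] by (simp add: q_def)
qed

text \<open>Only the values at integers are interpolated, and the result is constant near each
  integer, so that the pieces join smoothly. One \<open>m\<close> accounts for the passage from
  \<open>t\<close> to the integer below, the other for the step between two neighbours.\<close>

lemma ex_smooth_interpolation:
  fixes \<sigma> :: "real \<Rightarrow> real"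
  assumes \<sigma>: "\<And>s t. \<bar>t - s\<bar> \<le> 1 \<Longrightarrow> \<bar>\<sigma> t - \<sigma> s\<bar> \<le> m"
  shows "\<exists>\<rho>. smooth \<rho> \<and> (\<forall>t. \<bar>\<rho> t - \<sigma> t\<bar> \<le> 2 * m)"
proof -
  obtain S :: "real \<Rightarrow> real" where S: "smooth S" "\<And>x. x \<le> 0 \<Longrightarrow> S x = 0" "\<And>x. x \<ge> 1 \<Longrightarrow> S x = 1" "\<And>x. 0 \<le> S x" "\<And>x. S x \<le> 1"
    using ex_smooth_step by blast
  define \<alpha> :: "int \<Rightarrow> real" where "\<alpha> n = \<sigma> (of_int n)" for n
  \<comment> \<open>The argument 3 (t - n) - 1 passes from 0 to 1 on the middle third
    [n + 1/3, n + 2/3].\<close>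
  define piece where "piece n t = \<alpha> n + S (3 * t + (- 3 * of_int n - 1)) * (\<alpha> (n + 1) - \<alpha> n)" for n :: int and t
  have sp: "smooth (piece n)" for n
    unfolding piece_def[abs_def] by (intro smooth_add smooth_mult smooth_const smooth_affine S(1))
  define \<rho> where "\<rho> t = piece \<lfloor>t\<rfloor> t" for t
  have lo: "piece n t = \<alpha> n" if "t \<le> of_int n + 1/3" for n t using that S(2)[of "3 * t + (- 3 * of_int n - 1)"] by (simp add: piece_def)
  have hi: "piece n t = \<alpha> (n + 1)" if "of_int n + 2/3 \<le> t" for n t using that S(3)[of "3 * t + (- 3 * of_int n - 1)"] by (simp add: piece_def)
  have "smooth \<rho>"
  proof (rule smooth_locally)
    fix x :: real
    define n where "n = \<lfloor>x\<rfloor>"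
    have n: "of_int n \<le> x" "x < of_int n + 1" by (simp_all add: n_def)
    show "\<exists>\<epsilon>>0. \<exists>g. smooth g \<and> (\<forall>y. \<bar>y - x\<bar> < \<epsilon> \<longrightarrow> \<rho> y = g y)"
    proof (cases "x = of_int n")
      case True
      have "\<rho> y = \<alpha> n" if y: "\<bar>y - x\<bar> < 1/3" for y
      proof (cases "y \<ge> of_int n")
        case True
        then have "\<lfloor>y\<rfloor> = n" using y \<open>x = of_int n\<close> by (intro floor_unique) auto
        moreover have "y \<le> of_int n + 1/3" using y \<open>x = of_int n\<close> by linarith
        ultimately show ?thesis using lo by (simp add: \<rho>_def)
      next
        case False
        then have "\<lfloor>y\<rfloor> = n - 1" using y \<open>x = of_int n\<close> by (intro floor_unique) auto
        moreover have "of_int (n - 1) + 2/3 \<le> y" using y \<open>x = of_int n\<close> unfolding of_int_diff of_int_1 by linarith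
        ultimately show ?thesis using hi[of "n - 1" y] by (simp add: \<rho>_def)
      qed
      then show ?thesis by (intro exI[of _ "1/3"] conjI exI[of _ "\<lambda>y. \<alpha> n"] smooth_const) auto
    next
      case False
      define \<epsilon> where "\<epsilon> = min (x - of_int n) (of_int n + 1 - x)"
      have "\<epsilon> > 0" using n False by (auto simp: \<epsilon>_def)
      moreover have "\<rho> y = piece n y" if y: "\<bar>y - x\<bar> < \<epsilon>" for y
      proof -
        have "\<lfloor>y\<rfloor> = n" using y by (intro floor_unique) (auto simp: \<epsilon>_def)
        then show ?thesis by (simp add: \<rho>_def)
      qed
      ultimately show ?thesis using sp by blast
    qed
  qed
  moreover have "\<bar>\<rho> t - \<sigma> t\<bar> \<le> 2 * m" for t
  proof -
    define n where "n = \<lfloor>t\<rfloor>"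
    have n: "of_int n \<le> t" "t < of_int n + 1" by (simp_all add: n_def)
    define s where "s = S (3 * t + (- 3 * of_int n - 1))"
    have "\<bar>\<alpha> n - \<sigma> t\<bar> \<le> m" unfolding \<alpha>_def by (rule \<sigma>) (use n in auto)
    moreover have "\<bar>s * (\<alpha> (n + 1) - \<alpha> n)\<bar> \<le> 1 * m"
      unfolding abs_mult
    proof (rule mult_mono)
      show "\<bar>\<alpha> (n + 1) - \<alpha> n\<bar> \<le> m" unfolding \<alpha>_def by (rule \<sigma>) simp
    qed (use S(4,5) in \<open>auto simp: s_def\<close>)
    moreover have "\<rho> t - \<sigma> t = (\<alpha> n - \<sigma> t) + s * (\<alpha> (n + 1) - \<alpha> n)" by (simp add: \<rho>_def piece_def n_def s_def)
    ultimately show ?thesis by linarith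
  qed
  ultimately show ?thesis by blast
qed

lemma orbital_stability:
  "\<exists>\<delta>>0. \<exists>C>0. \<forall>v. (\<forall>t. (v has_vector_derivative U (- t) (N (U t (v t)))) (at t)) \<and> norm (v 0) \<le> \<delta> \<longrightarrow>
    (\<exists>\<rho>. smooth \<rho> \<and> (\<forall>t. dom (sh (\<rho> t) (u1 (U t (v t)))) \<and>
      norm (sh (\<rho> t) (u1 (U t (v t)))) \<le> C * norm (v 0) \<and> norm (dx (sh (\<rho> t) (u1 (U t (v t))))) \<le> C * norm (v 0) \<and>
      norm (u2 (U t (v t))) \<le> C * norm (v 0)))"
proof -
  obtain K where K: "K \<ge> 1" "\<And>z. norm z \<le> 1 \<Longrightarrow> sqrt (2 * En z) \<le> K * norm z" using energy_small by blast
  define L where "L = 120 * K"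
  define h where "h = dH 2"
  define Q where "Q = exp (sqrt 2) * norm (cl dH)"
  \<comment> \<open>\<open>L\<close> is the bound at the centre \<sigma> t. The other term pays for
    using \<rho> t, at distance at most \<open>12 * L / h * norm (v 0)\<close>: \<open>Q\<close> is
    the Lipschitz constant of \<open>qa\<close> on [-1, 1], and 2 the loss for its
    derivative.\<close>
  define C where "C = L + 2 * (12 * L / h * Q)"
  have h: "h > 0" by (simp add: h_def dH_pos)
  have Q: "Q \<ge> 0" by (simp add: Q_def)
  have L: "L \<ge> 120" using K(1) by (simp add: L_def)
  \<comment> \<open>1 admits \<open>energy_small\<close>; 1 / (64 K) puts the residual under the
    threshold of \<open>static_stability\<close>; h / (12 L) gives 12 M <= h, so that displacements
    in unit time are below 1 and \<rho> stays within distance 1 of \<sigma>.\<close>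
  define \<delta> where "\<delta> = min 1 (min (1 / (64 * K)) (h / (12 * L)))"
  have \<delta>: "\<delta> > 0" using K(1) L h by (simp add: \<delta>_def)
  have hL: "12 * L / h * Q \<ge> 0" using L h Q by simp
  have C: "C > 0" "L \<le> C" using L hL unfolding C_def by linarith+
  have main: "\<exists>\<rho>. smooth \<rho> \<and> (\<forall>t. dom (sh (\<rho> t) (u1 (U t (v t)))) \<and>
      norm (sh (\<rho> t) (u1 (U t (v t)))) \<le> C * norm (v 0) \<and> norm (dx (sh (\<rho> t) (u1 (U t (v t))))) \<le> C * norm (v 0) \<and>
      norm (u2 (U t (v t))) \<le> C * norm (v 0))"
    if v: "\<And>t. (v has_vector_derivative U (- t) (N (U t (v t)))) (at t)" and small: "norm (v 0) \<le> \<delta>" for v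
  proof -
    define e where "e = K * norm (v 0)"
    define M where "M = 120 * e"
    define u where "u t = u1 (U t (v t))" for t
    have u: "dom (u t)" for t by (simp add: u_def dom_u1)
    have e0: "0 \<le> e" using K(1) by (simp add: e_def)
    have Me: "M = L * norm (v 0)" by (simp add: M_def L_def e_def)
    have "norm (v 0) \<le> 1 / (64 * K)" using small by (simp add: \<delta>_def)
    then have "K * norm (v 0) \<le> K * (1 / (64 * K))" using K(1) by (intro mult_left_mono) auto
    then have e64: "e \<le> 1 / 64" using K(1) by (simp add: e_def)
    have "norm (v 0) \<le> h / (12 * L)" using small by (simp add: \<delta>_def)
    then have "12 * L * norm (v 0) \<le> 12 * L * (h / (12 * L))" using L by (intro mult_left_mono) auto
    then have M12: "12 * M \<le> h" using L by (simp add: Me mult.assoc)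
    have vp: "(v has_vector_derivative U (- t) (0, snd (N (U t (v t))))) (at t)" for t
      using v[of t] by (simp only: N_fst[symmetric])
    have En: "sqrt (2 * En (U t (v t))) \<le> e" for t
    proof -
      have "En (U t (v t)) = En (v 0)" by (rule En_const[OF vp N_fst[symmetric], of t "\<bar>t\<bar>"]) simp
      then show ?thesis using K(2)[of "v 0"] small by (simp add: e_def \<delta>_def)
    qed
    have "(norm (u2 (U t (v t))))\<^sup>2 \<le> 2 * En (U t (v t))" "(norm (rr (u t)))\<^sup>2 \<le> 2 * En (U t (v t))" for t
      using En_Bogomolny[of "U t (v t)"] zero_le_power2[of "norm (u2 (U t (v t)))"] zero_le_power2[of "norm (rr (u t))"] unfolding u_def by linarith+
    then have ue: "norm (u2 (U t (v t))) \<le> e" and re: "norm (rr (u t)) \<le> e" for t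
      using En[of t] by (meson order_trans real_le_rsqrt)+
    have "\<exists>\<sigma>. nH (sh \<sigma> (u t)) \<le> M" for t
    proof -
      obtain \<sigma> where "nH (sh \<sigma> (u t)) \<le> 120 * norm (rr (u t))" using static_stability[OF u order_trans[OF re e64]] by blast
      then show ?thesis using re[of t] unfolding M_def by (intro exI[of _ \<sigma>]) linarith
    qed
    then obtain \<sigma> where \<sigma>: "\<And>t. nH (sh (\<sigma> t) (u t)) \<le> M" by metis
    have "\<bar>\<sigma> t - \<sigma> s\<bar> \<le> 6 * M / h" if ts: "\<bar>t - s\<bar> \<le> 1" for s t
    proof -
      have eM: "e \<le> M" using e0 by (simp add: M_def)
      have "(norm (u t - u s))\<^sup>2 \<le> \<bar>t - s\<bar> * (norm (dx (u t - u s)) * e)"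
        unfolding u_def by (rule u1_increment[OF vp ue])
      also have "\<dots> \<le> 1 * (norm (dx (u t - u s)) * M)" using ts e0 eM by (intro mult_mono) auto
      finally have "h * min \<bar>\<sigma> s - \<sigma> t\<bar> 1 \<le> 6 * M"
        unfolding h_def by (intro recentring_close[OF u u \<sigma> \<sigma>]) simp
      then have m: "min \<bar>\<sigma> s - \<sigma> t\<bar> 1 \<le> 6 * M / h" using h by (simp add: field_simps)
      \<comment> \<open>Hence the minimum with 1 is the displacement itself: this excludes a jump of
        the centre to a distant zero.\<close>
      moreover have "6 * M / h < 1" using M12 h by (simp add: field_simps)
      ultimately show ?thesis by (simp add: min_def abs_minus_commute split: if_splits)
    qed
    then obtain \<rho> where \<rho>: "smooth \<rho>" "\<And>t. \<bar>\<rho> t - \<sigma> t\<bar> \<le> 2 * (6 * M / h)" using ex_smooth_interpolation[of \<sigma> "6 * M / h"] by blast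
    have "dom (sh (\<rho> t) (u t)) \<and> norm (sh (\<rho> t) (u t)) \<le> C * norm (v 0) \<and> norm (dx (sh (\<rho> t) (u t))) \<le> C * norm (v 0) \<and>
      norm (u2 (U t (v t))) \<le> C * norm (v 0)" for t
    proof -
      define c where "c = \<rho> t - \<sigma> t"
      define w where "w = sh (\<sigma> t) (u t)"
      have w: "dom w" unfolding w_def by (intro dom_sh u)
      have c: "\<bar>c\<bar> \<le> 12 * M / h" using \<rho>(2)[of t] by (simp add: c_def)
      also have "12 * M / h \<le> 1" using M12 h by simp
      finally have "norm (qa c) \<le> \<bar>c\<bar> * Q" unfolding Q_def by (rule norm_qa_le)
      also have "\<dots> \<le> 12 * M / h * Q" using c Q by (rule mult_right_mono)
      also have "\<dots> = 12 * L / h * Q * norm (v 0)" by (simp add: Me)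
      finally have q: "norm (qa c) \<le> 12 * L / h * Q * norm (v 0)" .
      have CC: "C * norm (v 0) = M + 2 * (12 * L / h * Q * norm (v 0))" by (simp add: C_def Me algebra_simps)
      have q0: "0 \<le> 12 * L / h * Q * norm (v 0)" by (rule mult_nonneg_nonneg[OF hL norm_ge_zero])
      have eq: "sh (\<rho> t) (u t) = tr c w + qa c"
        using sh_add[of c "\<sigma> t" "u t"] by (simp add: w_def c_def sh_def[of "\<rho> t - \<sigma> t"])
      have n: "norm w \<le> M" "norm (dx w) \<le> M" using norm_le_nH[OF w] norm_dx_le_nH[OF w] \<sigma>[of t] by (auto simp: w_def)
      have "norm (sh (\<rho> t) (u t)) \<le> norm w + norm (qa c)" unfolding eq using norm_triangle_ineq[of "tr c w" "qa c"] by (simp add: norm_aff)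
      then have 1: "norm (sh (\<rho> t) (u t)) \<le> C * norm (v 0)" using n q q0 CC by linarith
      have "dx (sh (\<rho> t) (u t)) = tr c (dx w) + dx (qa c)" unfolding eq by (simp add: dx_add dom_tr dx_tr w qa)
      then have "norm (dx (sh (\<rho> t) (u t))) \<le> norm (dx w) + norm (dx (qa c))" using norm_triangle_ineq[of "tr c (dx w)" "dx (qa c)"] by (simp add: norm_aff)
      then have 2: "norm (dx (sh (\<rho> t) (u t))) \<le> C * norm (v 0)" using n q norm_dx_qa_le[of c] CC by linarith
      have "norm (u2 (U t (v t))) \<le> C * norm (v 0)" using ue[of t] e0 q0 CC unfolding M_def by linarith
      with 1 2 dom_sh[OF u] show ?thesis by blast
    qed
    with \<rho>(1) show ?thesis unfolding u_def by blast
  qed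
  show ?thesis
    by (rule exI[of _ \<delta>], rule conjI[OF \<delta>], rule exI[of _ C], rule conjI[OF C(1)], intro allI impI, rule main) blast+
qed

lemma translate_state:
  assumes f: "\<phi> - kink \<in> H1 \<times> L2"
  defines "z \<equiv> TT (\<phi> - kink)"
  shows "translate r \<phi> - kink \<in> H1 \<times> L2" "cl (fst (translate r \<phi> - kink)) = sh r (u1 z)" "cl (snd (translate r \<phi> - kink)) = tr r (u2 z)"
proof -
  define f1 where "f1 = fst (\<phi> - kink)"
  define f2 where "f2 = snd (\<phi> - kink)"
  have fL: "f1 \<in> L2" "f2 \<in> L2" "cl f1 = u1 z" "cl f2 = u2 z" using TT_simps[OF f] by (simp_all add: f1_def f2_def z_def)
  have s: "(\<lambda>x. f1 (x + r)) \<in> L2" "(\<lambda>x. f2 (x + r)) \<in> L2"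
    using L2_affine[of 1 f1 r] L2_affine[of 1 f2 r] fL by (simp_all add: add.commute)
  have e1: "fst (translate r \<phi> - kink) = (\<lambda>x. f1 (x + r) + shH r x)"
    by (rule ext) (simp add: translate_def kink_def f1_def shH_def)
  have e2: "snd (translate r \<phi> - kink) = (\<lambda>x. f2 (x + r))"
    by (rule ext) (simp add: translate_def kink_def f2_def)
  show c1: "cl (fst (translate r \<phi> - kink)) = sh r (u1 z)"
    unfolding e1 using tr_cl[OF fL(1), of r] by (simp add: cl_add s shH_L2 sh_def qa_def fL)
  show "cl (snd (translate r \<phi> - kink)) = tr r (u2 z)" unfolding e2 using tr_cl[OF fL(2), of r] by (simp add: fL)
  have "fst (translate r \<phi> - kink) \<in> L2" unfolding e1 by (intro L2_add s shH_L2)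
  then have "fst (translate r \<phi> - kink) \<in> H1" using c1 dom_sh[OF dom_u1, of r z] by (simp only: H1_iff simp_thms)
  moreover have "snd (translate r \<phi> - kink) \<in> L2" unfolding e2 by (rule s(2))
  ultimately show "translate r \<phi> - kink \<in> H1 \<times> L2" by (simp only: mem_Times_iff simp_thms)
qed

theorem theorem1p1:
  shows "\<exists>\<delta>\<^sub>0>0. \<exists>C>0. \<forall>\<delta> \<phi>in.
    0 < \<delta> \<and> \<delta> \<le> \<delta>\<^sub>0 \<and> \<phi>in \<in> E_H \<and> X_norm (\<phi>in - kink) \<le> \<delta> \<longrightarrow>
    (\<exists>\<phi>. global_solution \<phi> \<and> \<phi> 0 \<approx> \<phi>in \<and>
      (\<forall>\<psi>. global_solution \<psi> \<and> \<psi> 0 \<approx> \<phi>in \<longrightarrow> (\<forall>t. \<psi> t \<approx> \<phi> t)) \<and>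
      (\<exists>\<rho>. smooth \<rho> \<and>
        (SUP t. ereal (X_norm (translate (\<rho> t) (\<phi> t) - kink))) \<le> ereal (C * X_norm (\<phi>in - kink))))"
proof -
  obtain \<delta>1 C1 where \<delta>1: "\<delta>1 > 0" and C1: "C1 > 0"
    and stab: "\<And>v. (\<forall>t. (v has_vector_derivative U (- t) (N (U t (v t)))) (at t)) \<and> norm (v 0) \<le> \<delta>1 \<Longrightarrow>
    (\<exists>\<rho>. smooth \<rho> \<and> (\<forall>t. dom (sh (\<rho> t) (u1 (U t (v t)))) \<and>
      norm (sh (\<rho> t) (u1 (U t (v t)))) \<le> C1 * norm (v 0) \<and> norm (dx (sh (\<rho> t) (u1 (U t (v t))))) \<le> C1 * norm (v 0) \<and>
      norm (u2 (U t (v t))) \<le> C1 * norm (v 0)))"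
    using orbital_stability by blast
  have state_eq_kink: "\<phi> \<approx> \<psi> \<longleftrightarrow> \<phi> - kink \<approx> \<psi> - kink" for \<phi> \<psi> :: state
    by (simp add: state_eq_def)
  show ?thesis
  \<comment> \<open>The energy norm of the initial state is at most twice its \<open>X_norm\<close>;
    this halves the threshold and gives one factor 2 in 4 C1. The other factor 2 comes from adding
    up the component bounds.\<close>
  proof (rule exI[of _ "\<delta>1 / 2"], rule conjI, use \<delta>1 in simp, rule exI[of _ "4 * C1"], rule conjI, use C1 in simp, intro allI impI)
    fix \<delta> :: real and \<phi>in :: state
    assume as: "0 < \<delta> \<and> \<delta> \<le> \<delta>1 / 2 \<and> \<phi>in \<in> E_H \<and> X_norm (\<phi>in - kink) \<le> \<delta>"
    have X: "\<phi>in - kink \<in> H1 \<times> L2" using as by (simp add: E_H_def)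
    define z0 where "z0 = TT (\<phi>in - kink)"
    have n0: "norm z0 \<le> 2 * X_norm (\<phi>in - kink)" unfolding z0_def by (rule X_norm_TT(2)[OF X])
    obtain v where v0: "v 0 = z0" and v: "\<And>t. (v has_vector_derivative U (- t) (N (U t (v t)))) (at t)"
      using global_solution_ex[of z0] by blast
    define z where "z t = U t (v t)" for t
    have Uz: "U (- t) (z t) = v t" for t by (simp add: z_def U_U U_0)
    define f where "f t = (fn (u1 (z t)), fn (u2 (z t)))" for t
    have f: "f t \<in> H1 \<times> L2" "TT (f t) = z t" for t unfolding f_def by (rule TT_surj)+
    define \<phi> where "\<phi> t = kink + f t" for t
    have pk: "\<phi> t - kink = f t" for t by (simp add: \<phi>_def)
    have cz: "continuous_on UNIV z" unfolding z_def[abs_def] by (rule continuous_U[OF continuous_on_vector_derivative_UNIV[OF v]])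
    have sol: "global_solution \<phi>"
      unfolding global_solution_iff pk f(2) Uz
      using kink_add_in_E_H[OF f(1)] cz v by (simp add: \<phi>_def z_def[symmetric] eta_contract_eq)
    have init: "\<phi> 0 \<approx> \<phi>in"
      unfolding state_eq_kink[of "\<phi> 0"] pk state_eq_iff_TT[OF f(1) X] by (simp add: f(2) z_def U_0 v0 z0_def)
    have unique: "\<psi> t \<approx> \<phi> t" if \<psi>: "global_solution \<psi>" "\<psi> 0 \<approx> \<phi>in" for \<psi> t
    proof -
      define y where "y t = TT (\<psi> t - kink)" for t
      have XX: "\<psi> t - kink \<in> H1 \<times> L2" for t using \<psi>(1) by (simp add: global_solution_iff E_H_def)
      have dy: "((\<lambda>t. U (- t) (y t)) has_vector_derivative U (- t) (N (y t))) (at t)" for t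
        using \<psi>(1) by (simp add: global_solution_iff y_def)
      have "y 0 = z0" using \<psi>(2) unfolding state_eq_kink[of "\<psi> 0"] state_eq_iff_TT[OF XX X] by (simp add: y_def z0_def)
      then have y0: "U (- 0) (y 0) = v 0" by (simp add: U_0 v0)
      have "U (- t) (y t) = v t"
      proof (rule solution_unique[where v="\<lambda>t. U (- t) (y t)" and v'="\<lambda>t. U (- t) (N (y t))" and w=v and T="\<bar>t\<bar>", OF dy _ v])
        show "U (- s) (N (y s)) = U (- s) (N (U s (U (- s) (y s))))" for s by (simp add: U_U U_0)
      qed (simp_all only: y0 order_refl)
      then have "U t (U (- t) (y t)) = z t" by (simp add: z_def)
      then have "TT (\<psi> t - kink) = TT (\<phi> t - kink)" by (simp add: U_U U_0 y_def pk f(2))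
      then show ?thesis unfolding state_eq_kink[of "\<psi> t"] using state_eq_iff_TT[OF XX] f(1) pk by simp
    qed
    have "norm (v 0) \<le> \<delta>1" using n0 as by (simp add: v0)
    then obtain \<rho> where \<rho>: "smooth \<rho>" "\<And>t. norm (sh (\<rho> t) (u1 (z t))) \<le> C1 * norm z0"
        "\<And>t. norm (dx (sh (\<rho> t) (u1 (z t)))) \<le> C1 * norm z0" "\<And>t. norm (u2 (z t)) \<le> C1 * norm z0"
      using stab[of v] v unfolding z_def v0 by blast
    have "X_norm (translate (\<rho> t) (\<phi> t) - kink) \<le> 4 * C1 * X_norm (\<phi>in - kink)" for t
    proof -
      have kX: "\<phi> t - kink \<in> H1 \<times> L2" by (simp add: pk f)
      note T = translate_state[OF kX, of "\<rho> t", unfolded pk f(2)]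
      \<comment> \<open>One square for each of the function, its derivative and the second
        component; 3 is then rounded up to 2^2.\<close>
      have "(X_norm (translate (\<rho> t) (\<phi> t) - kink))\<^sup>2 \<le> (C1 * norm z0)\<^sup>2 + (C1 * norm z0)\<^sup>2 + (C1 * norm z0)\<^sup>2"
        unfolding X_norm_eq(1)[OF T(1)] T(2,3) by (intro add_mono power_mono) (simp_all add: \<rho> norm_aff)
      also have "\<dots> \<le> (2 * (C1 * norm z0))\<^sup>2" by (simp add: power_mult_distrib)
      finally have "X_norm (translate (\<rho> t) (\<phi> t) - kink) \<le> 2 * (C1 * norm z0)"
        by (rule power2_le_imp_le) (use C1 in simp)
      also have "\<dots> \<le> 2 * (C1 * (2 * X_norm (\<phi>in - kink)))" using n0 C1 by (intro mult_left_mono) auto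
      finally show ?thesis by simp
    qed
    then have "(SUP t. ereal (X_norm (translate (\<rho> t) (\<phi> t) - kink))) \<le> ereal (4 * C1 * X_norm (\<phi>in - kink))"
      by (intro SUP_least) simp
    then show "\<exists>\<phi>. global_solution \<phi> \<and> \<phi> 0 \<approx> \<phi>in \<and>
      (\<forall>\<psi>. global_solution \<psi> \<and> \<psi> 0 \<approx> \<phi>in \<longrightarrow> (\<forall>t. \<psi> t \<approx> \<phi> t)) \<and>
      (\<exists>\<rho>. smooth \<rho> \<and>
        (SUP t. ereal (X_norm (translate (\<rho> t) (\<phi> t) - kink))) \<le> ereal (4 * C1 * X_norm (\<phi>in - kink)))"
      using sol init unique \<rho>(1) by blast
  qed
qed

end
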